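(* Let $X,Y$ be two Banach function spaces over the unit circle $\mathbb{T}$. Suppose that $X$ is separable and the Riesz projection $P$ is bounded on the space $Y$. If $A\in\mathcal{B}(H[X],H[Y])$ and there exists a sequence $\{a_n\}_{n\in\mathbb{Z}}$ of complex numbers such that \[ \langle A\chi_j,\chi_k\rangle=a_{k-j}\quad\text{for all integers } j,k\ge 0, \] then there is a function $a\in M(X,Y)$ such that $A=T_a$ and $\widehat{a}(n)=a_n$ for all $n\in\mathbb{Z}$. Moreover, \[ \|a\|_{M(X,Y)}\le \|T_a\|_{\mathcal{B}(H[X],H[Y])}\le \|P\|_{\mathcal{B}(Y)}\|a\|_{M(X,Y)}. \]
   Context: $\mathbb{T}$ is the unit circle in $\mathbb{C}$ with normalized Lebesgue measure $dm(t)=|dt|/(2\pi)$; $L^p=L^p(\mathbb{T})$ with respect to $m$; $L^0$ is the space of measurable complex-valued functions on $\mathbb{T}$, and $L^0_+$ is the set of measurable functions on $\mathbb{T}$ with values in $[0,\infty]$. $\mathbb{I}_E$ is the indicator function of $E$. A Banach function norm is a mapping $\rho:L^0_+\to[0,\infty]$ such that for all $f,g,f_n\in L^0_+$ ($n\in\mathbb{N}$), all constants $c\ge 0$ and all measurable $E\subset\mathbb{T}$: (A1) $\rho(f)=0\Leftrightarrow f=0$ a.e., $\rho(cf)=c\rho(f)$, $\rho(f+g)\le\rho(f)+\rho(g)$; (A2) $0\le g\le f$ a.e. implies $\rho(g)\le\rho(f)$; (A3) $0\le f_n\uparrow f$ a.e. implies $\rho(f_n)\uparrow\rho(f)$; (A4)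 $\rho(\mathbb{I}_E)<\infty$; (A5) $\int_E f\,dm\le C_E\,\rho(f)$ with a constant $C_E\in(0,\infty)$ independent of $f$. The Banach function space determined by $\rho$ is $X=\{f\in L^0:\rho(|f|)<\infty\}$ (functions equal a.e. are identified) with norm $\|f\|_X=\rho(|f|)$. One has $L^\infty\subset X\subset L^1$ continuously. For $f\in L^1$, $\widehat f(n)=\int_{\mathbb{T}}f(t)t^{-n}\,dm(t)$, $n\in\mathbb{Z}$. The abstract Hardy space is $H[X]=\{f\in X:\widehat f(n)=0\text{ for all }n<0\}$, with the norm of $X$. Put $\chi_n(t)=t^n$ and $\langle f,g\rangle=\int_{\mathbb{T}}f\overline{g}\,dm$ whenever the integral makes sense. The Riesz projection is defined for $f\in L^1$ and a.e. $t\in\mathbb{T}$ by $(Pf)(t)=\frac12\big(f(t)+(Sf)(t)\big)$, where $(Sf)(t)=\frac1{\pi i}\,\mathrm{p.v.}\int_{\mathbb{T}}\frac{f(\tau)}{\tau-t}\,d\tau$. "$P$ is bounded on $Y$" means that $P$ maps $Y$ to $Y$ and is a bounded operator there. In that case $P(Y)=H[Y]$. $\mathcal{B}(E,F)$ is the space of bounded linear operators from a Banach space $E$ to a Banach space $F$, and $\mathcal{B}(E)=\mathcal{B}(E,E)$. The space of pointwise multipliers is $M(X,Y)=\{f\in L^0: fg\in Y\text{ for all }g\in X\}$ with norm $\|f\|_{M(X,Y)}=\sup_{\|g\|_X\le1}\|fg\|_Y$. If $P$ is bounded on $Y$ and $a\in M(X,Y)$, the Toeplitz operator $T_a:H[X]\to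 H[Y]$ is $T_af=P(af)$. *)

theory Defs
  imports "HOL-Analysis.Analysis"
begin

section \<open>The unit circle\<close>

text \<open>Normalized Lebesgue measure \<open>dm(t) = |dt|/(2 pi)\<close>; the completion makes measurability
  Lebesgue (not Borel) measurability. Functions on the circle are functions on \<open>complex\<close> whose
  values off \<open>sphere 0 1\<close> are irrelevant. Elements of \<open>L\<^sup>0\<close> and of its subspaces are represented
  by measurable functions; their equality is equality almost everywhere.\<close>

definition circle :: "complex measure" where
  "circle = completion
     (distr (uniform_measure lborel {0..<2 * pi}) (restrict_space borel (sphere 0 1)) cis)"

lemma space_circle: "space circle = sphere 0 1"
  by (simp add: circle_def space_restrict_space)

lemma emeasure_circle: "emeasure circle (sphere 0 1) = 1"
proof -
  have "cis \<in> borel_measurable borel"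
    by (intro borel_measurable_continuous_onI continuous_intros)
  then have "cis \<in> borel_measurable (uniform_measure lborel {0..<2 * pi})"
    by (simp cong: measurable_cong_sets)
  then have cis: "cis \<in> measurable (uniform_measure lborel {0..<2 * pi})
                     (restrict_space borel (sphere 0 1))"
    by (intro measurable_restrict_space2) auto
  have S: "sphere 0 1 \<in> sets (restrict_space borel (sphere 0 (1::real) :: complex set))"
    by (simp add: sets_restrict_space_iff)
  have vim: "cis -` sphere 0 1 = UNIV"
    by auto
  have "emeasure (distr (uniform_measure lborel {0..<2 * pi})
           (restrict_space borel (sphere 0 1)) cis) (sphere 0 1) = 1"
    using cis S vim by (subst emeasure_distr) (auto simp: ennreal_divide_self)
  then show ?thesis
    using S by (simp add: circle_def)
qed

definition fourier_coeff :: "(complex \<Rightarrow> complex) \<Rightarrow> int \<Rightarrow> complex" where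
  "fourier_coeff f n = (\<integral>t. f t * t powi (- n) \<partial>circle)"

definition chi :: "int \<Rightarrow> complex \<Rightarrow> complex" where
  "chi n t = t powi n"

definition pairing :: "(complex \<Rightarrow> complex) \<Rightarrow> (complex \<Rightarrow> complex) \<Rightarrow> complex" where
  "pairing f g = (\<integral>t. f t * cnj (g t) \<partial>circle)"


section \<open>Banach function spaces\<close>

text \<open>Only the values of \<open>\<rho>\<close> on measurable functions matter.\<close>

definition banach_function_norm :: "((complex \<Rightarrow> ennreal) \<Rightarrow> ennreal) \<Rightarrow> bool" where
  "banach_function_norm \<rho> \<longleftrightarrow>
     (\<forall>f \<in> borel_measurable circle. \<rho> f = 0 \<longleftrightarrow> (AE t in circle. f t = 0)) \<and>
     (\<forall>f \<in> borel_measurable circle. \<forall>c::real. 0 \<le> c \<longrightarrow> \<rho> (\<lambda>t. ennreal c * f t) = ennreal c * \<rho> f) \<and>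
     (\<forall>f \<in> borel_measurable circle. \<forall>g \<in> borel_measurable circle.
        \<rho> (\<lambda>t. f t + g t) \<le> \<rho> f + \<rho> g) \<and>
     (\<forall>f \<in> borel_measurable circle. \<forall>g \<in> borel_measurable circle.
        (AE t in circle. g t \<le> f t) \<longrightarrow> \<rho> g \<le> \<rho> f) \<and>
     (\<forall>F f. (\<forall>n::nat. F n \<in> borel_measurable circle) \<longrightarrow> f \<in> borel_measurable circle \<longrightarrow>
        (AE t in circle. incseq (\<lambda>n. F n t) \<and> (\<lambda>n. F n t) \<longlonglongrightarrow> f t) \<longrightarrow>
        incseq (\<lambda>n. \<rho> (F n)) \<and> (\<lambda>n. \<rho> (F n)) \<longlonglongrightarrow> \<rho> f) \<and>
     (\<forall>E \<in> sets circle. \<rho> (indicator E) < \<infinity>) \<and>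
     (\<forall>E \<in> sets circle. \<exists>C::real. 0 < C \<and>
        (\<forall>f \<in> borel_measurable circle. (\<integral>\<^sup>+t\<in>E. f t \<partial>circle) \<le> ennreal C * \<rho> f))"

text \<open>Norms, and the suprema defining operator and multiplier norms, are taken in \<open>ennreal\<close>, so
  that no supremum is a junk value; on the space itself \<open>bfs_norm\<close> is finite.\<close>

definition bfs_norm :: "((complex \<Rightarrow> ennreal) \<Rightarrow> ennreal) \<Rightarrow> (complex \<Rightarrow> complex) \<Rightarrow> ennreal" where
  "bfs_norm \<rho> f = \<rho> (\<lambda>t. ennreal (cmod (f t)))"

definition bfs :: "((complex \<Rightarrow> ennreal) \<Rightarrow> ennreal) \<Rightarrow> (complex \<Rightarrow> complex) set" where
  "bfs \<rho> = {f \<in> borel_measurable circle. bfs_norm \<rho> f < \<infinity>}"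

definition separable_bfs :: "((complex \<Rightarrow> ennreal) \<Rightarrow> ennreal) \<Rightarrow> bool" where
  "separable_bfs \<rho> \<longleftrightarrow>
     (\<exists>D \<subseteq> bfs \<rho>. countable D \<and>
        (\<forall>f \<in> bfs \<rho>. \<forall>e::real. 0 < e \<longrightarrow> (\<exists>d \<in> D. bfs_norm \<rho> (\<lambda>t. f t - d t) < ennreal e)))"

definition hardy :: "((complex \<Rightarrow> ennreal) \<Rightarrow> ennreal) \<Rightarrow> (complex \<Rightarrow> complex) set" where
  "hardy \<rho> = {f \<in> bfs \<rho>. \<forall>n<0. fourier_coeff f n = 0}"

definition multipliers ::
  "((complex \<Rightarrow> ennreal) \<Rightarrow> ennreal) \<Rightarrow> ((complex \<Rightarrow> ennreal) \<Rightarrow> ennreal) \<Rightarrow> (complex \<Rightarrow> complex) set" where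
  "multipliers \<rho> \<sigma> = {f \<in> borel_measurable circle. \<forall>g \<in> bfs \<rho>. (\<lambda>t. f t * g t) \<in> bfs \<sigma>}"

definition multiplier_norm ::
  "((complex \<Rightarrow> ennreal) \<Rightarrow> ennreal) \<Rightarrow> ((complex \<Rightarrow> ennreal) \<Rightarrow> ennreal) \<Rightarrow> (complex \<Rightarrow> complex) \<Rightarrow> ennreal" where
  "multiplier_norm \<rho> \<sigma> f = (SUP g \<in> {g \<in> bfs \<rho>. bfs_norm \<rho> g \<le> 1}. bfs_norm \<sigma> (\<lambda>t. f t * g t))"


section \<open>Bounded operators\<close>

text \<open>\<open>V\<close> and \<open>W\<close> are linear subspaces of \<open>bfs \<rho>\<close> and \<open>bfs \<sigma>\<close> carrying their norms.
  Linearity holds almost everywhere; together with the norm bound it implies that the operator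
  maps functions equal almost everywhere to functions equal almost everywhere.\<close>

definition bounded_operator ::
  "((complex \<Rightarrow> ennreal) \<Rightarrow> ennreal) \<Rightarrow> (complex \<Rightarrow> complex) set \<Rightarrow>
   ((complex \<Rightarrow> ennreal) \<Rightarrow> ennreal) \<Rightarrow> (complex \<Rightarrow> complex) set \<Rightarrow>
   ((complex \<Rightarrow> complex) \<Rightarrow> (complex \<Rightarrow> complex)) \<Rightarrow> bool" where
  "bounded_operator \<rho> V \<sigma> W A \<longleftrightarrow>
     (\<forall>f \<in> V. A f \<in> W) \<and>
     (\<forall>f \<in> V. \<forall>g \<in> V. AE t in circle. A (\<lambda>s. f s + g s) t = A f t + A g t) \<and>
     (\<forall>f \<in> V. \<forall>c. AE t in circle. A (\<lambda>s. c * f s) t = c * A f t) \<and>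
     (\<exists>C::real. \<forall>f \<in> V. bfs_norm \<sigma> (A f) \<le> ennreal C * bfs_norm \<rho> f)"

definition operator_norm ::
  "((complex \<Rightarrow> ennreal) \<Rightarrow> ennreal) \<Rightarrow> (complex \<Rightarrow> complex) set \<Rightarrow>
   ((complex \<Rightarrow> ennreal) \<Rightarrow> ennreal) \<Rightarrow> ((complex \<Rightarrow> complex) \<Rightarrow> (complex \<Rightarrow> complex)) \<Rightarrow> ennreal" where
  "operator_norm \<rho> V \<sigma> A = (SUP f \<in> {f \<in> V. bfs_norm \<rho> f \<le> 1}. bfs_norm \<sigma> (A f))"


section \<open>Riesz projection and Toeplitz operators\<close>

text \<open>On the positively oriented circle \<open>d\<tau> = 2 pi i \<tau> dm(\<tau>)\<close>. The principal value removes
  the arc \<open>|\<tau> - t| < \<epsilon>\<close> and lets \<open>\<epsilon>\<close> tend to 0 from the right. For integrable \<open>f\<close> this limit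
  exists for almost every \<open>t\<close>; where it does not, \<open>Lim\<close> is unspecified.\<close>

definition singular_integral :: "(complex \<Rightarrow> complex) \<Rightarrow> complex \<Rightarrow> complex" where
  "singular_integral f t =
     1 / (of_real pi * \<i>) *
     Lim (at_right (0::real))
       (\<lambda>\<epsilon>. \<integral>\<tau>\<in>{\<tau> \<in> sphere 0 1. \<epsilon> \<le> cmod (\<tau> - t)}.
              f \<tau> / (\<tau> - t) * (2 * of_real pi * \<i> * \<tau>) \<partial>circle)"

definition riesz :: "(complex \<Rightarrow> complex) \<Rightarrow> complex \<Rightarrow> complex" where
  "riesz f t = (f t + singular_integral f t) / 2"

definition toeplitz :: "(complex \<Rightarrow> complex) \<Rightarrow> (complex \<Rightarrow> complex) \<Rightarrow> complex \<Rightarrow> complex" where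
  "toeplitz a f = riesz (\<lambda>t. a t * f t)"

end

theory Submission
  imports Defs "HOL-Complex_Analysis.Complex_Analysis"
begin

text \<open>Put \<open>b\<^sub>k = t^(-k) A(t^k)\<close>. These functions are bounded in \<open>Y\<close> and their Fourier coefficients are
  eventually those required of the symbol. The compactness needed to pass to a limit comes from the
  Riesz projection: for \<open>0 \<le> g\<close> in \<open>Y\<close> the conjugate function of \<open>g\<close> is integrable, so that \<open>g\<close> lies
  in \<open>L log L\<close> with a bound in terms of the norm (mean value property of \<open>F log F\<close>); hence balls of
  \<open>Y\<close> are uniformly integrable. Minimizing a strictly convex functional over the convex sets of
  functions in a ball of \<open>Y\<close> with finitely many prescribed Fourier coefficients gives a sequence that
  converges in \<open>L\<^sup>1\<close> and almost everywhere, and the Fatou property bounds the limit in \<open>Y\<close>. The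
  same extraction applied to \<open>t^(-k) A(t^k f)\<close> shows that the norm of \<open>a f\<close> in \<open>Y\<close> is at most \<open>\<parallel>A\<parallel> \<parallel>f\<parallel>\<close> for
  trigonometric polynomials \<open>f\<close>. Separability of \<open>X\<close> gives dominated convergence in \<open>X\<close>, hence the
  density of trigonometric polynomials in \<open>X\<close> and of analytic polynomials in \<open>H[X]\<close>.

  The principal value in the definition of the Riesz projection is controlled by Kolmogorov's
  inequality with exponent \<open>1/2\<close>; its existence almost everywhere is a consequence of the assumed
  linearity of the projection on \<open>Y\<close>.\<close>

section \<open>The circle measure\<close>

text \<open>Neither space is assumed translation invariant, so convolution means need not be bounded
  in it, and \<open>Y\<close> is not assumed separable or reflexive, so neither polynomial density
  nor weak compactness is at hand there. A sequence bounded in \<open>Y\<close> is a priori bounded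
  only in L1, where limits of Fourier coefficients may belong to a singular measure. A circle must
  be avoided as well: that \<open>riesz f\<close> has the expected coefficients is clear for
  trigonometric polynomials, extends to bounded functions through L2, gives the logarithmic estimate
  there, and only the resulting uniform integrability gives it on all of \<open>Y\<close>. The
  functional that is minimized is the integral of sqrt (1 + |h|^2), whose linear growth makes it
  finite on L1. On \<open>X\<close> no bounded projection is available; functions of H[X] are made
  bounded by outer multipliers built from the square root of |f|, which lies in L2. The first norm
  inequality has constant 1 because multiplication by a power of t changes no norm on either side of
  \<open>A\<close>.\<close>

interpretation circle: finite_measure circle
  by (rule finite_measureI) (simp add: space_circle emeasure_circle)

lemma borel_measurable_circle_restrict:
  "f \<in> borel_measurable (restrict_space borel (sphere 0 1)) \<Longrightarrow> f \<in> borel_measurable circle"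
  unfolding circle_def by (rule measurable_completion) simp

lemma borel_measurable_circle [measurable (raw)]:
  "f \<in> borel_measurable borel \<Longrightarrow> f \<in> borel_measurable circle"
  by (intro borel_measurable_circle_restrict measurable_restrict_space1)

lemma borel_measurable_circle_continuous:
  fixes f :: "complex \<Rightarrow> 'a::topological_space"
  shows "continuous_on (sphere 0 1) f \<Longrightarrow> f \<in> borel_measurable circle"
  by (intro borel_measurable_circle_restrict borel_measurable_continuous_on_restrict)

lemma AE_circleI: "(\<And>t. cmod t = 1 \<Longrightarrow> P t) \<Longrightarrow> AE t in circle. P t"
  by (rule AE_I2) (simp add: space_circle)

lemma integrable_circle_bounded:
  fixes f :: "complex \<Rightarrow> 'a::{banach, second_countable_topology}"
  assumes "f \<in> borel_measurable circle" "\<And>t. cmod t = 1 \<Longrightarrow> norm (f t) \<le> B"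
  shows "integrable circle f"
  by (rule circle.integrable_const_bound[where B=B]) (auto intro!: AE_circleI assms)

lemma integrable_circle_continuous:
  fixes f :: "complex \<Rightarrow> 'a::{banach, second_countable_topology}"
  assumes "continuous_on (sphere 0 1) f"
  shows "integrable circle f"
proof -
  have "bounded (f ` sphere 0 1)"
    using assms by (intro compact_imp_bounded compact_continuous_image) auto
  then obtain B where "\<forall>x\<in>f ` sphere 0 1. norm x \<le> B"
    unfolding bounded_iff by blast
  then show ?thesis
    by (intro integrable_circle_bounded[where B=B] borel_measurable_circle_continuous assms) auto
qed

lemma measurable_cis: "cis \<in> measurable borel (restrict_space borel (sphere 0 1))"
  by (intro measurable_restrict_space2 borel_measurable_continuous_onI continuous_intros) auto

text \<open>Borel measurability is required because the completion is removed before the change of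
  variables by \<open>cis\<close>.\<close>

lemma integral_circle:
  fixes f :: "complex \<Rightarrow> 'a::{banach, second_countable_topology}"
  assumes f: "f \<in> borel_measurable (restrict_space borel (sphere 0 1))"
  shows "(\<integral>t. f t \<partial>circle) = (\<integral>x. (indicator {0..<2*pi} x / (2*pi)) *\<^sub>R f (cis x) \<partial>lborel)"
proof -
  have cis: "cis \<in> measurable (uniform_measure lborel {0..<2 * pi}) (restrict_space borel (sphere 0 1))"
    using measurable_cis by (simp cong: measurable_cong_sets)
  have fc: "(\<lambda>x. f (cis x)) \<in> borel_measurable lborel"
    using measurable_compose[OF measurable_cis f] by simp
  have d: "uniform_measure lborel {0..<2 * pi} = density lborel (\<lambda>x. ennreal (indicator {0..<2*pi} x / (2*pi)))"
    unfolding uniform_measure_def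
    by (intro arg_cong[where f="density lborel"] ext)
       (simp add: indicator_def ennreal_divide_times divide_ennreal[symmetric] flip: ennreal_1)
  have "(\<integral>t. f t \<partial>circle) = (\<integral>x. f (cis x) \<partial>uniform_measure lborel {0..<2 * pi})"
    unfolding circle_def by (subst integral_completion) (use f integral_distr[OF cis f] in auto)
  also have "\<dots> = (\<integral>x. (indicator {0..<2*pi} x / (2*pi)) *\<^sub>R f (cis x) \<partial>lborel)"
    unfolding d by (rule integral_density) (use fc in auto)
  finally show ?thesis .
qed

lemma has_integral_circle:
  fixes f :: "complex \<Rightarrow> complex"
  assumes f: "continuous_on (sphere 0 1) f"
    and I: "((\<lambda>x. f (cis x)) has_integral I) {0..2*pi}"
  shows "(\<integral>t. f t \<partial>circle) = I / (2*pi)"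
proof -
  have c: "continuous_on {0..2*pi} (\<lambda>x. f (cis x))"
    by (intro continuous_on_compose2[OF f] continuous_intros) auto
  have "(\<lambda>x. f (cis x)) absolutely_integrable_on {0..2*pi}"
    by (rule absolutely_integrable_continuous_real[OF c])
  then have "I = set_lebesgue_integral lebesgue {0..2*pi} (\<lambda>x. f (cis x))"
    using I set_lebesgue_integral_eq_integral(2) integral_unique by metis
  also have "\<dots> = set_lebesgue_integral lborel {0..2*pi} (\<lambda>x. f (cis x))"
    unfolding set_lebesgue_integral_def
    by (rule integral_completion) (use borel_measurable_continuous_on_indicator[OF _ c] in auto)
  also have "\<dots> = (\<integral>x. indicator {0..<2*pi} x *\<^sub>R f (cis x) \<partial>lborel)"
    unfolding set_lebesgue_integral_def
  \<comment> \<open>The contour runs over the closed interval, the measure over the half-open one;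
    the endpoint is a null set.\<close>
  proof (rule integral_cong_AE)
    show "AE x in lborel. indicator {0..2*pi} x *\<^sub>R f (cis x) = indicator {0..<2*pi} x *\<^sub>R f (cis x)"
      using AE_lborel_singleton[of "2*pi"] by eventually_elim (auto simp: indicator_def)
    show "(\<lambda>x. indicator {0..2*pi} x *\<^sub>R f (cis x)) \<in> borel_measurable lborel"
      using borel_measurable_continuous_on_indicator[OF _ c] by auto
    have "(\<lambda>x. indicator {0..<2*pi} x *\<^sub>R f (cis x)) \<in> borel_measurable borel"
      using c by (intro borel_measurable_continuous_on_indicator) (auto intro: continuous_on_subset)
    then show "(\<lambda>x. indicator {0..<2*pi} x *\<^sub>R f (cis x)) \<in> borel_measurable lborel" by simp
  qed
  finally have "I = (\<integral>x. indicator {0..<2*pi} x *\<^sub>R f (cis x) \<partial>lborel)" .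
  moreover have "(\<integral>t. f t \<partial>circle) = (\<integral>x. (1/(2*pi)) *\<^sub>R (indicator {0..<2*pi} x *\<^sub>R f (cis x)) \<partial>lborel)"
    using borel_measurable_continuous_on_restrict[OF f]
    by (subst integral_circle) (auto intro!: Bochner_Integration.integral_cong)
  ultimately show ?thesis
    by (simp add: scaleR_conv_of_real del: scaleR_scaleR)
qed

text \<open>Cauchy's formula at the centre of the disc: on the circle dz / z is i dx, so the contour
  integral is 2 pi i times the mean over the circle.\<close>

lemma integral_circle_holomorphic:
  assumes "continuous_on (cball 0 1) f" "f holomorphic_on ball 0 1"
  shows "(\<integral>t. f t \<partial>circle) = f 0"
proof -
  have "((\<lambda>u. f u / (u - 0)) has_contour_integral (2 * of_real pi * \<i> * f 0)) (circlepath 0 1)"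
    by (rule Cauchy_integral_circlepath[OF assms]) simp
  then have "((\<lambda>x. f (cis x) / cis x * \<i> * cis x) has_integral (2 * of_real pi * \<i> * f 0)) {0..2*pi}"
    unfolding circlepath_def by (subst (asm) has_contour_integral_part_circlepath_iff) auto
  then have "((\<lambda>x. (1/\<i>) * (f (cis x) / cis x * \<i> * cis x)) has_integral (1/\<i>) * (2 * of_real pi * \<i> * f 0)) {0..2*pi}"
    by (rule has_integral_mult_right)
  then have "((\<lambda>x. f (cis x)) has_integral (2 * of_real pi * f 0)) {0..2*pi}"
    by (simp add: field_simps)
  then have "(\<integral>t. f t \<partial>circle) = 2 * of_real pi * f 0 / (2*pi)"
    by (intro has_integral_circle) (use assms in \<open>auto intro: continuous_on_subset\<close>)
  then show ?thesis by simp
qed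

lemma cnj_unit: "cmod t = 1 \<Longrightarrow> cnj t = inverse t"
  by (simp add: inverse_complex_def complex_eq_iff cmod_def)

lemma cnj_powi_unit: "cmod t = 1 \<Longrightarrow> cnj (t powi n) = t powi (- n)"
  by (simp add: complex_cnj_power_int power_int_minus cnj_unit power_int_inverse)

lemma integral_powi: "(\<integral>t. t powi n \<partial>circle) = (if n = 0 then 1 else 0)"
proof -
  have pos: "(\<integral>t. t powi int m \<partial>circle) = (if m = 0 then 1 else 0)" for m
    using integral_circle_holomorphic[of "\<lambda>t. t ^ m"]
    by (simp add: continuous_intros holomorphic_intros)
  show ?thesis
  proof (cases "n \<ge> 0")
    case True
    then show ?thesis using pos[of "nat n"] by auto
  next
    case False
    have "(\<integral>t. t powi n \<partial>circle) = (\<integral>t. cnj (t powi int (nat (-n))) \<partial>circle)"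
      using False by (intro Bochner_Integration.integral_cong refl)
        (subst cnj_powi_unit, auto simp: space_circle)
    also have "\<dots> = cnj (\<integral>t. t powi int (nat (-n)) \<partial>circle)"
      by (rule Bochner_Integration.integral_cnj)
    finally show ?thesis using pos[of "nat (-n)"] False by simp
  qed
qed

lemma continuous_on_powi_circle: "continuous_on (sphere 0 1) (\<lambda>t::complex. t powi n)"
  by (intro continuous_intros) auto

lemma measurable_powi_circle [measurable]: "(\<lambda>t::complex. t powi n) \<in> borel_measurable circle"
  by (intro borel_measurable_circle_continuous continuous_on_powi_circle)

text \<open>In the angle the map is x -> \<theta> - x, which carries
  [0, 2 pi) onto (\<theta> - 2 pi, \<theta>]; the part below 0 is moved up by one period. With
  \<open>w = t\<^sup>2\<close> it is the reflection fixing t, which evaluates the principal value of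
  a constant.\<close>

lemma integral_circle_reflect:
  fixes f :: "complex \<Rightarrow> complex"
  assumes f: "f \<in> borel_measurable borel" and B: "\<And>t. cmod t = 1 \<Longrightarrow> cmod (f t) \<le> B" and w: "cmod w = 1"
  shows "(\<integral>t. f (w * cnj t) \<partial>circle) = (\<integral>t. f t \<partial>circle)"
proof -
  define \<theta> where "\<theta> = Arg2pi w"
  have \<theta>: "0 \<le> \<theta>" "\<theta> < 2*pi" and wc: "w = cis \<theta>"
    unfolding \<theta>_def using Arg2pi[of w] w by (auto simp: cis_conv_exp is_Arg_def)
  define g where "g = (\<lambda>x. f (cis x))"
  have gm [measurable]: "g \<in> borel_measurable borel"
    unfolding g_def by (rule measurable_compose[OF _ f]) (intro borel_measurable_continuous_onI continuous_intros)
  have per: "g (x + 2*pi) = g x" for x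
    unfolding g_def by (simp add: cis.ctr)
  have gB: "cmod (g x) \<le> B" for x
    unfolding g_def by (rule B) simp
  have int: "integrable lborel (\<lambda>x. indicator {a..b} x *\<^sub>R g x)" for a b
    using gm by (intro integrableI_bounded_set_indicator[where B=B]) (auto simp: g_def[symmetric] gB emeasure_lborel_Icc_eq)
  have intS: "integrable lborel (\<lambda>x. indicator S x *\<^sub>R g x)" if "S \<in> sets borel" "S \<subseteq> {a..b}" for S a b
  proof -
    have "integrable lborel (\<lambda>x. indicator S x *\<^sub>R (indicator {a..b} x *\<^sub>R g x))"
      using that by (intro integrable_mult_indicator int) auto
    also have "(\<lambda>x. indicator S x *\<^sub>R (indicator {a..b} x *\<^sub>R g x)) = (\<lambda>x. indicator S x *\<^sub>R g x)"
      using that by (auto simp: indicator_def fun_eq_iff)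
    finally show ?thesis .
  qed
  let ?I = "\<lambda>S. \<integral>x. indicator S x *\<^sub>R g x \<partial>lborel"
  have shift: "?I {\<theta> - 2*pi<..<0} = ?I {\<theta><..<2*pi}"
  proof -
    have "?I {\<theta> - 2*pi<..<0} = \<bar>1\<bar> *\<^sub>R (\<integral>x. indicator {\<theta> - 2*pi<..<0} (-2*pi + 1 * x) *\<^sub>R g (-2*pi + 1 * x) \<partial>lborel)"
      by (rule lborel_integral_real_affine) simp
    also have "\<dots> = (\<integral>x. indicator {\<theta> - 2*pi<..<0} (x - 2*pi) *\<^sub>R g x \<partial>lborel)"
      using per[of "_ - 2*pi"] by simp
    also have "\<dots> = ?I {\<theta><..<2*pi}"
      by (intro Bochner_Integration.integral_cong refl) (auto simp: indicator_def)
    finally show ?thesis .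
  qed
  have "(\<integral>x. indicator {0..<2*pi} x *\<^sub>R g (\<theta> - x) \<partial>lborel) = ?I {\<theta> - 2*pi<..\<theta>}"
  proof -
    have "?I {\<theta> - 2*pi<..\<theta>} = \<bar>-1\<bar> *\<^sub>R (\<integral>x. indicator {\<theta> - 2*pi<..\<theta>} (\<theta> + (-1) * x) *\<^sub>R g (\<theta> + (-1) * x) \<partial>lborel)"
      by (rule lborel_integral_real_affine) simp
    also have "\<dots> = (\<integral>x. indicator {\<theta> - 2*pi<..\<theta>} (\<theta> - x) *\<^sub>R g (\<theta> - x) \<partial>lborel)"
      by simp
    also have "\<dots> = (\<integral>x. indicator {0..<2*pi} x *\<^sub>R g (\<theta> - x) \<partial>lborel)"
      by (intro Bochner_Integration.integral_cong refl) (auto simp: indicator_def)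
    finally show ?thesis by simp
  qed
  also have "\<dots> = (\<integral>x. indicator {\<theta> - 2*pi<..<0} x *\<^sub>R g x + indicator {0..\<theta>} x *\<^sub>R g x \<partial>lborel)"
    using \<theta> by (intro Bochner_Integration.integral_cong) (auto simp: indicator_def)
  also have "\<dots> = ?I {\<theta> - 2*pi<..<0} + ?I {0..\<theta>}"
    by (intro Bochner_Integration.integral_add intS[of _ "\<theta> - 2*pi" "2*pi"]) (use \<theta> in auto)
  also have "\<dots> = ?I {\<theta><..<2*pi} + ?I {0..\<theta>}"
    by (simp add: shift)
  also have "\<dots> = (\<integral>x. indicator {\<theta><..<2*pi} x *\<^sub>R g x + indicator {0..\<theta>} x *\<^sub>R g x \<partial>lborel)"
    by (intro Bochner_Integration.integral_add[symmetric] intS[of _ "0" "2*pi"]) (use \<theta> in auto)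
  also have "\<dots> = ?I {0..<2*pi}"
    using \<theta> by (intro Bochner_Integration.integral_cong) (auto simp: indicator_def)
  finally have *: "(\<integral>x. indicator {0..<2*pi} x *\<^sub>R g (\<theta> - x) \<partial>lborel) = ?I {0..<2*pi}" .
  have rm: "(\<lambda>t. f (w * cnj t)) \<in> borel_measurable borel"
    by (rule measurable_compose[OF _ f]) (intro borel_measurable_continuous_onI continuous_intros)
  have "(\<integral>t. f (w * cnj t) \<partial>circle) = (\<integral>x. (1/(2*pi)) *\<^sub>R (indicator {0..<2*pi} x *\<^sub>R g (\<theta> - x)) \<partial>lborel)"
    by (subst integral_circle) (auto intro!: measurable_restrict_space1 rm[unfolded wc] Bochner_Integration.integral_cong
        simp: g_def wc cis_cnj cis_mult)
  also have "\<dots> = (\<integral>x. (1/(2*pi)) *\<^sub>R (indicator {0..<2*pi} x *\<^sub>R g x) \<partial>lborel)"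
    unfolding integral_scaleR_right * ..
  also have "\<dots> = (\<integral>t. f t \<partial>circle)"
    by (subst integral_circle) (auto intro!: measurable_restrict_space1 f Bochner_Integration.integral_cong simp: g_def)
  finally show ?thesis .
qed

section \<open>Trigonometric polynomials\<close>

text \<open>Agreement is demanded on the circle only, so that the conjugate of a monomial is again a
  monomial; an arbitrary finite set of frequencies spares the bookkeeping of degrees in sums and
  products.\<close>

definition trig_poly :: "(complex \<Rightarrow> complex) \<Rightarrow> bool" where
  "trig_poly p \<longleftrightarrow> (\<exists>K c. finite K \<and> (\<forall>t\<in>sphere 0 1. p t = (\<Sum>k\<in>K. c k * t powi k)))"

lemma trig_polyE:
  assumes "trig_poly p"
  obtains c N where "\<And>t. cmod t = 1 \<Longrightarrow> p t = (\<Sum>k\<in>{-int N..int N}. c k * t powi k)"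
proof -
  obtain K c where K: "finite K" "\<forall>t\<in>sphere 0 1. p t = (\<Sum>k\<in>K. c k * t powi k)"
    using assms unfolding trig_poly_def by blast
  define N where "N = nat (Max (insert 0 (abs ` K)))"
  have "K \<subseteq> {-int N..int N}"
  proof
    fix k assume "k \<in> K"
    then have "\<bar>k\<bar> \<le> Max (insert 0 (abs ` K))" using K by (intro Max_ge) auto
    then show "k \<in> {-int N..int N}" unfolding N_def by auto
  qed
  then have "p t = (\<Sum>k\<in>{-int N..int N}. (if k \<in> K then c k else 0) * t powi k)" if "cmod t = 1" for t
    using K that by (auto simp: if_distrib[of "\<lambda>x. x * _"] intro!: sum.mono_neutral_cong_left)
  then show thesis by (rule that)
qed

lemma trig_poly_cong: "(\<And>t. cmod t = 1 \<Longrightarrow> p t = q t) \<Longrightarrow> trig_poly p = trig_poly q"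
  unfolding trig_poly_def by (simp add: dist_norm)

lemma trig_poly_powi: "trig_poly (\<lambda>t. c * t powi n)"
  unfolding trig_poly_def by (rule exI[of _ "{n}"]) auto

lemma trig_poly_const: "trig_poly (\<lambda>t. c)"
  using trig_poly_powi[of c 0] by simp

lemma trig_poly_add:
  assumes "trig_poly p" "trig_poly q"
  shows "trig_poly (\<lambda>t. p t + q t)"
proof -
  obtain K c where K: "finite K" "\<forall>t\<in>sphere 0 1. p t = (\<Sum>k\<in>K. c k * t powi k)"
    using assms(1) unfolding trig_poly_def by blast
  obtain L d where L: "finite L" "\<forall>t\<in>sphere 0 1. q t = (\<Sum>k\<in>L. d k * t powi k)"
    using assms(2) unfolding trig_poly_def by blast
  have "p t + q t = (\<Sum>k\<in>K \<union> L. ((if k \<in> K then c k else 0) + (if k \<in> L then d k else 0)) * t powi k)"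
    if t: "t \<in> sphere 0 1" for t
  proof -
    have "p t = (\<Sum>k\<in>K \<union> L. (if k \<in> K then c k else 0) * t powi k)"
      using K L t by (auto simp: if_distrib[of "\<lambda>x. x * _"] intro!: sum.mono_neutral_cong_left)
    moreover have "q t = (\<Sum>k\<in>K \<union> L. (if k \<in> L then d k else 0) * t powi k)"
      using K L t by (auto simp: if_distrib[of "\<lambda>x. x * _"] intro!: sum.mono_neutral_cong_left)
    ultimately show ?thesis by (simp add: sum.distrib distrib_right)
  qed
  then show ?thesis
    unfolding trig_poly_def using K L
    by (intro exI[of _ "K \<union> L"] exI[of _ "\<lambda>k. (if k \<in> K then c k else 0) + (if k \<in> L then d k else 0)"]) auto
qed

lemma trig_poly_sum: "finite I \<Longrightarrow> (\<And>i. i \<in> I \<Longrightarrow> trig_poly (f i)) \<Longrightarrow> trig_poly (\<lambda>t. \<Sum>i\<in>I. f i t)"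
proof (induction I rule: finite_induct)
  case (insert i I)
  then show ?case using trig_poly_add[of "f i" "\<lambda>t. \<Sum>i\<in>I. f i t"] by simp
qed (simp add: trig_poly_const)

lemma trig_poly_mult:
  assumes "trig_poly p" "trig_poly q"
  shows "trig_poly (\<lambda>t. p t * q t)"
proof -
  obtain K c where K: "finite K" "\<forall>t\<in>sphere 0 1. p t = (\<Sum>k\<in>K. c k * t powi k)"
    using assms(1) unfolding trig_poly_def by blast
  obtain L d where L: "finite L" "\<forall>t\<in>sphere 0 1. q t = (\<Sum>k\<in>L. d k * t powi k)"
    using assms(2) unfolding trig_poly_def by blast
  have "trig_poly (\<lambda>t. \<Sum>k\<in>K. \<Sum>l\<in>L. (c k * d l) * t powi (k + l))"
    using K L by (intro trig_poly_sum trig_poly_powi)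
  also have "?this \<longleftrightarrow> ?thesis"
  proof (rule trig_poly_cong)
    fix t :: complex assume "cmod t = 1"
    moreover from this have "t \<noteq> 0" by auto
    ultimately show "(\<Sum>k\<in>K. \<Sum>l\<in>L. (c k * d l) * t powi (k + l)) = p t * q t"
      using K L by (simp add: sum_product power_int_add mult_ac)
  qed
  finally show ?thesis .
qed

lemma trig_poly_cmult: "trig_poly p \<Longrightarrow> trig_poly (\<lambda>t. c * p t)"
  by (intro trig_poly_mult trig_poly_const)

lemma trig_poly_diff: "trig_poly p \<Longrightarrow> trig_poly q \<Longrightarrow> trig_poly (\<lambda>t. p t - q t)"
  using trig_poly_add[of p "\<lambda>t. -1 * q t"] trig_poly_cmult[of q "-1"] by simp

lemma trig_poly_cnj:
  assumes "trig_poly p" shows "trig_poly (\<lambda>t. cnj (p t))"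
proof -
  obtain K c where K: "finite K" "\<forall>t\<in>sphere 0 1. p t = (\<Sum>k\<in>K. c k * t powi k)"
    using assms(1) unfolding trig_poly_def by blast
  have "trig_poly (\<lambda>t. \<Sum>k\<in>K. cnj (c k) * t powi (-k))"
    using K by (intro trig_poly_sum trig_poly_powi)
  also have "?this \<longleftrightarrow> ?thesis"
    using K by (intro trig_poly_cong) (simp add: cnj_powi_unit del: complex_cnj_power_int)
  finally show ?thesis .
qed

lemma trig_poly_continuous: "trig_poly p \<Longrightarrow> continuous_on (sphere 0 1) p"
proof -
  assume "trig_poly p"
  then obtain K c where K: "finite K" "\<forall>t\<in>sphere 0 1. p t = (\<Sum>k\<in>K. c k * t powi k)"
    unfolding trig_poly_def by blast
  have "continuous_on (sphere 0 1) (\<lambda>t::complex. \<Sum>k\<in>K. c k * t powi k)"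
    by (intro continuous_intros continuous_on_powi_circle)
  then show ?thesis using K(2) by (subst continuous_on_cong[OF refl, where g="\<lambda>t. \<Sum>k\<in>K. c k * t powi k"]) auto
qed

lemma trig_poly_measurable: "trig_poly p \<Longrightarrow> p \<in> borel_measurable circle"
  by (intro borel_measurable_circle_continuous trig_poly_continuous)

lemma trig_poly_integrable: "trig_poly p \<Longrightarrow> integrable circle p"
  by (intro integrable_circle_continuous trig_poly_continuous)

lemma trig_poly_bounded: "trig_poly p \<Longrightarrow> \<exists>B. \<forall>t. cmod t = 1 \<longrightarrow> cmod (p t) \<le> B"
proof -
  assume "trig_poly p"
  then have "bounded (p ` sphere 0 1)"
    by (intro compact_imp_bounded compact_continuous_image trig_poly_continuous) auto
  then show ?thesis unfolding bounded_iff by (metis imageI mem_sphere_0)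
qed

text \<open>Link to Stone-Weierstrass, which supplies polynomials in the real and imaginary parts:
  these parts are (t + cnj t) / 2 and (t - cnj t) / (2 i), and the class is closed under
  products.\<close>

lemma trig_poly_real_polynomial_function:
  "real_polynomial_function (q :: complex \<Rightarrow> real) \<Longrightarrow> trig_poly (\<lambda>t. of_real (q t))"
proof (induction rule: real_polynomial_function.induct)
  case (linear f)
  have lin: "f t = f 1 * Re t + f \<i> * Im t" for t
  proof -
    interpret f: bounded_linear f by fact
    have "t = Re t *\<^sub>R 1 + Im t *\<^sub>R \<i>" by (simp add: complex_eq_iff)
    then have "f t = f (Re t *\<^sub>R 1 + Im t *\<^sub>R \<i>)" by simp
    also have "\<dots> = f 1 * Re t + f \<i> * Im t" by (simp only: f.add f.scaleR) simp
    finally show ?thesis .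
  qed
  have "(\<lambda>t. complex_of_real (f t)) = (\<lambda>t. of_real (f 1 / 2) * (t + cnj t) + (of_real (f \<i>) / (2 * \<i>)) * (t - cnj t))"
  proof
    fix t
    show "complex_of_real (f t) = of_real (f 1 / 2) * (t + cnj t) + (of_real (f \<i>) / (2 * \<i>)) * (t - cnj t)"
      unfolding complex_add_cnj complex_diff_cnj by (subst lin) (simp add: field_simps)
  qed
  moreover have t1: "trig_poly (\<lambda>t. t)" using trig_poly_powi[of 1 1] by simp
  have "trig_poly (\<lambda>t. of_real (f 1 / 2) * (t + cnj t) + (of_real (f \<i>) / (2 * \<i>)) * (t - cnj t))"
    by (intro trig_poly_add trig_poly_cmult trig_poly_diff trig_poly_cnj t1)
  ultimately show ?case by simp
next
  case (const c)
  show ?case by (rule trig_poly_const)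
next
  case (add f g)
  then show ?case using trig_poly_add by simp
next
  case (mult f g)
  then show ?case using trig_poly_mult by simp
qed

section \<open>Approximation of continuous, integrable and bounded functions\<close>

lemma trig_poly_dense_continuous:
  fixes g :: "complex \<Rightarrow> real"
  assumes "continuous_on (sphere 0 1) g" "e > 0"
  obtains p :: "complex \<Rightarrow> real" where "trig_poly (\<lambda>t. of_real (p t))" "\<And>t. cmod t = 1 \<Longrightarrow> \<bar>g t - p t\<bar> < e"
proof -
  obtain q where "real_polynomial_function q" "\<And>t. t \<in> sphere 0 1 \<Longrightarrow> \<bar>g t - q t\<bar> < e"
    using Stone_Weierstrass_real_polynomial_function[OF _ assms] by auto
  then show thesis
    by (intro that[of q] trig_poly_real_polynomial_function) auto
qed

text \<open>A set of the completed measure is a Borel set up to a null set, and a Borel set is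
  filled by a compact one up to small measure; the distance function then turns the indicator of the
  compact set into a continuous function. Sums and dominated limits follow by the induction rule for
  integrable functions.\<close>

lemma continuous_dense_L1:
  fixes f :: "complex \<Rightarrow> real"
  assumes "integrable circle f" "e > 0"
  shows "\<exists>g. continuous_on UNIV g \<and> (\<integral>t. \<bar>f t - g t\<bar> \<partial>circle) < e"
  using assms
proof (induction arbitrary: e rule: integrable_induct)
  case (base A c)
  let ?C0 = "distr (uniform_measure lborel {0..<2 * pi}) (restrict_space borel (sphere 0 1)) cis"
  \<comment> \<open>The same measure on the Borel sets of the whole plane, where inner regularity by
    compact sets applies.\<close>
  define \<mu> where "\<mu> = distr ?C0 borel (\<lambda>x::complex. x)"
  obtain S N N' where A: "A = S \<union> N" "N \<subseteq> N'" "N' \<in> null_sets ?C0" "S \<in> sets ?C0"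
    using base(1) unfolding circle_def by (rule sets_completionE)
  have NC: "N' \<in> null_sets circle"
    unfolding circle_def using A(3) null_sets_completionI by blast
  have SB: "S \<in> sets borel" "S \<subseteq> sphere 0 1"
    using A(4) by (auto simp: sets_restrict_space)
  have idm: "(\<lambda>x::complex. x) \<in> measurable ?C0 borel"
    by (simp add: measurable_restrict_space1)
  have muC: "emeasure \<mu> B = emeasure circle (B \<inter> sphere 0 1)" if "B \<in> sets borel" for B
  proof -
    have "B \<inter> sphere 0 1 \<in> sets ?C0"
      using that by (auto simp: sets_restrict_space)
    then show ?thesis
      using that unfolding \<mu>_def circle_def
      by (subst emeasure_distr[OF idm]) (auto simp: space_restrict_space Int_commute)
  qed
  have S: "S \<in> sets circle"
    using A(4) unfolding circle_def by (rule sets_completionI_sets)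
  have ms: "emeasure \<mu> S = (SUP K \<in> {K. K \<subseteq> S \<and> compact K}. emeasure \<mu> K)"
    by (rule inner_regular) (use SB muC[of UNIV] in \<open>auto simp: \<mu>_def emeasure_circle\<close>)
  \<comment> \<open>The approximation of the indicator is multiplied by \<open>c\<close> in the end;
    adding 1 covers \<open>c = 0\<close> and makes the final inequality strict.\<close>
  define e' where "e' = e / (\<bar>c\<bar> + 1)"
  have e': "e' > 0" using base by (auto simp: e'_def)
  have mfin: "emeasure \<mu> S \<noteq> \<infinity>"
    using muC[OF SB(1)] circle.emeasure_finite by simp
  obtain K where K: "K \<subseteq> S" "compact K" "emeasure \<mu> S \<le> emeasure \<mu> K + ennreal (e'/2)"
  proof -
    have "{K. K \<subseteq> S \<and> compact K} \<noteq> {}" using compact_empty by blast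
    then have "\<exists>K\<in>{K. K \<subseteq> S \<and> compact K}. emeasure \<mu> S < emeasure \<mu> K + ennreal (e'/2)"
      using e' by (intro SUP_approx_ennreal[OF _ _ ms mfin]) auto
    then show ?thesis using that less_imp_le by blast
  qed
  have KB: "K \<in> sets borel" using K(2) by (simp add: borel_compact)
  have KC: "K \<in> sets circle"
    using borel_measurable_circle[of "indicator K :: complex \<Rightarrow> real"] KB K(1) SB
    by (simp add: borel_measurable_indicator_iff space_circle) (metis K(1) SB(2) Int_absorb2 subset_trans)
  have "measure circle S \<le> measure circle K + e'/2"
  proof -
    have "S \<inter> sphere 0 1 = S" "K \<inter> sphere 0 1 = K" using SB K by auto
    then have "ennreal (measure circle S) \<le> ennreal (measure circle K) + ennreal (e'/2)"
      using K(3) muC[OF SB(1)] muC[OF KB] by (simp add: circle.emeasure_eq_measure)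
    then show ?thesis using e' by (simp flip: ennreal_plus)
  qed
  then have SK: "measure circle (S - K) \<le> e'/2"
    using circle.finite_measure_Diff[OF S KC K(1)] by simp
  have "\<exists>g. continuous_on UNIV g \<and> (\<integral>t. \<bar>indicator K t - g t\<bar> \<partial>circle) < e'/2"
  proof (cases "K = {}")
    case True
    then show ?thesis using e' by (intro exI[of _ "\<lambda>_. 0"]) auto
  next
    case False
    \<comment> \<open>Decreases in n to the indicator of \<open>K\<close>, because \<open>K\<close>
      is closed.\<close>
    define g where "g n t = max 0 (1 - real n * infdist t K)" for n t
    have gc: "continuous_on UNIV (g n)" for n
      unfolding g_def by (intro continuous_intros)
    have lim: "(\<lambda>n. g n t) \<longlonglongrightarrow> indicator K t" for t
    proof (cases "t \<in> K")
      case True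
      then show ?thesis by (simp add: g_def)
    next
      case False
      then have "infdist t K > 0"
        using in_closed_iff_infdist_zero[OF compact_imp_closed[OF K(2)] \<open>K \<noteq> {}\<close>, of t] infdist_nonneg[of t K] by simp
      moreover obtain m where "real m > 1 / infdist t K" using reals_Archimedean2 by blast
      ultimately have m: "1 < real m * infdist t K" by (simp add: field_simps)
      have "g n t = 0" if "n \<ge> m" for n
      proof -
        have "real m * infdist t K \<le> real n * infdist t K" using that infdist_nonneg by (intro mult_right_mono) auto
        then show ?thesis using m unfolding g_def by simp
      qed
      then show ?thesis using False by (intro tendsto_eventually) (auto simp: eventually_sequentially)
    qed
    have "(\<lambda>n. \<integral>t. \<bar>indicator K t - g n t\<bar> \<partial>circle) \<longlonglongrightarrow> (\<integral>t. 0 \<partial>circle)"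
    proof (rule integral_dominated_convergence[where w="\<lambda>_. 2"])
      show "AE t in circle. (\<lambda>n. \<bar>indicator K t - g n t\<bar>) \<longlonglongrightarrow> 0"
      proof (intro AE_circleI tendsto_rabs_zero)
        show "(\<lambda>n. indicator K t - g n t) \<longlonglongrightarrow> 0" for t
          using tendsto_diff[OF tendsto_const lim, of "indicator K t" t] by simp
      qed
      show "AE t in circle. norm \<bar>indicator K t - g n t\<bar> \<le> 2" for n
      proof (rule AE_circleI)
        fix t
        have "0 \<le> real n * infdist t K" using infdist_nonneg[of t K] by simp
        then show "norm \<bar>indicator K t - g n t\<bar> \<le> 2" by (auto simp: g_def indicator_def max_def)
      qed
      show "(\<lambda>t. \<bar>indicator K t - g n t\<bar>) \<in> borel_measurable circle" for n
        using gc KC by (intro borel_measurable_abs borel_measurable_diff borel_measurable_indicator)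
          (auto intro!: borel_measurable_circle borel_measurable_continuous_onI)
    qed auto
    then have "\<forall>\<^sub>F n in sequentially. (\<integral>t. \<bar>indicator K t - g n t\<bar> \<partial>circle) < e'/2"
      using e' by (intro order_tendstoD) auto
    then show ?thesis using gc eventually_happens' sequentially_bot by blast
  qed
  then obtain g where g: "continuous_on UNIV g" "(\<integral>t. \<bar>indicator K t - g t\<bar> \<partial>circle) < e'/2" by blast
  have gi: "integrable circle g"
    using g by (auto intro!: integrable_circle_continuous intro: continuous_on_subset)
  have iK: "integrable circle (indicator K :: _ \<Rightarrow> real)" "integrable circle (indicator (S - K) :: _ \<Rightarrow> real)"
    "integrable circle (indicator S :: _ \<Rightarrow> real)"
    using KC S by (auto simp: integrable_indicator_iff circle.emeasure_finite less_top[symmetric])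
  have "(\<integral>t. \<bar>indicator A t *\<^sub>R c - c * g t\<bar> \<partial>circle) = (\<integral>t. \<bar>c\<bar> * \<bar>indicator S t - g t\<bar> \<partial>circle)"
  proof (rule integral_cong_AE)
    show "AE t in circle. \<bar>indicator A t *\<^sub>R c - c * g t\<bar> = \<bar>c\<bar> * \<bar>indicator S t - g t\<bar>"
      using AE_not_in[OF NC] by eventually_elim
        (use A in \<open>auto simp: indicator_def abs_mult[symmetric] algebra_simps\<close>)
  qed (use gi base S in auto)
  also have "\<dots> \<le> (\<integral>t. \<bar>c\<bar> * (indicator (S - K) t + \<bar>indicator K t - g t\<bar>) \<partial>circle)"
  proof (rule integral_mono)
    show "integrable circle (\<lambda>t. \<bar>c\<bar> * \<bar>indicator S t - g t\<bar>)"
      "integrable circle (\<lambda>t. \<bar>c\<bar> * (indicator (S - K) t + \<bar>indicator K t - g t\<bar>))"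
      by (intro integrable_mult_right Bochner_Integration.integrable_add integrable_abs
        Bochner_Integration.integrable_diff iK gi)+
    show "\<bar>c\<bar> * \<bar>indicator S t - g t\<bar> \<le> \<bar>c\<bar> * (indicator (S - K) t + \<bar>indicator K t - g t\<bar>)" for t
      using K(1) by (intro mult_left_mono) (auto simp: indicator_def)
  qed
  also have "\<dots> = \<bar>c\<bar> * (measure circle (S - K) + (\<integral>t. \<bar>indicator K t - g t\<bar> \<partial>circle))"
  proof -
    have "(\<integral>t. indicator (S - K) t \<partial>circle) = measure circle (S - K)"
      using S KC by (simp add: Int_absorb2 sets.sets_into_space[of "S - K"])
    then show ?thesis
      using gi iK by simp
  qed
  also have "\<dots> \<le> \<bar>c\<bar> * (e'/2 + e'/2)"
    using SK g(2) by (intro mult_left_mono add_mono) auto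
  also have "\<dots> < (\<bar>c\<bar> + 1) * e'" using e' by (simp add: distrib_right)
  also have "\<dots> = e" by (simp add: e'_def add_nonneg_pos less_imp_neq[symmetric])
  finally show ?case
    using g(1) by (intro exI[of _ "\<lambda>t. c * g t"]) (auto intro!: continuous_intros)
next
  case (add f g)
  from add.IH(1)[of "e/2"] add.IH(2)[of "e/2"] add.prems obtain u v where
    uv: "continuous_on UNIV u" "(\<integral>t. \<bar>f t - u t\<bar> \<partial>circle) < e/2"
    "continuous_on UNIV v" "(\<integral>t. \<bar>g t - v t\<bar> \<partial>circle) < e/2" by auto
  have int: "integrable circle u" "integrable circle v"
    by (intro integrable_circle_continuous continuous_on_subset[OF uv(1)] continuous_on_subset[OF uv(3)]; simp)+
  have "(\<integral>t. \<bar>(f t + g t) - (u t + v t)\<bar> \<partial>circle) \<le> (\<integral>t. \<bar>f t - u t\<bar> + \<bar>g t - v t\<bar> \<partial>circle)"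
    using add.hyps int by (intro integral_mono) auto
  also have "\<dots> = (\<integral>t. \<bar>f t - u t\<bar> \<partial>circle) + (\<integral>t. \<bar>g t - v t\<bar> \<partial>circle)"
    using add.hyps int by (intro Bochner_Integration.integral_add) auto
  finally show ?case
    using uv by (intro exI[of _ "\<lambda>t. u t + v t"]) (auto intro!: continuous_intros)
next
  case (lim f s)
  have "(\<lambda>i. \<integral>t. norm (s i t - f t) \<partial>circle) \<longlonglongrightarrow> 0"
  proof -
    have "(\<lambda>i. \<integral>t. norm (s i t - f t) \<partial>circle) \<longlonglongrightarrow> (\<integral>t. norm (0::real) \<partial>circle)"
    proof (rule integral_dominated_convergence[where w="\<lambda>t. 3 * norm (f t)"])
      show "AE t in circle. (\<lambda>i. norm (s i t - f t)) \<longlonglongrightarrow> norm (0::real)"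
      proof (intro AE_circleI tendsto_norm)
        fix t :: complex assume "cmod t = 1"
        then have "(\<lambda>i. s i t) \<longlonglongrightarrow> f t" using lim.hyps(2)[of t] by (simp add: space_circle)
        then show "(\<lambda>i. s i t - f t) \<longlonglongrightarrow> 0" by (rule LIM_zero)
      qed
      show "AE t in circle. norm (norm (s i t - f t)) \<le> 3 * norm (f t)" for i
      proof (rule AE_circleI)
        fix t :: complex assume "cmod t = 1"
        then have "\<bar>s i t\<bar> \<le> 2 * \<bar>f t\<bar>" using lim.hyps(3)[of t i] by (simp add: space_circle)
        then show "norm (norm (s i t - f t)) \<le> 3 * norm (f t)" by simp
      qed
    qed (use lim.hyps in auto)
    then show ?thesis by simp
  qed
  then have "\<forall>\<^sub>F i in sequentially. (\<integral>t. norm (s i t - f t) \<partial>circle) < e/2"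
    using lim.prems by (intro order_tendstoD) auto
  then obtain i where i: "(\<integral>t. norm (s i t - f t) \<partial>circle) < e/2"
    using eventually_happens'[OF sequentially_bot] by blast
  have "0 < e/2" using lim.prems by simp
  then obtain u where u: "continuous_on UNIV u" "(\<integral>t. \<bar>s i t - u t\<bar> \<partial>circle) < e/2"
    using lim.IH by blast
  have int: "integrable circle u"
    by (intro integrable_circle_continuous continuous_on_subset[OF u(1)]) auto
  have "(\<integral>t. \<bar>f t - u t\<bar> \<partial>circle) \<le> (\<integral>t. norm (s i t - f t) + \<bar>s i t - u t\<bar> \<partial>circle)"
    using lim.hyps int by (intro integral_mono) auto
  also have "\<dots> = (\<integral>t. norm (s i t - f t) \<partial>circle) + (\<integral>t. \<bar>s i t - u t\<bar> \<partial>circle)"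
    using lim.hyps int by (intro Bochner_Integration.integral_add) auto
  finally show ?case
    using u i by (intro exI[of _ u]) auto
qed


lemma integrable_circle_between:
  fixes f :: "complex \<Rightarrow> real"
  assumes f: "f \<in> borel_measurable circle" and bd: "\<And>t. cmod t = 1 \<Longrightarrow> a \<le> f t \<and> f t \<le> b"
  shows "integrable circle f"
proof (rule integrable_circle_bounded[OF f])
  fix t :: complex assume "cmod t = 1"
  from bd[OF this] show "norm (f t) \<le> \<bar>a\<bar> + \<bar>b\<bar>" by (simp add: abs_if)
qed

text \<open>Clamping an L1 approximation to [a, b] does not move it away from \<open>f\<close>;
  raising it by e / 4 before a uniform approximation within e / 4 keeps the polynomial strictly
  above a, at the price of the upper bound b + e. The exact lower bound matters: polynomials at
  least 1 enter a logarithm, nonnegative ones a Herglotz transform.\<close>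

lemma trig_poly_dense_L1:
  fixes f :: "complex \<Rightarrow> real"
  assumes f: "f \<in> borel_measurable circle" and bd: "\<And>t. cmod t = 1 \<Longrightarrow> a \<le> f t \<and> f t \<le> b" and e: "e > 0"
  obtains p :: "complex \<Rightarrow> real" where "trig_poly (\<lambda>t. of_real (p t))"
    "\<And>t. cmod t = 1 \<Longrightarrow> a < p t \<and> p t < b + e" "(\<integral>t. \<bar>f t - p t\<bar> \<partial>circle) < e"
proof -
  have ab: "a \<le> b" using bd[of 1] by auto
  have fi: "integrable circle f"
    by (rule integrable_circle_between[OF f bd])
  obtain g0 where g0: "continuous_on UNIV g0" "(\<integral>t. \<bar>f t - g0 t\<bar> \<partial>circle) < e/4"
    using continuous_dense_L1[OF fi, of "e/4"] e by auto
  define g where "g t = max a (min b (g0 t))" for t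
  have gc: "continuous_on (sphere 0 1) g"
    unfolding g_def by (intro continuous_intros continuous_on_subset[OF g0(1)]) auto
  have gi: "integrable circle g" "integrable circle g0"
    using gc g0 by (auto intro!: integrable_circle_continuous intro: continuous_on_subset)
  obtain p where p: "trig_poly (\<lambda>t. of_real (p t))" "\<And>t. cmod t = 1 \<Longrightarrow> \<bar>(g t + e/4) - p t\<bar> < e/4"
    by (rule trig_poly_dense_continuous[of "\<lambda>t. g t + e/4" "e/4"]) (use gc e in \<open>auto intro!: continuous_intros\<close>)
  have pm: "p \<in> borel_measurable circle"
    using measurable_compose[OF trig_poly_measurable[OF p(1)] borel_measurable_Re] by simp
  have pb: "a < p t \<and> p t < b + e" if "cmod t = 1" for t
  proof -
    have "a \<le> g t" "g t \<le> b" using ab by (auto simp: g_def)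
    moreover have "g t + e/4 - p t < e/4" "p t - (g t + e/4) < e/4"
      using p(2)[OF that] by (simp_all add: abs_less_iff del: less_divide_eq_numeral1)
    ultimately show ?thesis using e by (auto simp del: less_divide_eq_numeral1)
  qed
  have pi: "integrable circle p"
    by (rule integrable_circle_between[OF pm, of a "b + e"]) (use pb less_imp_le in blast)
  have "(\<integral>t. \<bar>f t - p t\<bar> \<partial>circle) \<le> (\<integral>t. \<bar>f t - g0 t\<bar> + e/2 \<partial>circle)"
  proof (rule integral_mono)
    fix t assume t: "t \<in> space circle"
    then have "\<bar>f t - g t\<bar> \<le> \<bar>f t - g0 t\<bar>"
      using bd[of t] unfolding g_def by (auto simp: space_circle)
    then show "\<bar>f t - p t\<bar> \<le> \<bar>f t - g0 t\<bar> + e/2"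
      using p(2)[of t] t abs_triangle_ineq[of "f t - g t" "g t - p t"]
        abs_triangle_ineq[of "g t + e/4 - p t" "-(e/4)"] e by (simp add: space_circle del: less_divide_eq_numeral1)
  qed (use fi gi pi in auto)
  also have "\<dots> = (\<integral>t. \<bar>f t - g0 t\<bar> \<partial>circle) + e/2"
    using fi gi by (simp add: space_circle measure_def emeasure_circle)
  also have "\<dots> < e" using g0(2) e by simp
  finally show thesis using that p(1) pb by blast
qed

lemma bounded_trig_seq_real:
  fixes f :: "complex \<Rightarrow> real"
  assumes f: "f \<in> borel_measurable circle" and bd: "\<And>t. cmod t = 1 \<Longrightarrow> a \<le> f t \<and> f t \<le> b"
  obtains p :: "nat \<Rightarrow> complex \<Rightarrow> real" where "\<And>n. trig_poly (\<lambda>t. of_real (p n t))"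
    "\<And>n t. cmod t = 1 \<Longrightarrow> a < p n t \<and> p n t < b + 1" "AE t in circle. (\<lambda>n. p n t) \<longlonglongrightarrow> f t"
proof -
  have "\<exists>p. trig_poly (\<lambda>t. of_real (p t)) \<and> (\<forall>t. cmod t = 1 \<longrightarrow> a < p t \<and> p t < b + 1 / real (Suc n)) \<and> (\<integral>t. \<bar>f t - p t\<bar> \<partial>circle) < 1 / real (Suc n)" for n
    by (rule trig_poly_dense_L1[OF f bd, of "1 / real (Suc n)"]) auto
  then obtain p where p: "\<And>n. trig_poly (\<lambda>t. of_real (p n t))"
    "\<And>n t. cmod t = 1 \<Longrightarrow> a < p n t \<and> p n t < b + 1 / real (Suc n)" "\<And>n. (\<integral>t. \<bar>f t - p n t\<bar> \<partial>circle) < 1 / real (Suc n)"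
    by metis
  have pb: "a < p n t \<and> p n t < b + 1" if "cmod t = 1" for n t
    using p(2)[OF that, of n] by (auto intro: less_le_trans)
  have pm: "p n \<in> borel_measurable circle" for n
    using measurable_compose[OF trig_poly_measurable[OF p(1)[of n]] borel_measurable_Re] by simp
  have int: "integrable circle (\<lambda>t. p n t - f t)" for n
  proof (intro Bochner_Integration.integrable_diff)
    show "integrable circle (p n)"
      by (rule integrable_circle_between[OF pm[of n], of a "b + 1"]) (use pb less_imp_le in blast)
    show "integrable circle f"
      by (rule integrable_circle_between[OF f bd])
  qed
  have "(\<lambda>n. \<integral>t. norm (p n t - f t) \<partial>circle) \<longlonglongrightarrow> 0"
  proof (rule tendsto_sandwich[OF always_eventually always_eventually tendsto_const LIMSEQ_inverse_real_of_nat])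
    show "\<forall>n. (\<integral>t. norm (p n t - f t) \<partial>circle) \<le> inverse (real (Suc n))"
      using p(3) by (simp add: abs_minus_commute inverse_eq_divide less_imp_le)
  qed auto
  then obtain r where r: "strict_mono r" "AE t in circle. (\<lambda>n. p (r n) t - f t) \<longlonglongrightarrow> 0"
    using tendsto_L1_AE_subseq[of circle "\<lambda>n t. p n t - f t", OF int] by auto
  show thesis
    by (rule that[of "\<lambda>n. p (r n)"]) (use p(1) pb r(2) in \<open>auto simp: LIM_zero_iff\<close>)
qed

text \<open>Real and imaginary parts are treated separately; each approximant stays below B + 1 in
  modulus, whence the factor 2.\<close>

lemma bounded_trig_seq:
  fixes f :: "complex \<Rightarrow> complex"
  assumes f: "f \<in> borel_measurable circle" and bd: "\<And>t. cmod t = 1 \<Longrightarrow> cmod (f t) \<le> B"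
  obtains p where "\<And>n. trig_poly (p n)"
    "\<And>n t. cmod t = 1 \<Longrightarrow> cmod (p n t) \<le> 2 * (B + 1)" "AE t in circle. (\<lambda>n. p n t) \<longlonglongrightarrow> f t"
proof -
  have b: "-B \<le> Re (f t) \<and> Re (f t) \<le> B" "-B \<le> Im (f t) \<and> Im (f t) \<le> B" if "cmod t = 1" for t
    using bd[OF that] abs_Re_le_cmod[of "f t"] abs_Im_le_cmod[of "f t"] by linarith+
  obtain p :: "nat \<Rightarrow> complex \<Rightarrow> real" where
    p: "\<And>n. trig_poly (\<lambda>t. of_real (p n t))" "\<And>n t. cmod t = 1 \<Longrightarrow> -B < p n t \<and> p n t < B + 1" "AE t in circle. (\<lambda>n. p n t) \<longlonglongrightarrow> Re (f t)"
    by (rule bounded_trig_seq_real[OF measurable_compose[OF f borel_measurable_Re] b(1)], assumption) (rule that)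
  obtain q :: "nat \<Rightarrow> complex \<Rightarrow> real" where
    q: "\<And>n. trig_poly (\<lambda>t. of_real (q n t))" "\<And>n t. cmod t = 1 \<Longrightarrow> -B < q n t \<and> q n t < B + 1" "AE t in circle. (\<lambda>n. q n t) \<longlonglongrightarrow> Im (f t)"
    by (rule bounded_trig_seq_real[OF measurable_compose[OF f borel_measurable_Im] b(2)], assumption) (rule that)
  show thesis
  proof (rule that[of "\<lambda>n t. of_real (p n t) + \<i> * of_real (q n t)"])
    show "trig_poly (\<lambda>t. of_real (p n t) + \<i> * of_real (q n t))" for n
      by (intro trig_poly_add trig_poly_cmult p q)
    show "cmod (of_real (p n t) + \<i> * of_real (q n t)) \<le> 2 * (B + 1)" if "cmod t = 1" for n t
    proof -
      have "cmod (of_real (p n t) + \<i> * of_real (q n t)) \<le> \<bar>p n t\<bar> + \<bar>q n t\<bar>"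
        by (rule order_trans[OF norm_triangle_ineq]) (simp add: norm_mult)
      also have "\<dots> \<le> 2 * (B + 1)" using p(2)[OF that, of n] q(2)[OF that, of n] by (auto simp: abs_if)
      finally show ?thesis .
    qed
    show "AE t in circle. (\<lambda>n. of_real (p n t) + \<i> * of_real (q n t)) \<longlonglongrightarrow> f t"
      using p(3) q(3)
    proof eventually_elim
      case (elim t)
      then have "(\<lambda>n. of_real (p n t) + \<i> * of_real (q n t)) \<longlonglongrightarrow> of_real (Re (f t)) + \<i> * of_real (Im (f t))"
        by (intro tendsto_intros)
      then show ?case by (simp only: complex_eq[symmetric])
    qed
  qed
qed

section \<open>Fourier coefficients of integrable functions\<close>

lemma integrable_mult_bounded:
  fixes f g :: "complex \<Rightarrow> complex"
  assumes f: "integrable circle f" and g: "g \<in> borel_measurable circle" "\<And>t. cmod t = 1 \<Longrightarrow> cmod (g t) \<le> B"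
  shows "integrable circle (\<lambda>t. f t * g t)"
proof (rule Bochner_Integration.integrable_bound[where f="\<lambda>t. B * norm (f t)"])
  show "AE t in circle. norm (f t * g t) \<le> norm (B * norm (f t))"
  proof (rule AE_circleI)
    fix t :: complex assume t: "cmod t = 1"
    then have "cmod (g t) \<le> B" "0 \<le> B" using g(2)[of t] by (auto intro: order_trans[OF norm_ge_zero])
    then show "norm (f t * g t) \<le> norm (B * norm (f t))"
      by (simp add: norm_mult abs_mult mult_right_mono mult.commute[of "cmod (f t)"])
  qed
qed (use f g in auto)

lemma fourier_coeff_cong_AE:
  assumes "f \<in> borel_measurable circle" "g \<in> borel_measurable circle" "AE t in circle. f t = g t"
  shows "fourier_coeff f n = fourier_coeff g n"
  unfolding fourier_coeff_def using assms by (intro integral_cong_AE) auto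

lemma integrable_fourier: "integrable circle f \<Longrightarrow> integrable circle (\<lambda>t. f t * t powi n)"
  by (rule integrable_mult_bounded[where B=1]) (auto simp: norm_power_int)

lemma fourier_coeff_add:
  assumes "integrable circle f" "integrable circle g"
  shows "fourier_coeff (\<lambda>t. f t + g t) n = fourier_coeff f n + fourier_coeff g n"
  unfolding fourier_coeff_def distrib_right
  by (intro Bochner_Integration.integral_add integrable_fourier assms)

lemma fourier_coeff_diff:
  assumes "integrable circle f" "integrable circle g"
  shows "fourier_coeff (\<lambda>t. f t - g t) n = fourier_coeff f n - fourier_coeff g n"
  unfolding fourier_coeff_def left_diff_distrib
  by (intro Bochner_Integration.integral_diff integrable_fourier assms)

lemma fourier_coeff_cmult: "fourier_coeff (\<lambda>t. c * f t) n = c * fourier_coeff f n"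
  by (simp add: fourier_coeff_def mult.assoc)

lemma fourier_coeff_sum:
  assumes "\<And>i. i \<in> I \<Longrightarrow> integrable circle (f i)"
  shows "fourier_coeff (\<lambda>t. \<Sum>i\<in>I. f i t) n = (\<Sum>i\<in>I. fourier_coeff (f i) n)"
  unfolding fourier_coeff_def sum_distrib_right
  by (intro Bochner_Integration.integral_sum integrable_fourier assms)

lemma fourier_coeff_powi_mult: "fourier_coeff (\<lambda>t. t powi m * f t) n = fourier_coeff f (n - m)"
  unfolding fourier_coeff_def
proof (intro Bochner_Integration.integral_cong refl)
  fix t :: complex assume "t \<in> space circle"
  then have "t \<noteq> 0" by (auto simp: space_circle)
  then have "t powi m * t powi - n = t powi - (n - m)"
    by (simp flip: power_int_add)
  then show "t powi m * f t * t powi - n = f t * t powi - (n - m)"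
    by (metis mult.assoc mult.commute)
qed

lemma fourier_coeff_powi: "fourier_coeff (\<lambda>t. t powi m) n = (if m = n then 1 else 0)"
  using fourier_coeff_powi_mult[of m "\<lambda>_. 1" n] integral_powi[of "m - n"] by (simp add: fourier_coeff_def)

lemma fourier_coeff_norm_diff:
  assumes "integrable circle f" "integrable circle g"
  shows "cmod (fourier_coeff f n - fourier_coeff g n) \<le> (\<integral>t. cmod (f t - g t) \<partial>circle)"
proof -
  have "cmod (fourier_coeff (\<lambda>t. f t - g t) n) \<le> (\<integral>t. cmod ((f t - g t) * t powi - n) \<partial>circle)"
    unfolding fourier_coeff_def by (rule integral_norm_bound)
  also have "\<dots> = (\<integral>t. cmod (f t - g t) \<partial>circle)"
    by (intro Bochner_Integration.integral_cong) (auto simp: norm_mult norm_power_int space_circle)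
  finally show ?thesis using assms by (simp add: fourier_coeff_diff)
qed

lemma integral_mult_trig_poly_eq_0:
  assumes f: "integrable circle f" and c: "\<And>n. fourier_coeff f n = 0" and p: "trig_poly p"
  shows "(\<integral>t. f t * p t \<partial>circle) = 0"
proof -
  obtain K c where K: "finite K" "\<forall>t\<in>sphere 0 1. p t = (\<Sum>k\<in>K. c k * t powi k)"
    using p unfolding trig_poly_def by blast
  have "(\<integral>t. f t * p t \<partial>circle) = (\<integral>t. (\<Sum>k\<in>K. c k * (f t * t powi k)) \<partial>circle)"
    using K by (intro Bochner_Integration.integral_cong) (auto simp: space_circle sum_distrib_left mult_ac)
  also have "\<dots> = (\<Sum>k\<in>K. c k * (\<integral>t. f t * t powi k \<partial>circle))"
    using integrable_fourier[OF f] by simp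
  also have "\<dots> = 0"
    using c[of "- _"] by (simp add: fourier_coeff_def)
  finally show ?thesis .
qed

text \<open>Trigonometric polynomials that converge boundedly almost everywhere to the conjugate
  sign of \<open>f\<close> turn the vanishing of the coefficients into the vanishing of the integral
  of |f|.\<close>

lemma fourier_uniqueness:
  assumes f: "integrable circle f" and c: "\<And>n. fourier_coeff f n = 0"
  shows "AE t in circle. f t = 0"
proof -
  define u where "u t = cnj (sgn (f t))" for t
  have fm: "f \<in> borel_measurable circle" using f by simp
  have um: "u \<in> borel_measurable circle"
    unfolding u_def sgn_div_norm using fm
    by (intro borel_measurable_continuous_on[where f=cnj] continuous_intros) auto
  have ub: "cmod (u t) \<le> 1" for t unfolding u_def by (simp add: norm_sgn)
  obtain p where p: "\<And>n. trig_poly (p n)"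
    "\<And>n t. cmod t = 1 \<Longrightarrow> cmod (p n t) \<le> 2 * (1 + 1)" "AE t in circle. (\<lambda>n. p n t) \<longlonglongrightarrow> u t"
    using bounded_trig_seq[OF um ub] by blast
  have "(\<lambda>n. \<integral>t. f t * p n t \<partial>circle) \<longlonglongrightarrow> (\<integral>t. f t * u t \<partial>circle)"
  proof (rule integral_dominated_convergence[where w="\<lambda>t. 4 * norm (f t)"])
    show "AE t in circle. (\<lambda>n. f t * p n t) \<longlonglongrightarrow> f t * u t"
      using p(3) by eventually_elim (intro tendsto_intros)
    show "AE t in circle. norm (f t * p n t) \<le> 4 * norm (f t)" for n
      using p(2)[of _ n] by (intro AE_circleI) (simp add: norm_mult mult.commute mult_left_mono)
  qed (use f fm um trig_poly_measurable[OF p(1)] in auto)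
  then have "(\<integral>t. f t * u t \<partial>circle) = 0"
    unfolding integral_mult_trig_poly_eq_0[OF f c p(1)] by (simp add: LIMSEQ_const_iff)
  moreover have "f t * u t = of_real (norm (f t))" for t
  proof (cases "f t = 0")
    case False
    have "f t * u t = (f t * cnj (f t)) / of_real (norm (f t))"
      by (simp add: u_def sgn_div_norm scaleR_conv_of_real divide_inverse)
    then show ?thesis
      using False by (simp add: complex_norm_square[symmetric] power2_eq_square del: complex_mult_cnj)
  qed (simp add: u_def)
  ultimately have "(\<integral>t. norm (f t) \<partial>circle) = 0"
    using integral_complex_of_real[of circle "\<lambda>t. norm (f t)"] by simp
  then show ?thesis
    using integral_nonneg_eq_0_iff_AE[of circle "\<lambda>t. norm (f t)"] f by simp
qed

lemma fourier_unique:
  assumes "integrable circle f" "integrable circle g" "\<And>n. fourier_coeff f n = fourier_coeff g n"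
  shows "AE t in circle. f t = g t"
  using fourier_uniqueness[of "\<lambda>t. f t - g t"] assms by (simp add: fourier_coeff_diff)

section \<open>Cauchy and Herglotz integrals\<close>

lemma measure_circle [simp]: "measure circle (space circle) = 1"
  by (simp add: measure_def space_circle emeasure_circle)

text \<open>The usual Cauchy integral of \<open>h\<close> over the circle, since d\<tau> / (2 pi i)
  is \<tau> dm(\<tau>).\<close>

definition cauchy_transform :: "(complex \<Rightarrow> complex) \<Rightarrow> complex \<Rightarrow> complex" where
  "cauchy_transform h z = (\<integral>\<tau>. h \<tau> * (\<tau> / (\<tau> - z)) \<partial>circle)"

text \<open>The integral of \<open>h\<close> against (\<tau> + z) / (\<tau> - z); for real
  \<open>h\<close> its real part is the Poisson integral of \<open>h\<close>.\<close>

definition herglotz :: "(complex \<Rightarrow> complex) \<Rightarrow> complex \<Rightarrow> complex" where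
  "herglotz h z = 2 * cauchy_transform h z - (\<integral>\<tau>. h \<tau> \<partial>circle)"

lemma integrable_cauchy_kernel:
  assumes h: "integrable circle h" and z: "cmod z < 1"
  shows "integrable circle (\<lambda>\<tau>. h \<tau> * (\<tau> / (\<tau> - z)))"
proof (rule integrable_mult_bounded[OF h, where B="1 / (1 - cmod z)"])
  show "(\<lambda>\<tau>. \<tau> / (\<tau> - z)) \<in> borel_measurable circle"
    by (intro borel_measurable_circle) measurable
  show "cmod (t / (t - z)) \<le> 1 / (1 - cmod z)" if "cmod t = 1" for t
    using that z norm_triangle_ineq2[of t z] by (simp add: norm_divide frac_le)
qed

text \<open>The kernel is the geometric series in z / \<tau>, absolutely convergent uniformly in
  \<tau>. Holomorphy in the disc and the transforms of trigonometric polynomials are both read off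
  from this expansion.\<close>

lemma cauchy_transform_sums:
  assumes h: "integrable circle h" and z: "cmod z < 1"
  shows "(\<lambda>n. fourier_coeff h (int n) * z ^ n) sums cauchy_transform h z"
proof -
  define f where "f n \<tau> = h \<tau> * \<tau> powi (- int n) * z ^ n" for n \<tau>
  have fi: "integrable circle (f n)" for n
    unfolding f_def by (intro integrable_mult_left integrable_fourier h)
  have nf: "norm (f n \<tau>) = norm (h \<tau>) * cmod z ^ n" if "cmod \<tau> = 1" for n \<tau>
    using that by (simp add: f_def norm_mult norm_power norm_power_int)
  have "(\<lambda>i. integral\<^sup>L circle (f i)) sums (\<integral>\<tau>. (\<Sum>i. f i \<tau>) \<partial>circle)"
  proof (rule sums_integral[OF fi])
    show "AE \<tau> in circle. summable (\<lambda>i. norm (f i \<tau>))"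
    proof (rule AE_circleI)
      fix t :: complex assume "cmod t = 1"
      then show "summable (\<lambda>i. norm (f i t))"
        using z by (simp add: nf summable_mult summable_geometric)
    qed
    have "(\<integral>\<tau>. norm (f i \<tau>) \<partial>circle) = (\<integral>\<tau>. norm (h \<tau>) * cmod z ^ i \<partial>circle)" for i
      by (intro Bochner_Integration.integral_cong) (auto simp: nf space_circle)
    then show "summable (\<lambda>i. \<integral>\<tau>. norm (f i \<tau>) \<partial>circle)"
      using z by (simp add: summable_mult summable_geometric)
  qed
  moreover have "(\<integral>\<tau>. (\<Sum>i. f i \<tau>) \<partial>circle) = cauchy_transform h z"
    unfolding cauchy_transform_def
  proof (intro Bochner_Integration.integral_cong refl)
    fix \<tau> assume "\<tau> \<in> space circle"
    then have t: "cmod \<tau> = 1" "\<tau> \<noteq> 0" by (auto simp: space_circle)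
    have "(\<lambda>n. (z / \<tau>) ^ n) sums (1 / (1 - z / \<tau>))"
      using z t by (intro geometric_sums) (simp add: norm_divide)
    then have "(\<lambda>n. h \<tau> * (z / \<tau>) ^ n) sums (h \<tau> * (1 / (1 - z / \<tau>)))"
      by (rule sums_mult)
    also have "(\<lambda>n. h \<tau> * (z / \<tau>) ^ n) = (\<lambda>n. f n \<tau>)"
      unfolding f_def by (simp add: power_divide power_int_minus field_simps)
    finally have "(\<Sum>n. f n \<tau>) = h \<tau> * (1 / (1 - z / \<tau>))"
      by (simp add: sums_iff)
    also have "1 / (1 - z / \<tau>) = \<tau> / (\<tau> - z)"
      using t by (simp add: field_simps)
    finally show "(\<Sum>n. f n \<tau>) = h \<tau> * (\<tau> / (\<tau> - z))" .
  qed
  moreover have "integral\<^sup>L circle (f i) = fourier_coeff h (int i) * z ^ i" for i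
    unfolding f_def fourier_coeff_def by simp
  ultimately show ?thesis by simp
qed

lemma cauchy_transform_holomorphic:
  assumes "integrable circle h"
  shows "cauchy_transform h holomorphic_on ball 0 1"
  by (rule power_series_holomorphic[where a="\<lambda>n. fourier_coeff h (int n)"])
     (use cauchy_transform_sums[OF assms] in auto)

lemma cauchy_transform_0: "integrable circle h \<Longrightarrow> cauchy_transform h 0 = (\<integral>\<tau>. h \<tau> \<partial>circle)"
  unfolding cauchy_transform_def
  by (intro Bochner_Integration.integral_cong) (auto simp: space_circle)

lemma herglotz_holomorphic: "integrable circle h \<Longrightarrow> herglotz h holomorphic_on ball 0 1"
  unfolding herglotz_def by (intro holomorphic_intros cauchy_transform_holomorphic)

lemma herglotz_0: "integrable circle h \<Longrightarrow> herglotz h 0 = (\<integral>\<tau>. h \<tau> \<partial>circle)"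
  by (simp add: herglotz_def cauchy_transform_0)

lemma Re_herglotz_kernel:
  assumes "cmod \<tau> = 1" "cmod z < 1"
  shows "Re (2 * (\<tau> / (\<tau> - z)) - 1) = (1 - (cmod z)\<^sup>2) / (cmod (\<tau> - z))\<^sup>2"
proof -
  have nz: "\<tau> - z \<noteq> 0" using assms by auto
  then have "2 * (\<tau> / (\<tau> - z)) - 1 = (\<tau> + z) / (\<tau> - z)" by (simp add: field_simps)
  also have "Re \<dots> = Re ((\<tau> + z) * cnj (\<tau> - z)) / (cmod (\<tau> - z))\<^sup>2"
    by (subst complex_div_cnj) (simp only: of_real_power[symmetric] Re_divide_of_real)
  also have "Re ((\<tau> + z) * cnj (\<tau> - z)) = (cmod \<tau>)\<^sup>2 - (cmod z)\<^sup>2"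
    unfolding cmod_power2 by (simp add: algebra_simps power2_eq_square)
  finally show ?thesis using assms by simp
qed

lemma integrable_poisson:
  assumes u: "integrable circle (u :: complex \<Rightarrow> real)" and z: "cmod z < 1"
  shows "integrable circle (\<lambda>\<tau>. u \<tau> * ((1 - (cmod z)\<^sup>2) / (cmod (\<tau> - z))\<^sup>2))"
    and "Re (herglotz (\<lambda>\<tau>. of_real (u \<tau>)) z) = (\<integral>\<tau>. u \<tau> * ((1 - (cmod z)\<^sup>2) / (cmod (\<tau> - z))\<^sup>2) \<partial>circle)"
proof -
  have ui: "integrable circle (\<lambda>\<tau>. of_real (u \<tau>) :: complex)" using u by simp
  have eq: "(\<lambda>\<tau>. of_real (u \<tau>) * (2 * (\<tau> / (\<tau> - z)) - 1)) = (\<lambda>\<tau>. 2 * (of_real (u \<tau>) * (\<tau> / (\<tau> - z))) - complex_of_real (u \<tau>))"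
    by (simp add: fun_eq_iff right_diff_distrib mult.left_commute[of _ 2])
  have i: "integrable circle (\<lambda>\<tau>. of_real (u \<tau>) * (2 * (\<tau> / (\<tau> - z)) - 1))"
    unfolding eq by (intro Bochner_Integration.integrable_diff integrable_mult_right integrable_cauchy_kernel ui z)
  have e: "Re (of_real (u \<tau>) * (2 * (\<tau> / (\<tau> - z)) - 1)) = u \<tau> * ((1 - (cmod z)\<^sup>2) / (cmod (\<tau> - z))\<^sup>2)"
    if "\<tau> \<in> space circle" for \<tau>
    using that Re_herglotz_kernel[of \<tau> z] z by (simp add: space_circle)
  have "integrable circle (\<lambda>\<tau>. Re (of_real (u \<tau>) * (2 * (\<tau> / (\<tau> - z)) - 1)))"
    by (rule integrable_Re[OF i])
  then show "integrable circle (\<lambda>\<tau>. u \<tau> * ((1 - (cmod z)\<^sup>2) / (cmod (\<tau> - z))\<^sup>2))"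
    using e by (subst (asm) Bochner_Integration.integrable_cong[OF refl e]) auto
  have "herglotz (\<lambda>\<tau>. of_real (u \<tau>)) z = (\<integral>\<tau>. of_real (u \<tau>) * (2 * (\<tau> / (\<tau> - z)) - 1) \<partial>circle)"
    unfolding herglotz_def cauchy_transform_def eq
    using Bochner_Integration.integral_diff[OF integrable_mult_right[of 2, OF integrable_cauchy_kernel[OF ui z]] ui]
    by (simp only: integral_mult_right_zero)
  then have "Re (herglotz (\<lambda>\<tau>. of_real (u \<tau>)) z) = (\<integral>\<tau>. Re (of_real (u \<tau>) * (2 * (\<tau> / (\<tau> - z)) - 1)) \<partial>circle)"
    using integral_Re[OF i] by simp
  also have "\<dots> = (\<integral>\<tau>. u \<tau> * ((1 - (cmod z)\<^sup>2) / (cmod (\<tau> - z))\<^sup>2) \<partial>circle)"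
    by (intro Bochner_Integration.integral_cong refl e)
  finally show "Re (herglotz (\<lambda>\<tau>. of_real (u \<tau>)) z) = (\<integral>\<tau>. u \<tau> * ((1 - (cmod z)\<^sup>2) / (cmod (\<tau> - z))\<^sup>2) \<partial>circle)" .
qed

lemma herglotz_const: "cmod z < 1 \<Longrightarrow> herglotz (\<lambda>\<tau>. c) z = c"
proof -
  assume z: "cmod z < 1"
  have "(\<lambda>n. fourier_coeff (\<lambda>\<tau>. c) (int n) * z ^ n) = (\<lambda>n. if n = 0 then c else 0)"
    using fourier_coeff_powi[of 0] fourier_coeff_cmult[of c "\<lambda>\<tau>. 1"] by (auto simp: fun_eq_iff)
  then have "(\<lambda>n. if n = 0 then c else 0) sums cauchy_transform (\<lambda>\<tau>. c) z"
    using cauchy_transform_sums[OF _ z, of "\<lambda>\<tau>. c"] by simp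
  moreover have "(\<lambda>n. if n = 0 then c else 0) sums c"
    using sums_single[of 0 "\<lambda>_. c"] by simp
  ultimately have "cauchy_transform (\<lambda>\<tau>. c) z = c" by (rule sums_unique2)
  then show ?thesis
    by (simp add: herglotz_def)
qed

lemma Re_herglotz_mono:
  assumes u: "integrable circle (u :: complex \<Rightarrow> real)" and v: "integrable circle v" and uv: "\<And>t. cmod t = 1 \<Longrightarrow> u t \<le> v t"
    and z: "cmod z < 1"
  shows "Re (herglotz (\<lambda>\<tau>. of_real (u \<tau>)) z) \<le> Re (herglotz (\<lambda>\<tau>. of_real (v \<tau>)) z)"
  unfolding integrable_poisson(2)[OF u z] integrable_poisson(2)[OF v z]
proof (intro integral_mono integrable_poisson u v z mult_right_mono)
  show "0 \<le> (1 - (cmod z)\<^sup>2) / (cmod (\<tau> - z))\<^sup>2" for \<tau>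
    using z power_le_one[of "cmod z" 2] by simp
qed (auto simp: space_circle uv)

lemma Re_herglotz_ge:
  assumes u: "integrable circle (u :: complex \<Rightarrow> real)" and uv: "\<And>t. cmod t = 1 \<Longrightarrow> c \<le> u t" and z: "cmod z < 1"
  shows "c \<le> Re (herglotz (\<lambda>\<tau>. of_real (u \<tau>)) z)"
  using Re_herglotz_mono[of "\<lambda>_. c" u z] u uv z by (simp add: herglotz_const)

text \<open>Half-angle formula: the real part of the principal root of w is the root of (|w| + Re w)
  / 2.\<close>

lemma sqrt_cmod_le_Re_csqrt: "0 \<le> Re w \<Longrightarrow> sqrt (cmod w) \<le> sqrt 2 * Re (csqrt w)"
proof -
  assume "0 \<le> Re w"
  then have "sqrt (cmod w) \<le> sqrt (2 * ((cmod w + Re w) / 2))" by simp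
  also have "\<dots> = sqrt 2 * sqrt ((cmod w + Re w) / 2)" by (rule real_sqrt_mult)
  finally show ?thesis by simp
qed

lemma continuous_on_dilate:
  assumes "f holomorphic_on ball 0 1" "0 \<le> r" "r < 1"
  shows "(\<lambda>z. f (of_real r * z)) holomorphic_on ball 0 1" "continuous_on (cball 0 1) (\<lambda>z. f (of_real r * z))"
proof -
  have *: "of_real r * z \<in> ball 0 1" if "cmod z \<le> 1" for z :: complex
  proof -
    have "cmod (of_real r * z) \<le> r * 1" using assms that by (simp add: norm_mult mult_left_le)
    then show ?thesis using assms by simp
  qed
  show "(\<lambda>z. f (of_real r * z)) holomorphic_on ball 0 1"
    using holomorphic_on_compose_gen[of "\<lambda>z. of_real r * z" "ball 0 1" f "ball 0 1"] assms *
    by (auto simp: o_def image_subset_iff intro!: holomorphic_intros)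
  show "continuous_on (cball 0 1) (\<lambda>z. f (of_real r * z))"
    by (rule continuous_on_compose2[OF holomorphic_on_imp_continuous_on[OF assms(1)]])
       (use * in \<open>auto intro!: continuous_intros\<close>)
qed

text \<open>Kolmogorov's argument with exponent 1/2: the transform F of a nonnegative function has
  values in the right half-plane, so its principal root has argument at most pi / 4 in modulus and
  |F|^(1/2) <= sqrt 2 * Re (csqrt F). The mean of the holomorphic root is its value at 0, the root
  of the mean of \<open>u\<close>.\<close>

lemma herglotz_sqrt_bound:
  fixes u :: "complex \<Rightarrow> real"
  assumes u: "integrable circle u" and pos: "\<And>t. cmod t = 1 \<Longrightarrow> 0 \<le> u t" and r: "0 \<le> r" "r < 1"
  shows "(\<integral>t. sqrt (cmod (herglotz (\<lambda>\<tau>. of_real (u \<tau>)) (of_real r * t))) \<partial>circle) \<le> sqrt 2 * sqrt (\<integral>t. u t \<partial>circle)"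
proof -
  define F where "F = herglotz (\<lambda>\<tau>. of_real (u \<tau>))"
  have ui: "integrable circle (\<lambda>\<tau>. of_real (u \<tau>) :: complex)" using u by simp
  have hol: "F holomorphic_on ball 0 1" unfolding F_def by (rule herglotz_holomorphic[OF ui])
  have F0: "F 0 = of_real (\<integral>t. u t \<partial>circle)" unfolding F_def herglotz_0[OF ui] by simp
  have inb: "cmod (of_real r * z) < 1" if "cmod z \<le> 1" for z :: complex
  proof -
    have "cmod (of_real r * z) \<le> r * 1" using r that by (simp add: norm_mult mult_left_le)
    then show ?thesis using r by simp
  qed
  have RF: "0 \<le> Re (F z)" if "cmod z < 1" for z
    unfolding F_def by (rule Re_herglotz_ge[OF u pos that])
  have contF: "continuous_on (cball 0 1) (\<lambda>z. F (of_real r * z))"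
    by (rule continuous_on_dilate[OF hol r])
  have holF: "(\<lambda>z. F (of_real r * z)) holomorphic_on ball 0 1"
    by (rule continuous_on_dilate[OF hol r])
  \<comment> \<open>The shift by \<open>d\<close> keeps the values off the branch cut of
    \<open>csqrt\<close>, which starts at 0; it is removed by letting \<open>d\<close> tend to
    0.\<close>
  have main: "(\<integral>t. sqrt (cmod (F (of_real r * t))) \<partial>circle) \<le> sqrt 2 * sqrt ((\<integral>t. u t \<partial>circle) + d)" if d: "d > 0" for d
  proof -
    define G where "G z = csqrt (F (of_real r * z) + of_real d)" for z
    have np: "F (of_real r * z) + of_real d \<notin> \<real>\<^sub>\<le>\<^sub>0" if "cmod z \<le> 1" for z
      using RF[OF inb[OF that]] d by (auto simp: complex_nonpos_Reals_iff)
    have cG: "continuous_on (cball 0 1) G"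
      unfolding G_def
    proof (rule continuous_on_compose2[OF _ continuous_on_add[OF contF continuous_on_const]])
      show "continuous_on (- \<real>\<^sub>\<le>\<^sub>0) csqrt"
        by (rule holomorphic_on_imp_continuous_on, rule holomorphic_on_csqrt)
    qed (use np in auto)
    have hG: "G holomorphic_on ball 0 1"
      unfolding G_def by (intro holomorphic_on_csqrt' holomorphic_intros holF np) simp
    have "(\<integral>t. sqrt (cmod (F (of_real r * t))) \<partial>circle) \<le> (\<integral>t. sqrt 2 * Re (G t) \<partial>circle)"
    proof (rule integral_mono)
      show "integrable circle (\<lambda>t. sqrt (cmod (F (of_real r * t))))"
        by (intro integrable_circle_continuous continuous_intros continuous_on_subset[OF contF]) auto
      have iG: "integrable circle G"
        by (intro integrable_circle_continuous continuous_on_subset[OF cG]) auto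
      then show "integrable circle (\<lambda>t. sqrt 2 * Re (G t))" by simp
      fix t assume "t \<in> space circle"
      then have t: "cmod t = 1" by (simp add: space_circle)
      let ?w = "F (of_real r * t)"
      have R: "0 \<le> Re ?w" using RF inb t by simp
      have "cmod ?w \<le> cmod (?w + of_real d)"
        unfolding cmod_def using R d by (intro real_sqrt_le_mono add_right_mono) (simp add: power_mono)
      then have "sqrt (cmod ?w) \<le> sqrt (cmod (?w + of_real d))" by simp
      also have "\<dots> \<le> sqrt 2 * Re (csqrt (?w + of_real d))"
        using R d by (intro sqrt_cmod_le_Re_csqrt) simp
      finally show "sqrt (cmod ?w) \<le> sqrt 2 * Re (G t)" unfolding G_def .
    qed
    also have "\<dots> = sqrt 2 * Re (\<integral>t. G t \<partial>circle)"
    proof -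
      have "integrable circle G"
        by (intro integrable_circle_continuous continuous_on_subset[OF cG]) auto
      then show ?thesis by simp
    qed
    also have "(\<integral>t. G t \<partial>circle) = G 0" by (rule integral_circle_holomorphic[OF cG hG])
    also have "G 0 = csqrt (of_real ((\<integral>t. u t \<partial>circle) + d))" by (simp add: G_def F0)
    also have "Re \<dots> = sqrt ((\<integral>t. u t \<partial>circle) + d)"
    proof -
      have "0 \<le> (\<integral>t. u t \<partial>circle)"
        using pos by (intro integral_nonneg_AE AE_circleI) auto
      then show ?thesis using d by (subst csqrt_of_real_nonneg) auto
    qed
    finally show ?thesis .
  qed
  have "(\<lambda>n. sqrt 2 * sqrt ((\<integral>t. u t \<partial>circle) + inverse (real (Suc n)))) \<longlonglongrightarrow> sqrt 2 * sqrt ((\<integral>t. u t \<partial>circle) + 0)"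
    by (intro tendsto_intros LIMSEQ_inverse_real_of_nat)
  moreover have "\<exists>N. \<forall>n\<ge>N. (\<integral>t. sqrt (cmod (F (of_real r * t))) \<partial>circle) \<le> sqrt 2 * sqrt ((\<integral>t. u t \<partial>circle) + inverse (real (Suc n)))"
    by (intro exI allI impI main) simp
  ultimately have "(\<integral>t. sqrt (cmod (F (of_real r * t))) \<partial>circle) \<le> sqrt 2 * sqrt ((\<integral>t. u t \<partial>circle) + 0)"
    by (rule LIMSEQ_le_const)
  then show ?thesis
    unfolding F_def by simp
qed

section \<open>Truncated singular integrals\<close>

text \<open>The integral under the limit in \<open>singular_integral\<close>, named so that its
  convergence can be discussed.\<close>

definition strunc :: "(complex \<Rightarrow> complex) \<Rightarrow> real \<Rightarrow> complex \<Rightarrow> complex" where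
  "strunc f \<epsilon> t = (\<integral>\<tau>\<in>{\<tau> \<in> sphere 0 1. \<epsilon> \<le> cmod (\<tau> - t)}. f \<tau> / (\<tau> - t) * (2 * of_real pi * \<i> * \<tau>) \<partial>circle)"

definition pv_exists :: "(complex \<Rightarrow> complex) \<Rightarrow> complex \<Rightarrow> bool" where
  "pv_exists f t \<longleftrightarrow> (\<exists>l. ((\<lambda>\<epsilon>. strunc f \<epsilon> t) \<longlongrightarrow> l) (at_right 0))"

text \<open>The truncated kernel with the factor pi i divided out, which makes it comparable with
  twice the Cauchy kernel at the inner point (1 - \<epsilon>) t.\<close>

definition trunc_kernel :: "real \<Rightarrow> complex \<Rightarrow> complex \<Rightarrow> complex" where
  "trunc_kernel \<epsilon> t \<tau> = (if \<epsilon> \<le> cmod (\<tau> - t) then 2 * (\<tau> / (\<tau> - t)) else 0)"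

lemma trunc_kernel_measurable: "trunc_kernel \<epsilon> t \<in> borel_measurable borel"
  unfolding trunc_kernel_def by measurable

lemma trunc_kernel_bound: "0 < \<epsilon> \<Longrightarrow> cmod \<tau> = 1 \<Longrightarrow> cmod (trunc_kernel \<epsilon> t \<tau>) \<le> 2 / \<epsilon>"
  unfolding trunc_kernel_def by (auto simp: norm_mult norm_divide frac_le)

lemma strunc_eq: "strunc f \<epsilon> t = of_real pi * \<i> * (\<integral>\<tau>. f \<tau> * trunc_kernel \<epsilon> t \<tau> \<partial>circle)"
proof -
  have "strunc f \<epsilon> t = (\<integral>\<tau>. of_real pi * \<i> * (f \<tau> * trunc_kernel \<epsilon> t \<tau>) \<partial>circle)"
    unfolding strunc_def set_lebesgue_integral_def
    by (intro Bochner_Integration.integral_cong) (auto simp: space_circle indicator_def trunc_kernel_def)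
  then show ?thesis by simp
qed

lemma integrable_trunc_kernel:
  "integrable circle f \<Longrightarrow> 0 < \<epsilon> \<Longrightarrow> integrable circle (\<lambda>\<tau>. f \<tau> * trunc_kernel \<epsilon> t \<tau>)"
  by (intro integrable_mult_bounded[where B="2/\<epsilon>"] borel_measurable_circle trunc_kernel_measurable trunc_kernel_bound)

lemma singular_integral_eq:
  assumes "((\<lambda>\<epsilon>. strunc f \<epsilon> t) \<longlongrightarrow> of_real pi * \<i> * l) (at_right 0)"
  shows "singular_integral f t = l"
proof -
  have "Lim (at_right 0) (\<lambda>\<epsilon>. strunc f \<epsilon> t) = of_real pi * \<i> * l"
    using assms by (intro tendsto_Lim) auto
  then show ?thesis unfolding singular_integral_def strunc_def by simp
qed

lemma strunc_add:
  "integrable circle f \<Longrightarrow> integrable circle g \<Longrightarrow> 0 < \<epsilon> \<Longrightarrow>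
    strunc (\<lambda>t. f t + g t) \<epsilon> t = strunc f \<epsilon> t + strunc g \<epsilon> t"
  using integrable_trunc_kernel[of f \<epsilon> t] integrable_trunc_kernel[of g \<epsilon> t]
  by (simp add: strunc_eq distrib_right distrib_left)

lemma strunc_cmult: "strunc (\<lambda>t. c * f t) \<epsilon> t = c * strunc f \<epsilon> t"
  by (simp add: strunc_eq mult.assoc)

text \<open>Truncating at distance \<epsilon> and moving inside to z = (1 - \<epsilon>) t differ by
  a multiple of the Poisson kernel. Since |t - z| = \<epsilon>, far points satisfy |\<tau> - z| <= 2
  |\<tau> - t| and the difference of the kernels carries a factor t - z; near points satisfy |\<tau>
  - z| <= 2 \<epsilon>. Both cases give 4 \<epsilon> / |\<tau> - z|^2, and \<epsilon> <= 1 -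
  |z|^2.\<close>

lemma trunc_kernel_cauchy_diff:
  assumes t: "cmod t = 1" "cmod \<tau> = 1" and e: "0 < \<epsilon>" "\<epsilon> < 1"
  shows "cmod (trunc_kernel \<epsilon> t \<tau> - 2 * (\<tau> / (\<tau> - of_real (1 - \<epsilon>) * t)))
    \<le> 4 * ((1 - (cmod (of_real (1 - \<epsilon>) * t))\<^sup>2) / (cmod (\<tau> - of_real (1 - \<epsilon>) * t))\<^sup>2)"
proof -
  define z where "z = of_real (1 - \<epsilon>) * t"
  have cz: "cmod z = 1 - \<epsilon>" using t e by (simp add: z_def norm_mult del: of_real_diff)
  have tz: "t - z = of_real \<epsilon> * t" by (simp add: z_def algebra_simps)
  have tzn: "cmod (t - z) = \<epsilon>" using t e by (simp add: tz norm_mult)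
  have nz: "\<tau> - z \<noteq> 0" using cz t e by auto
  have pz: "0 < cmod (\<tau> - z)" using nz by simp
  have up: "cmod (\<tau> - z) \<le> cmod (\<tau> - t) + \<epsilon>"
    using norm_triangle_ineq[of "\<tau> - t" "t - z"] tzn by simp
  have e2: "\<epsilon> \<le> 1 - (cmod z)\<^sup>2"
  proof -
    have "\<epsilon> * \<epsilon> \<le> \<epsilon> * 1" using e by (intro mult_left_mono) auto
    then show ?thesis unfolding cz power2_eq_square by (simp add: algebra_simps)
  qed
  have "cmod (trunc_kernel \<epsilon> t \<tau> - 2 * (\<tau> / (\<tau> - z))) \<le> 4 * (\<epsilon> / (cmod (\<tau> - z))\<^sup>2)"
  proof (cases "\<epsilon> \<le> cmod (\<tau> - t)")
    case True
    then have nt: "\<tau> - t \<noteq> 0" using e by auto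
    have "trunc_kernel \<epsilon> t \<tau> - 2 * (\<tau> / (\<tau> - z)) = 2 * \<tau> * (t - z) / ((\<tau> - t) * (\<tau> - z))"
      using True nt nz by (simp add: trunc_kernel_def field_simps)
    then have "cmod (trunc_kernel \<epsilon> t \<tau> - 2 * (\<tau> / (\<tau> - z))) = 2 * \<epsilon> / (cmod (\<tau> - t) * cmod (\<tau> - z))"
      using t tzn by (simp add: norm_mult norm_divide)
    also have "\<dots> \<le> 2 * \<epsilon> / ((cmod (\<tau> - z) / 2) * cmod (\<tau> - z))"
      using True up pz e nt by (intro divide_left_mono mult_right_mono mult_pos_pos) auto
    also have "\<dots> = 4 * (\<epsilon> / (cmod (\<tau> - z))\<^sup>2)" by (simp add: power2_eq_square)
    finally show ?thesis .
  next
    case False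
    then have "cmod (trunc_kernel \<epsilon> t \<tau> - 2 * (\<tau> / (\<tau> - z))) = 2 / cmod (\<tau> - z)"
      using t by (simp add: trunc_kernel_def norm_divide)
    also have "\<dots> = 2 * cmod (\<tau> - z) / (cmod (\<tau> - z))\<^sup>2"
      using pz by (simp add: power2_eq_square)
    also have "\<dots> \<le> 2 * (2 * \<epsilon>) / (cmod (\<tau> - z))\<^sup>2"
      using up False pz by (intro divide_right_mono mult_left_mono) auto
    finally show ?thesis by simp
  qed
  also have "\<dots> \<le> 4 * ((1 - (cmod z)\<^sup>2) / (cmod (\<tau> - z))\<^sup>2)"
    using e2 by (intro mult_left_mono divide_right_mono) auto
  finally show ?thesis unfolding z_def .
qed

text \<open>For u >= 0 the kernel error integrates to at most 4 times the real part of the Herglotz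
  transform; a fifth transform and the mean come from rewriting twice the Cauchy transform.\<close>

lemma strunc_bound:
  fixes u :: "complex \<Rightarrow> real"
  assumes u: "integrable circle u" and pos: "\<And>t. cmod t = 1 \<Longrightarrow> 0 \<le> u t" and t: "cmod t = 1" and e: "0 < \<epsilon>" "\<epsilon> < 1"
  shows "cmod (strunc (\<lambda>\<tau>. of_real (u \<tau>)) \<epsilon> t) \<le> pi * (5 * cmod (herglotz (\<lambda>\<tau>. of_real (u \<tau>)) (of_real (1 - \<epsilon>) * t)) + (\<integral>\<tau>. u \<tau> \<partial>circle))"
proof -
  let ?h = "\<lambda>\<tau>. complex_of_real (u \<tau>)"
  define z where "z = of_real (1 - \<epsilon>) * t"
  have z: "cmod z < 1" using t e by (simp add: z_def norm_mult del: of_real_diff)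
  have ui: "integrable circle ?h" using u by simp
  let ?P = "\<lambda>\<tau>. (1 - (cmod z)\<^sup>2) / (cmod (\<tau> - z))\<^sup>2"
  let ?I = "\<integral>\<tau>. ?h \<tau> * trunc_kernel \<epsilon> t \<tau> \<partial>circle"
  have eq: "(\<lambda>\<tau>. ?h \<tau> * (trunc_kernel \<epsilon> t \<tau> - 2 * (\<tau> / (\<tau> - z)))) = (\<lambda>\<tau>. ?h \<tau> * trunc_kernel \<epsilon> t \<tau> - 2 * (?h \<tau> * (\<tau> / (\<tau> - z))))"
    by (simp add: fun_eq_iff right_diff_distrib mult.left_commute[of _ 2])
  have "?I - 2 * cauchy_transform ?h z = (\<integral>\<tau>. ?h \<tau> * (trunc_kernel \<epsilon> t \<tau> - 2 * (\<tau> / (\<tau> - z))) \<partial>circle)"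
    unfolding cauchy_transform_def eq
    using Bochner_Integration.integral_diff[OF integrable_trunc_kernel[OF ui e(1), of t]
        integrable_mult_right[of 2, OF integrable_cauchy_kernel[OF ui z]]]
    by (simp only: integral_mult_right_zero)
  also have "cmod \<dots> \<le> (\<integral>\<tau>. cmod (?h \<tau> * (trunc_kernel \<epsilon> t \<tau> - 2 * (\<tau> / (\<tau> - z)))) \<partial>circle)"
    by (rule integral_norm_bound)
  also have "\<dots> \<le> (\<integral>\<tau>. 4 * (u \<tau> * ?P \<tau>) \<partial>circle)"
  proof (rule integral_mono)
    have "integrable circle (\<lambda>\<tau>. ?h \<tau> * trunc_kernel \<epsilon> t \<tau> - 2 * (?h \<tau> * (\<tau> / (\<tau> - z))))"
      by (intro Bochner_Integration.integrable_diff integrable_mult_right integrable_cauchy_kernel ui z integrable_trunc_kernel e)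
    then have "integrable circle (\<lambda>\<tau>. ?h \<tau> * (trunc_kernel \<epsilon> t \<tau> - 2 * (\<tau> / (\<tau> - z))))" unfolding eq .
    then show "integrable circle (\<lambda>\<tau>. cmod (?h \<tau> * (trunc_kernel \<epsilon> t \<tau> - 2 * (\<tau> / (\<tau> - z)))))"
      by (rule integrable_norm)
    show "integrable circle (\<lambda>\<tau>. 4 * (u \<tau> * ?P \<tau>))"
      by (intro integrable_mult_right integrable_poisson(1)[OF u z])
    fix \<tau> assume "\<tau> \<in> space circle"
    then have \<tau>: "cmod \<tau> = 1" by (simp add: space_circle)
    have "cmod (?h \<tau> * (trunc_kernel \<epsilon> t \<tau> - 2 * (\<tau> / (\<tau> - z)))) = u \<tau> * cmod (trunc_kernel \<epsilon> t \<tau> - 2 * (\<tau> / (\<tau> - z)))"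
      using pos[OF \<tau>] by (simp add: norm_mult)
    also have "\<dots> \<le> u \<tau> * (4 * ?P \<tau>)"
      using trunc_kernel_cauchy_diff[OF t \<tau> e] pos[OF \<tau>] unfolding z_def by (rule mult_left_mono)
    finally show "cmod (?h \<tau> * (trunc_kernel \<epsilon> t \<tau> - 2 * (\<tau> / (\<tau> - z)))) \<le> 4 * (u \<tau> * ?P \<tau>)" by (simp add: mult_ac)
  qed
  also have "\<dots> = 4 * Re (herglotz ?h z)"
    by (simp only: integral_mult_right_zero integrable_poisson(2)[OF u z])
  also have "\<dots> \<le> 4 * cmod (herglotz ?h z)"
    using complex_Re_le_cmod[of "herglotz ?h z"] by simp
  finally have 1: "cmod (?I - 2 * cauchy_transform ?h z) \<le> 4 * cmod (herglotz ?h z)" .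
  have un: "0 \<le> (\<integral>\<tau>. u \<tau> \<partial>circle)" using pos by (intro integral_nonneg_AE AE_circleI) auto
  have "?I = (?I - 2 * cauchy_transform ?h z) + herglotz ?h z + of_real (\<integral>\<tau>. u \<tau> \<partial>circle)"
    by (simp add: herglotz_def)
  also have "cmod \<dots> \<le> cmod (?I - 2 * cauchy_transform ?h z) + cmod (herglotz ?h z) + (\<integral>\<tau>. u \<tau> \<partial>circle)"
    using norm_triangle_ineq[of "(?I - 2 * cauchy_transform ?h z) + herglotz ?h z" "of_real (\<integral>\<tau>. u \<tau> \<partial>circle)"]
      norm_triangle_ineq[of "?I - 2 * cauchy_transform ?h z" "herglotz ?h z"] un by simp
  finally have "cmod ?I \<le> 5 * cmod (herglotz ?h z) + (\<integral>\<tau>. u \<tau> \<partial>circle)" using 1 by simp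
  then show ?thesis
    unfolding strunc_eq z_def by (simp add: norm_mult mult_left_mono)
qed


section \<open>The Riesz projection of trigonometric polynomials\<close>

lemma AE_circle_neq: "AE s in circle. s \<noteq> t"
proof -
  have ind: "(indicator {t} :: complex \<Rightarrow> real) \<in> borel_measurable borel" by simp
  have "(\<integral>s. (indicator {t} s :: real) \<partial>circle) = (\<integral>x. (indicator {0..<2*pi} x / (2*pi)) *\<^sub>R indicator {t} (cis x) \<partial>lborel)"
    by (rule integral_circle) (intro measurable_restrict_space1 ind)
  also have "\<dots> = 0"
  proof (rule integral_eq_zero_AE)
    show "AE x in lborel. (indicator {0..<2*pi} x / (2*pi)) *\<^sub>R (indicator {t} (cis x) :: real) = 0"
      using AE_lborel_singleton[of "Arg2pi t"]
    proof eventually_elim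
      case (elim x)
      have "Arg2pi t = x" if "0 \<le> x" "x < 2*pi" "cis x = t"
        using that Arg2pi_unique[of 1 x t] by (simp add: cis_conv_exp)
      then show ?case using elim by (auto simp: indicator_def)
    qed
  qed
  finally have "(\<integral>s. (indicator {t} s :: real) \<partial>circle) = 0" .
  moreover have "integrable circle (indicator {t} :: complex \<Rightarrow> real)"
    by (rule integrable_circle_bounded[where B=1]) (auto intro!: borel_measurable_circle)
  ultimately have "AE s in circle. (indicator {t} s :: real) = 0"
    by (subst (asm) integral_nonneg_eq_0_iff_AE) auto
  then show ?thesis by eventually_elim (auto simp: indicator_def)
qed

lemma measurable_trunc:
  assumes "(q :: complex \<Rightarrow> complex) \<in> borel_measurable circle"
  shows "(\<lambda>\<tau>. if \<epsilon> \<le> cmod (\<tau> - t) then q \<tau> else 0) \<in> borel_measurable circle"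
proof (intro measurable_If assms borel_measurable_le borel_measurable_const)
  show "(\<lambda>\<tau>. cmod (\<tau> - t)) \<in> borel_measurable circle"
    by (intro borel_measurable_circle borel_measurable_continuous_onI continuous_intros)
qed

lemma integral_trunc_tendsto:
  assumes q: "integrable circle (q :: complex \<Rightarrow> complex)"
  shows "((\<lambda>\<epsilon>. \<integral>\<tau>. (if \<epsilon> \<le> cmod (\<tau> - t) then q \<tau> else 0) \<partial>circle) \<longlongrightarrow> (\<integral>\<tau>. q \<tau> \<partial>circle)) (at_right 0)"
proof (rule tendsto_at_right_sequentially[where b=1])
  fix S :: "nat \<Rightarrow> real" assume S: "\<And>n. 0 < S n" "S \<longlonglongrightarrow> 0"
  show "(\<lambda>n. \<integral>\<tau>. (if S n \<le> cmod (\<tau> - t) then q \<tau> else 0) \<partial>circle) \<longlonglongrightarrow> (\<integral>\<tau>. q \<tau> \<partial>circle)"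
  proof (rule integral_dominated_convergence[where w="\<lambda>\<tau>. norm (q \<tau>)"])
    show "AE \<tau> in circle. (\<lambda>n. if S n \<le> cmod (\<tau> - t) then q \<tau> else 0) \<longlonglongrightarrow> q \<tau>"
      using AE_circle_neq[of t]
    proof eventually_elim
      case (elim \<tau>)
      then have ev: "\<forall>\<^sub>F n in sequentially. S n < cmod (\<tau> - t)"
        using S(2) by (intro order_tendstoD(2)) auto
      show ?case by (rule tendsto_eventually, rule eventually_mono[OF ev]) auto
    qed
    show "(\<lambda>\<tau>. if S n \<le> cmod (\<tau> - t) then q \<tau> else 0) \<in> borel_measurable circle" for n
      using q by (intro measurable_trunc) simp
  qed (use q in auto)
qed simp

text \<open>The reflection \<tau> -> t^2 * cnj \<tau> preserves the distance to t, and the kernel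
  values at a point and at its mirror image add up to 2. Hence the integral of the truncated kernel
  is the measure of the remaining arc, which tends to 1.\<close>

lemma strunc_const_tendsto:
  assumes t: "cmod t = 1"
  shows "((\<lambda>\<epsilon>. strunc (\<lambda>_. 1) \<epsilon> t) \<longlongrightarrow> of_real pi * \<i>) (at_right 0)"
proof -
  have "(\<integral>\<tau>. trunc_kernel \<epsilon> t \<tau> \<partial>circle) = (\<integral>\<tau>. (if \<epsilon> \<le> cmod (\<tau> - t) then 1 else 0) \<partial>circle)" if e: "\<epsilon> > 0" for \<epsilon>
  proof -
    have int: "integrable circle (trunc_kernel \<epsilon> t)"
      using e by (intro integrable_circle_bounded[where B="2/\<epsilon>"] borel_measurable_circle trunc_kernel_measurable trunc_kernel_bound)
    have refl: "trunc_kernel \<epsilon> t \<tau> + trunc_kernel \<epsilon> t (t\<^sup>2 * cnj \<tau>) = 2 * (if \<epsilon> \<le> cmod (\<tau> - t) then 1 else 0)"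
      if "cmod \<tau> = 1" for \<tau>
    proof -
      have nz: "\<tau> \<noteq> 0" "t \<noteq> 0" using that t by auto
      have "t\<^sup>2 * cnj \<tau> - t = (t / \<tau>) * (t - \<tau>)"
        using nz that by (simp add: cnj_unit field_simps power2_eq_square)
      then have "cmod (t\<^sup>2 * cnj \<tau> - t) = cmod (\<tau> - t)"
        using that t by (simp add: norm_mult norm_divide norm_minus_commute)
      moreover have "2 * (\<tau> / (\<tau> - t)) + 2 * ((t\<^sup>2 * cnj \<tau>) / (t\<^sup>2 * cnj \<tau> - t)) = 2" if "\<epsilon> \<le> cmod (\<tau> - t)"
      proof -
        have ne: "\<tau> - t \<noteq> 0" "t - \<tau> \<noteq> 0" using that e by auto
        have "(t\<^sup>2 * cnj \<tau>) / (t\<^sup>2 * cnj \<tau> - t) = t / (t - \<tau>)"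
          unfolding \<open>t\<^sup>2 * cnj \<tau> - t = _\<close> using nz ne \<open>cmod \<tau> = 1\<close> by (simp add: cnj_unit field_simps power2_eq_square)
        moreover have "t / (t - \<tau>) = - (t / (\<tau> - t))" by (metis minus_diff_eq divide_minus_right)
        moreover have "2 * (\<tau> / (\<tau> - t)) + 2 * (- (t / (\<tau> - t))) = 2 * ((\<tau> - t) / (\<tau> - t))"
          by (simp only: diff_divide_distrib) simp
        ultimately show ?thesis using ne by simp
      qed
      ultimately show ?thesis by (auto simp: trunc_kernel_def)
    qed
    have "(\<integral>\<tau>. trunc_kernel \<epsilon> t (t\<^sup>2 * cnj \<tau>) \<partial>circle) = (\<integral>\<tau>. trunc_kernel \<epsilon> t \<tau> \<partial>circle)"
      by (rule integral_circle_reflect[where B="2/\<epsilon>"])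
         (use t e in \<open>auto intro: trunc_kernel_measurable trunc_kernel_bound simp: norm_power\<close>)
    moreover have "integrable circle (\<lambda>\<tau>. trunc_kernel \<epsilon> t (t\<^sup>2 * cnj \<tau>))"
    proof (rule integrable_circle_bounded[where B="2/\<epsilon>"])
      show "(\<lambda>\<tau>. trunc_kernel \<epsilon> t (t\<^sup>2 * cnj \<tau>)) \<in> borel_measurable circle"
        by (intro borel_measurable_circle measurable_compose[OF _ trunc_kernel_measurable]
            borel_measurable_continuous_onI continuous_intros)
      show "cmod (trunc_kernel \<epsilon> t (t\<^sup>2 * cnj \<tau>)) \<le> 2/\<epsilon>" if "cmod \<tau> = 1" for \<tau>
        using that t e by (intro trunc_kernel_bound) (auto simp: norm_mult norm_power)
    qed
    ultimately have "2 * (\<integral>\<tau>. trunc_kernel \<epsilon> t \<tau> \<partial>circle) = (\<integral>\<tau>. trunc_kernel \<epsilon> t \<tau> + trunc_kernel \<epsilon> t (t\<^sup>2 * cnj \<tau>) \<partial>circle)"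
      using int by simp
    also have "\<dots> = (\<integral>\<tau>. 2 * (if \<epsilon> \<le> cmod (\<tau> - t) then 1 else 0) \<partial>circle)"
      by (intro Bochner_Integration.integral_cong) (auto simp: space_circle refl)
    also have "\<dots> = 2 * (\<integral>\<tau>. (if \<epsilon> \<le> cmod (\<tau> - t) then 1 else 0) \<partial>circle)"
      by (rule integral_mult_right_zero)
    finally show ?thesis by simp
  qed
  then have "\<forall>\<^sub>F \<epsilon> in at_right 0. of_real pi * \<i> * (\<integral>\<tau>. (if \<epsilon> \<le> cmod (\<tau> - t) then 1 else 0) \<partial>circle) = strunc (\<lambda>_. 1) \<epsilon> t"
    by (intro eventually_at_right_less[THEN eventually_mono]) (simp add: strunc_eq)
  moreover have "((\<lambda>\<epsilon>. of_real pi * \<i> * (\<integral>\<tau>. (if \<epsilon> \<le> cmod (\<tau> - t) then 1 else 0) \<partial>circle)) \<longlongrightarrow> of_real pi * \<i> * (\<integral>\<tau>. 1 \<partial>circle)) (at_right 0)"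
    by (intro tendsto_intros integral_trunc_tendsto) simp
  ultimately have "((\<lambda>\<epsilon>. strunc (\<lambda>_. 1) \<epsilon> t) \<longlongrightarrow> of_real pi * \<i> * (\<integral>\<tau>. 1 \<partial>circle)) (at_right 0)"
    by (rule Lim_transform_eventually[rotated])
  then show ?thesis by simp
qed

text \<open>The power is split into its value at t, covered by the constant case, and a multiple of
  \<tau> - t, which cancels the singularity; what remains is the mean of a trigonometric
  polynomial.\<close>

lemma strunc_powi_tendsto:
  assumes t: "cmod t = 1"
  shows "((\<lambda>\<epsilon>. strunc (\<lambda>\<tau>. \<tau> powi n) \<epsilon> t) \<longlongrightarrow> of_real pi * \<i> * (if 0 \<le> n then t powi n else - (t powi n))) (at_right 0)"
proof -
  define m where "m = nat \<bar>n\<bar>"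
  \<comment> \<open>\<tau> times the divided difference of the n-th power; for negative n it comes
    from that of the m-th power by the factor -(\<tau>^n t^n). For n >= 0 all exponents of \<tau>
    are positive and the mean is 0; for n < 0 they run from 1 - m to 0, and only the last summand,
    with coefficient -(t^n), has a mean.\<close>
  define q where "q \<tau> = (\<Sum>i<m. if 0 \<le> n then t ^ (m - Suc i) * \<tau> powi (int i + 1)
      else - (t ^ (m - Suc i) * t powi n) * \<tau> powi (int i + 1 + n))" for \<tau>
  have t0: "t \<noteq> 0" using t by auto
  have q: "\<tau> powi n - t powi n = (\<tau> - t) * (q \<tau> / \<tau>)" if "cmod \<tau> = 1" for \<tau>
  proof -
    have \<tau>0: "\<tau> \<noteq> 0" using that by auto
    have pd: "\<tau> ^ m - t ^ m = (\<tau> - t) * (\<Sum>i<m. t ^ (m - Suc i) * \<tau> ^ i)"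
      by (rule power_diff_sumr2)
    show ?thesis
    proof (cases "0 \<le> n")
      case True
      have "q \<tau> / \<tau> = (\<Sum>i<m. t ^ (m - Suc i) * \<tau> ^ i)"
        using True \<tau>0 by (simp add: q_def sum_divide_distrib power_int_add)
      then show ?thesis using pd True by (simp add: m_def power_int_def)
    next
      case False
      then have n: "n = - int m" by (simp add: m_def)
      have "q \<tau> / \<tau> = (\<Sum>i<m. - (\<tau> powi n * t powi n) * (t ^ (m - Suc i) * \<tau> ^ i))"
        unfolding q_def sum_divide_distrib using False \<tau>0 t0
        by (intro sum.cong) (simp_all add: power_int_add)
      also have "\<dots> = - (\<tau> powi n * t powi n) * (\<Sum>i<m. t ^ (m - Suc i) * \<tau> ^ i)"
        by (simp only: sum_distrib_left)
      finally have "(\<tau> - t) * (q \<tau> / \<tau>) = - (\<tau> powi n * t powi n) * (\<tau> ^ m - t ^ m)"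
        unfolding pd by (simp only: mult_ac)
      also have "\<dots> = \<tau> powi n - t powi n"
        using \<tau>0 t0 by (simp add: n power_int_minus field_simps)
      finally show ?thesis ..
    qed
  qed
  have qi: "(\<integral>\<tau>. 2 * q \<tau> \<partial>circle) = (if 0 \<le> n then 0 else - 2 * t powi n)"
  proof -
    have i: "integrable circle (\<lambda>\<tau>. \<tau> powi k)" for k
      by (intro integrable_circle_continuous continuous_on_powi_circle)
    show ?thesis
    proof (cases "0 \<le> n")
      case True
      then have "(\<integral>\<tau>. 2 * q \<tau> \<partial>circle) = 2 * (\<Sum>i<m. t ^ (m - Suc i) * (\<integral>\<tau>. \<tau> powi (int i + 1) \<partial>circle))"
        unfolding q_def using i by simp
      then show ?thesis using True by (simp add: integral_powi)
    next
      case False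
      then have n: "n = - int m" and m: "m > 0" by (auto simp: m_def)
      have "(\<integral>\<tau>. 2 * q \<tau> \<partial>circle) = 2 * (\<Sum>i<m. - (t ^ (m - Suc i) * t powi n) * (\<integral>\<tau>. \<tau> powi (int i + 1 + n) \<partial>circle))"
        unfolding q_def using False i by simp
      also have "\<dots> = 2 * (\<Sum>i<m. if i = m - 1 then - (t powi n) else 0)"
        using m by (intro arg_cong[where f="\<lambda>x. 2 * x"] sum.cong) (auto simp: integral_powi n)
      also have "\<dots> = - 2 * t powi n" using m by simp
      finally show ?thesis using False by simp
    qed
  qed
  have qint: "integrable circle (\<lambda>\<tau>. 2 * q \<tau>)"
  proof (intro integrable_circle_continuous continuous_on_mult continuous_on_const)
    show "continuous_on (sphere 0 1) q"
      unfolding q_def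
      by (cases "0 \<le> n"; simp only: if_True if_False;
          intro continuous_on_sum continuous_on_mult continuous_on_const continuous_on_powi_circle)
  qed
  have e: "strunc (\<lambda>\<tau>. \<tau> powi n) \<epsilon> t = t powi n * strunc (\<lambda>_. 1) \<epsilon> t + of_real pi * \<i> * (\<integral>\<tau>. (if \<epsilon> \<le> cmod (\<tau> - t) then 2 * q \<tau> else 0) \<partial>circle)"
    if "\<epsilon> > 0" for \<epsilon>
  proof -
    have "(\<integral>\<tau>. \<tau> powi n * trunc_kernel \<epsilon> t \<tau> \<partial>circle) = (\<integral>\<tau>. t powi n * trunc_kernel \<epsilon> t \<tau> + (if \<epsilon> \<le> cmod (\<tau> - t) then 2 * q \<tau> else 0) \<partial>circle)"
    proof (intro Bochner_Integration.integral_cong refl)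
      fix \<tau> assume "\<tau> \<in> space circle"
      then have \<tau>: "cmod \<tau> = 1" "\<tau> \<noteq> 0" by (auto simp: space_circle)
      show "\<tau> powi n * trunc_kernel \<epsilon> t \<tau> = t powi n * trunc_kernel \<epsilon> t \<tau> + (if \<epsilon> \<le> cmod (\<tau> - t) then 2 * q \<tau> else 0)"
      proof (cases "\<epsilon> \<le> cmod (\<tau> - t)")
        case True
        then have "\<tau> - t \<noteq> 0" using that by auto
        then have "(\<tau> powi n - t powi n) * (\<tau> / (\<tau> - t)) = q \<tau>"
          unfolding q[OF \<tau>(1)] using \<tau>(2) by simp
        then have "2 * ((\<tau> powi n - t powi n) * (\<tau> / (\<tau> - t))) = 2 * q \<tau>" by simp
        then have "\<tau> powi n * (2 * (\<tau> / (\<tau> - t))) = t powi n * (2 * (\<tau> / (\<tau> - t))) + 2 * q \<tau>"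
          by (simp only: left_diff_distrib right_diff_distrib mult.left_commute[of 2] diff_eq_eq add.commute)
        then show ?thesis using True by (simp only: trunc_kernel_def if_True)
      qed (simp add: trunc_kernel_def)
    qed
    also have "\<dots> = t powi n * (\<integral>\<tau>. trunc_kernel \<epsilon> t \<tau> \<partial>circle) + (\<integral>\<tau>. (if \<epsilon> \<le> cmod (\<tau> - t) then 2 * q \<tau> else 0) \<partial>circle)"
    proof -
      have "integrable circle (\<lambda>\<tau>. if \<epsilon> \<le> cmod (\<tau> - t) then 2 * q \<tau> else 0)"
        by (rule Bochner_Integration.integrable_bound[OF qint]) (use measurable_trunc[OF borel_measurable_integrable[OF qint]] in auto)
      moreover have "integrable circle (trunc_kernel \<epsilon> t)"
        using that by (intro integrable_circle_bounded[where B="2/\<epsilon>"] borel_measurable_circle trunc_kernel_measurable trunc_kernel_bound)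
      ultimately show ?thesis by simp
    qed
    finally show ?thesis by (simp add: strunc_eq algebra_simps)
  qed
  have "((\<lambda>\<epsilon>. t powi n * strunc (\<lambda>_. 1) \<epsilon> t + of_real pi * \<i> * (\<integral>\<tau>. (if \<epsilon> \<le> cmod (\<tau> - t) then 2 * q \<tau> else 0) \<partial>circle))
      \<longlongrightarrow> t powi n * (of_real pi * \<i>) + of_real pi * \<i> * (\<integral>\<tau>. 2 * q \<tau> \<partial>circle)) (at_right 0)"
    by (intro tendsto_intros strunc_const_tendsto t integral_trunc_tendsto qint)
  moreover have "\<forall>\<^sub>F \<epsilon> in at_right 0. t powi n * strunc (\<lambda>_. 1) \<epsilon> t + of_real pi * \<i> * (\<integral>\<tau>. (if \<epsilon> \<le> cmod (\<tau> - t) then 2 * q \<tau> else 0) \<partial>circle) = strunc (\<lambda>\<tau>. \<tau> powi n) \<epsilon> t"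
    by (intro eventually_at_right_less[THEN eventually_mono]) (simp add: e)
  ultimately have "((\<lambda>\<epsilon>. strunc (\<lambda>\<tau>. \<tau> powi n) \<epsilon> t) \<longlongrightarrow> t powi n * (of_real pi * \<i>) + of_real pi * \<i> * (\<integral>\<tau>. 2 * q \<tau> \<partial>circle)) (at_right 0)"
    by (rule Lim_transform_eventually)
  moreover have "t powi n * (of_real pi * \<i>) + of_real pi * \<i> * (\<integral>\<tau>. 2 * q \<tau> \<partial>circle)
      = of_real pi * \<i> * (if 0 \<le> n then t powi n else - (t powi n))"
    unfolding qi by (cases "0 \<le> n") (simp_all add: algebra_simps)
  ultimately show ?thesis by (simp only:)
qed

lemma strunc_cong: "(\<And>\<tau>. cmod \<tau> = 1 \<Longrightarrow> f \<tau> = g \<tau>) \<Longrightarrow> strunc f \<epsilon> t = strunc g \<epsilon> t"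
  unfolding strunc_eq
  by (intro arg_cong[where f="\<lambda>x. _ * x"] Bochner_Integration.integral_cong) (auto simp: space_circle)

lemma strunc_sum:
  assumes "\<And>k. k \<in> K \<Longrightarrow> integrable circle (f k)" "0 < \<epsilon>"
  shows "strunc (\<lambda>\<tau>. \<Sum>k\<in>K. f k \<tau>) \<epsilon> t = (\<Sum>k\<in>K. strunc (f k) \<epsilon> t)"
  unfolding strunc_eq sum_distrib_right sum_distrib_left[symmetric]
  by (intro arg_cong[where f="\<lambda>x. _ * x"] Bochner_Integration.integral_sum integrable_trunc_kernel assms)

lemma riesz_trig_poly:
  assumes K: "finite K" and p: "\<And>t. cmod t = 1 \<Longrightarrow> p t = (\<Sum>k\<in>K. c k * t powi k)" and t: "cmod t = 1"
  shows "pv_exists p t" and "riesz p t = (\<Sum>k\<in>{k\<in>K. 0 \<le> k}. c k * t powi k)"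
proof -
  define l where "l = (\<Sum>k\<in>K. c k * (if 0 \<le> k then t powi k else - (t powi k)))"
  have i: "integrable circle (\<lambda>\<tau>. c k * \<tau> powi k)" for k
    by (intro integrable_mult_right integrable_circle_continuous continuous_on_powi_circle)
  have "((\<lambda>\<epsilon>. \<Sum>k\<in>K. c k * strunc (\<lambda>\<tau>. \<tau> powi k) \<epsilon> t) \<longlongrightarrow> (\<Sum>k\<in>K. c k * (of_real pi * \<i> * (if 0 \<le> k then t powi k else - (t powi k))))) (at_right 0)"
    by (intro tendsto_intros strunc_powi_tendsto t)
  moreover have "\<forall>\<^sub>F \<epsilon> in at_right 0. (\<Sum>k\<in>K. c k * strunc (\<lambda>\<tau>. \<tau> powi k) \<epsilon> t) = strunc p \<epsilon> t"
  proof (intro eventually_at_right_less[THEN eventually_mono])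
    fix \<epsilon> :: real assume "0 < \<epsilon>"
    then have "strunc (\<lambda>\<tau>. \<Sum>k\<in>K. c k * \<tau> powi k) \<epsilon> t = (\<Sum>k\<in>K. strunc (\<lambda>\<tau>. c k * \<tau> powi k) \<epsilon> t)"
      by (intro strunc_sum i)
    then show "(\<Sum>k\<in>K. c k * strunc (\<lambda>\<tau>. \<tau> powi k) \<epsilon> t) = strunc p \<epsilon> t"
      using strunc_cong[OF p] by (simp add: strunc_cmult)
  qed
  ultimately have "((\<lambda>\<epsilon>. strunc p \<epsilon> t) \<longlongrightarrow> (\<Sum>k\<in>K. c k * (of_real pi * \<i> * (if 0 \<le> k then t powi k else - (t powi k))))) (at_right 0)"
    by (rule Lim_transform_eventually)
  also have "(\<Sum>k\<in>K. c k * (of_real pi * \<i> * (if 0 \<le> k then t powi k else - (t powi k)))) = of_real pi * \<i> * l"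
    unfolding l_def sum_distrib_left by (intro sum.cong) (simp_all only: mult_ac)
  finally have lim: "((\<lambda>\<epsilon>. strunc p \<epsilon> t) \<longlongrightarrow> of_real pi * \<i> * l) (at_right 0)" .
  then show "pv_exists p t" unfolding pv_exists_def by blast
  have "p t + l = (\<Sum>k\<in>K. 2 * (if 0 \<le> k then c k * t powi k else 0))"
    unfolding p[OF t] l_def sum.distrib[symmetric] by (intro sum.cong) auto
  also have "\<dots> = 2 * (\<Sum>k\<in>K. if 0 \<le> k then c k * t powi k else 0)" by (simp only: sum_distrib_left)
  also have "(\<Sum>k\<in>K. if 0 \<le> k then c k * t powi k else 0) = (\<Sum>k\<in>{k\<in>K. 0 \<le> k}. c k * t powi k)"
    using K by (simp add: sum.If_cases Int_def)
  finally show "riesz p t = (\<Sum>k\<in>{k\<in>K. 0 \<le> k}. c k * t powi k)"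
    unfolding riesz_def singular_integral_eq[OF lim] by simp
qed

section \<open>Two inequalities for trigonometric polynomials\<close>

lemma parseval:
  assumes K: "finite K"
  shows "(\<integral>t. (cmod (\<Sum>k\<in>K. c k * t powi k))\<^sup>2 \<partial>circle) = (\<Sum>k\<in>K. (cmod (c k))\<^sup>2)"
proof -
  have i: "integrable circle (\<lambda>t. t powi k)" for k
    by (intro integrable_circle_continuous continuous_on_powi_circle)
  have "complex_of_real (\<integral>t. (cmod (\<Sum>k\<in>K. c k * t powi k))\<^sup>2 \<partial>circle)
      = (\<integral>t. of_real ((cmod (\<Sum>k\<in>K. c k * t powi k))\<^sup>2) \<partial>circle)"
    by (rule integral_complex_of_real[symmetric])
  also have "\<dots> = (\<integral>t. (\<Sum>k\<in>K. \<Sum>l\<in>K. (c k * cnj (c l)) * t powi (k - l)) \<partial>circle)"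
  proof (intro Bochner_Integration.integral_cong refl)
    fix t assume "t \<in> space circle"
    then have t: "cmod t = 1" "t \<noteq> 0" by (auto simp: space_circle)
    have "of_real ((cmod (\<Sum>k\<in>K. c k * t powi k))\<^sup>2) = (\<Sum>k\<in>K. c k * t powi k) * cnj (\<Sum>k\<in>K. c k * t powi k)"
      by (simp only: complex_norm_square[symmetric] of_real_power)
    also have "cnj (\<Sum>k\<in>K. c k * t powi k) = (\<Sum>l\<in>K. cnj (c l) * t powi (- l))"
      unfolding cnj_sum complex_cnj_mult cnj_powi_unit[OF t(1)] ..
    also have "(\<Sum>k\<in>K. c k * t powi k) * \<dots> = (\<Sum>k\<in>K. \<Sum>l\<in>K. (c k * cnj (c l)) * t powi (k - l))"
      unfolding sum_product
    proof (intro sum.cong refl)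
      fix k l
      have "t powi k * t powi (- l) = t powi (k - l)"
        using t by (simp flip: power_int_add)
      then show "c k * t powi k * (cnj (c l) * t powi (- l)) = (c k * cnj (c l)) * t powi (k - l)"
        by (metis mult.assoc mult.left_commute)
    qed
    finally show "of_real ((cmod (\<Sum>k\<in>K. c k * t powi k))\<^sup>2) = (\<Sum>k\<in>K. \<Sum>l\<in>K. (c k * cnj (c l)) * t powi (k - l))" .
  qed
  also have "\<dots> = (\<Sum>k\<in>K. \<Sum>l\<in>K. (c k * cnj (c l)) * (\<integral>t. t powi (k - l) \<partial>circle))"
    using i by simp
  also have "\<dots> = (\<Sum>k\<in>K. \<Sum>l\<in>K. if k = l then c k * cnj (c k) else 0)"
    by (intro sum.cong refl) (auto simp: integral_powi)
  also have "\<dots> = (\<Sum>k\<in>K. of_real ((cmod (c k))\<^sup>2))"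
    using K by (simp add: complex_norm_square[symmetric] del: complex_mult_cnj)
  also have "\<dots> = of_real (\<Sum>k\<in>K. (cmod (c k))\<^sup>2)" by simp
  finally show ?thesis by (simp only: of_real_eq_iff)
qed

lemma riesz_trig_poly_L2:
  assumes "trig_poly p"
  shows "(\<integral>t. (cmod (riesz p t))\<^sup>2 \<partial>circle) \<le> (\<integral>t. (cmod (p t))\<^sup>2 \<partial>circle)"
proof -
  obtain K c where K: "finite K" "\<forall>t\<in>sphere 0 1. p t = (\<Sum>k\<in>K. c k * t powi k)"
    using assms unfolding trig_poly_def by blast
  then have p: "p t = (\<Sum>k\<in>K. c k * t powi k)" if "cmod t = 1" for t using that by simp
  have "(\<integral>t. (cmod (riesz p t))\<^sup>2 \<partial>circle) = (\<integral>t. (cmod (\<Sum>k\<in>{k\<in>K. 0 \<le> k}. c k * t powi k))\<^sup>2 \<partial>circle)"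
    by (intro Bochner_Integration.integral_cong refl) (simp add: space_circle riesz_trig_poly(2)[OF K(1) p])
  also have "\<dots> = (\<Sum>k\<in>{k\<in>K. 0 \<le> k}. (cmod (c k))\<^sup>2)"
    using K by (intro parseval) simp
  also have "\<dots> \<le> (\<Sum>k\<in>K. (cmod (c k))\<^sup>2)"
    using K by (intro sum_mono2) auto
  also have "\<dots> = (\<integral>t. (cmod (\<Sum>k\<in>K. c k * t powi k))\<^sup>2 \<partial>circle)"
    by (rule parseval[OF K(1), symmetric])
  also have "\<dots> = (\<integral>t. (cmod (p t))\<^sup>2 \<partial>circle)"
    by (intro Bochner_Integration.integral_cong refl) (simp add: space_circle p)
  finally show ?thesis .
qed

lemma riesz_trig_poly_trig:
  assumes "trig_poly p" shows "trig_poly (riesz p)"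
    and "fourier_coeff (riesz p) n = (if 0 \<le> n then fourier_coeff p n else 0)"
proof -
  obtain K c where K: "finite K" "\<forall>t\<in>sphere 0 1. p t = (\<Sum>k\<in>K. c k * t powi k)"
    using assms unfolding trig_poly_def by blast
  then have p: "p t = (\<Sum>k\<in>K. c k * t powi k)" if "cmod t = 1" for t using that by simp
  have r: "riesz p t = (\<Sum>k\<in>{k\<in>K. 0 \<le> k}. c k * t powi k)" if "cmod t = 1" for t
    by (rule riesz_trig_poly(2)[OF K(1) p that])
  then show tr: "trig_poly (riesz p)"
    unfolding trig_poly_def using K(1) by (intro exI[of _ "{k\<in>K. 0 \<le> k}"] exI[of _ c]) auto
  have fc: "fourier_coeff q n = (if n \<in> L then c n else 0)"
    if L: "finite L" and q: "\<And>t. cmod t = 1 \<Longrightarrow> q t = (\<Sum>k\<in>L. c k * t powi k)" for L q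
  proof -
    have "fourier_coeff q n = fourier_coeff (\<lambda>t. \<Sum>k\<in>L. c k * t powi k) n"
      unfolding fourier_coeff_def by (intro Bochner_Integration.integral_cong refl) (simp add: space_circle q)
    also have "\<dots> = (\<Sum>k\<in>L. fourier_coeff (\<lambda>t. c k * t powi k) n)"
      by (intro fourier_coeff_sum integrable_mult_right integrable_circle_continuous continuous_on_powi_circle)
    also have "\<dots> = (\<Sum>k\<in>L. if k = n then c k else 0)"
      unfolding fourier_coeff_cmult fourier_coeff_powi by (intro sum.cong) auto
    finally show ?thesis using L by simp
  qed
  have "fourier_coeff (riesz p) n = (if n \<in> {k\<in>K. 0 \<le> k} then c n else 0)"
    by (rule fc[OF _ r]) (use K in auto)
  moreover have "fourier_coeff p n = (if n \<in> K then c n else 0)"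
    by (rule fc[OF K(1) p])
  ultimately show "fourier_coeff (riesz p) n = (if 0 \<le> n then fourier_coeff p n else 0)" by auto
qed

lemma fourier_coeff_uminus_real:
  "fourier_coeff (\<lambda>t. of_real (u t)) (- n) = cnj (fourier_coeff (\<lambda>t. of_real (u t)) n)"
proof -
  have "cnj (fourier_coeff (\<lambda>t. of_real (u t)) n) = (\<integral>t. cnj (of_real (u t) * t powi (- n)) \<partial>circle)"
    unfolding fourier_coeff_def by (rule Bochner_Integration.integral_cnj[symmetric])
  also have "\<dots> = fourier_coeff (\<lambda>t. of_real (u t)) (- n)"
    unfolding fourier_coeff_def
    by (intro Bochner_Integration.integral_cong refl)
       (simp add: space_circle cnj_powi_unit del: complex_cnj_power_int)
  finally show ?thesis ..
qed

lemma trig_poly_fourier: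
  assumes p: "trig_poly p"
  obtains N where "\<And>t. cmod t = 1 \<Longrightarrow> p t = (\<Sum>k\<in>{-int N..int N}. fourier_coeff p k * t powi k)"
    and "\<And>k. int N < \<bar>k\<bar> \<Longrightarrow> fourier_coeff p k = 0"
proof -
  obtain c N where c: "\<And>t. cmod t = 1 \<Longrightarrow> p t = (\<Sum>k\<in>{-int N..int N}. c k * t powi k)"
    using trig_polyE[OF p] by blast
  have fc: "fourier_coeff p n = (if n \<in> {-int N..int N} then c n else 0)" for n
  proof -
    have "fourier_coeff p n = fourier_coeff (\<lambda>t. \<Sum>k\<in>{-int N..int N}. c k * t powi k) n"
      unfolding fourier_coeff_def by (intro Bochner_Integration.integral_cong refl) (simp add: space_circle c)
    also have "\<dots> = (\<Sum>k\<in>{-int N..int N}. fourier_coeff (\<lambda>t. c k * t powi k) n)"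
      by (intro fourier_coeff_sum integrable_mult_right integrable_circle_continuous continuous_on_powi_circle)
    also have "\<dots> = (\<Sum>k\<in>{-int N..int N}. if k = n then c k else 0)"
      unfolding fourier_coeff_cmult fourier_coeff_powi by (intro sum.cong) auto
    finally show ?thesis by simp
  qed
  show thesis
  proof (rule that[of N])
    show "p t = (\<Sum>k\<in>{-int N..int N}. fourier_coeff p k * t powi k)" if "cmod t = 1" for t
      unfolding c[OF that] by (intro sum.cong) (auto simp: fc)
    show "fourier_coeff p k = 0" if "int N < \<bar>k\<bar>" for k using that by (auto simp: fc)
  qed
qed

text \<open>The Herglotz transform of a trigonometric polynomial is itself a polynomial, so its
  boundary values need no limit: they are \<open>p\<close> plus i times the conjugate function,
  expressed through the Riesz projection.\<close>

lemma trig_poly_herglotz: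
  fixes p :: "complex \<Rightarrow> real"
  assumes p: "trig_poly (\<lambda>t. of_real (p t))"
  obtains F where "\<And>S. F holomorphic_on S" "F 0 = of_real (\<integral>t. p t \<partial>circle)"
    "\<And>t. cmod t = 1 \<Longrightarrow> F t = 2 * riesz (\<lambda>t. of_real (p t)) t - of_real (\<integral>t. p t \<partial>circle)"
    "\<And>t. cmod t = 1 \<Longrightarrow> Re (F t) = p t"
    "\<And>z. cmod z < 1 \<Longrightarrow> F z = herglotz (\<lambda>t. of_real (p t)) z"
proof -
  define c where "c = (\<integral>t. p t \<partial>circle)"
  let ?p = "\<lambda>t. complex_of_real (p t)"
  let ?f = "fourier_coeff ?p"
  obtain N where N: "\<And>t. cmod t = 1 \<Longrightarrow> ?p t = (\<Sum>k\<in>{-int N..int N}. ?f k * t powi k)"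
      "\<And>k. int N < \<bar>k\<bar> \<Longrightarrow> ?f k = 0"
    using trig_poly_fourier[OF p] by blast
  have pint: "integrable circle ?p" by (rule trig_poly_integrable[OF p])
  have f0: "?f 0 = of_real c" unfolding fourier_coeff_def c_def by simp
  define F where "F z = 2 * (\<Sum>k\<le>N. ?f (int k) * z ^ k) - of_real c" for z
  have F0: "F 0 = of_real c"
  proof -
    have "(\<Sum>k\<le>N. ?f (int k) * 0 ^ k) = (\<Sum>k\<le>N. if k = 0 then ?f 0 else 0)" by (intro sum.cong) auto
    then show ?thesis unfolding F_def by (simp add: f0)
  qed
  have holF: "F holomorphic_on S" for S unfolding F_def by (intro holomorphic_intros)
  have rz: "riesz ?p t = (\<Sum>k\<le>N. ?f (int k) * t ^ k)" if t: "cmod t = 1" for t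
  proof -
    have "riesz ?p t = (\<Sum>k\<in>{k\<in>{-int N..int N}. 0 \<le> k}. ?f k * t powi k)"
      by (rule riesz_trig_poly(2)[OF _ N(1) t]) simp
    also have "{k\<in>{-int N..int N}. 0 \<le> k} = int ` {..N}"
      unfolding atMost_atLeast0 image_int_atLeastAtMost by auto
    also have "(\<Sum>k\<in>int ` {..N}. ?f k * t powi k) = (\<Sum>k\<le>N. ?f (int k) * t ^ k)"
      by (subst sum.reindex) auto
    finally show ?thesis .
  qed
  have Ft: "F t = 2 * riesz ?p t - of_real c" if "cmod t = 1" for t
    unfolding F_def rz[OF that] ..
  have Re_circ: "Re (F t) = p t" if t: "cmod t = 1" for t
  proof -
    \<comment> \<open>The positive frequencies; for a real function the negative ones contribute the
      conjugate.\<close>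
    define A where "A = (\<Sum>k\<in>{1..int N}. ?f k * t powi k)"
    have set: "{-int N..int N} = insert 0 ({1..int N} \<union> uminus ` {1..int N})"
      unfolding image_uminus_atLeastAtMost by auto
    then have "?p t = ?f 0 + (\<Sum>k\<in>{1..int N} \<union> uminus ` {1..int N}. ?f k * t powi k)"
      unfolding N(1)[OF t] by (subst set, subst sum.insert) auto
    also have "\<dots> = ?f 0 + (A + (\<Sum>k\<in>uminus ` {1..int N}. ?f k * t powi k))"
      unfolding A_def by (subst sum.union_disjoint) auto
    also have "(\<Sum>k\<in>uminus ` {1..int N}. ?f k * t powi k) = (\<Sum>k\<in>{1..int N}. ?f (-k) * t powi (-k))"
      by (subst sum.reindex) (auto simp: inj_on_def)
    also have "\<dots> = cnj A"
      unfolding A_def cnj_sum complex_cnj_mult fourier_coeff_uminus_real cnj_powi_unit[OF t] ..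
    finally have pt: "?p t = of_real c + (A + cnj A)" by (simp only: f0)
    have "(\<Sum>k\<le>N. ?f (int k) * t ^ k) = (\<Sum>k\<in>int ` {..N}. ?f k * t powi k)"
      by (subst sum.reindex) auto
    also have "int ` {..N} = insert 0 {1..int N}"
      unfolding atMost_atLeast0 image_int_atLeastAtMost by auto
    also have "(\<Sum>k\<in>insert 0 {1..int N}. ?f k * t powi k) = of_real c + A"
      unfolding A_def by (subst sum.insert) (auto simp: f0)
    finally have "F t = 2 * (of_real c + A) - of_real c" unfolding F_def by simp
    then have "Re (F t) = c + 2 * Re A" by simp
    moreover have "p t = Re (?p t)" by simp
    ultimately show ?thesis unfolding pt by simp
  qed
  have hz: "F z = herglotz ?p z" if z: "cmod z < 1" for z
  proof -
    have "(\<lambda>n. ?f (int n) * z ^ n) sums (\<Sum>k\<le>N. ?f (int k) * z ^ k)"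
      by (rule sums_finite) (use N(2) in auto)
    then have "cauchy_transform ?p z = (\<Sum>k\<le>N. ?f (int k) * z ^ k)"
      using cauchy_transform_sums[OF pint z] by (simp add: sums_iff)
    then show ?thesis unfolding F_def herglotz_def c_def by simp
  qed
  show thesis
    by (rule that[of F, OF holF F0[unfolded c_def] Ft[unfolded c_def] Re_circ hz])
qed

text \<open>The mean value property of \<open>F log F\<close>, where \<open>F\<close> has real part \<open>p\<close>, turns integrability of the
  conjugate function into \<open>L log L\<close> integrability of \<open>p\<close>.\<close>

lemma trig_poly_log_bound:
  fixes p :: "complex \<Rightarrow> real"
  assumes p: "trig_poly (\<lambda>t. of_real (p t))" and ge: "\<And>t. cmod t = 1 \<Longrightarrow> 1 \<le> p t"
  defines "c \<equiv> (\<integral>t. p t \<partial>circle)"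
  shows "(\<integral>t. p t * ln (p t) \<partial>circle) \<le> c * ln c + pi / 2 * (\<integral>t. cmod (2 * riesz (\<lambda>t. of_real (p t)) t - of_real c) \<partial>circle)"
proof -
  let ?p = "\<lambda>t. complex_of_real (p t)"
  obtain F where holF: "\<And>S. F holomorphic_on S" and F0: "F 0 = of_real c"
    and Ft: "\<And>t. cmod t = 1 \<Longrightarrow> F t = 2 * riesz ?p t - of_real c"
    and Re_circ: "\<And>t. cmod t = 1 \<Longrightarrow> Re (F t) = p t"
    and hz: "\<And>z. cmod z < 1 \<Longrightarrow> F z = herglotz ?p z"
    by (rule trig_poly_herglotz[OF p, folded c_def]) (rule that)
  have pr: "integrable circle p"
    using integrable_Re[OF trig_poly_integrable[OF p]] by simp
  have Re1: "1 \<le> Re (F z)" if "cmod z \<le> 1" for z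
  proof (cases "cmod z = 1")
    case True
    then show ?thesis using Re_circ ge by simp
  next
    case False
    then have "cmod z < 1" using that by simp
    then show ?thesis unfolding hz[OF \<open>cmod z < 1\<close>] using Re_herglotz_ge[OF pr ge] by simp
  qed
  have np: "F z \<notin> \<real>\<^sub>\<le>\<^sub>0" if "cmod z \<le> 1" for z
    using Re1[OF that] by (auto simp: complex_nonpos_Reals_iff)
  define G where "G z = F z * Ln (F z)" for z
  have hG: "G holomorphic_on cball 0 1"
    unfolding G_def by (intro holomorphic_intros holF) (use np in auto)
  have cG: "continuous_on (cball 0 1) G" by (rule holomorphic_on_imp_continuous_on[OF hG])
  have iG: "integrable circle G"
    by (intro integrable_circle_continuous continuous_on_subset[OF cG]) auto
  have c1: "c \<ge> 1"
  proof -
    have "(\<integral>t. 1 \<partial>circle) \<le> c" unfolding c_def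
      by (intro integral_mono pr) (auto simp: space_circle ge)
    then show ?thesis by simp
  qed
  have "(\<integral>t. G t \<partial>circle) = G 0"
    by (rule integral_circle_holomorphic[OF cG holomorphic_on_subset[OF hG]]) auto
  also have "G 0 = of_real (c * ln c)"
    unfolding G_def F0 using c1 by (simp add: Ln_of_real)
  finally have G0: "(\<integral>t. Re (G t) \<partial>circle) = c * ln c"
    using integral_Re[OF iG] by simp
  have iF: "integrable circle (\<lambda>t. cmod (F t))"
    by (intro integrable_circle_continuous continuous_intros holomorphic_on_imp_continuous_on[OF holF])
  have pc: "continuous_on (sphere 0 1) p"
    using continuous_on_Re[OF trig_poly_continuous[OF p]] by simp
  have "(\<integral>t. p t * ln (p t) \<partial>circle) \<le> (\<integral>t. Re (G t) + pi / 2 * cmod (F t) \<partial>circle)"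
  proof (rule integral_mono)
    show "integrable circle (\<lambda>t. p t * ln (p t))"
      by (intro integrable_circle_continuous continuous_intros pc) (use ge in force)
    show "integrable circle (\<lambda>t. Re (G t) + pi / 2 * cmod (F t))"
      using iG iF by simp
    fix t assume "t \<in> space circle"
    then have t: "cmod t = 1" by (simp add: space_circle)
    have R: "1 \<le> Re (F t)" using Re1 t by simp
    then have nz: "F t \<noteq> 0" by auto
    \<comment> \<open>On the circle Re (F Ln F) is p ln |F| minus Im F times the argument of F. Here
      |F| >= p, and in the right half-plane the argument is below pi / 2 in modulus.\<close>
    have "p t * ln (p t) \<le> p t * ln (cmod (F t))"
    proof (rule mult_left_mono)
      have "0 < p t" "p t \<le> cmod (F t)" using R complex_Re_le_cmod[of "F t"] unfolding Re_circ[OF t] by auto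
      then show "ln (p t) \<le> ln (cmod (F t))" by (subst ln_le_cancel_iff) auto
      show "0 \<le> p t" using \<open>0 < p t\<close> by simp
    qed
    also have "\<dots> = Re (G t) + Im (F t) * Im (Ln (F t))"
      unfolding G_def using nz by (simp add: Re_circ[OF t])
    also have "Im (F t) * Im (Ln (F t)) \<le> pi / 2 * cmod (F t)"
    proof -
      have "\<bar>Im (Ln (F t))\<bar> < pi / 2" using R Re_Ln_pos_lt[OF nz] by simp
      then have "\<bar>Im (F t)\<bar> * \<bar>Im (Ln (F t))\<bar> \<le> cmod (F t) * (pi / 2)"
        by (intro mult_mono abs_Im_le_cmod) auto
      then show ?thesis by (simp add: abs_mult[symmetric] mult.commute abs_le_iff)
    qed
    finally show "p t * ln (p t) \<le> Re (G t) + pi / 2 * cmod (F t)" by simp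
  qed
  also have "\<dots> = c * ln c + pi / 2 * (\<integral>t. cmod (F t) \<partial>circle)"
    using iG iF G0 by simp
  also have "(\<integral>t. cmod (F t) \<partial>circle) = (\<integral>t. cmod (2 * riesz ?p t - of_real c) \<partial>circle)"
    by (intro Bochner_Integration.integral_cong refl) (simp add: space_circle Ft)
  finally show ?thesis .
qed

section \<open>Banach function spaces\<close>

locale bfn =
  fixes \<rho> :: "(complex \<Rightarrow> ennreal) \<Rightarrow> ennreal"
  assumes bfn: "banach_function_norm \<rho>"
begin

lemma rho_eq_0: "f \<in> borel_measurable circle \<Longrightarrow> \<rho> f = 0 \<longleftrightarrow> (AE t in circle. f t = 0)"
  using bfn unfolding banach_function_norm_def by blast

lemma rho_cmult: "f \<in> borel_measurable circle \<Longrightarrow> 0 \<le> c \<Longrightarrow> \<rho> (\<lambda>t. ennreal c * f t) = ennreal c * \<rho> f"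
  using bfn unfolding banach_function_norm_def by blast

lemma rho_add: "f \<in> borel_measurable circle \<Longrightarrow> g \<in> borel_measurable circle \<Longrightarrow> \<rho> (\<lambda>t. f t + g t) \<le> \<rho> f + \<rho> g"
  using bfn unfolding banach_function_norm_def by blast

lemma rho_mono: "f \<in> borel_measurable circle \<Longrightarrow> g \<in> borel_measurable circle \<Longrightarrow> AE t in circle. g t \<le> f t \<Longrightarrow> \<rho> g \<le> \<rho> f"
  using bfn unfolding banach_function_norm_def by blast

lemma rho_monotone_convergence:
  assumes "\<And>n::nat. F n \<in> borel_measurable circle" "f \<in> borel_measurable circle"
    "AE t in circle. incseq (\<lambda>n. F n t) \<and> (\<lambda>n. F n t) \<longlonglongrightarrow> f t"
  shows "(\<lambda>n. \<rho> (F n)) \<longlonglongrightarrow> \<rho> f"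
  using bfn assms unfolding banach_function_norm_def by blast

lemma rho_indicator: "E \<in> sets circle \<Longrightarrow> \<rho> (indicator E) < \<infinity>"
  using bfn unfolding banach_function_norm_def by blast

lemma sets_circle_sphere: "sphere 0 1 \<in> sets circle"
  using sets.top[of circle] by (simp add: space_circle)

lemma rho_L1: "\<exists>C>0. \<forall>f\<in>borel_measurable circle. (\<integral>\<^sup>+t. f t \<partial>circle) \<le> ennreal C * \<rho> f"
proof -
  have "\<forall>E \<in> sets circle. \<exists>C::real. 0 < C \<and> (\<forall>f \<in> borel_measurable circle. (\<integral>\<^sup>+t\<in>E. f t \<partial>circle) \<le> ennreal C * \<rho> f)"
    using bfn unfolding banach_function_norm_def by (elim conjE)
  from bspec[OF this sets_circle_sphere] obtain C where
    C: "0 < C" "\<And>f. f \<in> borel_measurable circle \<Longrightarrow> (\<integral>\<^sup>+t\<in>sphere 0 1. f t \<partial>circle) \<le> ennreal C * \<rho> f"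
    by auto
  have "(\<integral>\<^sup>+t\<in>sphere 0 1. f t \<partial>circle) = (\<integral>\<^sup>+t. f t \<partial>circle)" for f
    by (intro nn_integral_cong) (simp add: space_circle)
  then show ?thesis using C by auto
qed

abbreviation N where "N \<equiv> bfs_norm \<rho>"

lemma bfs_measurable: "f \<in> bfs \<rho> \<Longrightarrow> f \<in> borel_measurable circle"
  by (simp add: bfs_def)

lemma bfs_finite: "f \<in> bfs \<rho> \<Longrightarrow> N f < \<infinity>"
  by (simp add: bfs_def)

lemma bfsI: "f \<in> borel_measurable circle \<Longrightarrow> N f \<le> M \<Longrightarrow> M < \<infinity> \<Longrightarrow> f \<in> bfs \<rho>"
  by (auto simp: bfs_def)

lemma N_mono:
  assumes "f \<in> borel_measurable circle" "g \<in> borel_measurable circle" "AE t in circle. cmod (g t) \<le> cmod (f t)"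
  shows "N g \<le> N f"
  unfolding bfs_norm_def
  by (rule rho_mono) (use assms in \<open>auto simp: ennreal_leI elim!: eventually_mono\<close>)

lemma N_cong:
  assumes "f \<in> borel_measurable circle" "g \<in> borel_measurable circle" "AE t in circle. cmod (g t) = cmod (f t)"
  shows "N g = N f"
  by (intro antisym N_mono assms) (use assms(3) in \<open>auto elim!: eventually_mono\<close>)

lemma bfs_mono:
  assumes "f \<in> bfs \<rho>" "g \<in> borel_measurable circle" "AE t in circle. cmod (g t) \<le> cmod (f t)"
  shows "g \<in> bfs \<rho>"
  using assms N_mono[OF bfs_measurable[OF assms(1)] assms(2,3)] bfs_finite[OF assms(1)] by (intro bfsI)

lemma N_add:
  assumes "f \<in> borel_measurable circle" "g \<in> borel_measurable circle"
  shows "N (\<lambda>t. f t + g t) \<le> N f + N g"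
proof -
  have "N (\<lambda>t. f t + g t) \<le> \<rho> (\<lambda>t. ennreal (cmod (f t)) + ennreal (cmod (g t)))"
    unfolding bfs_norm_def using assms
    by (intro rho_mono) (auto intro!: AE_circleI simp: norm_triangle_ineq ennreal_leI simp flip: ennreal_plus)
  also have "\<dots> \<le> N f + N g"
    unfolding bfs_norm_def using assms by (intro rho_add) auto
  finally show ?thesis .
qed

lemma N_cmult: "f \<in> borel_measurable circle \<Longrightarrow> N (\<lambda>t. c * f t) = ennreal (cmod c) * N f"
  unfolding bfs_norm_def norm_mult ennreal_mult' [OF norm_ge_zero] by (rule rho_cmult) auto

lemma N_uminus: "N (\<lambda>t. - f t) = N f"
  unfolding bfs_norm_def by simp

lemma N_diff:
  assumes "f \<in> borel_measurable circle" "g \<in> borel_measurable circle"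
  shows "N (\<lambda>t. f t - g t) \<le> N f + N g"
  using N_add[of f "\<lambda>t. - g t"] assms by (simp add: N_uminus)

lemma bfs_add: "f \<in> bfs \<rho> \<Longrightarrow> g \<in> bfs \<rho> \<Longrightarrow> (\<lambda>t. f t + g t) \<in> bfs \<rho>"
  using N_add[of f g] by (auto simp: bfs_def intro: le_less_trans)

lemma bfs_diff: "f \<in> bfs \<rho> \<Longrightarrow> g \<in> bfs \<rho> \<Longrightarrow> (\<lambda>t. f t - g t) \<in> bfs \<rho>"
  using N_diff[of f g] by (auto simp: bfs_def intro: le_less_trans)

lemma bfs_cmult: "f \<in> bfs \<rho> \<Longrightarrow> (\<lambda>t. c * f t) \<in> bfs \<rho>"
  using N_cmult[of f c] by (auto simp: bfs_def ennreal_mult_less_top)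

lemma N_one: "N (\<lambda>_. 1) < \<infinity>"
proof -
  have "N (\<lambda>_. 1) \<le> \<rho> (indicator (sphere 0 1))"
    unfolding bfs_norm_def using sets_circle_sphere by (intro rho_mono) (auto intro!: AE_circleI)
  then show ?thesis using rho_indicator[OF sets_circle_sphere] by (rule le_less_trans)
qed

lemma N_bounded:
  assumes "f \<in> borel_measurable circle" "AE t in circle. cmod (f t) \<le> B" "0 \<le> B"
  shows "N f \<le> ennreal B * N (\<lambda>_. 1)"
proof -
  have "N f \<le> N (\<lambda>t. of_real B * 1)"
    using assms by (intro N_mono) (auto elim!: eventually_mono)
  then show ?thesis using N_cmult[of "\<lambda>_. 1" "of_real B"] assms(3) by simp
qed

lemma bfs_bounded:
  assumes "f \<in> borel_measurable circle" "\<And>t. cmod t = 1 \<Longrightarrow> cmod (f t) \<le> B"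
  shows "f \<in> bfs \<rho>"
proof (rule bfsI[OF assms(1) N_bounded[OF assms(1)]])
  show "AE t in circle. cmod (f t) \<le> B" using assms(2) by (rule AE_circleI)
  show "0 \<le> B" using assms(2)[of 1] by (auto intro: order_trans[OF norm_ge_zero])
  show "ennreal B * N (\<lambda>_. 1) < \<infinity>" using N_one by (simp add: ennreal_mult_less_top)
qed

lemma bfs_const: "(\<lambda>_. c) \<in> bfs \<rho>"
  by (rule bfs_bounded[where B="cmod c"]) auto

lemma bfs_trig_poly: "trig_poly p \<Longrightarrow> p \<in> bfs \<rho>"
  using trig_poly_bounded[of p] by (auto intro: bfs_bounded trig_poly_measurable)

lemma bfs_L1:
  obtains C where "0 < C" "\<And>f. f \<in> bfs \<rho> \<Longrightarrow> integrable circle f" "\<And>f. f \<in> bfs \<rho> \<Longrightarrow> ennreal (\<integral>t. cmod (f t) \<partial>circle) \<le> ennreal C * N f"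
proof -
  obtain C where C: "0 < C" "\<And>f. f\<in>borel_measurable circle \<Longrightarrow> (\<integral>\<^sup>+t. f t \<partial>circle) \<le> ennreal C * \<rho> f"
    using rho_L1 by blast
  have nn: "(\<integral>\<^sup>+t. ennreal (cmod (f t)) \<partial>circle) \<le> ennreal C * N f" if "f \<in> bfs \<rho>" for f
    unfolding bfs_norm_def using bfs_measurable[OF that] by (intro C) auto
  have int: "integrable circle f" if "f \<in> bfs \<rho>" for f
    using bfs_measurable[OF that]
  proof (rule integrableI_bounded)
    have "ennreal C * N f < \<infinity>" using bfs_finite[OF that] by (simp add: ennreal_mult_less_top)
    then show "(\<integral>\<^sup>+t. ennreal (norm (f t)) \<partial>circle) < \<infinity>" by (rule le_less_trans[OF nn[OF that]])
  qed
  have "ennreal (\<integral>t. cmod (f t) \<partial>circle) \<le> ennreal C * N f" if "f \<in> bfs \<rho>" for f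
    using nn[OF that] int[OF that] by (subst (asm) nn_integral_eq_integral) auto
  with C(1) int show thesis by (rule that)
qed

lemma bfs_integrable: "f \<in> bfs \<rho> \<Longrightarrow> integrable circle f"
  using bfs_L1 by blast

text \<open>(A3) applied to the tail infima of the moduli, which increase to the modulus of the
  limit. Thus limits almost everywhere stay in a ball without any convergence in norm.\<close>

lemma N_fatou:
  assumes f: "\<And>n::nat. f n \<in> borel_measurable circle" and g: "g \<in> borel_measurable circle"
    and le: "\<And>n. N (f n) \<le> M" and lim: "AE t in circle. (\<lambda>n. f n t) \<longlonglongrightarrow> g t"
  shows "N g \<le> M"
proof -
  define F where "F n t = (INF k\<in>{n..}. ennreal (cmod (f k t)))" for n t
  have Fm: "F n \<in> borel_measurable circle" for n
    unfolding F_def using f by (intro borel_measurable_INF) auto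
  have "(\<lambda>n. \<rho> (F n)) \<longlonglongrightarrow> \<rho> (\<lambda>t. ennreal (cmod (g t)))"
  proof (rule rho_monotone_convergence[OF Fm])
    show "AE t in circle. incseq (\<lambda>n. F n t) \<and> (\<lambda>n. F n t) \<longlonglongrightarrow> ennreal (cmod (g t))"
      using lim
    proof eventually_elim
      case (elim t)
      have inc: "incseq (\<lambda>n. F n t)"
        unfolding F_def by (intro monoI INF_superset_mono) auto
      have "(\<lambda>n. ennreal (cmod (f n t))) \<longlonglongrightarrow> ennreal (cmod (g t))"
        using elim by (intro tendsto_intros)
      then have "liminf (\<lambda>n. ennreal (cmod (f n t))) = ennreal (cmod (g t))"
        by (intro lim_imp_Liminf) auto
      then have "(SUP n. F n t) = ennreal (cmod (g t))"
        unfolding F_def liminf_SUP_INF .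
      then show ?case using inc LIMSEQ_SUP[OF inc] by simp
    qed
  qed (use g in auto)
  moreover have "\<rho> (F n) \<le> M" for n
  proof -
    have "\<rho> (F n) \<le> N (f n)"
      unfolding bfs_norm_def using Fm f
      by (intro rho_mono) (auto intro!: AE_circleI INF_lower simp: F_def)
    then show ?thesis using le by (rule order_trans)
  qed
  ultimately show ?thesis
    unfolding bfs_norm_def by (intro LIMSEQ_le_const2) auto
qed

lemma N_eq_0: "f \<in> borel_measurable circle \<Longrightarrow> N f = 0 \<longleftrightarrow> (AE t in circle. f t = 0)"
  unfolding bfs_norm_def by (subst rho_eq_0) (auto simp: ennreal_eq_0_iff)

end

section \<open>Consequences of the boundedness of the Riesz projection\<close>

text \<open>Jensen's inequality for the root, from sqrt x <= (x / s + s) / 2 with s the root of the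
  integral; if the integral is 0, s is made arbitrarily small.\<close>

lemma integral_sqrt_le:
  assumes g: "integrable circle (g :: complex \<Rightarrow> real)" and nn: "\<And>t. cmod t = 1 \<Longrightarrow> 0 \<le> g t"
  shows "integrable circle (\<lambda>t. sqrt (g t))" and "(\<integral>t. sqrt (g t) \<partial>circle) \<le> sqrt (\<integral>t. g t \<partial>circle)"
proof -
  have amgm: "sqrt x \<le> (x / s + s) / 2" if "0 \<le> x" "0 < s" for x s :: real
  proof -
    have "0 \<le> (sqrt x - s)\<^sup>2" by simp
    then have "2 * (sqrt x * s) \<le> (sqrt x)\<^sup>2 + s\<^sup>2" by (simp add: power2_diff)
    also have "(sqrt x)\<^sup>2 = x" using that by simp
    finally show ?thesis using that by (simp add: field_simps power2_eq_square)
  qed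
  show int: "integrable circle (\<lambda>t. sqrt (g t))"
  proof (rule Bochner_Integration.integrable_bound[where f="\<lambda>t. (g t / 1 + 1) / 2"])
    show "AE t in circle. norm (sqrt (g t)) \<le> norm ((g t / 1 + 1) / 2)"
    proof (rule AE_circleI)
      fix t :: complex assume "cmod t = 1"
      then show "norm (sqrt (g t)) \<le> norm ((g t / 1 + 1) / 2)" using amgm[of "g t" 1] nn[of t] by simp
    qed
  qed (use g in auto)
  let ?I = "\<integral>t. g t \<partial>circle"
  have le: "(\<integral>t. sqrt (g t) \<partial>circle) \<le> (?I / s + s) / 2" if s: "0 < s" for s
  proof -
    have "(\<integral>t. sqrt (g t) \<partial>circle) \<le> (\<integral>t. (g t / s + s) / 2 \<partial>circle)"
      by (rule integral_mono[OF int]) (use g amgm nn s in \<open>auto simp: space_circle\<close>)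
    also have "\<dots> = (?I / s + s) / 2" using g by simp
    finally show ?thesis .
  qed
  have I0: "0 \<le> ?I" using nn by (intro integral_nonneg_AE AE_circleI)
  show "(\<integral>t. sqrt (g t) \<partial>circle) \<le> sqrt ?I"
  proof (cases "?I = 0")
    case True
    then have "(\<integral>t. sqrt (g t) \<partial>circle) \<le> 0 + s" if "0 < s" for s using le[of "2 * s"] that by simp
    then have "(\<integral>t. sqrt (g t) \<partial>circle) \<le> 0" by (rule field_le_epsilon)
    then show ?thesis using True by simp
  next
    case False
    then have p: "0 < ?I" using I0 by simp
    have "?I / sqrt ?I = sqrt ?I" using p by (simp add: real_div_sqrt)
    then show ?thesis using le[of "sqrt ?I"] p by simp
  qed
qed

lemma integral_square_le:
  assumes "integrable circle (\<lambda>t. (cmod (g t))\<^sup>2)" "g \<in> borel_measurable circle"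
  shows "integrable circle g" "(\<integral>t. cmod (g t) \<partial>circle) \<le> sqrt (\<integral>t. (cmod (g t))\<^sup>2 \<partial>circle)"
  using integral_sqrt_le[OF assms(1)] assms(2) by (auto simp: integrable_norm_iff)

locale riesz_bounded = bfn +
  assumes riesz: "bounded_operator \<rho> (bfs \<rho>) \<rho> (bfs \<rho>) riesz"
begin

lemma riesz_bfs: "f \<in> bfs \<rho> \<Longrightarrow> riesz f \<in> bfs \<rho>"
  using riesz unfolding bounded_operator_def by blast

lemma riesz_add: "f \<in> bfs \<rho> \<Longrightarrow> g \<in> bfs \<rho> \<Longrightarrow> AE t in circle. riesz (\<lambda>s. f s + g s) t = riesz f t + riesz g t"
  using riesz unfolding bounded_operator_def by blast

lemma riesz_cmult: "f \<in> bfs \<rho> \<Longrightarrow> AE t in circle. riesz (\<lambda>s. c * f s) t = c * riesz f t"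
  using riesz unfolding bounded_operator_def by blast

lemma riesz_diff:
  assumes "f \<in> bfs \<rho>" "g \<in> bfs \<rho>"
  shows "AE t in circle. riesz (\<lambda>s. f s - g s) t = riesz f t - riesz g t"
  using riesz_add[OF assms(1) bfs_cmult[OF assms(2), of "-1"]] riesz_cmult[OF assms(2), of "-1"]
  by eventually_elim simp

lemma riesz_bound:
  obtains C where "0 \<le> C" "\<And>f. f \<in> bfs \<rho> \<Longrightarrow> N (riesz f) \<le> ennreal C * N f"
proof -
  obtain C where C: "\<forall>f \<in> bfs \<rho>. N (riesz f) \<le> ennreal C * N f"
    using riesz unfolding bounded_operator_def by blast
  have "ennreal C = ennreal (max 0 C)" by (simp add: max_def ennreal_neg)
  with C show thesis by (intro that[of "max 0 C"]) auto
qed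

text \<open>Where the principal value does not exist, \<open>singular_integral\<close> has a fixed unspecified value;
  additivity of \<open>riesz\<close> on \<open>f\<close> and \<open>1\<close> excludes this on a set of positive measure.\<close>

lemma pv_exists_AE:
  assumes f: "f \<in> bfs \<rho>"
  shows "AE t in circle. pv_exists f t"
proof -
  \<comment> \<open>\<open>Lim\<close> of a function without limit is \<open>THE\<close> of the
    false predicate, one and the same number for all such functions.\<close>
  define c where "c = 1 / (of_real pi * \<i>) * (THE l::complex. False)"
  have junk: "singular_integral g t = c" if "\<not> pv_exists g t" for g t
  proof -
    have "(\<lambda>l. ((\<lambda>\<epsilon>. strunc g \<epsilon> t) \<longlongrightarrow> l) (at_right 0)) = (\<lambda>l. False)"
      using that unfolding pv_exists_def by auto
    then show ?thesis
      unfolding singular_integral_def strunc_def[symmetric] c_def t2_space_class.Lim_def by simp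
  qed
  have shift: "pv_exists f t" if ex: "pv_exists (\<lambda>s. f s + 1) t" and t: "cmod t = 1" for t
  proof -
    obtain l where l: "((\<lambda>\<epsilon>. strunc (\<lambda>s. f s + 1) \<epsilon> t) \<longlongrightarrow> l) (at_right 0)"
      using ex unfolding pv_exists_def by blast
    have "((\<lambda>\<epsilon>. strunc (\<lambda>s. f s + 1) \<epsilon> t - strunc (\<lambda>s. 1) \<epsilon> t) \<longlongrightarrow> l - of_real pi * \<i>) (at_right 0)"
      by (intro tendsto_intros l strunc_const_tendsto t)
    moreover have "\<forall>\<^sub>F \<epsilon> in at_right 0. strunc (\<lambda>s. f s + 1) \<epsilon> t - strunc (\<lambda>s. 1) \<epsilon> t = strunc f \<epsilon> t"
      using bfs_integrable[OF f]
      by (intro eventually_at_right_less[THEN eventually_mono]) (simp add: strunc_add)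
    ultimately have "((\<lambda>\<epsilon>. strunc f \<epsilon> t) \<longlongrightarrow> l - of_real pi * \<i>) (at_right 0)"
      by (rule Lim_transform_eventually)
    then show ?thesis unfolding pv_exists_def by blast
  qed
  have one: "riesz (\<lambda>s. 1) t = 1" if "cmod t = 1" for t
  proof -
    have "riesz (\<lambda>s. 1) t = (\<Sum>k\<in>{k\<in>{0::int}. 0 \<le> k}. 1 * t powi k)"
      by (rule riesz_trig_poly(2)) (use that in auto)
    also have "{k\<in>{0::int}. 0 \<le> k} = {0}" by auto
    finally show ?thesis by simp
  qed
  show ?thesis
    using riesz_add[OF f bfs_const[of 1]] AE_space
  proof eventually_elim
    case (elim t)
    then have t: "cmod t = 1" by (simp add: space_circle)
    show ?case
    proof (rule ccontr)
      assume n: "\<not> pv_exists f t"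
      then have "\<not> pv_exists (\<lambda>s. f s + 1) t" using shift t by blast
      \<comment> \<open>Both singular integrals would equal \<open>c\<close>, and additivity would
        read (f + 1 + c) / 2 = (f + c) / 2 + 1.\<close>
      then show False
        using elim(1) junk[OF n] junk[of "\<lambda>s. f s + 1" t] one[OF t] unfolding riesz_def by (simp add: add_divide_distrib)
    qed
  qed
qed

text \<open>The truncated integral is bounded by the Herglotz transform at radius 1 - \<epsilon>,
  whose half-power mean is controlled; since the principal value exists almost everywhere, Fatou's
  lemma suffices and no maximal inequality enters. The constant is sqrt 10 + 1 <= 5 for the singular
  integral, plus 1 for \<open>u\<close> itself.\<close>

lemma kolmogorov_nonneg:
  fixes u :: "complex \<Rightarrow> real"
  assumes u: "(\<lambda>t. of_real (u t)) \<in> bfs \<rho>" and pos: "\<And>t. cmod t = 1 \<Longrightarrow> 0 \<le> u t"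
  shows "integrable circle (\<lambda>t. sqrt (cmod (riesz (\<lambda>t. of_real (u t)) t)))"
    and "(\<integral>t. sqrt (cmod (riesz (\<lambda>t. of_real (u t)) t)) \<partial>circle) \<le> 6 * sqrt (\<integral>t. u t \<partial>circle)"
proof -
  let ?h = "\<lambda>t. complex_of_real (u t)"
  have hint: "integrable circle ?h" by (rule bfs_integrable[OF u])
  have uint: "integrable circle u" using integrable_Re[OF hint] by simp
  let ?I = "\<integral>t. u t \<partial>circle"
  have I0: "0 \<le> ?I" using pos by (intro integral_nonneg_AE AE_circleI)
  \<comment> \<open>The offset 2 keeps \<epsilon> = 1 / (n + 2) strictly below 1, as the comparison
    of the kernels demands.\<close>
  define r where "r n = 1 - 1 / real (n + 2)" for n :: nat
  have r: "0 < 1 / real (n + 2)" "1 / real (n + 2) < 1" "0 \<le> r n" "r n < 1" for n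
    by (auto simp: r_def)
  define B where "B n t = sqrt (5 * cmod (herglotz ?h (of_real (r n) * t)) + ?I)" for n t
  have hol: "herglotz ?h holomorphic_on ball 0 1" by (rule herglotz_holomorphic[OF hint])
  have Bc: "continuous_on (sphere 0 1) (\<lambda>t. herglotz ?h (of_real (r n) * t))" for n
    by (rule continuous_on_subset[OF continuous_on_dilate(2)[OF hol r(3,4)]]) auto
  have Bm: "B n \<in> borel_measurable circle" for n
    unfolding B_def by (intro borel_measurable_circle_continuous continuous_intros Bc)
  have Bi: "(\<integral>\<^sup>+t. ennreal (B n t) \<partial>circle) \<le> ennreal (5 * sqrt ?I)" for n
  proof -
    have hi: "integrable circle (\<lambda>t. sqrt (cmod (herglotz ?h (of_real (r n) * t))))"
      by (intro integrable_circle_continuous continuous_intros Bc)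
    have "(\<integral>\<^sup>+t. ennreal (B n t) \<partial>circle) \<le> (\<integral>\<^sup>+t. ennreal (sqrt 5 * sqrt (cmod (herglotz ?h (of_real (r n) * t))) + sqrt ?I) \<partial>circle)"
    proof (intro nn_integral_mono ennreal_leI)
      fix t
      have "B n t \<le> sqrt (5 * cmod (herglotz ?h (of_real (r n) * t))) + sqrt ?I"
        unfolding B_def by (rule sqrt_add_le_add_sqrt) (use I0 in auto)
      then show "B n t \<le> sqrt 5 * sqrt (cmod (herglotz ?h (of_real (r n) * t))) + sqrt ?I"
        by (simp only: real_sqrt_mult)
    qed
    also have "\<dots> = ennreal (\<integral>t. sqrt 5 * sqrt (cmod (herglotz ?h (of_real (r n) * t))) + sqrt ?I \<partial>circle)"
      by (rule nn_integral_eq_integral) (use hi I0 in auto)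
    also have "(\<integral>t. sqrt 5 * sqrt (cmod (herglotz ?h (of_real (r n) * t))) + sqrt ?I \<partial>circle)
        = sqrt 5 * (\<integral>t. sqrt (cmod (herglotz ?h (of_real (r n) * t))) \<partial>circle) + sqrt ?I"
      using hi by simp
    also have "\<dots> \<le> sqrt 5 * (sqrt 2 * sqrt ?I) + sqrt ?I"
      by (intro add_right_mono mult_left_mono herglotz_sqrt_bound uint pos r) auto
    also have "\<dots> = (sqrt 10 + 1) * sqrt ?I"
      by (simp add: real_sqrt_mult[symmetric] algebra_simps)
    also have "\<dots> \<le> 5 * sqrt ?I"
    proof (rule mult_right_mono)
      have "sqrt 10 \<le> 4" by (rule real_le_lsqrt) auto
      then show "sqrt 10 + 1 \<le> 5" by simp
    qed (use I0 in simp)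
    finally show ?thesis by (simp add: ennreal_leI)
  qed
  have rzm: "riesz ?h \<in> borel_measurable circle" by (rule bfs_measurable[OF riesz_bfs[OF u]])
  define S where "S t = 2 * riesz ?h t - ?h t" for t
  have "2 * ((x + y) / 2) - x = y" for x y :: complex by (simp add: field_simps)
  then have SS: "S t = singular_integral ?h t" for t unfolding S_def riesz_def .
  have Sm: "S \<in> borel_measurable circle"
    unfolding S_def by (intro borel_measurable_diff borel_measurable_times borel_measurable_const rzm bfs_measurable[OF u])
  have bd: "AE t in circle. ennreal (sqrt (cmod (S t))) \<le> liminf (\<lambda>n. ennreal (B n t))"
    using pv_exists_AE[OF u] AE_space
  proof eventually_elim
    case (elim t)
    then have t: "cmod t = 1" by (simp add: space_circle)
    obtain l where l: "((\<lambda>\<epsilon>. strunc ?h \<epsilon> t) \<longlongrightarrow> l) (at_right 0)"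
      using elim unfolding pv_exists_def by blast
    have St: "S t = l / (of_real pi * \<i>)"
      unfolding SS by (rule singular_integral_eq) (use l in simp)
    have "filterlim (\<lambda>n. 1 / real (n + 2)) (at_right 0) sequentially"
      unfolding filterlim_at
    proof (intro conjI always_eventually allI)
      show "(\<lambda>n. 1 / real (n + 2)) \<longlonglongrightarrow> 0"
        by (rule LIMSEQ_ignore_initial_segment[OF lim_1_over_n])
    qed auto
    then have "(\<lambda>n. strunc ?h (1 / real (n + 2)) t) \<longlonglongrightarrow> l"
      by (rule filterlim_compose[OF l])
    then have "(\<lambda>n. ennreal (sqrt (cmod (strunc ?h (1 / real (n + 2)) t / (of_real pi * \<i>))))) \<longlonglongrightarrow> ennreal (sqrt (cmod (S t)))"
      unfolding St by (intro tendsto_intros) auto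
    then have "ennreal (sqrt (cmod (S t))) = liminf (\<lambda>n. ennreal (sqrt (cmod (strunc ?h (1 / real (n + 2)) t / (of_real pi * \<i>)))))"
      by (intro lim_imp_Liminf[symmetric]) auto
    also have "\<dots> \<le> liminf (\<lambda>n. ennreal (B n t))"
    proof (intro Liminf_mono always_eventually allI ennreal_leI)
      fix n
      have "cmod (strunc ?h (1 / real (n + 2)) t) \<le> pi * (5 * cmod (herglotz ?h (of_real (r n) * t)) + ?I)"
        unfolding r_def by (rule strunc_bound[OF uint pos t r(1,2)])
      then have "cmod (strunc ?h (1 / real (n + 2)) t / (of_real pi * \<i>)) \<le> 5 * cmod (herglotz ?h (of_real (r n) * t)) + ?I"
        by (simp add: norm_divide norm_mult field_simps)
      then show "sqrt (cmod (strunc ?h (1 / real (n + 2)) t / (of_real pi * \<i>))) \<le> B n t"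
        unfolding B_def by (rule real_sqrt_le_mono)
    qed
    finally show ?case .
  qed
  have "(\<integral>\<^sup>+t. ennreal (sqrt (cmod (S t))) \<partial>circle) \<le> (\<integral>\<^sup>+t. liminf (\<lambda>n. ennreal (B n t)) \<partial>circle)"
    by (rule nn_integral_mono_AE[OF bd])
  also have "\<dots> \<le> liminf (\<lambda>n. \<integral>\<^sup>+t. ennreal (B n t) \<partial>circle)"
    using Bm by (intro nn_integral_liminf) auto
  also have "\<dots> \<le> liminf (\<lambda>n. ennreal (5 * sqrt ?I))"
    by (intro Liminf_mono always_eventually allI Bi)
  also have "\<dots> = ennreal (5 * sqrt ?I)" by (simp add: Liminf_const)
  finally have nnS: "(\<integral>\<^sup>+t. ennreal (sqrt (cmod (S t))) \<partial>circle) \<le> ennreal (5 * sqrt ?I)" .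
  have Si: "integrable circle (\<lambda>t. sqrt (cmod (S t)))"
    using Sm nnS by (intro integrableI_bounded) (auto intro: le_less_trans)
  have SI: "(\<integral>t. sqrt (cmod (S t)) \<partial>circle) \<le> 5 * sqrt ?I"
    using nnS I0 by (subst (asm) nn_integral_eq_integral[OF Si]) auto
  have sle: "sqrt (cmod (riesz ?h t)) \<le> sqrt (u t) + sqrt (cmod (S t))" if t: "cmod t = 1" for t
  proof -
    have "riesz ?h t = (?h t + S t) / 2" by (simp add: S_def)
    then have "cmod (riesz ?h t) = cmod (?h t + S t) / 2" by (simp only: norm_divide) simp
    also have "\<dots> \<le> (cmod (?h t) + cmod (S t)) / 2"
      by (intro divide_right_mono norm_triangle_ineq) simp
    also have "\<dots> \<le> u t + cmod (S t)" using pos[OF t] by simp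
    finally have "sqrt (cmod (riesz ?h t)) \<le> sqrt (u t + cmod (S t))" by simp
    also have "\<dots> \<le> sqrt (u t) + sqrt (cmod (S t))" by (rule sqrt_add_le_add_sqrt) (use pos[OF t] in auto)
    finally show ?thesis .
  qed
  have su: "integrable circle (\<lambda>t. sqrt (u t))" "(\<integral>t. sqrt (u t) \<partial>circle) \<le> sqrt ?I"
    by (rule integral_sqrt_le[OF uint pos], assumption)+
  show int: "integrable circle (\<lambda>t. sqrt (cmod (riesz ?h t)))"
  proof (rule Bochner_Integration.integrable_bound[where f="\<lambda>t. sqrt (u t) + sqrt (cmod (S t))"])
    show "AE t in circle. norm (sqrt (cmod (riesz ?h t))) \<le> norm (sqrt (u t) + sqrt (cmod (S t)))"
      using sle pos by (intro AE_circleI) auto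
  qed (use su Si rzm in auto)
  have "(\<integral>t. sqrt (cmod (riesz ?h t)) \<partial>circle) \<le> (\<integral>t. sqrt (u t) + sqrt (cmod (S t)) \<partial>circle)"
    by (rule integral_mono[OF int]) (use su Si sle in \<open>auto simp: space_circle\<close>)
  also have "\<dots> = (\<integral>t. sqrt (u t) \<partial>circle) + (\<integral>t. sqrt (cmod (S t)) \<partial>circle)" using su Si by simp
  also have "\<dots> \<le> 6 * sqrt ?I" using su(2) SI by simp
  finally show "(\<integral>t. sqrt (cmod (riesz ?h t)) \<partial>circle) \<le> 6 * sqrt ?I" .
qed

text \<open>\<open>f\<close> is a combination with weights 1, -1, i, -i of four nonnegative
  functions below |f|, each contributing the constant 6.\<close>

lemma kolmogorov:
  assumes f: "f \<in> bfs \<rho>"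
  shows "integrable circle (\<lambda>t. sqrt (cmod (riesz f t)))"
    and "(\<integral>t. sqrt (cmod (riesz f t)) \<partial>circle) \<le> 24 * sqrt (\<integral>t. cmod (f t) \<partial>circle)"
proof -
  have fm: "f \<in> borel_measurable circle" by (rule bfs_measurable[OF f])
  define v :: "nat \<Rightarrow> complex \<Rightarrow> real" where
    "v i t = (if i = 0 then max 0 (Re (f t)) else if i = 1 then max 0 (- Re (f t))
       else if i = 2 then max 0 (Im (f t)) else max 0 (- Im (f t)))" for i t
  define w :: "nat \<Rightarrow> complex" where "w i = (if i = 0 then 1 else if i = 1 then -1 else if i = 2 then \<i> else -\<i>)" for i
  have w1: "cmod (w i) = 1" for i by (simp add: w_def)
  have vb: "0 \<le> v i t" "v i t \<le> cmod (f t)" for i t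
    using abs_Re_le_cmod[of "f t"] abs_Im_le_cmod[of "f t"] by (auto simp: v_def)
  have vm: "v i \<in> borel_measurable circle" for i
    unfolding v_def using fm by (cases "i = 0"; cases "i = 1"; cases "i = 2"; simp)
  have vX: "(\<lambda>t. of_real (v i t)) \<in> bfs \<rho>" for i
    by (rule bfs_mono[OF f]) (use vm[of i] vb[of i] in auto)
  have fsum: "f = (\<lambda>t. ((w 0 * of_real (v 0 t) + w 1 * of_real (v 1 t)) + w 2 * of_real (v 2 t)) + w 3 * of_real (v 3 t))"
    by (simp add: fun_eq_iff complex_eq_iff v_def w_def max_def)
  have wX: "(\<lambda>t. w i * of_real (v i t)) \<in> bfs \<rho>" for i by (rule bfs_cmult[OF vX])
  let ?R = "\<lambda>i. riesz (\<lambda>t. of_real (v i t))"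
  have rsum: "AE t in circle. riesz f t = w 0 * ?R 0 t + w 1 * ?R 1 t + w 2 * ?R 2 t + w 3 * ?R 3 t"
    using riesz_add[OF bfs_add[OF bfs_add[OF wX[of 0] wX[of 1]] wX[of 2]] wX[of 3], folded fsum]
      riesz_add[OF bfs_add[OF wX[of 0] wX[of 1]] wX[of 2]] riesz_add[OF wX[of 0] wX[of 1]]
      riesz_cmult[OF vX[of 0], of "w 0"] riesz_cmult[OF vX[of 1], of "w 1"]
      riesz_cmult[OF vX[of 2], of "w 2"] riesz_cmult[OF vX[of 3], of "w 3"]
    by eventually_elim simp
  let ?q = "\<lambda>i t. sqrt (cmod (?R i t))"
  have le: "AE t in circle. sqrt (cmod (riesz f t)) \<le> ?q 0 t + ?q 1 t + ?q 2 t + ?q 3 t"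
    using rsum
  proof eventually_elim
    case (elim t)
    have "cmod (riesz f t) \<le> cmod (?R 0 t) + cmod (?R 1 t) + cmod (?R 2 t) + cmod (?R 3 t)"
      unfolding elim by (intro order_trans[OF norm_triangle_ineq] add_mono) (simp_all add: norm_mult w1)
    then have "sqrt (cmod (riesz f t)) \<le> sqrt (cmod (?R 0 t) + cmod (?R 1 t) + cmod (?R 2 t) + cmod (?R 3 t))" by simp
    also have "\<dots> \<le> ?q 0 t + ?q 1 t + ?q 2 t + ?q 3 t"
      by (intro order_trans[OF sqrt_add_le_add_sqrt] add_mono) auto
    finally show ?case .
  qed
  have qi: "integrable circle (?q i)" for i
    by (rule kolmogorov_nonneg(1)[OF vX vb(1)])
  have qb: "(\<integral>t. ?q i t \<partial>circle) \<le> 6 * sqrt (\<integral>t. cmod (f t) \<partial>circle)" for i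
  proof -
    have "integrable circle (v i)" using integrable_Re[OF bfs_integrable[OF vX[of i]]] by simp
    then have le: "(\<integral>t. v i t \<partial>circle) \<le> (\<integral>t. cmod (f t) \<partial>circle)"
      using bfs_integrable[OF f] vb by (intro integral_mono) auto
    have "(\<integral>t. ?q i t \<partial>circle) \<le> 6 * sqrt (\<integral>t. v i t \<partial>circle)"
      by (rule kolmogorov_nonneg(2)[OF vX vb(1)])
    also have "\<dots> \<le> 6 * sqrt (\<integral>t. cmod (f t) \<partial>circle)"
      by (intro mult_left_mono real_sqrt_le_mono le) simp
    finally show ?thesis .
  qed
  have rm: "riesz f \<in> borel_measurable circle" by (rule bfs_measurable[OF riesz_bfs[OF f]])
  have qs: "integrable circle (\<lambda>t. ?q 0 t + ?q 1 t + ?q 2 t + ?q 3 t)"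
    by (intro Bochner_Integration.integrable_add qi)
  show int: "integrable circle (\<lambda>t. sqrt (cmod (riesz f t)))"
    by (rule Bochner_Integration.integrable_bound[OF qs])
       (use rm le in \<open>auto elim!: eventually_mono\<close>)
  have "(\<integral>t. sqrt (cmod (riesz f t)) \<partial>circle) \<le> (\<integral>t. ?q 0 t + ?q 1 t + ?q 2 t + ?q 3 t \<partial>circle)"
    by (rule integral_mono_AE[OF int qs le])
  also have "\<dots> = (\<integral>t. ?q 0 t \<partial>circle) + (\<integral>t. ?q 1 t \<partial>circle) + (\<integral>t. ?q 2 t \<partial>circle) + (\<integral>t. ?q 3 t \<partial>circle)"
    using qi by simp
  also have "\<dots> \<le> 24 * sqrt (\<integral>t. cmod (f t) \<partial>circle)"
    using qb[of 0] qb[of 1] qb[of 2] qb[of 3] by simp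
  finally show "(\<integral>t. sqrt (cmod (riesz f t)) \<partial>circle) \<le> 24 * sqrt (\<integral>t. cmod (f t) \<partial>circle)" .
qed

text \<open>Kolmogorov's inequality makes the projection continuous from L1 to L^(1/2). This
  replaces approximation in the norm of \<open>Y\<close>, where polynomials need not be
  dense.\<close>

lemma riesz_AE_subseq:
  assumes f: "f \<in> bfs \<rho>" and p: "\<And>n. p n \<in> bfs \<rho>" and L: "(\<lambda>n. \<integral>t. cmod (f t - p n t) \<partial>circle) \<longlonglongrightarrow> 0"
  obtains r :: "nat \<Rightarrow> nat" where "strict_mono r" "AE t in circle. (\<lambda>n. riesz (p (r n)) t) \<longlonglongrightarrow> riesz f t"
proof -
  define u where "u n t = sqrt (cmod (riesz (\<lambda>s. f s - p n s) t))" for n t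
  have d: "(\<lambda>s. f s - p n s) \<in> bfs \<rho>" for n by (rule bfs_diff[OF f p])
  have ui: "integrable circle (u n)" for n unfolding u_def by (rule kolmogorov(1)[OF d])
  have "(\<lambda>n. \<integral>t. norm (u n t) \<partial>circle) \<longlonglongrightarrow> 0"
  proof (rule tendsto_sandwich[OF always_eventually always_eventually tendsto_const])
    show "\<forall>n. (\<integral>t. norm (u n t) \<partial>circle) \<le> 24 * sqrt (\<integral>t. cmod (f t - p n t) \<partial>circle)"
      using kolmogorov(2)[OF d] by (simp add: u_def)
    show "(\<lambda>n. 24 * sqrt (\<integral>t. cmod (f t - p n t) \<partial>circle)) \<longlonglongrightarrow> 0"
      using tendsto_mult_right_zero[OF tendsto_real_sqrt[OF L, simplified]] by simp
  qed auto
  then obtain r where r: "strict_mono r" "AE t in circle. (\<lambda>n. u (r n) t) \<longlonglongrightarrow> 0"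
    using tendsto_L1_AE_subseq[of circle u, OF ui] by blast
  have "AE t in circle. \<forall>n. riesz (\<lambda>s. f s - p n s) t = riesz f t - riesz (p n) t"
    unfolding AE_all_countable using riesz_diff[OF f p] by blast
  with r(2) have "AE t in circle. (\<lambda>n. riesz (p (r n)) t) \<longlonglongrightarrow> riesz f t"
  proof eventually_elim
    case (elim t)
    have "(\<lambda>n. (u (r n) t)\<^sup>2) \<longlonglongrightarrow> 0\<^sup>2" by (intro tendsto_intros elim)
    then have "(\<lambda>n. cmod (riesz f t - riesz (p (r n)) t)) \<longlonglongrightarrow> 0"
      using elim(2) by (simp add: u_def)
    then have "(\<lambda>n. riesz f t - riesz (p (r n)) t) \<longlonglongrightarrow> 0" by (rule tendsto_norm_zero_cancel)
    then have "(\<lambda>n. riesz f t - (riesz f t - riesz (p (r n)) t)) \<longlonglongrightarrow> riesz f t - 0"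
      by (intro tendsto_intros)
    then show ?case by simp
  qed
  with r(1) show thesis by (rule that)
qed

section \<open>The projection of bounded functions: L2 contraction and Fourier coefficients\<close>

lemma tendsto_integral_diff_bounded:
  assumes f: "f \<in> borel_measurable circle" "\<And>t. cmod t = 1 \<Longrightarrow> cmod (f t) \<le> B"
    and p: "\<And>n. p n \<in> borel_measurable circle" "\<And>n t. cmod t = 1 \<Longrightarrow> cmod (p n t) \<le> B'"
    and lim: "AE t in circle. (\<lambda>n. p n t) \<longlonglongrightarrow> f t" and k: "0 < (k::nat)"
  shows "(\<lambda>n. \<integral>t. cmod (f t - p n t) ^ k \<partial>circle) \<longlonglongrightarrow> 0"
proof -
  have "(\<lambda>n. \<integral>t. cmod (f t - p n t) ^ k \<partial>circle) \<longlonglongrightarrow> (\<integral>t. 0 \<partial>circle)"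
  proof (rule integral_dominated_convergence[where w="\<lambda>_. (B + B') ^ k"])
    show "AE t in circle. (\<lambda>n. cmod (f t - p n t) ^ k) \<longlonglongrightarrow> 0"
      using lim
    proof eventually_elim
      case (elim t)
      have "cmod (f t - f t) ^ k = 0" using k by simp
      moreover have "(\<lambda>n. cmod (f t - p n t) ^ k) \<longlonglongrightarrow> cmod (f t - f t) ^ k" by (intro tendsto_intros elim)
      ultimately show ?case by (simp only:)
    qed
    show "AE t in circle. norm (cmod (f t - p n t) ^ k) \<le> (B + B') ^ k" for n
    proof (rule AE_circleI)
      fix t :: complex assume t: "cmod t = 1"
      have "cmod (f t - p n t) \<le> B + B'"
        using norm_triangle_ineq4[of "f t" "p n t"] f(2)[OF t] p(2)[OF t, of n] by simp
      then show "norm (cmod (f t - p n t) ^ k) \<le> (B + B') ^ k" by (simp add: power_mono)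
    qed
  qed (use f p in auto)
  then show ?thesis by simp
qed

text \<open>Parseval gives the contraction for trigonometric polynomials; Fatou's lemma transfers it
  along a bounded approximation whose projections converge almost everywhere.\<close>

lemma riesz_L2:
  assumes f: "f \<in> borel_measurable circle" "\<And>t. cmod t = 1 \<Longrightarrow> cmod (f t) \<le> B"
  shows "integrable circle (\<lambda>t. (cmod (riesz f t))\<^sup>2)"
    and "(\<integral>t. (cmod (riesz f t))\<^sup>2 \<partial>circle) \<le> (\<integral>t. (cmod (f t))\<^sup>2 \<partial>circle)"
proof -
  have fX: "f \<in> bfs \<rho>" by (rule bfs_bounded[OF f])
  obtain p where p: "\<And>n. trig_poly (p n)" "\<And>n t. cmod t = 1 \<Longrightarrow> cmod (p n t) \<le> 2 * (B + 1)"
    "AE t in circle. (\<lambda>n. p n t) \<longlonglongrightarrow> f t"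
    using bounded_trig_seq[OF f] by blast
  have pX: "p n \<in> bfs \<rho>" for n by (rule bfs_trig_poly[OF p(1)])
  have pm: "p n \<in> borel_measurable circle" for n by (rule trig_poly_measurable[OF p(1)])
  have L1: "(\<lambda>n. \<integral>t. cmod (f t - p n t) \<partial>circle) \<longlonglongrightarrow> 0"
    using tendsto_integral_diff_bounded[OF f pm p(2,3), of 1] by simp
  obtain r where r: "strict_mono r" "AE t in circle. (\<lambda>n. riesz (p (r n)) t) \<longlonglongrightarrow> riesz f t"
    using riesz_AE_subseq[of f p, OF fX pX L1] by blast
  have rm: "riesz f \<in> borel_measurable circle" by (rule bfs_measurable[OF riesz_bfs[OF fX]])
  have lim2: "(\<lambda>n. \<integral>t. (cmod (p n t))\<^sup>2 \<partial>circle) \<longlonglongrightarrow> (\<integral>t. (cmod (f t))\<^sup>2 \<partial>circle)"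
  proof (rule integral_dominated_convergence[where w="\<lambda>_. (2 * (B + 1))\<^sup>2"])
    show "AE t in circle. (\<lambda>n. (cmod (p n t))\<^sup>2) \<longlonglongrightarrow> (cmod (f t))\<^sup>2"
      using p(3) by eventually_elim (intro tendsto_intros)
    show "AE t in circle. norm ((cmod (p n t))\<^sup>2) \<le> (2 * (B + 1))\<^sup>2" for n
      by (rule AE_circleI) (use p(2) in \<open>auto intro: power_mono\<close>)
  qed (use f pm in auto)
  have "(\<integral>\<^sup>+t. ennreal ((cmod (riesz f t))\<^sup>2) \<partial>circle) \<le> (\<integral>\<^sup>+t. liminf (\<lambda>n. ennreal ((cmod (riesz (p (r n)) t))\<^sup>2)) \<partial>circle)"
  proof (rule nn_integral_mono_AE)
    show "AE t in circle. ennreal ((cmod (riesz f t))\<^sup>2) \<le> liminf (\<lambda>n. ennreal ((cmod (riesz (p (r n)) t))\<^sup>2))"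
      using r(2)
    proof eventually_elim
      case (elim t)
      then have l: "(\<lambda>n. ennreal ((cmod (riesz (p (r n)) t))\<^sup>2)) \<longlonglongrightarrow> ennreal ((cmod (riesz f t))\<^sup>2)"
        by (intro tendsto_intros)
      show ?case by (rule eq_refl, rule lim_imp_Liminf[OF _ l, symmetric]) simp
    qed
  qed
  also have "\<dots> \<le> liminf (\<lambda>n. \<integral>\<^sup>+t. ennreal ((cmod (riesz (p (r n)) t))\<^sup>2) \<partial>circle)"
    by (intro nn_integral_liminf) (use bfs_measurable[OF riesz_bfs[OF pX]] in auto)
  also have "\<dots> \<le> liminf (\<lambda>n. ennreal (\<integral>t. (cmod (p (r n) t))\<^sup>2 \<partial>circle))"
  proof (intro Liminf_mono always_eventually allI)
    fix n
    have tr: "trig_poly (riesz (p (r n)))" by (rule riesz_trig_poly_trig(1)[OF p(1)])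
    have "integrable circle (\<lambda>t. (cmod (riesz (p (r n)) t))\<^sup>2)"
      by (intro integrable_circle_continuous continuous_intros trig_poly_continuous[OF tr])
    then have "(\<integral>\<^sup>+t. ennreal ((cmod (riesz (p (r n)) t))\<^sup>2) \<partial>circle) = ennreal (\<integral>t. (cmod (riesz (p (r n)) t))\<^sup>2 \<partial>circle)"
      by (rule nn_integral_eq_integral) auto
    also have "\<dots> \<le> ennreal (\<integral>t. (cmod (p (r n) t))\<^sup>2 \<partial>circle)"
      by (intro ennreal_leI riesz_trig_poly_L2 p)
    finally show "(\<integral>\<^sup>+t. ennreal ((cmod (riesz (p (r n)) t))\<^sup>2) \<partial>circle) \<le> ennreal (\<integral>t. (cmod (p (r n) t))\<^sup>2 \<partial>circle)" .
  qed
  also have "\<dots> = ennreal (\<integral>t. (cmod (f t))\<^sup>2 \<partial>circle)"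
  proof (rule lim_imp_Liminf)
    show "(\<lambda>n. ennreal (\<integral>t. (cmod (p (r n) t))\<^sup>2 \<partial>circle)) \<longlonglongrightarrow> ennreal (\<integral>t. (cmod (f t))\<^sup>2 \<partial>circle)"
      using LIMSEQ_subseq_LIMSEQ[OF lim2 r(1)] by (intro tendsto_intros) (simp add: o_def)
  qed simp
  finally have nn: "(\<integral>\<^sup>+t. ennreal ((cmod (riesz f t))\<^sup>2) \<partial>circle) \<le> ennreal (\<integral>t. (cmod (f t))\<^sup>2 \<partial>circle)" .
  show int: "integrable circle (\<lambda>t. (cmod (riesz f t))\<^sup>2)"
    using rm nn by (intro integrableI_bounded) (auto intro: le_less_trans)
  show "(\<integral>t. (cmod (riesz f t))\<^sup>2 \<partial>circle) \<le> (\<integral>t. (cmod (f t))\<^sup>2 \<partial>circle)"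
    using nn by (subst (asm) nn_integral_eq_integral[OF int]) auto
qed

text \<open>Bounded convergence almost everywhere is convergence in L2, where the projection
  contracts, and on a probability space the L2 norm controls the L1 norm.\<close>

lemma riesz_L1_convergence:
  assumes f: "f \<in> borel_measurable circle" "\<And>t. cmod t = 1 \<Longrightarrow> cmod (f t) \<le> B"
    and p: "\<And>n. p n \<in> borel_measurable circle" "\<And>n t. cmod t = 1 \<Longrightarrow> cmod (p n t) \<le> B'"
    and lim: "AE t in circle. (\<lambda>n. p n t) \<longlonglongrightarrow> f t"
  shows "(\<lambda>n. \<integral>t. cmod (riesz f t - riesz (p n) t) \<partial>circle) \<longlonglongrightarrow> 0"
proof (rule tendsto_sandwich[OF always_eventually always_eventually tendsto_const])
  have fX: "f \<in> bfs \<rho>" by (rule bfs_bounded[OF f])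
  have pX: "p n \<in> bfs \<rho>" for n by (rule bfs_bounded[OF p])
  show "\<forall>n. (\<integral>t. cmod (riesz f t - riesz (p n) t) \<partial>circle) \<le> sqrt (\<integral>t. (cmod (f t - p n t))\<^sup>2 \<partial>circle)"
  proof
    fix n
    let ?d = "\<lambda>s. f s - p n s"
    have dm: "?d \<in> borel_measurable circle" using f(1) p(1)[of n] by simp
    have db: "cmod (?d t) \<le> B + B'" if "cmod t = 1" for t
      using norm_triangle_ineq4[of "f t" "p n t"] f(2)[OF that] p(2)[OF that, of n] by simp
    have dX: "?d \<in> bfs \<rho>" by (rule bfs_diff[OF fX pX])
    have "(\<integral>t. cmod (riesz f t - riesz (p n) t) \<partial>circle) = (\<integral>t. cmod (riesz ?d t) \<partial>circle)"
      using riesz_diff[OF fX pX[of n]] bfs_measurable[OF riesz_bfs[OF fX]] bfs_measurable[OF riesz_bfs[OF pX[of n]]]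
        bfs_measurable[OF riesz_bfs[OF dX]]
      by (intro integral_cong_AE) (auto elim!: eventually_mono)
    also have "\<dots> \<le> sqrt (\<integral>t. (cmod (riesz ?d t))\<^sup>2 \<partial>circle)"
      by (rule integral_square_le(2)[OF riesz_L2(1)[OF dm db] bfs_measurable[OF riesz_bfs[OF dX]]])
    also have "\<dots> \<le> sqrt (\<integral>t. (cmod (?d t))\<^sup>2 \<partial>circle)"
      by (intro real_sqrt_le_mono riesz_L2(2)[OF dm db])
    finally show "(\<integral>t. cmod (riesz f t - riesz (p n) t) \<partial>circle) \<le> sqrt (\<integral>t. (cmod (?d t))\<^sup>2 \<partial>circle)" .
  qed
  show "(\<lambda>n. sqrt (\<integral>t. (cmod (f t - p n t))\<^sup>2 \<partial>circle)) \<longlonglongrightarrow> 0"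
    using tendsto_real_sqrt[OF tendsto_integral_diff_bounded[OF f p lim, of 2]] by simp
qed auto

lemma fourier_riesz_bounded:
  assumes f: "f \<in> borel_measurable circle" "\<And>t. cmod t = 1 \<Longrightarrow> cmod (f t) \<le> B"
  shows "fourier_coeff (riesz f) n = (if 0 \<le> n then fourier_coeff f n else 0)"
proof -
  have fX: "f \<in> bfs \<rho>" by (rule bfs_bounded[OF f])
  obtain p where p: "\<And>n. trig_poly (p n)" "\<And>n t. cmod t = 1 \<Longrightarrow> cmod (p n t) \<le> 2 * (B + 1)"
    "AE t in circle. (\<lambda>n. p n t) \<longlonglongrightarrow> f t"
    using bounded_trig_seq[OF f] by blast
  have pX: "p n \<in> bfs \<rho>" for n by (rule bfs_trig_poly[OF p(1)])
  have pm: "p n \<in> borel_measurable circle" for n by (rule trig_poly_measurable[OF p(1)])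
  have conv: "(\<lambda>m. fourier_coeff (q m) n) \<longlonglongrightarrow> fourier_coeff g n"
    if "integrable circle g" "\<And>m. integrable circle (q m)" "(\<lambda>m. \<integral>t. cmod (g t - q m t) \<partial>circle) \<longlonglongrightarrow> 0" for g q
  proof -
    have "(\<lambda>m. fourier_coeff g n - fourier_coeff (q m) n) \<longlonglongrightarrow> 0"
      by (rule Lim_null_comparison[OF always_eventually that(3)])
         (use fourier_coeff_norm_diff[OF that(1,2)] in auto)
    then have "(\<lambda>m. fourier_coeff g n - (fourier_coeff g n - fourier_coeff (q m) n)) \<longlonglongrightarrow> fourier_coeff g n - 0"
      by (intro tendsto_intros)
    then show ?thesis by simp
  qed
  have 1: "(\<lambda>m. fourier_coeff (p m) n) \<longlonglongrightarrow> fourier_coeff f n"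
    using tendsto_integral_diff_bounded[OF f pm p(2,3), of 1] by (intro conv bfs_integrable fX pX) simp
  have 2: "(\<lambda>m. fourier_coeff (riesz (p m)) n) \<longlonglongrightarrow> fourier_coeff (riesz f) n"
    by (intro conv bfs_integrable riesz_bfs fX pX riesz_L1_convergence[OF f pm p(2,3)])
  show ?thesis
  proof (cases "0 \<le> n")
    case True
    then show ?thesis using LIMSEQ_unique[OF 1] 2 riesz_trig_poly_trig(2)[OF p(1)] by simp
  next
    case False
    then show ?thesis using 2 riesz_trig_poly_trig(2)[OF p(1)] by (simp add: LIMSEQ_const_iff)
  qed
qed

end

section \<open>Uniform integrability and extraction of limits\<close>

lemma mult_ln_mono: "1 \<le> x \<Longrightarrow> x \<le> y \<Longrightarrow> x * ln x \<le> y * ln (y::real)"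
  by (intro mult_mono) auto

text \<open>Quantitative strict convexity of sqrt (1 + |z|^2). With a, b the values at x, y and s
  twice the value at the midpoint, the parallelogram law gives (a + b)^2 - s^2 = |x - y|^2 - (a -
  b)^2. The last square is absorbed because |a - b| (a + b) <= |x - y| (|x| + |y|) and (a + b)^2 -
  (|x| + |y|)^2 >= 4. The convexity degenerates at infinity, hence the dependence on K.\<close>

lemma midpoint_deficiency:
  fixes x y :: complex
  assumes K: "0 \<le> K" "cmod x \<le> K" "cmod y \<le> K"
  shows "(cmod (x - y))\<^sup>2 \<le> 4 * (1 + K) ^ 3 * (sqrt (1 + (cmod x)\<^sup>2) + sqrt (1 + (cmod y)\<^sup>2) - 2 * sqrt (1 + (cmod ((x + y) / 2))\<^sup>2))"
    and "0 \<le> sqrt (1 + (cmod x)\<^sup>2) + sqrt (1 + (cmod y)\<^sup>2) - 2 * sqrt (1 + (cmod ((x + y) / 2))\<^sup>2)"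
proof -
  define X Y D where "X = cmod x" and "Y = cmod y" and "D = cmod (x - y)"
  define a b s where "a = sqrt (1 + X\<^sup>2)" and "b = sqrt (1 + Y\<^sup>2)" and "s = sqrt (4 + (cmod (x + y))\<^sup>2)"
  have XY: "0 \<le> X" "0 \<le> Y" "0 \<le> D" "X \<le> K" "Y \<le> K" using K by (auto simp: X_def Y_def D_def)
  have sq: "a\<^sup>2 = 1 + X\<^sup>2" "b\<^sup>2 = 1 + Y\<^sup>2" "s\<^sup>2 = 4 + (cmod (x + y))\<^sup>2"
    by (auto simp: a_def b_def s_def)
  have a1: "1 \<le> a" "1 \<le> b" "0 \<le> s" by (auto simp: a_def b_def s_def)
  have par: "(cmod (x + y))\<^sup>2 = 2 * X\<^sup>2 + 2 * Y\<^sup>2 - D\<^sup>2"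
    unfolding X_def Y_def D_def cmod_power2 by (simp add: power2_eq_square algebra_simps)
  have DXY: "\<bar>X - Y\<bar> \<le> D" unfolding X_def Y_def D_def by (rule norm_triangle_ineq3)
  have e1: "(a + b)\<^sup>2 - s\<^sup>2 = D\<^sup>2 - (a - b)\<^sup>2"
    unfolding power2_sum power2_diff sq par by (simp add: sq algebra_simps)
  have "((a - b) * (a + b))\<^sup>2 = ((X - Y) * (X + Y))\<^sup>2"
  proof -
    have "(a - b) * (a + b) = (X - Y) * (X + Y)"
      using sq by (simp add: power2_eq_square algebra_simps)
    then show ?thesis by simp
  qed
  also have "\<dots> = (X - Y)\<^sup>2 * (X + Y)\<^sup>2" by (rule power_mult_distrib)
  also have "\<dots> \<le> D\<^sup>2 * (X + Y)\<^sup>2"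
    using DXY XY by (intro mult_right_mono) (auto simp: power2_le_iff_abs_le)
  finally have e2: "(a - b)\<^sup>2 * (a + b)\<^sup>2 \<le> D\<^sup>2 * (X + Y)\<^sup>2" by (simp only: power_mult_distrib)
  have ab: "1 + X * Y \<le> a * b"
  proof (rule power2_le_imp_le)
    have "0 \<le> (X - Y)\<^sup>2" by simp
    then have "(1 + X * Y)\<^sup>2 \<le> (1 + X\<^sup>2) * (1 + Y\<^sup>2)"
      by (simp add: power2_eq_square algebra_simps)
    then show "(1 + X * Y)\<^sup>2 \<le> (a * b)\<^sup>2" by (simp only: power_mult_distrib sq)
  qed (use a1 in simp)
  have e3: "4 \<le> (a + b)\<^sup>2 - (X + Y)\<^sup>2"
    unfolding power2_sum sq using ab by simp
  have "4 * D\<^sup>2 \<le> D\<^sup>2 * ((a + b)\<^sup>2 - (X + Y)\<^sup>2)"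
    using mult_left_mono[OF e3, of "D\<^sup>2"] by (simp add: mult.commute)
  also have "\<dots> \<le> (a + b)\<^sup>2 * (D\<^sup>2 - (a - b)\<^sup>2)"
    using e2 by (simp add: algebra_simps)
  finally have e4: "4 * D\<^sup>2 \<le> (a + b)\<^sup>2 * ((a + b)\<^sup>2 - s\<^sup>2)" unfolding e1 .
  have sle: "s \<le> a + b"
  proof (rule power2_le_imp_le)
    have "0 \<le> (a + b)\<^sup>2 * ((a + b)\<^sup>2 - s\<^sup>2)" using e4 by (rule order_trans[rotated]) simp
    moreover have "0 < (a + b)\<^sup>2" using a1 by simp
    ultimately have "0 \<le> (a + b)\<^sup>2 - s\<^sup>2" by (simp add: zero_le_mult_iff)
    then show "s\<^sup>2 \<le> (a + b)\<^sup>2" by simp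
  qed (use a1 in simp)
  have "(a + b)\<^sup>2 - s\<^sup>2 = (a + b - s) * (a + b + s)" by (simp add: power2_eq_square algebra_simps)
  also have "\<dots> \<le> (a + b - s) * (2 * (a + b))" using sle by (intro mult_left_mono) auto
  finally have "4 * D\<^sup>2 \<le> (a + b)\<^sup>2 * ((a + b - s) * (2 * (a + b)))"
    using e4 by (meson mult_left_mono order_trans zero_le_power2)
  then have e5: "2 * D\<^sup>2 \<le> (a + b) ^ 3 * (a + b - s)"
    by (simp add: power2_eq_square power3_eq_cube algebra_simps)
  have "a \<le> 1 + K" "b \<le> 1 + K"
  proof -
    have *: "sqrt (1 + Z\<^sup>2) \<le> 1 + K" if "0 \<le> Z" "Z \<le> K" for Z
    proof (rule real_le_lsqrt)
      have "Z\<^sup>2 \<le> K\<^sup>2" using that by (intro power_mono)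
      then show "1 + Z\<^sup>2 \<le> (1 + K)\<^sup>2" using K(1) by (simp add: power2_sum)
    qed (use K in auto)
    show "a \<le> 1 + K" "b \<le> 1 + K" unfolding a_def b_def using XY by (auto intro: *)
  qed
  then have "(a + b) ^ 3 \<le> (2 * (1 + K)) ^ 3" using a1 by (intro power_mono) auto
  also have "\<dots> = 8 * (1 + K) ^ 3" by (simp only: power_mult_distrib) simp
  finally have "(a + b) ^ 3 * (a + b - s) \<le> 8 * (1 + K) ^ 3 * (a + b - s)"
    using sle by (intro mult_right_mono) auto
  with e5 have fin: "D\<^sup>2 \<le> 4 * (1 + K) ^ 3 * (a + b - s)" by simp
  have "s = sqrt (2\<^sup>2 * (1 + (cmod ((x + y) / 2))\<^sup>2))"
    unfolding s_def by (simp add: norm_divide power_divide)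
  then have s2: "s = 2 * sqrt (1 + (cmod ((x + y) / 2))\<^sup>2)"
    by (simp only: real_sqrt_mult real_sqrt_abs)
  show "(cmod (x - y))\<^sup>2 \<le> 4 * (1 + K) ^ 3 * (sqrt (1 + (cmod x)\<^sup>2) + sqrt (1 + (cmod y)\<^sup>2) - 2 * sqrt (1 + (cmod ((x + y) / 2))\<^sup>2))"
    using fin unfolding s2 a_def b_def D_def X_def Y_def .
  show "0 \<le> sqrt (1 + (cmod x)\<^sup>2) + sqrt (1 + (cmod y)\<^sup>2) - 2 * sqrt (1 + (cmod ((x + y) / 2))\<^sup>2)"
    using sle unfolding s2 a_def b_def X_def Y_def by simp
qed

section \<open>From the L log L bound to uniform integrability and limits\<close>

context riesz_bounded
begin

text \<open>Adding 1 meets the lower bound in the polynomial estimate, which the approximating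
  polynomials keep exactly. Boundedness lets every term pass to the limit: the logarithmic integral
  by domination, the projection by its L1 continuity along bounded sequences.\<close>

lemma log_bound_bounded:
  fixes g :: "complex \<Rightarrow> real"
  assumes g: "g \<in> borel_measurable circle" "\<And>t. cmod t = 1 \<Longrightarrow> 0 \<le> g t \<and> g t \<le> B"
  defines "c \<equiv> (\<integral>t. 1 + g t \<partial>circle)"
  shows "(\<integral>t. (1 + g t) * ln (1 + g t) \<partial>circle)
    \<le> c * ln c + pi / 2 * (\<integral>t. cmod (2 * riesz (\<lambda>t. of_real (1 + g t)) t - of_real c) \<partial>circle)"
proof -
  define f where "f t = 1 + g t" for t
  have fm: "f \<in> borel_measurable circle" unfolding f_def using g(1) by simp
  have fb: "1 \<le> f t \<and> f t \<le> 1 + B" if "cmod t = 1" for t using g(2)[OF that] by (simp add: f_def)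
  obtain p :: "nat \<Rightarrow> complex \<Rightarrow> real" where p: "\<And>n. trig_poly (\<lambda>t. of_real (p n t))"
    "\<And>n t. cmod t = 1 \<Longrightarrow> 1 < p n t \<and> p n t < 1 + B + 1" "AE t in circle. (\<lambda>n. p n t) \<longlonglongrightarrow> f t"
    using bounded_trig_seq_real[OF fm fb] by blast
  let ?F = "\<lambda>t. complex_of_real (f t)" and ?P = "\<lambda>n t. complex_of_real (p n t)"
  have Fm: "?F \<in> borel_measurable circle" using fm by simp
  have Fb: "cmod (?F t) \<le> 1 + B" if "cmod t = 1" for t using fb[OF that] by simp
  have Pm: "?P n \<in> borel_measurable circle" for n by (rule trig_poly_measurable[OF p(1)])
  have Pb: "cmod (?P n t) \<le> 2 + B" if "cmod t = 1" for n t using p(2)[OF that, of n] by simp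
  have Plim: "AE t in circle. (\<lambda>n. ?P n t) \<longlonglongrightarrow> ?F t"
    using p(3) by eventually_elim (intro tendsto_intros)
  have pm: "p n \<in> borel_measurable circle" for n
    using measurable_compose[OF Pm borel_measurable_Re] by simp
  have FX: "?F \<in> bfs \<rho>" by (rule bfs_bounded[OF Fm Fb])
  have PX: "?P n \<in> bfs \<rho>" for n by (rule bfs_trig_poly[OF p(1)])
  define cn where "cn n = (\<integral>t. p n t \<partial>circle)" for n
  have cc: "c = (\<integral>t. f t \<partial>circle)" unfolding c_def f_def ..
  have cn_lim: "cn \<longlonglongrightarrow> c"
    unfolding cn_def cc
  proof (rule integral_dominated_convergence[where w="\<lambda>_. 2 + B"])
    show "AE t in circle. norm (p n t) \<le> 2 + B" for n using Pb by (intro AE_circleI) simp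
  qed (use fm pm p(3) in auto)
  have c1: "1 \<le> c"
  proof -
    have "(\<integral>t. 1 \<partial>circle) \<le> (\<integral>t. f t \<partial>circle)"
      by (intro integral_mono integrable_circle_between[OF fm fb]) (auto simp: space_circle fb)
    then show ?thesis by (simp add: cc)
  qed
  have rF: "integrable circle (riesz ?F)" by (rule bfs_integrable[OF riesz_bfs[OF FX]])
  have rP: "integrable circle (riesz (?P n))" for n by (rule bfs_integrable[OF riesz_bfs[OF PX]])
  let ?d = "\<lambda>n. \<integral>t. cmod (riesz ?F t - riesz (?P n) t) \<partial>circle"
  have d0: "?d \<longlonglongrightarrow> 0"
    by (rule riesz_L1_convergence[OF Fm Fb Pm Pb Plim])
  have lhs: "(\<lambda>n. \<integral>t. p n t * ln (p n t) \<partial>circle) \<longlonglongrightarrow> (\<integral>t. f t * ln (f t) \<partial>circle)"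
  proof (rule integral_dominated_convergence[where w="\<lambda>_. (2 + B) * ln (2 + B)"])
    show "AE t in circle. (\<lambda>n. p n t * ln (p n t)) \<longlonglongrightarrow> f t * ln (f t)"
      using p(3) AE_space
    proof eventually_elim
      case (elim t)
      then have "f t \<noteq> 0" using fb[of t] by (auto simp: space_circle)
      with elim show ?case by (intro tendsto_intros)
    qed
    show "AE t in circle. norm (p n t * ln (p n t)) \<le> (2 + B) * ln (2 + B)" for n
    proof (rule AE_circleI)
      fix t :: complex assume "cmod t = 1"
      then have t: "1 \<le> p n t" "p n t \<le> 2 + B" using p(2)[of t n] by auto
      then have "p n t * ln (p n t) \<le> (2 + B) * ln (2 + B)" by (rule mult_ln_mono)
      moreover have "0 \<le> p n t * ln (p n t)" using t by simp
      ultimately show "norm (p n t * ln (p n t)) \<le> (2 + B) * ln (2 + B)" by simp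
    qed
  qed (use fm pm in auto)
  let ?R = "\<integral>t. cmod (2 * riesz ?F t - of_real c) \<partial>circle"
  have le: "(\<integral>t. p n t * ln (p n t) \<partial>circle) \<le> cn n * ln (cn n) + pi / 2 * (?R + 2 * ?d n + \<bar>cn n - c\<bar>)" for n
  proof -
    have "(\<integral>t. p n t * ln (p n t) \<partial>circle) \<le> cn n * ln (cn n) + pi / 2 * (\<integral>t. cmod (2 * riesz (?P n) t - of_real (cn n)) \<partial>circle)"
      unfolding cn_def by (rule trig_poly_log_bound[OF p(1)]) (use p(2) less_imp_le in blast)
    also have "(\<integral>t. cmod (2 * riesz (?P n) t - of_real (cn n)) \<partial>circle)
        \<le> (\<integral>t. cmod (2 * riesz ?F t - of_real c) + 2 * cmod (riesz ?F t - riesz (?P n) t) + \<bar>cn n - c\<bar> \<partial>circle)"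
    proof (rule integral_mono)
      fix t
      have "2 * riesz (?P n) t - of_real (cn n) = (2 * riesz ?F t - of_real c) - 2 * (riesz ?F t - riesz (?P n) t) - of_real (cn n - c)"
        by (simp add: algebra_simps)
      also have "cmod \<dots> \<le> cmod (2 * riesz ?F t - of_real c) + cmod (2 * (riesz ?F t - riesz (?P n) t)) + cmod (of_real (cn n - c))"
        by (intro order_trans[OF norm_triangle_ineq4] add_mono order_refl)
      finally show "cmod (2 * riesz (?P n) t - of_real (cn n))
          \<le> cmod (2 * riesz ?F t - of_real c) + 2 * cmod (riesz ?F t - riesz (?P n) t) + \<bar>cn n - c\<bar>"
        by (simp only: norm_mult norm_of_real) simp
    qed (use rF rP in auto)
    also have "\<dots> = ?R + 2 * ?d n + \<bar>cn n - c\<bar>" using rF rP[of n] by simp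
    finally show ?thesis by simp
  qed
  have "(\<lambda>n. cn n * ln (cn n) + pi / 2 * (?R + 2 * ?d n + \<bar>cn n - c\<bar>)) \<longlonglongrightarrow> c * ln c + pi / 2 * (?R + 2 * 0 + \<bar>c - c\<bar>)"
    using c1 by (intro tendsto_intros cn_lim d0) auto
  then have "(\<integral>t. f t * ln (f t) \<partial>circle) \<le> c * ln c + pi / 2 * (?R + 2 * 0 + \<bar>c - c\<bar>)"
    by (rule LIMSEQ_le[OF lhs]) (use le in auto)
  then show ?thesis unfolding f_def by simp
qed

text \<open>The estimate for bounded functions is applied to truncations of |g|. By the lattice
  property their norms are at most that of \<open>g\<close>, so the bound does not depend on the
  truncation, and Fatou's lemma removes it.\<close>

lemma L_log_L:
  assumes M: "M < \<infinity>"
  obtains B where "0 \<le> B" "\<And>g. g \<in> bfs \<rho> \<Longrightarrow> N g \<le> M \<Longrightarrow> (\<integral>\<^sup>+t. ennreal ((1 + cmod (g t)) * ln (1 + cmod (g t))) \<partial>circle) \<le> ennreal B"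
proof -
  obtain C where C: "0 < C" "\<And>f. f \<in> bfs \<rho> \<Longrightarrow> ennreal (\<integral>t. cmod (f t) \<partial>circle) \<le> ennreal C * N f"
    by (rule bfs_L1) (rule that)
  obtain P where P: "0 \<le> P" "\<And>f. f \<in> bfs \<rho> \<Longrightarrow> N (riesz f) \<le> ennreal P * N f"
    by (rule riesz_bound) (rule that)
  have "N (\<lambda>_. 1) + M < \<infinity>" using M N_one by simp
  then obtain m where m: "N (\<lambda>_. 1) + M = ennreal m" "0 \<le> m"
    by (cases "N (\<lambda>_. 1) + M") auto
  \<comment> \<open>Here m bounds the norm of 1 + u. The mean c is at most C m and c ln c <= c^2;
    the integral of |2 riesz F - c| is at most twice C P m, plus c.\<close>
  define B where "B = (C * m)\<^sup>2 + pi / 2 * (2 * (C * (P * m)) + C * m)"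
  have B0: "0 \<le> B" using C P m by (auto simp: B_def intro!: add_nonneg_nonneg mult_nonneg_nonneg)
  have bdd: "(\<integral>\<^sup>+t. ennreal ((1 + u t) * ln (1 + u t)) \<partial>circle) \<le> ennreal B"
    if um: "u \<in> borel_measurable circle" and ub: "\<And>t. cmod t = 1 \<Longrightarrow> 0 \<le> u t \<and> u t \<le> b" and uN: "N (\<lambda>t. of_real (u t)) \<le> M"
    for u :: "complex \<Rightarrow> real" and b
  proof -
    let ?F = "\<lambda>t. complex_of_real (1 + u t)"
    have Fm: "?F \<in> borel_measurable circle" using um by simp
    have nF: "cmod (?F t) = 1 + u t" if "cmod t = 1" for t
      using ub[OF that] unfolding norm_of_real by simp
    have FX: "?F \<in> bfs \<rho>" 
    proof (rule bfs_bounded[OF Fm, where B="1+b"])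
      show "cmod (?F t) \<le> 1 + b" if "cmod t = 1" for t
        unfolding nF[OF that] using ub[OF that] by simp
    qed
    have FN: "N ?F \<le> ennreal m"
    proof -
      have "N (\<lambda>t. 1 + of_real (u t)) \<le> N (\<lambda>_. 1) + N (\<lambda>t. of_real (u t))"
        using um by (intro N_add) auto
      also have "\<dots> \<le> N (\<lambda>_. 1) + M" by (intro add_left_mono uN)
      finally show ?thesis using m(1) by simp
    qed
    define c where "c = (\<integral>t. 1 + u t \<partial>circle)"
    have cF: "c = (\<integral>t. cmod (?F t) \<partial>circle)"
      unfolding c_def by (intro Bochner_Integration.integral_cong refl) (simp only: space_circle mem_sphere_0 nF)
    have "ennreal c \<le> ennreal C * N ?F" unfolding cF by (rule C(2)[OF FX])
    also have "\<dots> \<le> ennreal C * ennreal m" by (intro mult_left_mono FN) simp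
    finally have cm: "c \<le> C * m" using C m by (simp add: ennreal_mult[symmetric])
    have ui: "integrable circle (\<lambda>t. 1 + u t)" using integrable_circle_between[OF um ub] by simp
    have c1: "1 \<le> c"
    proof -
      have "(\<integral>t. 1 \<partial>circle) \<le> c" unfolding c_def by (intro integral_mono ui) (auto simp: space_circle ub)
      then show ?thesis by simp
    qed
    have "ennreal (\<integral>t. cmod (riesz ?F t) \<partial>circle) \<le> ennreal C * N (riesz ?F)" by (rule C(2)[OF riesz_bfs[OF FX]])
    also have "\<dots> \<le> ennreal C * (ennreal P * ennreal m)"
      by (intro mult_left_mono order_trans[OF P(2)[OF FX]] FN) auto
    finally have rm: "(\<integral>t. cmod (riesz ?F t) \<partial>circle) \<le> C * (P * m)"
      using C P m by (simp add: ennreal_mult[symmetric])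
    have rint: "integrable circle (riesz ?F)" by (rule bfs_integrable[OF riesz_bfs[OF FX]])
    have "(\<integral>t. (1 + u t) * ln (1 + u t) \<partial>circle) \<le> c * ln c + pi / 2 * (\<integral>t. cmod (2 * riesz ?F t - of_real c) \<partial>circle)"
      unfolding c_def by (rule log_bound_bounded[OF um ub])
    also have "(\<integral>t. cmod (2 * riesz ?F t - of_real c) \<partial>circle) \<le> (\<integral>t. 2 * cmod (riesz ?F t) + c \<partial>circle)"
    proof (rule integral_mono)
      fix t
      have "cmod (2 * riesz ?F t - of_real c) \<le> cmod (2 * riesz ?F t) + cmod (of_real c)" by (rule norm_triangle_ineq4)
      then show "cmod (2 * riesz ?F t - of_real c) \<le> 2 * cmod (riesz ?F t) + c"
        using c1 by (simp only: norm_mult norm_of_real) simp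
    qed (use rint in auto)
    also have "\<dots> = 2 * (\<integral>t. cmod (riesz ?F t) \<partial>circle) + c" using rint by simp
    also have "c * ln c + pi / 2 * (2 * (\<integral>t. cmod (riesz ?F t) \<partial>circle) + c) \<le> B"
    proof -
      have "c * ln c \<le> c * c" using c1 ln_le_minus_one[of c] by (intro mult_left_mono) auto
      also have "\<dots> \<le> (C * m)\<^sup>2" using cm c1 by (simp add: power2_eq_square mult_mono)
      finally show ?thesis unfolding B_def using cm rm by (intro add_mono mult_left_mono) auto
    qed
    finally have le: "(\<integral>t. (1 + u t) * ln (1 + u t) \<partial>circle) \<le> B" by simp
    have "integrable circle (\<lambda>t. (1 + u t) * ln (1 + u t))"
    proof (rule integrable_circle_between[where a=0 and b="(1 + b) * ln (1 + b)"])
      show "0 \<le> (1 + u t) * ln (1 + u t) \<and> (1 + u t) * ln (1 + u t) \<le> (1 + b) * ln (1 + b)" if "cmod t = 1" for t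
        using ub[OF that] by (auto intro!: mult_ln_mono)
    qed (use um in auto)
    then have "(\<integral>\<^sup>+t. ennreal ((1 + u t) * ln (1 + u t)) \<partial>circle) = ennreal (\<integral>t. (1 + u t) * ln (1 + u t) \<partial>circle)"
      using ub by (intro nn_integral_eq_integral AE_circleI) auto
    then show ?thesis using le by (simp add: ennreal_leI)
  qed
  have "(\<integral>\<^sup>+t. ennreal ((1 + cmod (g t)) * ln (1 + cmod (g t))) \<partial>circle) \<le> ennreal B"
    if g: "g \<in> bfs \<rho>" and gN: "N g \<le> M" for g
  proof -
    have gm: "g \<in> borel_measurable circle" by (rule bfs_measurable[OF g])
    define u where "u n t = min (cmod (g t)) (real n)" for n t
    have um: "u n \<in> borel_measurable circle" for n unfolding u_def using gm by simp
    define \<phi> where "\<phi> x = ennreal ((1 + x) * ln (1 + x))" for x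
    have "\<phi> (cmod (g t)) = liminf (\<lambda>n. \<phi> (u n t))" for t
    proof -
      obtain n0 where "cmod (g t) \<le> real n0" using real_arch_simple by blast
      then have "\<phi> (u n t) = \<phi> (cmod (g t))" if "n \<ge> n0" for n
        using that by (simp add: u_def min_def)
      then have "(\<lambda>n. \<phi> (u n t)) \<longlonglongrightarrow> \<phi> (cmod (g t))"
        by (intro tendsto_eventually) (auto simp: eventually_sequentially)
      then show ?thesis by (intro lim_imp_Liminf[symmetric]) auto
    qed
    then have "(\<integral>\<^sup>+t. \<phi> (cmod (g t)) \<partial>circle) = (\<integral>\<^sup>+t. liminf (\<lambda>n. \<phi> (u n t)) \<partial>circle)" by simp
    also have "\<dots> \<le> liminf (\<lambda>n. \<integral>\<^sup>+t. \<phi> (u n t) \<partial>circle)"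
      unfolding \<phi>_def using um by (intro nn_integral_liminf) auto
    also have "\<dots> \<le> liminf (\<lambda>n. ennreal B)"
    proof (intro Liminf_mono always_eventually allI)
      fix n
      have "N (\<lambda>t. of_real (u n t)) \<le> N g"
        using gm um[of n] by (intro N_mono AE_circleI) (auto simp: u_def)
      then show "(\<integral>\<^sup>+t. \<phi> (u n t) \<partial>circle) \<le> ennreal B"
        unfolding \<phi>_def by (intro bdd[OF um, of n "real n"]) (use gN in \<open>auto simp: u_def\<close>)
    qed
    also have "\<dots> = ennreal B" by (simp add: Liminf_const)
    finally show ?thesis unfolding \<phi>_def .
  qed
  with B0 show thesis by (rule that)
qed

lemma uniformly_integrable:
  assumes M: "M < \<infinity>" and e: "0 < e"
  obtains K where "0 < K" "\<And>g. g \<in> bfs \<rho> \<Longrightarrow> N g \<le> M \<Longrightarrow> (\<integral>t. (if K < cmod (g t) then cmod (g t) else 0) \<partial>circle) \<le> e"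
proof -
  obtain B where B: "0 \<le> B" "\<And>g. g \<in> bfs \<rho> \<Longrightarrow> N g \<le> M \<Longrightarrow> (\<integral>\<^sup>+t. ennreal ((1 + cmod (g t)) * ln (1 + cmod (g t))) \<partial>circle) \<le> ennreal B"
    by (rule L_log_L[OF M]) (rule that)
  \<comment> \<open>Chosen so that ln K = B / e: where |g| exceeds K, the integrand of the L log L
    bound is at least (B / e) |g|.\<close>
  define K where "K = exp (B / e)"
  have K: "0 < K" by (simp add: K_def)
  have "(\<integral>t. (if K < cmod (g t) then cmod (g t) else 0) \<partial>circle) \<le> e" if g: "g \<in> bfs \<rho>" and gN: "N g \<le> M" for g
  \<comment> \<open>The argument ends with a division by B; for B = 0 the bound forces
    \<open>g\<close> to vanish almost everywhere.\<close>
  proof (cases "B = 0")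
    case B0: True
    have gm: "g \<in> borel_measurable circle" by (rule bfs_measurable[OF g])
    have "(\<integral>\<^sup>+t. ennreal ((1 + cmod (g t)) * ln (1 + cmod (g t))) \<partial>circle) = 0" using B(2)[OF g gN] B0 by simp
    then have "AE t in circle. ennreal ((1 + cmod (g t)) * ln (1 + cmod (g t))) = 0"
      using gm by (subst (asm) nn_integral_0_iff_AE) auto
    then have "AE t in circle. (if K < cmod (g t) then cmod (g t) else 0) = 0"
    proof eventually_elim
      case (elim t)
      have "(1 + cmod (g t)) * ln (1 + cmod (g t)) \<le> 0" using elim by (simp add: ennreal_eq_0_iff)
      moreover have "0 < 1 + cmod (g t)" by (simp add: add_pos_nonneg)
      ultimately have "ln (1 + cmod (g t)) \<le> 0" by (simp add: mult_le_0_iff)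
      then have "1 + cmod (g t) \<le> 1" using \<open>0 < 1 + cmod (g t)\<close> by simp
      then show ?case by simp
    qed
    then have "(\<integral>t. (if K < cmod (g t) then cmod (g t) else 0) \<partial>circle) = 0"
      by (rule integral_eq_zero_AE)
    then show ?thesis using e by simp
  next
    case False
    then have Bp: "0 < B" using B by simp
    have gm: "g \<in> borel_measurable circle" by (rule bfs_measurable[OF g])
    let ?h = "\<lambda>t. if K < cmod (g t) then cmod (g t) else 0"
    have hm: "?h \<in> borel_measurable circle" using gm by simp
    have "(\<integral>\<^sup>+t. ennreal (B / e) * ennreal (?h t) \<partial>circle) \<le> (\<integral>\<^sup>+t. ennreal ((1 + cmod (g t)) * ln (1 + cmod (g t))) \<partial>circle)"
    proof (intro nn_integral_mono)
      fix t
      show "ennreal (B / e) * ennreal (?h t) \<le> ennreal ((1 + cmod (g t)) * ln (1 + cmod (g t)))"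
      proof (cases "K < cmod (g t)")
        case True
        have "B / e = ln K" by (simp add: K_def)
        also have "\<dots> \<le> ln (1 + cmod (g t))" using True K by (subst ln_le_cancel_iff) auto
        finally have l: "B / e \<le> ln (1 + cmod (g t))" .
        have "B / e * cmod (g t) \<le> ln (1 + cmod (g t)) * (1 + cmod (g t))"
          using l Bp e by (intro mult_mono) auto
        then have "ennreal (B / e * cmod (g t)) \<le> ennreal ((1 + cmod (g t)) * ln (1 + cmod (g t)))"
          by (intro ennreal_leI) (simp add: mult.commute)
        moreover have "ennreal (B / e) * ennreal (cmod (g t)) = ennreal (B / e * cmod (g t))"
          using Bp e by (intro ennreal_mult[symmetric]) auto
        ultimately show ?thesis using True by (simp only: if_True)
      qed simp
    qed
    also have "\<dots> \<le> ennreal B" by (rule B(2)[OF g gN])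
    finally have "ennreal (B / e) * (\<integral>\<^sup>+t. ennreal (?h t) \<partial>circle) \<le> ennreal B"
      using hm by (subst (asm) nn_integral_cmult) auto
    moreover have hi: "integrable circle ?h"
      by (rule Bochner_Integration.integrable_bound[OF integrable_norm[OF bfs_integrable[OF g]] hm]) auto
    moreover have "(\<integral>\<^sup>+t. ennreal (?h t) \<partial>circle) = ennreal (\<integral>t. ?h t \<partial>circle)"
      by (rule nn_integral_eq_integral[OF hi]) auto
    moreover have h0: "0 \<le> (\<integral>t. ?h t \<partial>circle)" by (intro integral_nonneg_AE AE_I2) auto
    moreover have "ennreal (B / e * (\<integral>t. ?h t \<partial>circle)) = ennreal (B / e) * ennreal (\<integral>t. ?h t \<partial>circle)"
      using h0 Bp e by (intro ennreal_mult) auto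
    ultimately have "ennreal (B / e * (\<integral>t. ?h t \<partial>circle)) \<le> ennreal B" by (simp only:)
    then have "B / e * (\<integral>t. ?h t \<partial>circle) \<le> B" using Bp by simp
    then show ?thesis using Bp e by (simp add: field_simps)
  qed
  with K show thesis by (rule that)
qed

text \<open>The truncations of \<open>f\<close> need not converge to \<open>f\<close> in
  \<open>Y\<close>. Still the projections of the differences stay in a ball of \<open>Y\<close>,
  hence are uniformly integrable, and they tend to 0 in L^(1/2) by Kolmogorov's inequality. Together
  this is convergence in L1, since |h| <= sqrt K * sqrt |h| where |h| <= K.\<close>

lemma fourier_riesz:
  assumes f: "f \<in> bfs \<rho>"
  shows "fourier_coeff (riesz f) n = (if 0 \<le> n then fourier_coeff f n else 0)"
proof -
  have fm: "f \<in> borel_measurable circle" by (rule bfs_measurable[OF f])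
  have fi: "integrable circle f" by (rule bfs_integrable[OF f])
  define fk where "fk k t = (if cmod (f t) \<le> real k then f t else 0)" for k t
  have fkm: "fk k \<in> borel_measurable circle" for k unfolding fk_def using fm by simp
  have fkb: "cmod (fk k t) \<le> real k" for k t unfolding fk_def by simp
  have fkX: "fk k \<in> bfs \<rho>" for k by (rule bfs_bounded[OF fkm fkb])
  have dX: "(\<lambda>t. f t - fk k t) \<in> bfs \<rho>" for k by (rule bfs_diff[OF f fkX])
  have rX: "riesz f \<in> bfs \<rho>" "riesz (fk k) \<in> bfs \<rho>" for k using riesz_bfs f fkX by auto
  have hX: "(\<lambda>t. riesz f t - riesz (fk k) t) \<in> bfs \<rho>" for k by (rule bfs_diff[OF rX])
  obtain P where P: "0 \<le> P" "\<And>f. f \<in> bfs \<rho> \<Longrightarrow> N (riesz f) \<le> ennreal P * N f"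
    by (rule riesz_bound) (rule that)
  define M where "M = ennreal P * N f"
  have M: "M < \<infinity>" unfolding M_def using bfs_finite[OF f] by (simp add: ennreal_mult_less_top)
  have hN: "N (\<lambda>t. riesz f t - riesz (fk k) t) \<le> M" for k
  proof -
    have "N (\<lambda>t. riesz f t - riesz (fk k) t) = N (riesz (\<lambda>t. f t - fk k t))"
      using riesz_diff[OF f fkX[of k]] bfs_measurable[OF riesz_bfs[OF dX[of k]]] bfs_measurable[OF hX[of k]]
      by (intro N_cong) (auto elim!: eventually_mono)
    also have "\<dots> \<le> ennreal P * N (\<lambda>t. f t - fk k t)" by (rule P(2)[OF dX])
    also have "\<dots> \<le> M"
      unfolding M_def using fm bfs_measurable[OF dX[of k]]
      by (intro mult_left_mono N_mono AE_I2) (auto simp: fk_def)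
    finally show ?thesis .
  qed
  define d where "d k = (\<integral>t. cmod (f t - fk k t) \<partial>circle)" for k
  have d0: "d \<longlonglongrightarrow> 0"
  proof -
    have "d \<longlonglongrightarrow> (\<integral>t. 0 \<partial>circle)"
      unfolding d_def
    proof (rule integral_dominated_convergence[where w="\<lambda>t. cmod (f t)"])
      show "AE t in circle. (\<lambda>k. cmod (f t - fk k t)) \<longlonglongrightarrow> 0"
      proof (rule AE_I2)
        fix t
        obtain n0 where "cmod (f t) \<le> real n0" using real_arch_simple by blast
        then have "cmod (f t - fk k t) = 0" if "k \<ge> n0" for k using that by (simp add: fk_def)
        then show "(\<lambda>k. cmod (f t - fk k t)) \<longlonglongrightarrow> 0"
          by (intro tendsto_eventually) (auto simp: eventually_sequentially)
      qed
      show "AE t in circle. norm (cmod (f t - fk k t)) \<le> cmod (f t)" for k by (rule AE_I2) (simp add: fk_def)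
    qed (use fi fm fkm in auto)
    then show ?thesis by simp
  qed
  have main: "cmod (fourier_coeff (riesz f) n - (if 0 \<le> n then fourier_coeff f n else 0)) \<le> e" if e: "0 < e" for e
  proof -
    obtain K where K: "0 < K" "\<And>g. g \<in> bfs \<rho> \<Longrightarrow> N g \<le> M \<Longrightarrow> (\<integral>t. (if K < cmod (g t) then cmod (g t) else 0) \<partial>circle) \<le> e"
      by (rule uniformly_integrable[OF M e]) (rule that)
    have le: "cmod (fourier_coeff (riesz f) n - (if 0 \<le> n then fourier_coeff f n else 0)) \<le> e + sqrt K * (24 * sqrt (d k)) + d k" for k
    proof -
      let ?h = "\<lambda>t. riesz f t - riesz (fk k) t"
      have hi: "integrable circle ?h" by (rule bfs_integrable[OF hX])
      have hm: "?h \<in> borel_measurable circle" using hi by simp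
      have ai: "integrable circle (\<lambda>t. if K < cmod (?h t) then cmod (?h t) else 0)"
        by (rule Bochner_Integration.integrable_bound[OF integrable_norm[OF hi]]) (use hm in auto)
      have sqe: "AE t in circle. sqrt (cmod (riesz (\<lambda>t. f t - fk k t) t)) = sqrt (cmod (?h t))"
        using riesz_diff[OF f fkX[of k]] by eventually_elim simp
      have si: "integrable circle (\<lambda>t. sqrt (cmod (?h t)))"
        by (rule integral_sqrt_le(1)[OF integrable_norm[OF hi]]) simp
      have "(\<integral>t. sqrt (cmod (?h t)) \<partial>circle) = (\<integral>t. sqrt (cmod (riesz (\<lambda>t. f t - fk k t) t)) \<partial>circle)"
        using sqe hm bfs_measurable[OF riesz_bfs[OF dX[of k]]]
        by (intro integral_cong_AE) (auto elim!: eventually_mono)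
      also have "\<dots> \<le> 24 * sqrt (d k)" unfolding d_def by (rule kolmogorov(2)[OF dX])
      finally have sb: "(\<integral>t. sqrt (cmod (?h t)) \<partial>circle) \<le> 24 * sqrt (d k)" .
      have "(\<integral>t. cmod (?h t) \<partial>circle) \<le> (\<integral>t. (if K < cmod (?h t) then cmod (?h t) else 0) + sqrt K * sqrt (cmod (?h t)) \<partial>circle)"
      proof (rule integral_mono)
        fix t
        show "cmod (?h t) \<le> (if K < cmod (?h t) then cmod (?h t) else 0) + sqrt K * sqrt (cmod (?h t))"
        proof (cases "K < cmod (?h t)")
          case False
          then have "sqrt (cmod (?h t)) * sqrt (cmod (?h t)) \<le> sqrt K * sqrt (cmod (?h t))"
            by (intro mult_right_mono) auto
          then show ?thesis using False by simp
        qed (use K in simp)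
      qed (use hi ai si in auto)
      also have "\<dots> = (\<integral>t. (if K < cmod (?h t) then cmod (?h t) else 0) \<partial>circle) + sqrt K * (\<integral>t. sqrt (cmod (?h t)) \<partial>circle)"
        using ai si by simp
      also have "\<dots> \<le> e + sqrt K * (24 * sqrt (d k))"
        using K(1) by (intro add_mono K(2)[OF hX hN] mult_left_mono sb) auto
      finally have hb: "(\<integral>t. cmod (?h t) \<partial>circle) \<le> e + sqrt K * (24 * sqrt (d k))" .
      have 1: "cmod (fourier_coeff (riesz f) n - fourier_coeff (riesz (fk k)) n) \<le> (\<integral>t. cmod (?h t) \<partial>circle)"
        by (intro fourier_coeff_norm_diff bfs_integrable rX)
      have 2: "cmod (fourier_coeff f n - fourier_coeff (fk k) n) \<le> d k"
        unfolding d_def by (intro fourier_coeff_norm_diff bfs_integrable f fkX)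
      have 3: "fourier_coeff (riesz (fk k)) n = (if 0 \<le> n then fourier_coeff (fk k) n else 0)"
        by (rule fourier_riesz_bounded[OF fkm fkb])
      have "cmod (fourier_coeff (riesz (fk k)) n - (if 0 \<le> n then fourier_coeff f n else 0)) \<le> d k"
        using 2 unfolding 3 by (auto simp: norm_minus_commute intro: order_trans[OF norm_ge_zero])
      then show ?thesis
        using 1 hb norm_triangle_ineq[of "fourier_coeff (riesz f) n - fourier_coeff (riesz (fk k)) n"
          "fourier_coeff (riesz (fk k)) n - (if 0 \<le> n then fourier_coeff f n else 0)"]
        by (simp del: of_nat_0_le_iff)
    qed
    have "(\<lambda>k. e + sqrt K * (24 * sqrt (d k)) + d k) \<longlonglongrightarrow> e + sqrt K * (24 * sqrt 0) + 0"
      by (intro tendsto_intros d0)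
    then have "cmod (fourier_coeff (riesz f) n - (if 0 \<le> n then fourier_coeff f n else 0)) \<le> e + sqrt K * (24 * sqrt 0) + 0"
      by (rule LIMSEQ_le_const) (use le in blast)
    then show ?thesis by simp
  qed
  have "cmod (fourier_coeff (riesz f) n - (if 0 \<le> n then fourier_coeff f n else 0)) \<le> 0"
    by (rule field_le_epsilon) (use main in simp)
  then show ?thesis by simp
qed


text \<open>Substitute for weak compactness of balls. The admissible sets are convex and decrease,
  so the infima of the functional increase to a finite limit; the midpoint of two near-minimizers is
  admissible at the earlier level, hence their convexity defect is small. The defect controls their
  difference where both are bounded by K, and uniform integrability controls it elsewhere.\<close>

lemma extract_limit:
  assumes M: "M < \<infinity>" and ex: "\<And>n::nat. \<exists>h\<in>bfs \<rho>. N h \<le> M \<and> (\<forall>m. \<bar>m\<bar> \<le> int n \<longrightarrow> fourier_coeff h m = c m)"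
  obtains h where "h \<in> bfs \<rho>" "N h \<le> M" "\<And>m. fourier_coeff h m = c m"
proof -
  \<comment> \<open>The shifted images under the operator have the required coefficients only from
    some negative index on, so each level prescribes a finite symmetric range.\<close>
  define Cs where "Cs n = {h \<in> bfs \<rho>. N h \<le> M \<and> (\<forall>m. \<bar>m\<bar> \<le> int n \<longrightarrow> fourier_coeff h m = c m)}" for n :: nat
  define \<Phi> where "\<Phi> h = (\<integral>t. sqrt (1 + (cmod (h t))\<^sup>2) \<partial>circle)" for h
  have dec: "Cs m \<subseteq> Cs n" if "n \<le> m" for n m
    using that unfolding Cs_def by (auto intro: order_trans)
  have CX: "h \<in> bfs \<rho>" "N h \<le> M" if "h \<in> Cs n" for h n using that by (auto simp: Cs_def)
  have phi_le: "sqrt (1 + (cmod z)\<^sup>2) \<le> 1 + cmod z" for z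
    by (rule real_le_lsqrt) (auto simp: power2_sum)
  have pint: "integrable circle (\<lambda>t. sqrt (1 + (cmod (h t))\<^sup>2))" if h: "h \<in> bfs \<rho>" for h
  proof (rule Bochner_Integration.integrable_bound[where f="\<lambda>t. 1 + cmod (h t)"])
    show "AE t in circle. norm (sqrt (1 + (cmod (h t))\<^sup>2)) \<le> norm (1 + cmod (h t))"
      using phi_le by (intro AE_I2) simp
  qed (use bfs_integrable[OF h] bfs_measurable[OF h] in auto)
  have mid: "(\<lambda>t. (g t + h t) / 2) \<in> Cs n" if g: "g \<in> Cs n" and h: "h \<in> Cs n" for g h n
  proof -
    note X = CX(1)[OF g] CX(1)[OF h]
    have eq: "(\<lambda>t. (g t + h t) / 2) = (\<lambda>t. (1/2) * (g t + h t))" by (simp add: fun_eq_iff)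
    have mX: "(\<lambda>t. (g t + h t) / 2) \<in> bfs \<rho>" unfolding eq by (intro bfs_cmult bfs_add X)
    have "N (\<lambda>t. (g t + h t) / 2) = ennreal (1/2) * N (\<lambda>t. g t + h t)"
      unfolding eq using N_cmult[OF bfs_measurable[OF bfs_add[OF X]], of "1/2"] by (simp add: norm_divide)
    also have "\<dots> \<le> ennreal (1/2) * (M + M)"
    proof (rule mult_left_mono)
      have "N (\<lambda>t. g t + h t) \<le> N g + N h" by (rule N_add[OF bfs_measurable[OF X(1)] bfs_measurable[OF X(2)]])
      also have "\<dots> \<le> M + M" by (intro add_mono CX(2)[OF g] CX(2)[OF h])
      finally show "N (\<lambda>t. g t + h t) \<le> M + M" .
    qed simp
    also have "\<dots> = M"
    proof -
      obtain m where m: "M = ennreal m" "0 \<le> m" using M by (cases M) auto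
      have "ennreal (1/2) * (ennreal m + ennreal m) = ennreal (1/2 * (m + m))"
        using m(2) ennreal_plus[of m m] ennreal_mult[of "1/2" "m + m"] by simp
      then show ?thesis unfolding m(1) by simp
    qed
    finally have mN: "N (\<lambda>t. (g t + h t) / 2) \<le> M" .
    have "fourier_coeff (\<lambda>t. (g t + h t) / 2) m = c m" if "\<bar>m\<bar> \<le> int n" for m
      unfolding eq fourier_coeff_cmult fourier_coeff_add[OF bfs_integrable[OF X(1)] bfs_integrable[OF X(2)]]
      using g h that by (simp add: Cs_def)
    then show ?thesis using mX mN by (simp add: Cs_def)
  qed
  obtain C where C: "0 < C" "\<And>f. f \<in> bfs \<rho> \<Longrightarrow> ennreal (\<integral>t. cmod (f t) \<partial>circle) \<le> ennreal C * N f"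
    by (rule bfs_L1) (rule that)
  obtain m0 where m0: "M = ennreal m0" "0 \<le> m0" using M by (cases M) auto
  have L1: "(\<integral>t. cmod (h t) \<partial>circle) \<le> C * m0" if "h \<in> bfs \<rho>" "N h \<le> M" for h
  proof -
    have "ennreal (\<integral>t. cmod (h t) \<partial>circle) \<le> ennreal C * N h" by (rule C(2)[OF that(1)])
    also have "\<dots> \<le> ennreal C * ennreal m0" using that(2) unfolding m0(1) by (rule mult_left_mono) simp
    finally have "ennreal (\<integral>t. cmod (h t) \<partial>circle) \<le> ennreal C * ennreal m0" .
    then show ?thesis using C m0 by (simp add: ennreal_mult[symmetric])
  qed
  define d where "d n = Inf (\<Phi> ` Cs n)" for n
  have \<Phi>0: "0 \<le> \<Phi> h" for h unfolding \<Phi>_def by (intro integral_nonneg_AE AE_I2) simp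
  have bdd: "bdd_below (\<Phi> ` Cs n)" for n by (rule bdd_belowI[of _ 0]) (use \<Phi>0 in auto)
  have ne: "Cs n \<noteq> {}" for n using ex[of n] by (auto simp: Cs_def)
  have d_le: "d n \<le> \<Phi> h" if "h \<in> Cs n" for n h unfolding d_def by (rule cInf_lower[OF _ bdd]) (use that in auto)
  have d_mono: "d n \<le> d m" if "n \<le> m" for n m
    unfolding d_def by (rule cInf_superset_mono) (use ne bdd dec[OF that] in auto)
  have d_bdd: "d n \<le> 1 + C * m0" for n
  proof -
    obtain h where h: "h \<in> Cs n" using ne by blast
    have hi: "integrable circle h" by (rule bfs_integrable[OF CX(1)[OF h]])
    have "d n \<le> \<Phi> h" by (rule d_le[OF h])
    also have "\<dots> \<le> (\<integral>t. 1 + cmod (h t) \<partial>circle)"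
      unfolding \<Phi>_def by (intro integral_mono pint CX(1)[OF h] phi_le) (use hi in auto)
    also have "\<dots> = 1 + (\<integral>t. cmod (h t) \<partial>circle)" using hi by simp
    also have "\<dots> \<le> 1 + C * m0" using L1[OF CX[OF h]] by simp
    finally show ?thesis .
  qed
  have "incseq d" by (rule monoI) (rule d_mono)
  then obtain dl where dl: "d \<longlonglongrightarrow> dl" "\<And>n. d n \<le> dl"
    using incseq_convergent[of d "1 + C * m0"] d_bdd by auto
  have "\<exists>h. h \<in> Cs n \<and> \<Phi> h < d n + 1 / real (Suc n)" for n
  proof -
    have "Inf (\<Phi> ` Cs n) < d n + 1 / real (Suc n)" unfolding d_def by simp
    then show ?thesis using cInf_lessD[of "\<Phi> ` Cs n"] ne by blast
  qed
  then obtain g where g: "\<And>n. g n \<in> Cs n" "\<And>n. \<Phi> (g n) < d n + 1 / real (Suc n)" by metis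
  have gX: "g n \<in> bfs \<rho>" "N (g n) \<le> M" for n using CX[OF g(1)] by auto
  have gi: "integrable circle (g n)" and gm: "g n \<in> borel_measurable circle" for n
    using bfs_integrable[OF gX(1)] bfs_measurable[OF gX(1)] by auto
  \<comment> \<open>For n <= m the two values of the functional sum to at most d n + dl + 2 / (n +
    1), and twice the value at the midpoint is at least 2 d n.\<close>
  define \<delta> where "\<delta> n = dl - d n + 2 / real (Suc n)" for n
  have \<delta>0: "\<delta> \<longlonglongrightarrow> 0"
  proof -
    have "(\<lambda>n. dl - d n + 2 * (1 / real (Suc n))) \<longlonglongrightarrow> dl - dl + 2 * 0"
      by (intro tendsto_intros dl(1) LIMSEQ_Suc[OF lim_1_over_n])
    moreover have "\<delta> = (\<lambda>n. dl - d n + 2 * (1 / real (Suc n)))" by (simp add: fun_eq_iff \<delta>_def)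
    ultimately show ?thesis by simp
  qed
  have defect: "\<Phi> (g n) + \<Phi> (g m) - 2 * \<Phi> (\<lambda>t. (g n t + g m t) / 2) \<le> \<delta> n" if "n \<le> m" for n m
  proof -
    have "d n \<le> \<Phi> (\<lambda>t. (g n t + g m t) / 2)"
      by (rule d_le[OF mid]) (use g(1) dec[OF that] in auto)
    moreover have "\<Phi> (g n) + \<Phi> (g m) \<le> d n + 1 / real (Suc n) + (dl + 1 / real (Suc m))"
      using g(2)[of n] g(2)[of m] dl(2)[of m] by simp
    moreover have "1 / real (Suc m) \<le> 1 / real (Suc n)" using that by (simp add: frac_le)
    ultimately show ?thesis unfolding \<delta>_def by simp
  qed
  have cauchy: "\<exists>n0. \<forall>i\<ge>n0. \<forall>j\<ge>n0. (\<integral>t. cmod (g i t - g j t) \<partial>circle) < e" if e: "0 < e" for e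
  proof -
    obtain K where K: "0 < K" "\<And>h. h \<in> bfs \<rho> \<Longrightarrow> N h \<le> M \<Longrightarrow> (\<integral>t. (if K < cmod (h t) then cmod (h t) else 0) \<partial>circle) \<le> e / 8"
      by (rule uniformly_integrable[OF M, of "e/8"]) (use e that in auto)
    let ?T = "\<lambda>h t. if K < cmod (h t) then cmod (h t) else 0"
    have Ti: "integrable circle (?T (g n))" for n
      by (rule Bochner_Integration.integrable_bound[OF integrable_norm[OF gi]]) (use gm[of n] in auto)
    have le: "(\<integral>t. cmod (g i t - g j t) \<partial>circle) \<le> e / 2 + sqrt (4 * (1 + K) ^ 3 * \<delta> i)" if ij: "i \<le> j" for i j
    proof -
      \<comment> \<open>The part where both values are at most K is estimated in L2 by the convexity
        defect. Elsewhere the larger value exceeds K, and the difference is at most twice that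
        value, a tail term.\<close>
      let ?B = "\<lambda>t. if cmod (g i t) \<le> K \<and> cmod (g j t) \<le> K then g i t - g j t else 0"
      let ?p = "\<lambda>t. sqrt (1 + (cmod (g i t))\<^sup>2) + sqrt (1 + (cmod (g j t))\<^sup>2) - 2 * sqrt (1 + (cmod ((g i t + g j t) / 2))\<^sup>2)"
      have mX: "(\<lambda>t. (g i t + g j t) / 2) \<in> bfs \<rho>"
        using CX(1)[OF mid[of "g i" i "g j"]] g(1) dec[OF ij] by auto
      have pi: "integrable circle ?p"
        by (intro Bochner_Integration.integrable_add Bochner_Integration.integrable_diff integrable_mult_right pint gX mX)
      have pI: "(\<integral>t. ?p t \<partial>circle) \<le> \<delta> i"
        using defect[OF ij] pint[OF gX(1)[of i]] pint[OF gX(1)[of j]] pint[OF mX] unfolding \<Phi>_def by simp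
      have Bm: "?B \<in> borel_measurable circle" using gm[of i] gm[of j] by simp
      have Bsq: "(cmod (?B t))\<^sup>2 \<le> 4 * (1 + K) ^ 3 * ?p t" for t
      proof (cases "cmod (g i t) \<le> K \<and> cmod (g j t) \<le> K")
        case True
        then show ?thesis using midpoint_deficiency(1)[of K "g i t" "g j t"] K by simp
      next
        case False
        \<comment> \<open>The defect is nonnegative for any two values; L only serves as a common
          bound for them.\<close>
        define L where "L = max (cmod (g i t)) (cmod (g j t))"
        have "0 \<le> ?p t" by (rule midpoint_deficiency(2)[of L]) (auto simp: L_def le_max_iff_disj)
        then have "0 \<le> 4 * (1 + K) ^ 3 * ?p t" using K by (intro mult_nonneg_nonneg) auto
        moreover have "?B t = 0" using False by (rule if_not_P)
        ultimately show ?thesis by simp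
      qed
      have Bi: "integrable circle (\<lambda>t. (cmod (?B t))\<^sup>2)"
      proof (rule Bochner_Integration.integrable_bound[OF integrable_mult_right[OF pi, of "4 * (1 + K) ^ 3"]])
        show "AE t in circle. norm ((cmod (?B t))\<^sup>2) \<le> norm (4 * (1 + K) ^ 3 * ?p t)"
        proof (rule AE_I2)
          fix t
          have "norm ((cmod (?B t))\<^sup>2) = (cmod (?B t))\<^sup>2" by (simp only: real_norm_def abs_power2)
          also note Bsq[of t]
          also have "4 * (1 + K) ^ 3 * ?p t \<le> norm (4 * (1 + K) ^ 3 * ?p t)" unfolding real_norm_def by (rule abs_ge_self)
          finally show "norm ((cmod (?B t))\<^sup>2) \<le> norm (4 * (1 + K) ^ 3 * ?p t)" .
        qed
      qed (use Bm in simp)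
      have "(\<integral>t. (cmod (?B t))\<^sup>2 \<partial>circle) \<le> (\<integral>t. 4 * (1 + K) ^ 3 * ?p t \<partial>circle)"
        by (intro integral_mono Bi integrable_mult_right pi Bsq)
      also have "\<dots> = 4 * (1 + K) ^ 3 * (\<integral>t. ?p t \<partial>circle)" by (rule integral_mult_right_zero)
      also have "\<dots> \<le> 4 * (1 + K) ^ 3 * \<delta> i" using K by (intro mult_left_mono pI) auto
      finally have B2: "(\<integral>t. (cmod (?B t))\<^sup>2 \<partial>circle) \<le> 4 * (1 + K) ^ 3 * \<delta> i" .
      have Bint: "integrable circle ?B" by (rule integral_square_le(1)[OF Bi Bm])
      have B1: "(\<integral>t. cmod (?B t) \<partial>circle) \<le> sqrt (4 * (1 + K) ^ 3 * \<delta> i)"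
        by (rule order_trans[OF integral_square_le(2)[OF Bi Bm] real_sqrt_le_mono[OF B2]])
      have "(\<integral>t. cmod (g i t - g j t) \<partial>circle) \<le> (\<integral>t. cmod (?B t) + (2 * ?T (g i) t + 2 * ?T (g j) t) \<partial>circle)"
      proof (rule integral_mono)
        show "cmod (g i t - g j t) \<le> cmod (?B t) + (2 * ?T (g i) t + 2 * ?T (g j) t)" for t
          using norm_triangle_ineq4[of "g i t" "g j t"] K(1) by auto
      qed (use gi Ti Bint in auto)
      also have "\<dots> = (\<integral>t. cmod (?B t) \<partial>circle) + (2 * (\<integral>t. ?T (g i) t \<partial>circle) + 2 * (\<integral>t. ?T (g j) t \<partial>circle))"
        using Bint Ti[of i] Ti[of j] by simp
      also have "\<dots> \<le> sqrt (4 * (1 + K) ^ 3 * \<delta> i) + (2 * (e / 8) + 2 * (e / 8))"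
        by (intro add_mono B1 mult_left_mono K(2) gX) auto
      finally show ?thesis by simp
    qed
    have "(\<lambda>i. sqrt (4 * (1 + K) ^ 3 * \<delta> i)) \<longlonglongrightarrow> sqrt (4 * (1 + K) ^ 3 * 0)"
      by (intro tendsto_intros \<delta>0)
    then have "\<forall>\<^sub>F i in sequentially. sqrt (4 * (1 + K) ^ 3 * \<delta> i) < e / 2"
      using e by (intro order_tendstoD(2)) auto
    then obtain n0 where n0: "\<And>i. i \<ge> n0 \<Longrightarrow> sqrt (4 * (1 + K) ^ 3 * \<delta> i) < e / 2"
      by (auto simp: eventually_sequentially)
    have "(\<integral>t. cmod (g i t - g j t) \<partial>circle) < e" if "i \<ge> n0" "j \<ge> n0" for i j
    proof (cases "i \<le> j")
      case True
      then show ?thesis using le[OF True] n0[OF that(1)] by simp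
    next
      case False
      then have "(\<integral>t. cmod (g j t - g i t) \<partial>circle) < e" using le[of j i] n0[OF that(2)] by simp
      then show ?thesis by (simp add: norm_minus_commute)
    qed
    then show ?thesis by blast
  qed
  obtain r where r: "strict_mono r" "AE t in circle. Cauchy (\<lambda>i. g (r i) t)"
    by (rule cauchy_L1_AE_cauchy_subseq[of circle g, OF gi cauchy]) (use that in auto)
  define h where "h t = lim (\<lambda>i. g (r i) t)" for t
  have hm: "h \<in> borel_measurable circle" unfolding h_def using gm by (intro borel_measurable_lim_metric)
  have lim: "AE t in circle. (\<lambda>i. g (r i) t) \<longlonglongrightarrow> h t"
    using r(2) by eventually_elim (simp add: h_def Cauchy_convergent_iff convergent_LIMSEQ_iff)
  have hN: "N h \<le> M" by (rule N_fatou[of "\<lambda>i. g (r i)", OF gm hm gX(2) lim])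
  have hX: "h \<in> bfs \<rho>" by (rule bfsI[OF hm hN M])
  have hi: "integrable circle h" by (rule bfs_integrable[OF hX])
  have "fourier_coeff h m = c m" for m
  proof -
    have le: "cmod (fourier_coeff h m - c m) \<le> 0 + e" if e: "0 < e" for e
    proof -
      obtain n0 where n0: "\<And>i j. i \<ge> n0 \<Longrightarrow> j \<ge> n0 \<Longrightarrow> (\<integral>t. cmod (g i t - g j t) \<partial>circle) < e"
        using cauchy[OF e] by blast
      \<comment> \<open>From index |m| on, the m-th coefficient of the sequence has its prescribed
        value.\<close>
      define n where "n = max n0 (nat \<bar>m\<bar>)"
      have n: "n0 \<le> n" "\<bar>m\<bar> \<le> int n" by (auto simp: n_def)
      have "(\<integral>\<^sup>+t. ennreal (cmod (h t - g n t)) \<partial>circle) \<le> (\<integral>\<^sup>+t. liminf (\<lambda>i. ennreal (cmod (g (r i) t - g n t))) \<partial>circle)"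
      proof (rule nn_integral_mono_AE)
        show "AE t in circle. ennreal (cmod (h t - g n t)) \<le> liminf (\<lambda>i. ennreal (cmod (g (r i) t - g n t)))"
          using lim
        proof eventually_elim
          case (elim t)
          then have l: "(\<lambda>i. ennreal (cmod (g (r i) t - g n t))) \<longlonglongrightarrow> ennreal (cmod (h t - g n t))"
            by (intro tendsto_intros)
          show ?case by (rule eq_refl, rule lim_imp_Liminf[OF _ l, symmetric]) simp
        qed
      qed
      also have "\<dots> \<le> liminf (\<lambda>i. \<integral>\<^sup>+t. ennreal (cmod (g (r i) t - g n t)) \<partial>circle)"
        by (intro nn_integral_liminf) (use gm in auto)
      also have "\<dots> \<le> ennreal e"
      proof (rule Liminf_le)
        show "\<forall>\<^sub>F i in sequentially. (\<integral>\<^sup>+t. ennreal (cmod (g (r i) t - g n t)) \<partial>circle) \<le> ennreal e"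
          using eventually_ge_at_top[of n0]
        proof eventually_elim
          case (elim i)
          then have "n0 \<le> r i" using seq_suble[OF r(1), of i] by simp
          then have "(\<integral>t. cmod (g (r i) t - g n t) \<partial>circle) < e" by (intro n0 n)
          moreover have "(\<integral>\<^sup>+t. ennreal (cmod (g (r i) t - g n t)) \<partial>circle) = ennreal (\<integral>t. cmod (g (r i) t - g n t) \<partial>circle)"
            using gi by (intro nn_integral_eq_integral) auto
          ultimately show ?case by (simp add: ennreal_leI)
        qed
      qed simp
      finally have "(\<integral>t. cmod (h t - g n t) \<partial>circle) \<le> e"
        using hi gi[of n] e by (subst (asm) nn_integral_eq_integral) auto
      moreover have "cmod (fourier_coeff h m - fourier_coeff (g n) m) \<le> (\<integral>t. cmod (h t - g n t) \<partial>circle)"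
        by (rule fourier_coeff_norm_diff[OF hi gi])
      moreover have "fourier_coeff (g n) m = c m" using g(1)[of n] n(2) by (simp add: Cs_def)
      ultimately show ?thesis by simp
    qed
    have "cmod (fourier_coeff h m - c m) \<le> 0" by (rule field_le_epsilon) (rule le)
    then show ?thesis by simp
  qed
  with hX hN show thesis by (rule that)
qed

end

section \<open>Analytic polynomials\<close>

definition analytic_poly :: "(complex \<Rightarrow> complex) \<Rightarrow> bool" where
  "analytic_poly p \<longleftrightarrow> (\<exists>n c. \<forall>t\<in>sphere 0 1. p t = (\<Sum>i<(n::nat). c i * t ^ i))"

lemma analytic_poly_trig: "analytic_poly p \<Longrightarrow> trig_poly p"
proof -
  assume "analytic_poly p"
  then obtain n :: nat and c where p: "\<forall>t\<in>sphere 0 1. p t = (\<Sum>i<n. c i * t ^ i)"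
    unfolding analytic_poly_def by blast
  have "trig_poly (\<lambda>t. \<Sum>i<n. c i * t powi int i)"
    by (intro trig_poly_sum trig_poly_powi) simp
  also have "?this \<longleftrightarrow> trig_poly p" using p by (intro trig_poly_cong) simp
  finally show ?thesis .
qed

lemma analytic_poly_approx:
  assumes F: "F holomorphic_on ball 0 1" and r: "0 \<le> r" "r < 1" and e: "0 < e"
  obtains p where "analytic_poly p" "\<And>t. cmod t = 1 \<Longrightarrow> cmod (F (of_real r * t) - p t) < e"
proof -
  define a where "a n = (deriv ^^ n) F 0 / fact n" for n
  have s: "(\<lambda>n. a n * z ^ n) sums F z" if "cmod z < 1" for z
    using holomorphic_power_series[OF F, of z] that by (simp add: a_def)
  \<comment> \<open>A radius strictly between r and 1: convergence there puts the radius of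
    convergence above r, so that the Taylor polynomials converge uniformly on the closed disc of
    radius r.\<close>
  define q where "q = (1 + r) / 2"
  have q: "r < q" "q < 1" "0 < q" using r by (auto simp: q_def)
  have "summable (\<lambda>n. a n * of_real q ^ n)" using s[of "of_real q"] q by (simp add: sums_iff)
  then have "ereal (norm (complex_of_real q)) \<le> conv_radius a" by (rule conv_radius_geI)
  moreover have "ereal r < ereal (norm (complex_of_real q))" using q by simp
  ultimately have "ereal r < conv_radius a" by (rule less_le_trans[rotated])
  then have "uniform_limit (cball 0 r) (\<lambda>n x. \<Sum>i<n. a i * (x - 0) ^ i) (\<lambda>x. suminf (\<lambda>i. a i * (x - 0) ^ i)) sequentially"
    by (rule powser_uniform_limit)
  then obtain n where n: "\<And>x. x \<in> cball 0 r \<Longrightarrow> dist (\<Sum>i<n. a i * (x - 0) ^ i) (suminf (\<lambda>i. a i * (x - 0) ^ i)) < e"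
    using e unfolding uniform_limit_iff eventually_sequentially by blast
  define p where "p t = (\<Sum>i<n. (a i * of_real r ^ i) * t ^ i)" for t
  show thesis
  proof (rule that[of p])
    show "analytic_poly p"
      unfolding analytic_poly_def p_def by (intro exI[of _ n] exI[of _ "\<lambda>i. a i * of_real r ^ i"]) simp
    fix t :: complex assume t: "cmod t = 1"
    let ?z = "of_real r * t"
    have z: "cmod ?z = r" using t r by (simp add: norm_mult)
    then have "F ?z = suminf (\<lambda>i. a i * ?z ^ i)" using s[of ?z] r by (simp add: sums_iff)
    moreover have "p t = (\<Sum>i<n. a i * ?z ^ i)"
      unfolding p_def by (simp add: power_mult_distrib mult.assoc)
    ultimately show "cmod (F ?z - p t) < e"
      using n[of ?z] z by (simp add: dist_norm norm_minus_commute)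
  qed
qed

section \<open>Products with functions holomorphic in the disc\<close>

lemma fourier_coeff_mult_analytic_poly:
  assumes f: "integrable circle f" and neg: "\<And>n. n < 0 \<Longrightarrow> fourier_coeff f n = 0" and p: "analytic_poly p" and m: "m < 0"
  shows "fourier_coeff (\<lambda>t. f t * p t) m = 0"
proof -
  obtain n :: nat and c where c: "\<forall>t\<in>sphere 0 1. p t = (\<Sum>i<n. c i * t ^ i)"
    using p unfolding analytic_poly_def by blast
  have fi: "integrable circle (\<lambda>t. t powi k * f t)" for k
    using integrable_fourier[OF f, of k] by (simp only: mult.commute)
  have "fourier_coeff (\<lambda>t. f t * p t) m = fourier_coeff (\<lambda>t. \<Sum>i<n. c i * (t powi int i * f t)) m"
    unfolding fourier_coeff_def
    by (intro Bochner_Integration.integral_cong refl) (simp add: space_circle c sum_distrib_left mult_ac)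
  also have "\<dots> = (\<Sum>i<n. fourier_coeff (\<lambda>t. c i * (t powi int i * f t)) m)"
    by (intro fourier_coeff_sum integrable_mult_right fi)
  also have "\<dots> = (\<Sum>i<n. c i * fourier_coeff f (m - int i))"
    by (simp only: fourier_coeff_cmult fourier_coeff_powi_mult)
  also have "\<dots> = 0" using m by (simp add: neg)
  finally show ?thesis .
qed

lemma fourier_coeff_tendsto:
  assumes g: "integrable circle g" and q: "\<And>n. q n \<in> borel_measurable circle" and h: "h \<in> borel_measurable circle"
    and bd: "\<And>n. AE t in circle. cmod (q n t) \<le> cmod (g t)" and lim: "AE t in circle. (\<lambda>n. q n t) \<longlonglongrightarrow> h t"
  shows "(\<lambda>n. fourier_coeff (q n) m) \<longlonglongrightarrow> fourier_coeff h m"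
  unfolding fourier_coeff_def
proof (rule integral_dominated_convergence[where w="\<lambda>t. cmod (g t)"])
  show "AE t in circle. (\<lambda>n. q n t * t powi - m) \<longlonglongrightarrow> h t * t powi - m"
    using lim by eventually_elim (intro tendsto_intros)
  show "AE t in circle. norm (q n t * t powi - m) \<le> cmod (g t)" for n
    using bd[of n] AE_space by eventually_elim (auto simp: norm_mult norm_power_int space_circle)
qed (use g q h in auto)

text \<open>An analytic polynomial only shifts frequencies upwards. On the circle \<open>K\<close>
  is a bounded pointwise limit of such polynomials: its dilations converge to it by continuity on
  the closed disc and are uniformly approximated by their Taylor polynomials.\<close>

lemma fourier_coeff_mult_holomorphic:
  assumes f: "integrable circle f" and neg: "\<And>n. n < 0 \<Longrightarrow> fourier_coeff f n = 0"
    and K: "continuous_on (cball 0 1) K" "K holomorphic_on ball 0 1" and m: "m < 0"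
  shows "fourier_coeff (\<lambda>t. f t * K t) m = 0"
proof -
  define r where "r k = 1 - 1 / real (k + 2)" for k :: nat
  have r: "0 \<le> r k" "r k < 1" for k by (auto simp: r_def)
  have r1: "r \<longlonglongrightarrow> 1"
  proof -
    have "(\<lambda>k. 1 - 1 / real (k + 2)) \<longlonglongrightarrow> 1 - 0"
      by (intro tendsto_intros LIMSEQ_ignore_initial_segment[OF lim_1_over_n])
    moreover have "r = (\<lambda>k. 1 - 1 / real (k + 2))" by (simp add: fun_eq_iff r_def)
    ultimately show ?thesis by simp
  qed
  have "\<exists>p. analytic_poly p \<and> (\<forall>t. cmod t = 1 \<longrightarrow> cmod (K (of_real (r k) * t) - p t) < 1 / real (Suc k))" for k
    by (rule analytic_poly_approx[OF K(2) r, of "1 / real (Suc k)" k]) auto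
  then obtain p where p: "\<And>k. analytic_poly (p k)" "\<And>k t. cmod t = 1 \<Longrightarrow> cmod (K (of_real (r k) * t) - p k t) < 1 / real (Suc k)"
    by metis
  have "bounded (K ` cball 0 1)" by (intro compact_imp_bounded compact_continuous_image K) auto
  then obtain B where "\<forall>x\<in>K ` cball 0 1. cmod x \<le> B" unfolding bounded_iff by blast
  then have B: "cmod (K z) \<le> B" if "cmod z \<le> 1" for z using that by simp
  have rt: "cmod (of_real (r k) * t) \<le> 1" if "cmod t = 1" for k t
    using that r[of k] by (simp add: norm_mult)
  have lim: "(\<lambda>k. p k t) \<longlonglongrightarrow> K t" if t: "cmod t = 1" for t
  proof -
    have "(\<lambda>k. K (of_real (r k) * t)) \<longlonglongrightarrow> K (of_real 1 * t)"
    proof (rule continuous_on_tendsto_compose[OF K(1)])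
      show "(\<lambda>k. of_real (r k) * t) \<longlonglongrightarrow> of_real 1 * t" by (intro tendsto_intros r1)
    qed (use t rt in auto)
    moreover have "(\<lambda>k. K (of_real (r k) * t) - p k t) \<longlonglongrightarrow> 0"
      by (rule Lim_null_comparison[OF always_eventually LIMSEQ_Suc[OF lim_1_over_n]])
         (use p(2)[OF t] less_imp_le in blast)
    ultimately have "(\<lambda>k. K (of_real (r k) * t) - (K (of_real (r k) * t) - p k t)) \<longlonglongrightarrow> K (of_real 1 * t) - 0"
      by (intro tendsto_intros)
    then show ?thesis by simp
  qed
  have pb: "cmod (p k t) \<le> B + 1" if t: "cmod t = 1" for k t
  proof -
    have "1 / real (Suc k) \<le> 1" by simp
    then have "cmod (K (of_real (r k) * t) - p k t) \<le> 1" using p(2)[OF t, of k] by linarith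
    moreover have "cmod (K (of_real (r k) * t)) \<le> B" by (rule B[OF rt[OF t]])
    ultimately show ?thesis
      using norm_triangle_ineq4[of "K (of_real (r k) * t)" "K (of_real (r k) * t) - p k t"] by simp
  qed
  have "(\<lambda>k. fourier_coeff (\<lambda>t. f t * p k t) m) \<longlonglongrightarrow> fourier_coeff (\<lambda>t. f t * K t) m"
  proof (rule fourier_coeff_tendsto[where g="\<lambda>t. of_real (B + 1) * f t"])
    show "integrable circle (\<lambda>t. of_real (B + 1) * f t)" by (intro integrable_mult_right f)
    show "(\<lambda>t. f t * p k t) \<in> borel_measurable circle" for k
      by (intro borel_measurable_times borel_measurable_integrable f trig_poly_integrable analytic_poly_trig p)
    show "(\<lambda>t. f t * K t) \<in> borel_measurable circle"
      by (intro borel_measurable_times borel_measurable_integrable f integrable_circle_continuous continuous_on_subset[OF K(1)]) auto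
    show "AE t in circle. cmod (f t * p k t) \<le> cmod (of_real (B + 1) * f t)" for k
    proof (rule AE_circleI)
      fix t :: complex assume t: "cmod t = 1"
      have "cmod (f t) * cmod (p k t) \<le> cmod (f t) * (B + 1)" by (intro mult_left_mono pb t) simp
      also have "\<dots> \<le> cmod (f t) * \<bar>B + 1\<bar>" by (intro mult_left_mono) auto
      finally show "cmod (f t * p k t) \<le> cmod (of_real (B + 1) * f t)"
        unfolding norm_mult norm_of_real by (simp only: mult.commute)
    qed
    show "AE t in circle. (\<lambda>k. f t * p k t) \<longlonglongrightarrow> f t * K t"
      by (rule AE_circleI) (intro tendsto_intros lim)
  qed
  then show ?thesis
    using fourier_coeff_mult_analytic_poly[OF f neg p(1) m] by (simp add: LIMSEQ_const_iff)
qed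

section \<open>Poisson integrals\<close>

definition poisson :: "complex \<Rightarrow> complex \<Rightarrow> real" where
  "poisson z \<tau> = (1 - (cmod z)\<^sup>2) / (cmod (\<tau> - z))\<^sup>2"

definition poisson_int :: "(complex \<Rightarrow> complex) \<Rightarrow> complex \<Rightarrow> complex" where
  "poisson_int h z = (\<integral>\<tau>. h \<tau> * of_real (poisson z \<tau>) \<partial>circle)"

lemma poisson_nonneg: "cmod z < 1 \<Longrightarrow> 0 \<le> poisson z \<tau>"
  unfolding poisson_def using power_le_one[of "cmod z" 2] by simp

lemma poisson_measurable: "(\<lambda>\<tau>. poisson z \<tau>) \<in> borel_measurable borel"
  unfolding poisson_def by measurable

lemma poisson_bounded:
  assumes "cmod z < 1" "cmod \<tau> = 1"
  shows "poisson z \<tau> \<le> 1 / (1 - cmod z)\<^sup>2"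
  unfolding poisson_def
proof (rule frac_le)
  have "1 - cmod z \<le> cmod (\<tau> - z)" using norm_triangle_ineq2[of \<tau> z] assms by simp
  then show "(1 - cmod z)\<^sup>2 \<le> (cmod (\<tau> - z))\<^sup>2" using assms by (intro power_mono) auto
qed (use assms in auto)

lemma integrable_mult_poisson:
  fixes h :: "complex \<Rightarrow> complex"
  assumes h: "integrable circle h" and z: "cmod z < 1"
  shows "integrable circle (\<lambda>\<tau>. h \<tau> * of_real (poisson z \<tau>))"
proof (rule integrable_mult_bounded[OF h, where B="1 / (1 - cmod z)\<^sup>2"])
  show "(\<lambda>\<tau>. complex_of_real (poisson z \<tau>)) \<in> borel_measurable circle"
    by (intro borel_measurable_circle measurable_compose[OF poisson_measurable borel_measurable_of_real])
  show "cmod (of_real (poisson z \<tau>)) \<le> 1 / (1 - cmod z)\<^sup>2" if "cmod \<tau> = 1" for \<tau>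
    using poisson_bounded[OF z that] poisson_nonneg[OF z, of \<tau>] by simp
qed

lemma integral_poisson:
  assumes z: "cmod z < 1"
  shows "integrable circle (poisson z)" "(\<integral>\<tau>. poisson z \<tau> \<partial>circle) = 1"
proof -
  have eq: "poisson z = (\<lambda>\<tau>. (1 - (cmod z)\<^sup>2) / (cmod (\<tau> - z))\<^sup>2)" by (simp add: fun_eq_iff poisson_def)
  show "integrable circle (poisson z)" "(\<integral>\<tau>. poisson z \<tau> \<partial>circle) = 1"
    using integrable_poisson[of "\<lambda>_. 1", OF _ z] herglotz_const[OF z, of 1] by (auto simp: eq)
qed

lemma poisson_sym:
  assumes "cmod t = 1" "cmod \<tau> = 1" "0 \<le> r" "r < 1"
  shows "poisson (of_real r * t) \<tau> = poisson (of_real r * \<tau>) t"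
proof -
  have "(cmod (\<tau> - of_real r * t))\<^sup>2 = (cmod (t - of_real r * \<tau>))\<^sup>2"
  proof -
    have *: "(cmod (a - of_real r * b))\<^sup>2 = (cmod a)\<^sup>2 + r\<^sup>2 * (cmod b)\<^sup>2 - 2 * r * (Re a * Re b + Im a * Im b)" for a b
      unfolding cmod_power2 by (simp add: power2_eq_square algebra_simps)
    show ?thesis unfolding * using assms by (simp add: mult_ac)
  qed
  then show ?thesis using assms by (simp add: poisson_def norm_mult)
qed

lemma fourier_coeff_cnj: "fourier_coeff (\<lambda>t. cnj (g t)) n = cnj (fourier_coeff g (- n))"
proof -
  have "cnj (fourier_coeff g (- n)) = (\<integral>t. cnj (g t * t powi n) \<partial>circle)"
    unfolding fourier_coeff_def by (simp only: Bochner_Integration.integral_cnj minus_minus)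
  also have "\<dots> = fourier_coeff (\<lambda>t. cnj (g t)) n"
    unfolding fourier_coeff_def
    by (intro Bochner_Integration.integral_cong refl)
       (simp add: space_circle cnj_powi_unit del: complex_cnj_power_int)
  finally show ?thesis ..
qed

text \<open>The Poisson kernel is k + cnj k - 1 with k the Cauchy kernel. Against an analytic
  \<open>g\<close> the conjugate kernel yields only the mean, because the conjugate of
  \<open>g\<close> has no coefficients of positive index; this cancels the term -1.\<close>

lemma poisson_int_analytic:
  assumes g: "integrable circle g" and neg: "\<And>n. n < 0 \<Longrightarrow> fourier_coeff g n = 0" and z: "cmod z < 1"
  shows "poisson_int g z = cauchy_transform g z"
proof -
  let ?k = "\<lambda>\<tau>. \<tau> / (\<tau> - z)"
  have gc: "integrable circle (\<lambda>\<tau>. cnj (g \<tau>))" using g by simp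
  have "(\<lambda>n. fourier_coeff (\<lambda>\<tau>. cnj (g \<tau>)) (int n) * z ^ n) sums cauchy_transform (\<lambda>\<tau>. cnj (g \<tau>)) z"
    by (rule cauchy_transform_sums[OF gc z])
  moreover have "(\<lambda>n. fourier_coeff (\<lambda>\<tau>. cnj (g \<tau>)) (int n) * z ^ n) = (\<lambda>n. if n = 0 then cnj (\<integral>\<tau>. g \<tau> \<partial>circle) else 0)"
  proof
    fix n :: nat
    have "fourier_coeff g 0 = (\<integral>\<tau>. g \<tau> \<partial>circle)" by (simp add: fourier_coeff_def)
    then show "fourier_coeff (\<lambda>\<tau>. cnj (g \<tau>)) (int n) * z ^ n = (if n = 0 then cnj (\<integral>\<tau>. g \<tau> \<partial>circle) else 0)"
      by (simp add: fourier_coeff_cnj neg)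
  qed
  ultimately have "(\<lambda>n. if n = 0 then cnj (\<integral>\<tau>. g \<tau> \<partial>circle) else 0) sums cauchy_transform (\<lambda>\<tau>. cnj (g \<tau>)) z"
    by (simp only:)
  then have "cauchy_transform (\<lambda>\<tau>. cnj (g \<tau>)) z = cnj (\<integral>\<tau>. g \<tau> \<partial>circle)"
    by (rule sums_unique2) (rule sums_single[of 0 "\<lambda>_. cnj (\<integral>\<tau>. g \<tau> \<partial>circle)"])
  then have c1: "(\<integral>\<tau>. cnj (g \<tau>) * ?k \<tau> \<partial>circle) = cnj (\<integral>\<tau>. g \<tau> \<partial>circle)"
    unfolding cauchy_transform_def .
  have "(\<integral>\<tau>. g \<tau> * cnj (?k \<tau>) \<partial>circle) = (\<integral>\<tau>. cnj (cnj (g \<tau>) * ?k \<tau>) \<partial>circle)"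
    by (simp only: complex_cnj_mult complex_cnj_cnj)
  also have "\<dots> = (\<integral>\<tau>. g \<tau> \<partial>circle)"
    by (simp only: Bochner_Integration.integral_cnj c1 complex_cnj_cnj)
  finally have c2: "(\<integral>\<tau>. g \<tau> * cnj (?k \<tau>) \<partial>circle) = (\<integral>\<tau>. g \<tau> \<partial>circle)" .
  have i1: "integrable circle (\<lambda>\<tau>. g \<tau> * ?k \<tau>)" by (rule integrable_cauchy_kernel[OF g z])
  have "integrable circle (\<lambda>\<tau>. cnj (cnj (g \<tau>) * ?k \<tau>))"
    using integrable_cauchy_kernel[OF gc z] by (rule integrable_cnj)
  then have i2: "integrable circle (\<lambda>\<tau>. g \<tau> * cnj (?k \<tau>))" by (simp only: complex_cnj_mult complex_cnj_cnj)
  have "poisson_int g z = (\<integral>\<tau>. g \<tau> * ?k \<tau> + g \<tau> * cnj (?k \<tau>) - g \<tau> \<partial>circle)"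
    unfolding poisson_int_def
  proof (intro Bochner_Integration.integral_cong refl)
    fix \<tau> assume "\<tau> \<in> space circle"
    then have "poisson z \<tau> = Re (2 * ?k \<tau> - 1)"
      unfolding poisson_def using Re_herglotz_kernel[of \<tau> z] z by (simp add: space_circle)
    moreover have "complex_of_real (Re (2 * w - 1)) = w + cnj w - 1" for w
      by (simp add: complex_eq_iff)
    ultimately have "of_real (poisson z \<tau>) = ?k \<tau> + cnj (?k \<tau>) - 1" by (simp only:)
    then show "g \<tau> * of_real (poisson z \<tau>) = g \<tau> * ?k \<tau> + g \<tau> * cnj (?k \<tau>) - g \<tau>"
      by (simp only: distrib_left right_diff_distrib mult_1_right)
  qed
  also have "\<dots> = (\<integral>\<tau>. g \<tau> * ?k \<tau> \<partial>circle) + (\<integral>\<tau>. g \<tau> * cnj (?k \<tau>) \<partial>circle) - (\<integral>\<tau>. g \<tau> \<partial>circle)"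
    using i1 i2 g by (simp only: Bochner_Integration.integral_diff Bochner_Integration.integral_add Bochner_Integration.integrable_add)
  also have "\<dots> = cauchy_transform g z" unfolding c2 cauchy_transform_def by simp
  finally show ?thesis .
qed

lemma poisson_int_bounded:
  assumes g: "\<And>t. cmod t = 1 \<Longrightarrow> cmod (g t) \<le> B" and z: "cmod z < 1"
  shows "cmod (poisson_int g z) \<le> B"
proof -
  have "cmod (poisson_int g z) \<le> (\<integral>\<tau>. B * poisson z \<tau> \<partial>circle)"
    unfolding poisson_int_def
  proof (rule order_trans[OF integral_norm_bound])
    have B: "0 \<le> B" using g[of 1] by (auto intro: order_trans[OF norm_ge_zero])
    have "(\<integral>\<tau>. norm (g \<tau> * of_real (poisson z \<tau>)) \<partial>circle) \<le> (\<integral>\<tau>. B * poisson z \<tau> \<partial>circle)"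
    proof (rule integral_mono_AE')
      show "AE \<tau> in circle. norm (g \<tau> * of_real (poisson z \<tau>)) \<le> B * poisson z \<tau>"
      proof (rule AE_circleI)
        fix \<tau> :: complex assume "cmod \<tau> = 1"
        then show "norm (g \<tau> * of_real (poisson z \<tau>)) \<le> B * poisson z \<tau>"
          using g[of \<tau>] poisson_nonneg[OF z, of \<tau>] by (simp add: norm_mult mult_right_mono)
      qed
      show "AE \<tau> in circle. 0 \<le> B * poisson z \<tau>"
        by (intro AE_I2 mult_nonneg_nonneg B poisson_nonneg z)
    qed (use integral_poisson(1)[OF z] in simp)
    then show "(\<integral>\<tau>. norm (g \<tau> * of_real (poisson z \<tau>)) \<partial>circle) \<le> (\<integral>\<tau>. B * poisson z \<tau> \<partial>circle)" .
  qed
  then show ?thesis using integral_poisson[OF z] by simp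
qed

text \<open>Fubini's theorem, the symmetry of the kernel under exchange of t and \<tau>, and its
  total mass 1.\<close>

lemma poisson_int_contraction:
  assumes h: "integrable circle h" and r: "0 \<le> r" "r < 1"
  shows "(\<integral>\<^sup>+t. ennreal (cmod (poisson_int h (of_real r * t))) \<partial>circle) \<le> ennreal (\<integral>t. cmod (h t) \<partial>circle)"
proof -
  interpret pair_sigma_finite circle circle
    by (intro pair_sigma_finite.intro circle.sigma_finite_measure_axioms)
  have hm: "h \<in> borel_measurable circle" using h by simp
  have rt: "cmod (of_real r * t) < 1" if "cmod t = 1" for t using that r by (simp add: norm_mult)
  let ?f = "\<lambda>t \<tau>. ennreal (cmod (h \<tau>)) * ennreal (poisson (of_real r * t) \<tau>)"
  have idm: "(\<lambda>x. x) \<in> measurable circle (borel :: complex measure)"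
    by (rule borel_measurable_circle) simp
  have m: "(\<lambda>(t, \<tau>). ?f t \<tau>) \<in> borel_measurable (circle \<Otimes>\<^sub>M circle)"
  proof -
    have [measurable]: "fst \<in> borel_measurable (circle \<Otimes>\<^sub>M circle)" "snd \<in> borel_measurable (circle \<Otimes>\<^sub>M circle)"
      using measurable_compose[OF measurable_fst idm] measurable_compose[OF measurable_snd idm] by auto
    have [measurable]: "(\<lambda>x. h (snd x)) \<in> borel_measurable (circle \<Otimes>\<^sub>M circle)"
      using measurable_compose[OF measurable_snd hm] by auto
    show ?thesis unfolding poisson_def split_beta' by measurable
  qed
  have "(\<integral>\<^sup>+t. ennreal (cmod (poisson_int h (of_real r * t))) \<partial>circle) \<le> (\<integral>\<^sup>+t. (\<integral>\<^sup>+\<tau>. ?f t \<tau> \<partial>circle) \<partial>circle)"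
  proof (intro nn_integral_mono)
    fix t assume "t \<in> space circle"
    then have t: "cmod t = 1" by (simp add: space_circle)
    have i: "integrable circle (\<lambda>\<tau>. h \<tau> * of_real (poisson (of_real r * t) \<tau>))"
      by (rule integrable_mult_poisson[OF h rt[OF t]])
    have "ennreal (cmod (poisson_int h (of_real r * t))) \<le> (\<integral>\<^sup>+\<tau>. ennreal (cmod (h \<tau> * of_real (poisson (of_real r * t) \<tau>))) \<partial>circle)"
      unfolding poisson_int_def by (rule integral_norm_bound_ennreal[OF i])
    also have "\<dots> = (\<integral>\<^sup>+\<tau>. ?f t \<tau> \<partial>circle)"
      using poisson_nonneg[OF rt[OF t]] by (intro nn_integral_cong) (simp add: norm_mult ennreal_mult)
    finally show "ennreal (cmod (poisson_int h (of_real r * t))) \<le> (\<integral>\<^sup>+\<tau>. ?f t \<tau> \<partial>circle)" .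
  qed
  also have "\<dots> = (\<integral>\<^sup>+\<tau>. (\<integral>\<^sup>+t. ?f t \<tau> \<partial>circle) \<partial>circle)"
    by (rule Fubini'[OF m, symmetric])
  also have "\<dots> = (\<integral>\<^sup>+\<tau>. ennreal (cmod (h \<tau>)) \<partial>circle)"
  proof (intro nn_integral_cong)
    fix \<tau> assume "\<tau> \<in> space circle"
    then have t: "cmod \<tau> = 1" by (simp add: space_circle)
    have "(\<integral>\<^sup>+t. ?f t \<tau> \<partial>circle) = (\<integral>\<^sup>+t. ennreal (cmod (h \<tau>)) * ennreal (poisson (of_real r * \<tau>) t) \<partial>circle)"
      using poisson_sym[OF _ t r] by (intro nn_integral_cong) (simp add: space_circle)
    also have "\<dots> = ennreal (cmod (h \<tau>)) * (\<integral>\<^sup>+t. ennreal (poisson (of_real r * \<tau>) t) \<partial>circle)"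
      by (intro nn_integral_cmult measurable_compose[OF borel_measurable_circle[OF poisson_measurable]]) simp
    also have "(\<integral>\<^sup>+t. ennreal (poisson (of_real r * \<tau>) t) \<partial>circle) = ennreal (\<integral>t. poisson (of_real r * \<tau>) t \<partial>circle)"
      by (intro nn_integral_eq_integral integral_poisson(1) AE_I2 poisson_nonneg rt t)
    also have "\<dots> = 1" using integral_poisson(2)[OF rt[OF t]] by simp
    finally show "(\<integral>\<^sup>+t. ?f t \<tau> \<partial>circle) = ennreal (cmod (h \<tau>))" by simp
  qed
  also have "\<dots> = ennreal (\<integral>t. cmod (h t) \<partial>circle)"
    using h by (intro nn_integral_eq_integral) auto
  finally show ?thesis .
qed

text \<open>For k >= 0 the power series of the Cauchy transform has a single term; negative k follow
  by conjugation because the kernel is real.\<close>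

lemma poisson_int_powi:
  assumes t: "cmod t = 1" and r: "0 \<le> r" "r < 1"
  shows "poisson_int (\<lambda>\<tau>. \<tau> powi k) (of_real r * t) = of_real (r ^ nat \<bar>k\<bar>) * t powi k"
proof -
  have z: "cmod (of_real r * t) < 1" using t r by (simp add: norm_mult)
  have i: "integrable circle (\<lambda>\<tau>. \<tau> powi k)" for k
    by (intro integrable_circle_continuous continuous_on_powi_circle)
  have pos: "poisson_int (\<lambda>\<tau>. \<tau> powi int n) (of_real r * t) = of_real (r ^ n) * t powi int n" for n
  proof -
    have "poisson_int (\<lambda>\<tau>. \<tau> powi int n) (of_real r * t) = cauchy_transform (\<lambda>\<tau>. \<tau> powi int n) (of_real r * t)"
    proof (rule poisson_int_analytic[OF i _ z])
      show "fourier_coeff (\<lambda>\<tau>. \<tau> powi int n) m = 0" if "m < 0" for m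
        unfolding fourier_coeff_powi using that by simp
    qed
    moreover have "(\<lambda>m. if m = n then (of_real r * t) ^ m else 0) sums cauchy_transform (\<lambda>\<tau>. \<tau> powi int n) (of_real r * t)"
    proof -
      have "(\<lambda>m. fourier_coeff (\<lambda>\<tau>. \<tau> powi int n) (int m) * (of_real r * t) ^ m) = (\<lambda>m. if m = n then (of_real r * t) ^ m else 0)"
        unfolding fourier_coeff_powi by auto
      then show ?thesis using cauchy_transform_sums[OF i z, of "int n"] by (simp only:)
    qed
    ultimately have "poisson_int (\<lambda>\<tau>. \<tau> powi int n) (of_real r * t) = (of_real r * t) ^ n"
      using sums_unique2[OF _ sums_single[of n "\<lambda>m. (of_real r * t) ^ m"]] by (simp only:)
    then show ?thesis by (simp add: power_mult_distrib)
  qed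
  show ?thesis
  proof (cases "0 \<le> k")
    case True
    then show ?thesis using pos[of "nat k"] by simp
  next
    case False
    then have k: "k = - int (nat \<bar>k\<bar>)" by simp
    define n where "n = nat \<bar>k\<bar>"
    have kn: "k = - int n" using False by (simp add: n_def)
    have "poisson_int (\<lambda>\<tau>. \<tau> powi k) (of_real r * t) = (\<integral>\<tau>. cnj (\<tau> powi int n * of_real (poisson (of_real r * t) \<tau>)) \<partial>circle)"
      unfolding poisson_int_def kn
    proof (intro Bochner_Integration.integral_cong refl)
      fix \<tau> assume "\<tau> \<in> space circle"
      then have "cnj (\<tau> powi int n) = \<tau> powi (- int n)" by (intro cnj_powi_unit) (simp add: space_circle)
      then show "\<tau> powi (- int n) * of_real (poisson (of_real r * t) \<tau>) = cnj (\<tau> powi int n * of_real (poisson (of_real r * t) \<tau>))"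
        by (simp only: complex_cnj_mult complex_cnj_complex_of_real)
    qed
    also have "\<dots> = cnj (poisson_int (\<lambda>\<tau>. \<tau> powi int n) (of_real r * t))"
      unfolding poisson_int_def by (rule Bochner_Integration.integral_cnj)
    also have "\<dots> = of_real (r ^ n) * t powi (- int n)"
      unfolding pos complex_cnj_mult cnj_powi_unit[OF t] by simp
    finally show ?thesis unfolding kn[symmetric] unfolding n_def .
  qed
qed

section \<open>An outer multiplier\<close>

text \<open>Here linearity comes from the principal values themselves: the outer multiplier is built
  for functions of \<open>X\<close>, where the projection is not assumed to be bounded.\<close>

lemma riesz_diff_pv:
  assumes "integrable circle f" "integrable circle g" "pv_exists f t" "pv_exists g t"
  shows "riesz (\<lambda>s. f s - g s) t = riesz f t - riesz g t"
proof -
  obtain a b where a: "((\<lambda>\<epsilon>. strunc f \<epsilon> t) \<longlongrightarrow> a) (at_right 0)" and b: "((\<lambda>\<epsilon>. strunc g \<epsilon> t) \<longlongrightarrow> b) (at_right 0)"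
    using assms unfolding pv_exists_def by blast
  have "((\<lambda>\<epsilon>. strunc f \<epsilon> t + -1 * strunc g \<epsilon> t) \<longlongrightarrow> a + -1 * b) (at_right 0)"
    by (intro tendsto_intros a b)
  moreover have "\<forall>\<^sub>F \<epsilon> in at_right 0. strunc f \<epsilon> t + -1 * strunc g \<epsilon> t = strunc (\<lambda>s. f s + -1 * g s) \<epsilon> t"
    using assms
    by (intro eventually_at_right_less[THEN eventually_mono])
       (simp only: strunc_add integrable_mult_right strunc_cmult)
  ultimately have "((\<lambda>\<epsilon>. strunc (\<lambda>s. f s + -1 * g s) \<epsilon> t) \<longlongrightarrow> a + -1 * b) (at_right 0)"
    by (rule Lim_transform_eventually)
  then have c: "((\<lambda>\<epsilon>. strunc (\<lambda>s. f s - g s) \<epsilon> t) \<longlongrightarrow> a - b) (at_right 0)" by simp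
  have S: "singular_integral h t = l / (of_real pi * \<i>)" if "((\<lambda>\<epsilon>. strunc h \<epsilon> t) \<longlongrightarrow> l) (at_right 0)" for h l
    by (rule singular_integral_eq) (use that in simp)
  show ?thesis
    unfolding riesz_def S[OF a] S[OF b] S[OF c] by (simp add: field_simps)
qed

lemma riesz_trig_poly_diff:
  assumes "trig_poly p" "trig_poly q" "cmod t = 1"
  shows "riesz (\<lambda>s. p s - q s) t = riesz p t - riesz q t"
proof -
  have "pv_exists p t" if tp: "trig_poly p" for p
  proof -
    obtain K c where "finite K" "\<forall>t\<in>sphere 0 1. p t = (\<Sum>k\<in>K. c k * t powi k)"
      using tp unfolding trig_poly_def by blast
    then show ?thesis using assms(3) by (intro riesz_trig_poly(1)[of K p c]) auto
  qed
  then show ?thesis using assms by (intro riesz_diff_pv trig_poly_integrable)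
qed

text \<open>Truncation in L2 followed by bounded approximation. The approximants stay nonnegative so
  that their Herglotz transforms have nonnegative real part, which keeps the denominators of the
  multipliers away from 0.\<close>

lemma square_dense:
  fixes w :: "complex \<Rightarrow> real"
  assumes w: "w \<in> borel_measurable circle" "\<And>t. cmod t = 1 \<Longrightarrow> 0 \<le> w t" "integrable circle (\<lambda>t. (w t)\<^sup>2)" and e: "0 < e"
  obtains q :: "complex \<Rightarrow> real" where "trig_poly (\<lambda>t. of_real (q t))" "\<And>t. cmod t = 1 \<Longrightarrow> 0 \<le> q t"
    "integrable circle (\<lambda>t. (w t - q t)\<^sup>2)" "(\<integral>t. (w t - q t)\<^sup>2 \<partial>circle) < e"
proof -
  define v where "v n t = min (w t) (real n)" for n t
  have vm: "v n \<in> borel_measurable circle" for n unfolding v_def using w by simp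
  have vb: "0 \<le> v n t \<and> v n t \<le> real n" if "cmod t = 1" for n t using w(2)[OF that] by (simp add: v_def)
  have "(\<lambda>n. \<integral>t. (w t - v n t)\<^sup>2 \<partial>circle) \<longlonglongrightarrow> (\<integral>t. 0 \<partial>circle)"
  proof (rule integral_dominated_convergence[where w="\<lambda>t. (w t)\<^sup>2"])
    show "AE t in circle. (\<lambda>n. (w t - v n t)\<^sup>2) \<longlonglongrightarrow> 0"
    proof (rule AE_I2)
      fix t
      obtain n0 where "w t \<le> real n0" using real_arch_simple by blast
      then have "(w t - v n t)\<^sup>2 = 0" if "n \<ge> n0" for n using that by (simp add: v_def)
      then show "(\<lambda>n. (w t - v n t)\<^sup>2) \<longlonglongrightarrow> 0"
        by (intro tendsto_eventually) (auto simp: eventually_sequentially)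
    qed
    show "AE t in circle. norm ((w t - v n t)\<^sup>2) \<le> (w t)\<^sup>2" for n
    proof (rule AE_circleI)
      fix t :: complex assume "cmod t = 1"
      then have "0 \<le> w t - v n t" "w t - v n t \<le> w t" using vb[of t n] by (auto simp: v_def)
      then show "norm ((w t - v n t)\<^sup>2) \<le> (w t)\<^sup>2" by (simp add: power_mono)
    qed
  qed (use w vm in auto)
  then have "\<forall>\<^sub>F n in sequentially. (\<integral>t. (w t - v n t)\<^sup>2 \<partial>circle) < e / 4"
    using e by (intro order_tendstoD(2)) auto
  then obtain n where n: "(\<integral>t. (w t - v n t)\<^sup>2 \<partial>circle) < e / 4"
    using eventually_happens'[OF sequentially_bot] by blast
  obtain p :: "nat \<Rightarrow> complex \<Rightarrow> real" where p: "\<And>k. trig_poly (\<lambda>t. of_real (p k t))"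
    "\<And>k t. cmod t = 1 \<Longrightarrow> 0 < p k t \<and> p k t < real n + 1" "AE t in circle. (\<lambda>k. p k t) \<longlonglongrightarrow> v n t"
    by (rule bounded_trig_seq_real[OF vm[of n] vb], assumption) (rule that)
  have pm: "p k \<in> borel_measurable circle" for k
    using measurable_compose[OF trig_poly_measurable[OF p(1)[of k]] borel_measurable_Re] by simp
  have vp: "\<bar>v n t - p k t\<bar> \<le> real n + 1" if "cmod t = 1" for k t
    using vb[OF that, of n] p(2)[OF that, of k] by (simp add: abs_le_iff)
  have "(\<lambda>k. \<integral>t. (v n t - p k t)\<^sup>2 \<partial>circle) \<longlonglongrightarrow> (\<integral>t. 0 \<partial>circle)"
  proof (rule integral_dominated_convergence[where w="\<lambda>t. (real n + 1)\<^sup>2"])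
    show "AE t in circle. (\<lambda>k. (v n t - p k t)\<^sup>2) \<longlonglongrightarrow> 0"
      using p(3)
    proof eventually_elim
      case (elim t)
      have "(\<lambda>k. (v n t - p k t)\<^sup>2) \<longlonglongrightarrow> (v n t - v n t)\<^sup>2" by (intro tendsto_intros elim)
      then show ?case by simp
    qed
    show "AE t in circle. norm ((v n t - p k t)\<^sup>2) \<le> (real n + 1)\<^sup>2" for k
    proof (rule AE_circleI)
      fix t :: complex assume "cmod t = 1"
      from vp[OF this, of k] have "\<bar>v n t - p k t\<bar>\<^sup>2 \<le> (real n + 1)\<^sup>2" by (intro power_mono) auto
      then show "norm ((v n t - p k t)\<^sup>2) \<le> (real n + 1)\<^sup>2" by simp
    qed
  qed (use vm pm in auto)
  then have "\<forall>\<^sub>F k in sequentially. (\<integral>t. (v n t - p k t)\<^sup>2 \<partial>circle) < e / 4"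
    using e by (intro order_tendstoD(2)) auto
  then obtain k where k: "(\<integral>t. (v n t - p k t)\<^sup>2 \<partial>circle) < e / 4"
    using eventually_happens'[OF sequentially_bot] by blast
  have i1: "integrable circle (\<lambda>t. (w t - v n t)\<^sup>2)"
  proof (rule Bochner_Integration.integrable_bound[OF w(3)])
    show "AE t in circle. norm ((w t - v n t)\<^sup>2) \<le> norm ((w t)\<^sup>2)"
    proof (rule AE_circleI)
      fix t :: complex assume "cmod t = 1"
      then have "0 \<le> w t - v n t" "w t - v n t \<le> w t" using vb[of t n] by (auto simp: v_def)
      then show "norm ((w t - v n t)\<^sup>2) \<le> norm ((w t)\<^sup>2)" by (simp add: power_mono)
    qed
  qed (use w vm in auto)
  have i2: "integrable circle (\<lambda>t. (v n t - p k t)\<^sup>2)"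
  proof (rule integrable_circle_bounded[where B="(real n + 1)\<^sup>2"])
    fix t :: complex assume "cmod t = 1"
    from vp[OF this, of k] have "\<bar>v n t - p k t\<bar>\<^sup>2 \<le> (real n + 1)\<^sup>2" by (intro power_mono) auto
    then show "norm ((v n t - p k t)\<^sup>2) \<le> (real n + 1)\<^sup>2" by simp
  qed (use vm pm in auto)
  have sq: "(w t - p k t)\<^sup>2 \<le> 2 * (w t - v n t)\<^sup>2 + 2 * (v n t - p k t)\<^sup>2" for t
  proof -
    have "0 \<le> ((w t - v n t) - (v n t - p k t))\<^sup>2" by simp
    then show ?thesis by (simp add: power2_eq_square algebra_simps)
  qed
  have i3: "integrable circle (\<lambda>t. (w t - p k t)\<^sup>2)"
  proof (rule Bochner_Integration.integrable_bound)
    show "integrable circle (\<lambda>t. 2 * (w t - v n t)\<^sup>2 + 2 * (v n t - p k t)\<^sup>2)" using i1 i2 by simp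
    show "AE t in circle. norm ((w t - p k t)\<^sup>2) \<le> norm (2 * (w t - v n t)\<^sup>2 + 2 * (v n t - p k t)\<^sup>2)"
      using sq by (intro AE_I2) simp
  qed (use w pm in auto)
  have "(\<integral>t. (w t - p k t)\<^sup>2 \<partial>circle) \<le> (\<integral>t. 2 * (w t - v n t)\<^sup>2 + 2 * (v n t - p k t)\<^sup>2 \<partial>circle)"
    by (intro integral_mono i3 sq) (use i1 i2 in simp)
  also have "\<dots> = 2 * (\<integral>t. (w t - v n t)\<^sup>2 \<partial>circle) + 2 * (\<integral>t. (v n t - p k t)\<^sup>2 \<partial>circle)"
    using i1 i2 by simp
  also have "\<dots> < e" using n k by simp
  finally show thesis using that[of "p k"] p(1,2) i3 less_imp_le by blast
qed

text \<open>The boundary function \<open>h\<close> of the Herglotz transform of \<open>w = |f|^(1/2)\<close> gives the multipliers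
  \<open>(1 + h / n)^(-2)\<close>: they are analytic, of modulus at most 1, make \<open>f\<close> bounded and tend to 1.\<close>

lemma outer_multiplier:
  assumes f: "integrable circle f" and neg: "\<And>n. n < 0 \<Longrightarrow> fourier_coeff f n = 0"
  obtains h where "h \<in> borel_measurable circle" "AE t in circle. Re (h t) = sqrt (cmod (f t))"
    "\<And>n m. 0 < n \<Longrightarrow> m < 0 \<Longrightarrow> fourier_coeff (\<lambda>t. f t * (1 / (1 + h t / of_nat n)\<^sup>2)) m = 0"
proof -
  have fm: "f \<in> borel_measurable circle" using f by simp
  \<comment> \<open>The square root places \<open>w\<close> in L2, where Parseval controls the
    conjugate function; the square in the multiplier compensates for it, since |1 + h / n|^2 >= |f|
    / n^2.\<close>
  define w where "w t = sqrt (cmod (f t))" for t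
  have wm: "w \<in> borel_measurable circle" unfolding w_def using fm by simp
  have w2: "integrable circle (\<lambda>t. (w t)\<^sup>2)" unfolding w_def using f by simp
  have ex: "\<exists>q. trig_poly (\<lambda>t. of_real (q t)) \<and> (\<forall>t. cmod t = 1 \<longrightarrow> 0 \<le> q t) \<and>
      integrable circle (\<lambda>t. (w t - q t)\<^sup>2) \<and> (\<integral>t. (w t - q t)\<^sup>2 \<partial>circle) < 1 / real (Suc j)" for j
    by (rule square_dense[OF wm _ w2, of "1 / real (Suc j)"]) (auto simp: w_def)
  from choice[OF allI[OF ex]] obtain q :: "nat \<Rightarrow> complex \<Rightarrow> real" where
    q0: "\<forall>j. trig_poly (\<lambda>t. of_real (q j t)) \<and> (\<forall>t. cmod t = 1 \<longrightarrow> 0 \<le> q j t) \<and>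
      integrable circle (\<lambda>t. (w t - q j t)\<^sup>2) \<and> (\<integral>t. (w t - q j t)\<^sup>2 \<partial>circle) < 1 / real (Suc j)" ..
  have q: "\<And>j. trig_poly (\<lambda>t. of_real (q j t))"
    "\<And>j t. cmod t = 1 \<Longrightarrow> 0 \<le> q j t" "\<And>j. integrable circle (\<lambda>t. (w t - q j t)\<^sup>2)"
    "\<And>j. (\<integral>t. (w t - q j t)\<^sup>2 \<partial>circle) < 1 / real (Suc j)"
    using q0 by blast+
  let ?Q = "\<lambda>j t. complex_of_real (q j t)"
  have exF: "\<exists>F. F holomorphic_on UNIV \<and> (\<forall>t. cmod t = 1 \<longrightarrow> F t = 2 * riesz (?Q j) t - of_real (\<integral>t. q j t \<partial>circle))
      \<and> (\<forall>t. cmod t = 1 \<longrightarrow> Re (F t) = q j t) \<and> (\<forall>z. cmod z < 1 \<longrightarrow> F z = herglotz (?Q j) z)" for j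
    by (rule trig_poly_herglotz[OF q(1)[of j]]) blast
  from choice[OF allI[OF exF]] obtain F where
    F0: "\<forall>j. F j holomorphic_on UNIV \<and> (\<forall>t. cmod t = 1 \<longrightarrow> F j t = 2 * riesz (?Q j) t - of_real (\<integral>t. q j t \<partial>circle))
      \<and> (\<forall>t. cmod t = 1 \<longrightarrow> Re (F j t) = q j t) \<and> (\<forall>z. cmod z < 1 \<longrightarrow> F j z = herglotz (?Q j) z)" ..
  have F: "\<And>j. F j holomorphic_on UNIV"
    "\<And>j t. cmod t = 1 \<Longrightarrow> F j t = 2 * riesz (?Q j) t - of_real (\<integral>t. q j t \<partial>circle)"
    "\<And>j t. cmod t = 1 \<Longrightarrow> Re (F j t) = q j t" "\<And>j z. cmod z < 1 \<Longrightarrow> F j z = herglotz (?Q j) z"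
    using F0 by blast+
  have Fc: "continuous_on S (F j)" for j S
    using holomorphic_on_imp_continuous_on[OF F(1)] continuous_on_subset by blast
  have Fi: "integrable circle (F j)" for j by (intro integrable_circle_continuous Fc)
  have qi: "integrable circle (q j)" for j using integrable_Re[OF trig_poly_integrable[OF q(1)]] by simp
  have Re_F: "0 \<le> Re (F j z)" if "cmod z \<le> 1" for j z
  proof (cases "cmod z = 1")
    case False
    then have "cmod z < 1" using that by simp
    then show ?thesis unfolding F(4)[OF \<open>cmod z < 1\<close>] by (intro Re_herglotz_ge qi q(2))
  qed (use F(3) q(2) in simp)
  \<comment> \<open>Twice the projection of the difference and once the difference of the means
    account for the factor 3.\<close>
  have FF: "(\<integral>t. cmod (F i t - F j t) \<partial>circle) \<le> 3 * sqrt (2 / real (Suc i) + 2 / real (Suc j))" for i j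
  proof -
    let ?d = "\<lambda>t. complex_of_real (q i t - q j t)"
    have d: "trig_poly ?d" using trig_poly_diff[OF q(1)[of i] q(1)[of j]] by simp
    have sq: "(q i t - q j t)\<^sup>2 \<le> 2 * (w t - q i t)\<^sup>2 + 2 * (w t - q j t)\<^sup>2" for t
    proof -
      have "0 \<le> ((w t - q i t) + (w t - q j t))\<^sup>2" by simp
      then show ?thesis by (simp add: power2_eq_square algebra_simps)
    qed
    have cd: "(\<lambda>t. (cmod (?d t))\<^sup>2) = (\<lambda>t. (q i t - q j t)\<^sup>2)" by (simp only: norm_of_real power2_abs)
    have di: "integrable circle (\<lambda>t. (cmod (?d t))\<^sup>2)"
      by (intro integrable_circle_continuous continuous_intros trig_poly_continuous[OF d])
    have "(\<integral>t. (cmod (?d t))\<^sup>2 \<partial>circle) \<le> (\<integral>t. 2 * (w t - q i t)\<^sup>2 + 2 * (w t - q j t)\<^sup>2 \<partial>circle)"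
      using di sq unfolding cd by (intro integral_mono) (use q(3) in auto)
    also have "\<dots> = 2 * (\<integral>t. (w t - q i t)\<^sup>2 \<partial>circle) + 2 * (\<integral>t. (w t - q j t)\<^sup>2 \<partial>circle)"
      using q(3) by simp
    also have "\<dots> \<le> 2 / real (Suc i) + 2 / real (Suc j)"
      using q(4)[of i] q(4)[of j] by simp
    finally have D: "(\<integral>t. (cmod (?d t))\<^sup>2 \<partial>circle) \<le> 2 / real (Suc i) + 2 / real (Suc j)" .
    have rd: "trig_poly (riesz ?d)" by (rule riesz_trig_poly_trig(1)[OF d])
    have rdi: "integrable circle (\<lambda>t. (cmod (riesz ?d t))\<^sup>2)"
      by (intro integrable_circle_continuous continuous_intros trig_poly_continuous[OF rd])
    have A: "(\<integral>t. cmod (riesz ?d t) \<partial>circle) \<le> sqrt (2 / real (Suc i) + 2 / real (Suc j))"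
      by (rule order_trans[OF integral_square_le(2)[OF rdi trig_poly_measurable[OF rd]]
            real_sqrt_le_mono[OF order_trans[OF riesz_trig_poly_L2[OF d] D]]])
    have B: "(\<integral>t. cmod (?d t) \<partial>circle) \<le> sqrt (2 / real (Suc i) + 2 / real (Suc j))"
      by (rule order_trans[OF integral_square_le(2)[OF di trig_poly_measurable[OF d]] real_sqrt_le_mono[OF D]])
    have C: "\<bar>(\<integral>t. q i t \<partial>circle) - (\<integral>t. q j t \<partial>circle)\<bar> \<le> (\<integral>t. cmod (?d t) \<partial>circle)"
    proof -
      have "(\<integral>t. q i t \<partial>circle) - (\<integral>t. q j t \<partial>circle) = (\<integral>t. q i t - q j t \<partial>circle)" using qi by simp
      then have "\<bar>(\<integral>t. q i t \<partial>circle) - (\<integral>t. q j t \<partial>circle)\<bar> \<le> (\<integral>t. norm (q i t - q j t) \<partial>circle)"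
        using integral_norm_bound[of circle "\<lambda>t. q i t - q j t"] by simp
      then show ?thesis by (simp only: norm_of_real real_norm_def)
    qed
    have "(\<integral>t. cmod (F i t - F j t) \<partial>circle) \<le> (\<integral>t. 2 * cmod (riesz ?d t) + \<bar>(\<integral>t. q i t \<partial>circle) - (\<integral>t. q j t \<partial>circle)\<bar> \<partial>circle)"
    proof (rule integral_mono)
      fix t assume "t \<in> space circle"
      then have t: "cmod t = 1" by (simp add: space_circle)
      have rdt: "riesz ?d t = riesz (?Q i) t - riesz (?Q j) t"
        using riesz_trig_poly_diff[OF q(1)[of i] q(1)[of j] t] by simp
      have "F i t - F j t = 2 * riesz ?d t - of_real ((\<integral>t. q i t \<partial>circle) - (\<integral>t. q j t \<partial>circle))"
        unfolding F(2)[OF t] rdt by (simp add: algebra_simps)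
      then have "cmod (F i t - F j t) \<le> cmod (2 * riesz ?d t) + cmod (of_real ((\<integral>t. q i t \<partial>circle) - (\<integral>t. q j t \<partial>circle)))"
        by (simp only: norm_triangle_ineq4)
      then show "cmod (F i t - F j t) \<le> 2 * cmod (riesz ?d t) + \<bar>(\<integral>t. q i t \<partial>circle) - (\<integral>t. q j t \<partial>circle)\<bar>"
        by (simp only: norm_mult norm_of_real norm_numeral)
    qed (use Fi trig_poly_integrable[OF rd] in auto)
    also have "\<dots> = 2 * (\<integral>t. cmod (riesz ?d t) \<partial>circle) + \<bar>(\<integral>t. q i t \<partial>circle) - (\<integral>t. q j t \<partial>circle)\<bar>"
      using trig_poly_integrable[OF rd] by simp
    also have "\<dots> \<le> 3 * sqrt (2 / real (Suc i) + 2 / real (Suc j))" using A B C by simp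
    finally show ?thesis .
  qed
  have cauchy: "\<exists>N. \<forall>i\<ge>N. \<forall>j\<ge>N. (\<integral>t. cmod (F i t - F j t) \<partial>circle) < e" if e: "0 < e" for e
  proof -
    have "(\<lambda>n. 3 * sqrt (2 * (1 / real (Suc n)) + 2 * (1 / real (Suc n)))) \<longlonglongrightarrow> 3 * sqrt (2 * 0 + 2 * 0)"
      by (intro tendsto_intros LIMSEQ_Suc[OF lim_1_over_n])
    then have "\<forall>\<^sub>F n in sequentially. 3 * sqrt (2 * (1 / real (Suc n)) + 2 * (1 / real (Suc n))) < e"
      using e by (intro order_tendstoD(2)) auto
    then obtain N where N: "3 * sqrt (2 * (1 / real (Suc N)) + 2 * (1 / real (Suc N))) < e"
      using eventually_happens'[OF sequentially_bot] by blast
    have "(\<integral>t. cmod (F i t - F j t) \<partial>circle) < e" if "i \<ge> N" "j \<ge> N" for i j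
    proof -
      have "2 / real (Suc i) \<le> 2 * (1 / real (Suc N))" "2 / real (Suc j) \<le> 2 * (1 / real (Suc N))"
        using that by (auto simp: frac_le)
      then have "sqrt (2 / real (Suc i) + 2 / real (Suc j)) \<le> sqrt (2 * (1 / real (Suc N)) + 2 * (1 / real (Suc N)))"
        by (intro real_sqrt_le_mono add_mono)
      then show ?thesis using FF[of i j] N by linarith
    qed
    then show ?thesis by blast
  qed
  obtain r where r: "strict_mono r" "AE t in circle. Cauchy (\<lambda>i. F (r i) t)"
    by (rule cauchy_L1_AE_cauchy_subseq[of circle F, OF Fi cauchy]) (use that in auto)
  define h where "h t = lim (\<lambda>i. F (r i) t)" for t
  have Fm: "F j \<in> borel_measurable circle" for j using Fi by simp
  have hm: "h \<in> borel_measurable circle" unfolding h_def using Fm by (intro borel_measurable_lim_metric)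
  have lim: "AE t in circle. (\<lambda>i. F (r i) t) \<longlonglongrightarrow> h t"
    using r(2) by eventually_elim (simp add: h_def Cauchy_convergent_iff convergent_LIMSEQ_iff)
  have wq: "integrable circle (\<lambda>t. (w t - q (r i) t)\<^sup>2)" for i by (rule q(3))
  have "(\<lambda>i. \<integral>t. norm ((w t - q (r i) t)\<^sup>2) \<partial>circle) \<longlonglongrightarrow> 0"
  proof (rule tendsto_sandwich[OF always_eventually always_eventually tendsto_const])
    show "\<forall>i. (\<integral>t. norm ((w t - q (r i) t)\<^sup>2) \<partial>circle) \<le> 1 / real (Suc i)"
    proof
      fix i
      have "(\<integral>t. norm ((w t - q (r i) t)\<^sup>2) \<partial>circle) \<le> 1 / real (Suc (r i))"
        using q(4)[of "r i"] by simp
      also have "\<dots> \<le> 1 / real (Suc i)" using seq_suble[OF r(1), of i] by (simp add: frac_le)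
      finally show "(\<integral>t. norm ((w t - q (r i) t)\<^sup>2) \<partial>circle) \<le> 1 / real (Suc i)" .
    qed
    show "(\<lambda>i. 1 / real (Suc i)) \<longlonglongrightarrow> 0" by (rule LIMSEQ_Suc[OF lim_1_over_n])
  qed auto
  then obtain s where s: "strict_mono s" "AE t in circle. (\<lambda>i. (w t - q (r (s i)) t)\<^sup>2) \<longlonglongrightarrow> 0"
    using tendsto_L1_AE_subseq[of circle "\<lambda>i t. (w t - q (r i) t)\<^sup>2", OF wq] by blast
  have Re_h: "AE t in circle. Re (h t) = sqrt (cmod (f t))"
    using s(2) lim AE_space
  proof eventually_elim
    case (elim t)
    then have t: "cmod t = 1" by (simp add: space_circle)
    have "(\<lambda>i. sqrt ((w t - q (r (s i)) t)\<^sup>2)) \<longlonglongrightarrow> sqrt 0" by (intro tendsto_intros elim)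
    then have "(\<lambda>i. w t - q (r (s i)) t) \<longlonglongrightarrow> 0" by (simp add: tendsto_rabs_zero_iff)
    then have "(\<lambda>i. w t - (w t - q (r (s i)) t)) \<longlonglongrightarrow> w t - 0" by (intro tendsto_intros)
    then have 1: "(\<lambda>i. q (r (s i)) t) \<longlonglongrightarrow> w t" by simp
    have "(\<lambda>i. Re (F (r (s i)) t)) \<longlonglongrightarrow> Re (h t)"
      using LIMSEQ_subseq_LIMSEQ[OF elim(2) s(1)] by (intro tendsto_intros) (simp add: o_def)
    then have "(\<lambda>i. q (r (s i)) t) \<longlonglongrightarrow> Re (h t)" by (simp add: F(3)[OF t])
    then have "Re (h t) = w t" using 1 LIMSEQ_unique by blast
    then show ?case by (simp add: w_def)
  qed
  have "fourier_coeff (\<lambda>t. f t * (1 / (1 + h t / of_nat n)\<^sup>2)) m = 0" if n: "0 < n" and m: "m < 0" for n :: nat and m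
  proof -
    \<comment> \<open>The functions 1 + F / n have real part at least 1 on the closed disc, so each
      factor is holomorphic there and of modulus at most 1 on the circle; |f| dominates the
      products.\<close>
    let ?K = "\<lambda>j z. 1 / (1 + F j z / of_nat n)\<^sup>2"
    have Rd: "1 \<le> Re (1 + z / of_nat n)" if "0 \<le> Re z" for z
      using that n by simp
    have nz: "1 + F j z / of_nat n \<noteq> 0" if "cmod z \<le> 1" for j z
      using Rd[OF Re_F[OF that, of j]] by (metis not_one_le_zero zero_complex.simps(1))
    have hol: "?K j holomorphic_on cball 0 1" for j
    proof -
      have "F j holomorphic_on cball 0 1" using F(1) holomorphic_on_subset by blast
      then show ?thesis using nz n by (intro holomorphic_intros) auto
    qed
    have z: "fourier_coeff (\<lambda>t. f t * ?K (r j) t) m = 0" for j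
      by (rule fourier_coeff_mult_holomorphic[OF f neg holomorphic_on_imp_continuous_on[OF hol] holomorphic_on_subset[OF hol] m]) auto
    have "(\<lambda>j. fourier_coeff (\<lambda>t. f t * ?K (r j) t) m) \<longlonglongrightarrow> fourier_coeff (\<lambda>t. f t * (1 / (1 + h t / of_nat n)\<^sup>2)) m"
    proof (rule fourier_coeff_tendsto[OF f])
      show "(\<lambda>t. f t * ?K (r j) t) \<in> borel_measurable circle" for j using fm Fm[of "r j"] by simp
      show "(\<lambda>t. f t * (1 / (1 + h t / of_nat n)\<^sup>2)) \<in> borel_measurable circle" using fm hm by simp
      show "AE t in circle. cmod (f t * ?K (r j) t) \<le> cmod (f t)" for j
      proof (rule AE_circleI)
        fix t :: complex assume t: "cmod t = 1"
        have "1 \<le> cmod (1 + F (r j) t / of_nat n)"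
          using Rd[OF Re_F[of t "r j"]] complex_Re_le_cmod[of "1 + F (r j) t / of_nat n"] t by linarith
        then have "1 \<le> (cmod (1 + F (r j) t / of_nat n))\<^sup>2" by (rule one_le_power)
        then have "cmod (?K (r j) t) \<le> 1" unfolding norm_divide norm_power norm_one by (simp only: div_by_1 le_divide_eq_1 divide_le_eq_1) simp
        then show "cmod (f t * ?K (r j) t) \<le> cmod (f t)"
          unfolding norm_mult by (rule mult_left_le) simp
      qed
      show "AE t in circle. (\<lambda>j. f t * ?K (r j) t) \<longlonglongrightarrow> f t * (1 / (1 + h t / of_nat n)\<^sup>2)"
        using lim AE_space
      proof eventually_elim
        case (elim t)
        then have t: "cmod t = 1" by (simp add: space_circle)
        have "(\<lambda>i. Re (F (r i) t)) \<longlonglongrightarrow> Re (h t)" by (intro tendsto_intros elim)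
        then have "0 \<le> Re (h t)" by (rule LIMSEQ_le_const) (use Re_F[of t] t in auto)
        then have "1 + h t / of_nat n \<noteq> 0" using Rd[of "h t"] by (metis not_one_le_zero zero_complex.simps(1))
        then show ?case using n by (intro tendsto_intros elim) auto
      qed
    qed
    then show ?thesis using z by (simp add: LIMSEQ_const_iff)
  qed
  with hm Re_h show thesis by (rule that)
qed

section \<open>Density of polynomials in separable spaces\<close>

context bfn
begin

lemma N_minus_commute: "N (\<lambda>t. f t - g t) = N (\<lambda>t. g t - f t)"
  unfolding bfs_norm_def by (simp add: norm_minus_commute)

lemma N_triangle:
  assumes "f \<in> borel_measurable circle" "g \<in> borel_measurable circle" "h \<in> borel_measurable circle"
    and "N (\<lambda>t. f t - g t) \<le> ennreal a" "N (\<lambda>t. g t - h t) \<le> ennreal b" "0 \<le> a" "0 \<le> b"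
  shows "N (\<lambda>t. f t - h t) \<le> ennreal (a + b)"
proof -
  have "N (\<lambda>t. f t - h t) = N (\<lambda>t. (f t - g t) + (g t - h t))" by simp
  also have "\<dots> \<le> N (\<lambda>t. f t - g t) + N (\<lambda>t. g t - h t)"
    using assms by (intro N_add) auto
  also have "\<dots> \<le> ennreal a + ennreal b" by (intro add_mono assms)
  finally show ?thesis using assms by (simp add: ennreal_plus)
qed

lemma L1_of_N:
  obtains C where "0 < C" "\<And>f e. f \<in> borel_measurable circle \<Longrightarrow> N f \<le> ennreal e \<Longrightarrow> 0 \<le> e \<Longrightarrow> (\<integral>t. cmod (f t) \<partial>circle) \<le> C * e"
proof -
  obtain C where C: "0 < C" "\<And>f. f \<in> bfs \<rho> \<Longrightarrow> ennreal (\<integral>t. cmod (f t) \<partial>circle) \<le> ennreal C * N f"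
    by (rule bfs_L1) (rule that)
  have "(\<integral>t. cmod (f t) \<partial>circle) \<le> C * e" if "f \<in> borel_measurable circle" "N f \<le> ennreal e" "0 \<le> e" for f e
  proof -
    have "f \<in> bfs \<rho>" by (rule bfsI[OF that(1,2)]) simp
    then have "ennreal (\<integral>t. cmod (f t) \<partial>circle) \<le> ennreal C * N f" by (rule C(2))
    also have "\<dots> \<le> ennreal C * ennreal e" by (intro mult_left_mono that) simp
    also have "\<dots> = ennreal (C * e)" using C(1) that(3) by (simp add: ennreal_mult)
    finally show ?thesis using C(1) that(3) by simp
  qed
  with C(1) show thesis by (rule that)
qed

end

locale separable_bfn = bfn +
  assumes separable: "separable_bfs \<rho>"
begin

text \<open>If the norm of \<open>f\<close> restricted to \<open>E n\<close> does not tend to 0, then differences of the sets \<open>E n\<close> yield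
  infinitely many disjoint pieces of \<open>f\<close> whose norms are bounded below; the sums over arbitrary sets
  of pieces form an uncountable separated set.\<close>

lemma absolutely_continuous_norm:
  assumes f: "f \<in> bfs \<rho>" and E: "\<And>n. E n \<in> sets circle" "\<And>n. E (Suc n) \<subseteq> E n" and null: "AE t in circle. \<exists>n. t \<notin> E n"
    and e: "0 < (e::real)"
  shows "\<exists>n. N (\<lambda>t. if t \<in> E n then f t else 0) \<le> ennreal e"
proof (rule ccontr)
  assume "\<not> (\<exists>n. N (\<lambda>t. if t \<in> E n then f t else 0) \<le> ennreal e)"
  then have big: "ennreal e < N (\<lambda>t. if t \<in> E n then f t else 0)" for n by (simp add: not_le)
  have fm: "f \<in> borel_measurable circle" by (rule bfs_measurable[OF f])
  have dec: "E m \<subseteq> E n" if "n \<le> m" for n m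
    using lift_Suc_antimono_le[of E, OF E(2) that] .
  have rm: "(\<lambda>t. if t \<in> S then f t else 0) \<in> borel_measurable circle" if "S \<in> sets circle" for S
    using fm that by (intro measurable_If_set) auto
  have "\<exists>m>n. ennreal e < N (\<lambda>t. if t \<in> E n - E m then f t else 0)" for n
  proof -
    \<comment> \<open>(A3) applies because E n - E m increases with m to E n, up to a null
      set.\<close>
    have "(\<lambda>m. N (\<lambda>t. if t \<in> E n - E m then f t else 0)) \<longlonglongrightarrow> N (\<lambda>t. if t \<in> E n then f t else 0)"
      unfolding bfs_norm_def
    proof (rule rho_monotone_convergence)
      show "(\<lambda>t. ennreal (cmod (if t \<in> E n - E m then f t else 0))) \<in> borel_measurable circle" for m
        using rm[of "E n - E m"] E(1) by simp
      show "(\<lambda>t. ennreal (cmod (if t \<in> E n then f t else 0))) \<in> borel_measurable circle"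
        using rm[of "E n"] E(1) by simp
      show "AE t in circle. incseq (\<lambda>m. ennreal (cmod (if t \<in> E n - E m then f t else 0))) \<and>
          (\<lambda>m. ennreal (cmod (if t \<in> E n - E m then f t else 0))) \<longlonglongrightarrow> ennreal (cmod (if t \<in> E n then f t else 0))"
        using null
      proof eventually_elim
        case (elim t)
        then obtain k where k: "t \<notin> E k" by blast
        have "incseq (\<lambda>m. ennreal (cmod (if t \<in> E n - E m then f t else 0)))"
          using dec by (intro monoI ennreal_leI) auto
        moreover have "t \<notin> E m" if "m \<ge> k" for m using dec[OF that] k by blast
        then have "(\<lambda>m. ennreal (cmod (if t \<in> E n - E m then f t else 0))) \<longlonglongrightarrow> ennreal (cmod (if t \<in> E n then f t else 0))"
          by (intro tendsto_eventually) (auto simp: eventually_sequentially)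
        ultimately show ?case by blast
      qed
    qed
    then have "\<forall>\<^sub>F m in sequentially. ennreal e < N (\<lambda>t. if t \<in> E n - E m then f t else 0)"
      using big by (rule order_tendstoD(1))
    then have "\<forall>\<^sub>F m in sequentially. n < m \<and> ennreal e < N (\<lambda>t. if t \<in> E n - E m then f t else 0)"
      using eventually_gt_at_top[of n] by eventually_elim simp
    then show ?thesis using eventually_happens'[OF sequentially_bot] by blast
  qed
  then obtain nx where nx: "\<And>n. n < nx n" "\<And>n. ennreal e < N (\<lambda>t. if t \<in> E n - E (nx n) then f t else 0)"
    by metis
  define k where "k i = (nx ^^ i) 0" for i
  have kS: "k (Suc i) = nx (k i)" for i by (simp add: k_def)
  have "strict_mono k" by (rule strict_monoI_Suc) (simp add: kS nx)
  then have kmono: "k i \<le> k j" if "i \<le> j" for i j using that by (simp add: strict_mono_less_eq)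
  define P where "P i = E (k i) - E (k (Suc i))" for i
  have Pm: "P i \<in> sets circle" for i using E(1) by (simp add: P_def)
  have disj: "i = j" if "t \<in> P i" "t \<in> P j" for t i j
  proof (rule ccontr)
    assume "i \<noteq> j"
    then consider "Suc i \<le> j" | "Suc j \<le> i" by linarith
    then show False
    proof cases
      case 1
      then show False using that dec[OF kmono[OF 1]] by (auto simp: P_def)
    next
      case 2
      then show False using that dec[OF kmono[OF 2]] by (auto simp: P_def)
    qed
  qed
  define fS where "fS S t = (if t \<in> (\<Union>i\<in>S. P i) then f t else 0)" for S t
  have fSm: "fS S \<in> borel_measurable circle" for S
    unfolding fS_def using Pm by (intro rm sets.countable_UN'') auto
  have fSX: "fS S \<in> bfs \<rho>" for S
    by (rule bfs_mono[OF f fSm]) (auto simp: fS_def)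
  have sep: "ennreal e < N (\<lambda>t. fS S t - fS T t)" if "i \<in> S" "i \<notin> T" for S T i
  proof -
    have "ennreal e < N (\<lambda>t. if t \<in> P i then f t else 0)" unfolding P_def kS by (rule nx(2))
    also have "\<dots> \<le> N (\<lambda>t. fS S t - fS T t)"
    proof (rule N_mono)
      show "(\<lambda>t. fS S t - fS T t) \<in> borel_measurable circle" using fSm by simp
      show "(\<lambda>t. if t \<in> P i then f t else 0) \<in> borel_measurable circle" by (rule rm[OF Pm])
      show "AE t in circle. cmod (if t \<in> P i then f t else 0) \<le> cmod (fS S t - fS T t)"
      proof (rule AE_I2)
        fix t
        show "cmod (if t \<in> P i then f t else 0) \<le> cmod (fS S t - fS T t)"
        proof (cases "t \<in> P i")
          case True
          then have "t \<in> (\<Union>i\<in>S. P i)" "t \<notin> (\<Union>i\<in>T. P i)" using that disj by blast+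
          then show ?thesis unfolding fS_def by simp
        qed simp
      qed
    qed
    finally show ?thesis .
  qed
  have sep': "ennreal e < N (\<lambda>t. fS S t - fS T t)" if "S \<noteq> T" for S T
  proof -
    from that obtain i where "i \<in> S \<and> i \<notin> T \<or> i \<in> T \<and> i \<notin> S" by blast
    then show ?thesis using sep[of i S T] sep[of i T S] N_minus_commute[of "fS S" "fS T"] by auto
  qed
  obtain D where D: "D \<subseteq> bfs \<rho>" "countable D"
    "\<And>f e. f \<in> bfs \<rho> \<Longrightarrow> 0 < (e::real) \<Longrightarrow> \<exists>d\<in>D. N (\<lambda>t. f t - d t) < ennreal e"
    using separable unfolding separable_bfs_def by blast
  have "\<exists>d. d \<in> D \<and> N (\<lambda>t. fS S t - d t) < ennreal (e / 2)" for S
    using D(3)[OF fSX, of "e/2" S] e by auto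
  from choice[OF allI[OF this]] obtain d where d: "\<forall>S. d S \<in> D \<and> N (\<lambda>t. fS S t - d S t) < ennreal (e / 2)" ..
  \<comment> \<open>Sums over different index sets are more than e apart and cannot share an
    approximant within e / 2; a countable dense set would therefore make the power set of the
    naturals countable.\<close>
  have "inj d"
  proof (rule injI, rule ccontr)
    fix S T assume eq: "d S = d T" and ne: "S \<noteq> T"
    have dm: "d S \<in> borel_measurable circle" using d D(1) bfs_measurable by blast
    have "N (\<lambda>t. fS S t - fS T t) \<le> ennreal (e / 2 + e / 2)"
    proof (rule N_triangle[OF fSm dm fSm])
      show "N (\<lambda>t. fS S t - d S t) \<le> ennreal (e / 2)" using d less_imp_le by blast
      show "N (\<lambda>t. d S t - fS T t) \<le> ennreal (e / 2)"
        unfolding eq N_minus_commute[of "d T"] using d less_imp_le by blast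
    qed (use e in auto)
    then show False using sep'[OF ne] by simp
  qed
  moreover have "countable (range d)" by (rule countable_subset[OF _ D(2)]) (use d in auto)
  ultimately have "countable (UNIV :: nat set set)" by (rule countable_image_inj_on[rotated])
  then obtain g :: "nat \<Rightarrow> nat set" where "range g = UNIV"
    by (intro that[of "from_nat_into UNIV"] range_from_nat_into) auto
  then show False using Cantors_theorem[of "UNIV :: nat set"] by auto
qed

text \<open>Egorov-type splitting: outside E n the differences from index n on are at most \<delta>
  and contribute \<delta> times the norm of 1; on E n they are at most 2 |g|, whose norm over E n
  becomes small because these sets shrink to a null set.\<close>

lemma dominated_convergence:
  assumes fm: "\<And>n::nat. F n \<in> borel_measurable circle" and hm: "h \<in> borel_measurable circle" and g: "g \<in> bfs \<rho>"
    and bd: "\<And>n. AE t in circle. cmod (F n t) \<le> cmod (g t)" and lim: "AE t in circle. (\<lambda>n. F n t) \<longlonglongrightarrow> h t"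
    and e: "0 < (e::real)"
  shows "\<exists>n. N (\<lambda>t. F n t - h t) \<le> ennreal e"
proof -
  have gm: "g \<in> borel_measurable circle" by (rule bfs_measurable[OF g])
  obtain n1 where n1: "N (\<lambda>_. 1) = ennreal n1" "0 \<le> n1" using N_one by (cases "N (\<lambda>_. 1)") auto
  define \<delta> where "\<delta> = e / (2 * (n1 + 1))"
  have \<delta>: "0 < \<delta>" "\<delta> * n1 \<le> e / 2" using e n1 by (auto simp: \<delta>_def field_simps add_pos_nonneg)
  define E where "E n = {t \<in> space circle. \<exists>k\<ge>n. \<delta> < cmod (F k t - h t)}" for n
  have Em: "E n \<in> sets circle" for n
  proof -
    have "E n = (\<Union>k\<in>{n..}. {t \<in> space circle. \<delta> < cmod (F k t - h t)})" by (auto simp: E_def)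
    moreover have "{t \<in> space circle. \<delta> < cmod (F k t - h t)} \<in> sets circle" for k
      using fm[of k] hm by (intro borel_measurable_less) auto
    ultimately show ?thesis by (auto intro!: sets.countable_UN'')
  qed
  have Edec: "E (Suc n) \<subseteq> E n" for n by (auto simp: E_def intro: Suc_leD)
  have null: "AE t in circle. \<exists>n. t \<notin> E n"
    using lim
  proof eventually_elim
    case (elim t)
    then have "(\<lambda>n. F n t - h t) \<longlonglongrightarrow> 0" by (rule LIM_zero)
    then have "(\<lambda>n. cmod (F n t - h t)) \<longlonglongrightarrow> 0" by (rule tendsto_norm_zero)
    then have "\<forall>\<^sub>F n in sequentially. cmod (F n t - h t) < \<delta>" using \<delta> by (intro order_tendstoD(2)) auto
    then obtain n where "\<And>k. k \<ge> n \<Longrightarrow> cmod (F k t - h t) < \<delta>" by (auto simp: eventually_sequentially)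
    then have "t \<notin> E n" by (force simp: E_def)
    then show ?case ..
  qed
  have hb: "AE t in circle. cmod (h t) \<le> cmod (g t)"
  proof -
    have "AE t in circle. \<forall>n. cmod (F n t) \<le> cmod (g t)" unfolding AE_all_countable using bd by blast
    with lim show ?thesis
    proof eventually_elim
      case (elim t)
      then have "(\<lambda>n. cmod (F n t)) \<longlonglongrightarrow> cmod (h t)" by (intro tendsto_norm)
      then show ?case by (rule LIMSEQ_le_const2) (use elim in auto)
    qed
  qed
  have g2: "(\<lambda>t. 2 * g t) \<in> bfs \<rho>" by (rule bfs_cmult[OF g])
  obtain n where n: "N (\<lambda>t. if t \<in> E n then 2 * g t else 0) \<le> ennreal (e / 2)"
    using absolutely_continuous_norm[OF g2 Em Edec null, of "e/2"] e by auto
  have rm: "(\<lambda>t. if t \<in> E n then 2 * g t else 0) \<in> borel_measurable circle"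
    using gm Em by (intro measurable_If_set) auto
  have "N (\<lambda>t. F n t - h t) \<le> \<rho> (\<lambda>t. ennreal (cmod (of_real \<delta> * 1)) + ennreal (cmod (if t \<in> E n then 2 * g t else 0)))"
    unfolding bfs_norm_def
  proof (rule rho_mono)
    show "AE t in circle. ennreal (cmod (F n t - h t)) \<le> ennreal (cmod (of_real \<delta> * 1)) + ennreal (cmod (if t \<in> E n then 2 * g t else 0))"
      using bd[of n] hb AE_space
    proof eventually_elim
      case (elim t)
      have "cmod (F n t - h t) \<le> \<delta> + cmod (if t \<in> E n then 2 * g t else 0)"
      proof (cases "t \<in> E n")
        case True
        have "cmod (F n t - h t) \<le> cmod (F n t) + cmod (h t)" by (rule norm_triangle_ineq4)
        then show ?thesis using True elim \<delta> by (simp add: norm_mult)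
      next
        case False
        then have "cmod (F n t - h t) \<le> \<delta>" using elim(3) by (force simp: E_def)
        then show ?thesis using False by simp
      qed
      then have "ennreal (cmod (F n t - h t)) \<le> ennreal (\<delta> + cmod (if t \<in> E n then 2 * g t else 0))" by (rule ennreal_leI)
      also have "\<dots> = ennreal \<delta> + ennreal (cmod (if t \<in> E n then 2 * g t else 0))" using \<delta> by (intro ennreal_plus) auto
      finally show ?case using \<delta> by simp
    qed
    show "(\<lambda>t. ennreal (cmod (F n t - h t))) \<in> borel_measurable circle" using fm[of n] hm by simp
    show "(\<lambda>t. ennreal (cmod (of_real \<delta> * 1)) + ennreal (cmod (if t \<in> E n then 2 * g t else 0))) \<in> borel_measurable circle"
      using rm by simp
  qed
  also have "\<dots> \<le> N (\<lambda>t. of_real \<delta> * 1) + N (\<lambda>t. if t \<in> E n then 2 * g t else 0)"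
    unfolding bfs_norm_def using rm by (intro rho_add) auto
  also have "N (\<lambda>t. of_real \<delta> * 1) = ennreal (\<delta> * n1)"
    using N_cmult[of "\<lambda>_. 1" "of_real \<delta>"] \<delta> n1 by (simp add: ennreal_mult)
  also have "ennreal (\<delta> * n1) + N (\<lambda>t. if t \<in> E n then 2 * g t else 0) \<le> ennreal (e / 2) + ennreal (e / 2)"
    by (intro add_mono n ennreal_leI \<delta>)
  also have "\<dots> = ennreal e" using e by (simp flip: ennreal_plus)
  finally show ?thesis by blast
qed

section \<open>Density of trigonometric polynomials in X and of analytic polynomials in H[X]\<close>

lemma trig_poly_dense:
  assumes f: "f \<in> bfs \<rho>" and e: "0 < (e::real)"
  shows "\<exists>p. trig_poly p \<and> N (\<lambda>t. f t - p t) \<le> ennreal e"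
proof -
  have fm: "f \<in> borel_measurable circle" by (rule bfs_measurable[OF f])
  define F where "F n t = (if cmod (f t) \<le> real n then f t else 0)" for n t
  have Fm: "F n \<in> borel_measurable circle" for n unfolding F_def using fm by simp
  have Fb: "cmod (F n t) \<le> real n" for n t by (simp add: F_def)
  have "\<exists>n. N (\<lambda>t. F n t - f t) \<le> ennreal (e / 2)"
  proof (rule dominated_convergence[OF Fm fm f])
    show "AE t in circle. cmod (F n t) \<le> cmod (f t)" for n by (rule AE_I2) (simp add: F_def)
    show "AE t in circle. (\<lambda>n. F n t) \<longlonglongrightarrow> f t"
    proof (rule AE_I2)
      fix t
      obtain n0 where "cmod (f t) \<le> real n0" using real_arch_simple by blast
      then have "F n t = f t" if "n \<ge> n0" for n using that by (simp add: F_def)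
      then show "(\<lambda>n. F n t) \<longlonglongrightarrow> f t"
        by (intro tendsto_eventually) (auto simp: eventually_sequentially)
    qed
  qed (use e in simp)
  then obtain n where n: "N (\<lambda>t. F n t - f t) \<le> ennreal (e / 2)" by blast
  obtain p where p: "\<And>k. trig_poly (p k)" "\<And>k t. cmod t = 1 \<Longrightarrow> cmod (p k t) \<le> 2 * (real n + 1)"
    "AE t in circle. (\<lambda>k. p k t) \<longlonglongrightarrow> F n t"
    by (rule bounded_trig_seq[OF Fm[of n] Fb]) (rule that)
  have "\<exists>k. N (\<lambda>t. p k t - F n t) \<le> ennreal (e / 2)"
  proof (rule dominated_convergence[OF trig_poly_measurable[OF p(1)] Fm bfs_const _ p(3)])
    show "AE t in circle. cmod (p k t) \<le> cmod (of_real (2 * (real n + 1)))" for k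
    proof (rule AE_circleI)
      fix t :: complex assume "cmod t = 1"
      have "cmod (p k t) \<le> 2 * (real n + 1)" by (rule p(2)) fact
      also have "\<dots> \<le> cmod (of_real (2 * (real n + 1)))" unfolding norm_of_real by simp
      finally show "cmod (p k t) \<le> cmod (of_real (2 * (real n + 1)))" .
    qed
  qed (use e in simp)
  then obtain k where k: "N (\<lambda>t. p k t - F n t) \<le> ennreal (e / 2)" by blast
  have "N (\<lambda>t. f t - p k t) \<le> ennreal (e / 2 + e / 2)"
    by (rule N_triangle[OF fm Fm[of n] trig_poly_measurable[OF p(1)]])
       (use n k e N_minus_commute[of f "F n"] N_minus_commute[of "F n" "p k"] in auto)
  then show ?thesis using p(1) by auto
qed

text \<open>The dilations of \<open>g\<close> are Poisson integrals and hence bounded by B. They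
  converge to \<open>g\<close> in L1, so a subsequence does almost everywhere, and the common bound
  turns this into convergence in norm. Each dilation is a uniform limit of its Taylor polynomials on
  the circle.\<close>

lemma analytic_poly_dense_bounded:
  assumes gm: "g \<in> borel_measurable circle" and B: "\<And>t. cmod t = 1 \<Longrightarrow> cmod (g t) \<le> B"
    and neg: "\<And>n. n < 0 \<Longrightarrow> fourier_coeff g n = 0" and e: "0 < (e::real)"
  shows "\<exists>p. analytic_poly p \<and> N (\<lambda>t. g t - p t) \<le> ennreal e"
proof -
  have gi: "integrable circle g" by (rule integrable_circle_bounded[OF gm B])
  define r where "r k = 1 - 1 / real (k + 2)" for k :: nat
  have r: "0 \<le> r k" "r k < 1" for k by (auto simp: r_def)
  have r1: "r \<longlonglongrightarrow> 1"
  proof -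
    have "(\<lambda>k. 1 - 1 / real (k + 2)) \<longlonglongrightarrow> 1 - 0"
      by (intro tendsto_intros LIMSEQ_ignore_initial_segment[OF lim_1_over_n])
    moreover have "r = (\<lambda>k. 1 - 1 / real (k + 2))" by (simp add: fun_eq_iff r_def)
    ultimately show ?thesis by simp
  qed
  have rt: "cmod (of_real (r k) * t) < 1" if "cmod t = 1" for k t
    using that r[of k] by (simp add: norm_mult)
  define G where "G k t = cauchy_transform g (of_real (r k) * t)" for k t
  have Gp: "G k t = poisson_int g (of_real (r k) * t)" if "cmod t = 1" for k t
    unfolding G_def by (rule poisson_int_analytic[OF gi neg rt[OF that], symmetric])
  have Gb: "cmod (G k t) \<le> B" if "cmod t = 1" for k t
    unfolding Gp[OF that] by (rule poisson_int_bounded[OF B rt[OF that]])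
  have Gc: "continuous_on (sphere 0 1) (G k)" for k
    unfolding G_def
    by (rule continuous_on_subset[OF continuous_on_dilate(2)[OF cauchy_transform_holomorphic[OF gi] r]]) auto
  have Gm: "G k \<in> borel_measurable circle" for k by (rule borel_measurable_circle_continuous[OF Gc])
  have Gi: "integrable circle (G k)" for k by (rule integrable_circle_continuous[OF Gc])
  \<comment> \<open>Poisson integrals contract L1 and converge uniformly on trigonometric
    polynomials, so an e / 3 argument applies.\<close>
  have L1: "(\<lambda>k. \<integral>t. norm (G k t - g t) \<partial>circle) \<longlonglongrightarrow> 0"
  proof (rule LIMSEQ_I)
    fix e :: real assume e: "0 < e"
    obtain q where q: "\<And>k. trig_poly (q k)" "\<And>k t. cmod t = 1 \<Longrightarrow> cmod (q k t) \<le> 2 * (B + 1)"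
      "AE t in circle. (\<lambda>k. q k t) \<longlonglongrightarrow> g t"
      by (rule bounded_trig_seq[OF gm B], assumption) (rule that)
    have "(\<lambda>k. \<integral>t. norm (g t - q k t) \<partial>circle) \<longlonglongrightarrow> (\<integral>t. 0 \<partial>circle)"
    proof (rule integral_dominated_convergence[where w="\<lambda>_. B + 2 * (B + 1)"])
      show "AE t in circle. (\<lambda>k. norm (g t - q k t)) \<longlonglongrightarrow> 0"
        using q(3)
      proof eventually_elim
        case (elim t)
        have "(\<lambda>k. norm (g t - q k t)) \<longlonglongrightarrow> norm (g t - g t)" by (intro tendsto_intros elim)
        then show ?case by simp
      qed
      show "AE t in circle. norm (norm (g t - q k t)) \<le> B + 2 * (B + 1)" for k
      proof (rule AE_circleI)
        fix t :: complex assume t: "cmod t = 1"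
        show "norm (norm (g t - q k t)) \<le> B + 2 * (B + 1)"
          using norm_triangle_ineq4[of "g t" "q k t"] B[OF t] q(2)[OF t, of k] by simp
      qed
    qed (use gm trig_poly_measurable[OF q(1)] in auto)
    then have "\<forall>\<^sub>F k in sequentially. (\<integral>t. norm (g t - q k t) \<partial>circle) < e / 3"
      using e by (intro order_tendstoD(2)) auto
    then obtain k where k: "(\<integral>t. norm (g t - q k t) \<partial>circle) < e / 3"
      using eventually_happens'[OF sequentially_bot] by blast
    define p where "p = q k"
    have pt: "trig_poly p" by (simp add: p_def q)
    have pi: "integrable circle p" by (rule trig_poly_integrable[OF pt])
    have pe: "(\<integral>t. norm (g t - p t) \<partial>circle) < e / 3" using k by (simp add: p_def)
    have di: "integrable circle (\<lambda>t. g t - p t)" using gi pi by simp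
    obtain K c where K: "finite K" "\<forall>t\<in>sphere 0 1. p t = (\<Sum>j\<in>K. c j * t powi j)"
      using pt unfolding trig_poly_def by blast
    have Pp: "poisson_int p (of_real (r n) * t) = (\<Sum>j\<in>K. c j * (of_real (r n ^ nat \<bar>j\<bar>) * t powi j))" if t: "cmod t = 1" for n t
    proof -
      have "poisson_int p (of_real (r n) * t) = (\<integral>\<tau>. (\<Sum>j\<in>K. c j * (\<tau> powi j * of_real (poisson (of_real (r n) * t) \<tau>))) \<partial>circle)"
        unfolding poisson_int_def
        by (intro Bochner_Integration.integral_cong refl) (simp add: space_circle K sum_distrib_right mult.assoc)
      also have "\<dots> = (\<Sum>j\<in>K. c j * poisson_int (\<lambda>\<tau>. \<tau> powi j) (of_real (r n) * t))"
        unfolding poisson_int_def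
        by (subst Bochner_Integration.integral_sum)
           (intro integrable_mult_right integrable_mult_poisson rt[OF t] integrable_circle_continuous continuous_on_powi_circle, simp)
      also have "\<dots> = (\<Sum>j\<in>K. c j * (of_real (r n ^ nat \<bar>j\<bar>) * t powi j))"
        by (simp only: poisson_int_powi[OF t r])
      finally show ?thesis .
    qed
    have Pd: "cmod (poisson_int p (of_real (r n) * t) - p t) \<le> (\<Sum>j\<in>K. cmod (c j) * (1 - r n ^ nat \<bar>j\<bar>))" if t: "cmod t = 1" for n t
    proof -
      have "poisson_int p (of_real (r n) * t) - p t = (\<Sum>j\<in>K. c j * (of_real (r n ^ nat \<bar>j\<bar>) - 1) * t powi j)"
        unfolding Pp[OF t] using K(2) t by (simp add: sum_subtractf[symmetric] algebra_simps)
      also have "cmod \<dots> \<le> (\<Sum>j\<in>K. cmod (c j * (of_real (r n ^ nat \<bar>j\<bar>) - 1) * t powi j))" by (rule norm_sum)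
      also have "\<dots> = (\<Sum>j\<in>K. cmod (c j) * (1 - r n ^ nat \<bar>j\<bar>))"
      proof (intro sum.cong refl)
        fix j
        have "r n ^ nat \<bar>j\<bar> \<le> 1" using r[of n] by (intro power_le_one) auto
        then have "cmod (of_real (r n ^ nat \<bar>j\<bar>) - 1) = 1 - r n ^ nat \<bar>j\<bar>"
          using norm_of_real[of "r n ^ nat \<bar>j\<bar> - 1", where 'a=complex] by simp
        then show "cmod (c j * (of_real (r n ^ nat \<bar>j\<bar>) - 1) * t powi j) = cmod (c j) * (1 - r n ^ nat \<bar>j\<bar>)"
          using t by (simp only: norm_mult norm_power_int) simp
      qed
      finally show ?thesis .
    qed
    have "(\<lambda>n. \<Sum>j\<in>K. cmod (c j) * (1 - r n ^ nat \<bar>j\<bar>)) \<longlonglongrightarrow> (\<Sum>j\<in>K. cmod (c j) * (1 - 1 ^ nat \<bar>j\<bar>))"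
      by (intro tendsto_intros r1)
    then have "\<forall>\<^sub>F n in sequentially. (\<Sum>j\<in>K. cmod (c j) * (1 - r n ^ nat \<bar>j\<bar>)) < e / 3"
      using e by (intro order_tendstoD(2)) auto
    then obtain n0 where n0: "\<And>n. n \<ge> n0 \<Longrightarrow> (\<Sum>j\<in>K. cmod (c j) * (1 - r n ^ nat \<bar>j\<bar>)) < e / 3"
      by (auto simp: eventually_sequentially)
    have "(\<integral>t. norm (G n t - g t) \<partial>circle) < e" if n: "n \<ge> n0" for n
    proof -
      let ?s = "\<Sum>j\<in>K. cmod (c j) * (1 - r n ^ nat \<bar>j\<bar>)"
      let ?R = "\<lambda>t. \<Sum>j\<in>K. c j * (of_real (r n ^ nat \<bar>j\<bar>) * t powi j)"
      have Rc: "continuous_on (sphere 0 1) ?R" by (intro continuous_intros continuous_on_powi_circle)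
      have lin: "poisson_int (\<lambda>\<tau>. g \<tau> - p \<tau>) (of_real (r n) * t) = G n t - ?R t" if t: "cmod t = 1" for t
        unfolding Gp[OF t] Pp[OF t, symmetric] poisson_int_def left_diff_distrib
        by (intro Bochner_Integration.integral_diff integrable_mult_poisson gi pi rt t)
      have ci: "integrable circle (\<lambda>t. G n t - ?R t)"
        by (intro Bochner_Integration.integrable_diff Gi integrable_circle_continuous Rc)
      have "ennreal (\<integral>t. norm (G n t - ?R t) \<partial>circle) = (\<integral>\<^sup>+t. ennreal (cmod (G n t - ?R t)) \<partial>circle)"
        using ci by (intro nn_integral_eq_integral[symmetric]) auto
      also have "\<dots> = (\<integral>\<^sup>+t. ennreal (cmod (poisson_int (\<lambda>\<tau>. g \<tau> - p \<tau>) (of_real (r n) * t))) \<partial>circle)"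
        by (intro nn_integral_cong) (simp only: lin space_circle mem_sphere_0)
      also have "\<dots> \<le> ennreal (\<integral>t. cmod (g t - p t) \<partial>circle)"
        by (rule poisson_int_contraction[OF di r])
      finally have c3: "(\<integral>t. norm (G n t - ?R t) \<partial>circle) \<le> (\<integral>t. norm (g t - p t) \<partial>circle)" by simp
      have "(\<integral>t. norm (G n t - g t) \<partial>circle) \<le> (\<integral>t. norm (G n t - ?R t) + norm (g t - p t) + ?s \<partial>circle)"
      proof (rule integral_mono)
        fix t assume "t \<in> space circle"
        then have t: "cmod t = 1" by (simp add: space_circle)
        have "G n t - g t = (G n t - ?R t) - (g t - p t) + (?R t - p t)" by simp
        also have "norm \<dots> \<le> norm (G n t - ?R t) + norm (g t - p t) + norm (?R t - p t)"
          by (intro order_trans[OF norm_triangle_ineq] add_mono norm_triangle_ineq4 order_refl)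
        also have "norm (?R t - p t) \<le> ?s" using Pd[OF t, of n] unfolding Pp[OF t] .
        finally show "norm (G n t - g t) \<le> norm (G n t - ?R t) + norm (g t - p t) + ?s" by simp
      qed (use Gi gi ci di in auto)
      also have "\<dots> = (\<integral>t. norm (G n t - ?R t) \<partial>circle) + (\<integral>t. norm (g t - p t) \<partial>circle) + ?s"
        using ci di by simp
      also have "\<dots> < e" using c3 pe n0[OF n] by linarith
      finally show ?thesis .
    qed
    then show "\<exists>no. \<forall>n\<ge>no. norm ((\<integral>t. norm (G n t - g t) \<partial>circle) - 0) < e"
      by (intro exI[of _ n0]) simp
  qed
  have dint: "integrable circle (\<lambda>t. G k t - g t)" for k using Gi gi by simp
  obtain s where s: "strict_mono s" "AE t in circle. (\<lambda>k. G (s k) t - g t) \<longlonglongrightarrow> 0"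
    using tendsto_L1_AE_subseq[of circle "\<lambda>k t. G k t - g t", OF dint L1] by blast
  have "\<exists>k. N (\<lambda>t. G (s k) t - g t) \<le> ennreal (e / 2)"
  proof (rule dominated_convergence[OF Gm gm bfs_const])
    show "AE t in circle. cmod (G (s k) t) \<le> cmod (of_real B)" for k
    proof (rule AE_circleI)
      fix t :: complex assume "cmod t = 1"
      then have "cmod (G (s k) t) \<le> B" by (rule Gb)
      then show "cmod (G (s k) t) \<le> cmod (of_real B)" unfolding norm_of_real by simp
    qed
    show "AE t in circle. (\<lambda>k. G (s k) t) \<longlonglongrightarrow> g t"
      using s(2) by eventually_elim (rule LIM_zero_cancel)
  qed (use e in simp)
  then obtain k where k: "N (\<lambda>t. G (s k) t - g t) \<le> ennreal (e / 2)" by blast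
  obtain n1 where n1: "N (\<lambda>_. 1) = ennreal n1" "0 \<le> n1" using N_one by (cases "N (\<lambda>_. 1)") auto
  define \<eta> where "\<eta> = e / (2 * (n1 + 1))"
  have \<eta>: "0 < \<eta>" "\<eta> * n1 \<le> e / 2" using e n1 by (auto simp: \<eta>_def field_simps add_pos_nonneg)
  obtain p where p: "analytic_poly p" "\<And>t. cmod t = 1 \<Longrightarrow> cmod (G (s k) t - p t) < \<eta>"
    by (rule analytic_poly_approx[OF cauchy_transform_holomorphic[OF gi] r(1)[of "s k"] r(2)[of "s k"] \<eta>(1), folded G_def]) (rule that)
  have pm: "p \<in> borel_measurable circle" by (intro trig_poly_measurable analytic_poly_trig p)
  have "N (\<lambda>t. G (s k) t - p t) \<le> ennreal \<eta> * N (\<lambda>_. 1)"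
    by (rule N_bounded) (use Gm[of "s k"] pm p(2) \<eta> in \<open>auto intro!: AE_circleI less_imp_le\<close>)
  also have "\<dots> = ennreal (\<eta> * n1)" unfolding n1(1) using \<eta> n1 by (simp add: ennreal_mult)
  also have "\<dots> \<le> ennreal (e / 2)" by (intro ennreal_leI \<eta>)
  finally have "N (\<lambda>t. g t - p t) \<le> ennreal (e / 2 + e / 2)"
    by (intro N_triangle[OF gm Gm[of "s k"] pm]) (use k e N_minus_commute[of g "G (s k)"] in auto)
  then show ?thesis using p(1) by auto
qed

text \<open>The products of \<open>f\<close> with the outer multipliers are bounded analytic
  functions, dominated by |f| and convergent to \<open>f\<close>; dominated convergence reduces the
  claim to bounded functions.\<close>

lemma analytic_poly_dense:
  assumes f: "f \<in> hardy \<rho>" and e: "0 < (e::real)"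
  shows "\<exists>p. analytic_poly p \<and> N (\<lambda>t. f t - p t) \<le> ennreal e"
proof -
  have fX: "f \<in> bfs \<rho>" and neg: "\<And>n. n < 0 \<Longrightarrow> fourier_coeff f n = 0" using f by (auto simp: hardy_def)
  have fm: "f \<in> borel_measurable circle" by (rule bfs_measurable[OF fX])
  obtain h where h: "h \<in> borel_measurable circle" "AE t in circle. Re (h t) = sqrt (cmod (f t))"
    "\<And>n m. 0 < n \<Longrightarrow> m < 0 \<Longrightarrow> fourier_coeff (\<lambda>t. f t * (1 / (1 + h t / of_nat n)\<^sup>2)) m = 0"
    by (rule outer_multiplier[OF bfs_integrable[OF fX] neg], assumption) (rule that)
  define \<psi> where "\<psi> n t = f t * (1 / (1 + h t / of_nat (Suc n))\<^sup>2)" for n t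
  have \<psi>m: "\<psi> n \<in> borel_measurable circle" for n unfolding \<psi>_def using fm h(1) by simp
  have low: "1 + sqrt (cmod (f t)) / real (Suc n) \<le> cmod (1 + h t / of_nat (Suc n))"
    if "Re (h t) = sqrt (cmod (f t))" for n t
  proof -
    have "1 + sqrt (cmod (f t)) / real (Suc n) = Re (1 + h t / of_nat (Suc n))"
      using that Re_divide_of_nat[of "h t" "Suc n"] by (simp del: of_nat_Suc)
    then show ?thesis by (simp only: complex_Re_le_cmod)
  qed
  have "\<exists>n. N (\<lambda>t. \<psi> n t - f t) \<le> ennreal (e / 2)"
  proof (rule dominated_convergence[OF \<psi>m fm fX])
    show "AE t in circle. cmod (\<psi> n t) \<le> cmod (f t)" for n
      using h(2)
    proof eventually_elim
      case (elim t)
      have "0 \<le> sqrt (cmod (f t)) / real (Suc n)" by simp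
      then have "1 \<le> cmod (1 + h t / of_nat (Suc n))" using low[OF elim, of n] by linarith
      then have "1 \<le> (cmod (1 + h t / of_nat (Suc n)))\<^sup>2" by (rule one_le_power)
      then have "cmod (1 / (1 + h t / of_nat (Suc n))\<^sup>2) \<le> 1" unfolding norm_divide norm_power norm_one by (simp only: div_by_1 le_divide_eq_1 divide_le_eq_1) simp
      then show ?case unfolding \<psi>_def norm_mult by (rule mult_left_le) simp
    qed
    show "AE t in circle. (\<lambda>n. \<psi> n t) \<longlonglongrightarrow> f t"
    proof (rule AE_I2)
      fix t
      have "(\<lambda>n. f t * (1 / (1 + h t * (1 / of_nat (Suc n)))\<^sup>2)) \<longlonglongrightarrow> f t * (1 / (1 + h t * 0)\<^sup>2)"
        by (intro tendsto_intros LIMSEQ_Suc[OF lim_1_over_n]) auto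
      then show "(\<lambda>n. \<psi> n t) \<longlonglongrightarrow> f t" by (simp add: \<psi>_def)
    qed
  qed (use e in simp)
  then obtain n where n: "N (\<lambda>t. \<psi> n t - f t) \<le> ennreal (e / 2)" by blast
  \<comment> \<open>The bound (n + 1)^2 holds for \<open>\<psi> n\<close> almost everywhere only;
    cutting off enforces it at every point and changes the function on a null set.\<close>
  define g where "g t = (if cmod (\<psi> n t) \<le> (real (Suc n))\<^sup>2 then \<psi> n t else 0)" for t
  have gm: "g \<in> borel_measurable circle" unfolding g_def using \<psi>m[of n] by simp
  have gb: "cmod (g t) \<le> (real (Suc n))\<^sup>2" for t by (simp add: g_def)
  have geq: "AE t in circle. g t = \<psi> n t"
    using h(2)
  proof eventually_elim
    case (elim t)
    let ?a = "cmod (1 + h t / of_nat (Suc n))"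
    have s0: "0 \<le> sqrt (cmod (f t)) / real (Suc n)" by simp
    then have a: "0 < ?a" "sqrt (cmod (f t)) / real (Suc n) \<le> ?a" using low[OF elim, of n] by linarith+
    then have "(sqrt (cmod (f t)) / real (Suc n))\<^sup>2 \<le> ?a\<^sup>2" using s0 by (intro power_mono)
    then have "cmod (f t) / (real (Suc n))\<^sup>2 \<le> ?a\<^sup>2" by (simp only: power_divide) simp
    then have "cmod (f t) \<le> ?a\<^sup>2 * (real (Suc n))\<^sup>2" by (simp add: divide_le_eq del: of_nat_Suc)
    then have "cmod (f t) / ?a\<^sup>2 \<le> (real (Suc n))\<^sup>2"
      using a(1) by (simp add: divide_le_eq mult.commute del: of_nat_Suc)
    then have "cmod (\<psi> n t) \<le> (real (Suc n))\<^sup>2"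
      unfolding \<psi>_def norm_mult norm_divide norm_power by simp
    then show ?case by (simp add: g_def)
  qed
  have gneg: "fourier_coeff g m = 0" if "m < 0" for m
  proof -
    have "fourier_coeff g m = fourier_coeff (\<psi> n) m" by (rule fourier_coeff_cong_AE[OF gm \<psi>m geq])
    also have "\<dots> = 0" unfolding \<psi>_def by (rule h(3)) (use that in auto)
    finally show ?thesis .
  qed
  obtain p where p: "analytic_poly p" "N (\<lambda>t. g t - p t) \<le> ennreal (e / 2)"
    using analytic_poly_dense_bounded[OF gm gb gneg, of "e/2"] e by auto
  have pm: "p \<in> borel_measurable circle" by (intro trig_poly_measurable analytic_poly_trig p)
  have "N (\<lambda>t. f t - g t) = N (\<lambda>t. \<psi> n t - f t)"
    using fm gm \<psi>m[of n] geq by (intro N_cong) (auto elim!: eventually_mono simp: norm_minus_commute)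
  then have "N (\<lambda>t. f t - p t) \<le> ennreal (e / 2 + e / 2)"
    using n p(2) e by (intro N_triangle[OF fm gm pm]) auto
  then show ?thesis using p(1) by auto
qed

end

section \<open>Operators with a Toeplitz matrix\<close>

lemma hardy_bfs: "f \<in> hardy \<rho> \<Longrightarrow> f \<in> bfs \<rho>"
  by (simp add: hardy_def)

lemma hardy_coeff: "f \<in> hardy \<rho> \<Longrightarrow> n < 0 \<Longrightarrow> fourier_coeff f n = 0"
  by (simp add: hardy_def)

context bfn
begin

lemma hardy_add: "f \<in> hardy \<rho> \<Longrightarrow> g \<in> hardy \<rho> \<Longrightarrow> (\<lambda>t. f t + g t) \<in> hardy \<rho>"
  by (auto simp: hardy_def fourier_coeff_add bfs_integrable intro: bfs_add)

lemma hardy_cmult: "f \<in> hardy \<rho> \<Longrightarrow> (\<lambda>t. c * f t) \<in> hardy \<rho>"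
  by (auto simp: hardy_def fourier_coeff_cmult intro: bfs_cmult)

lemma hardy_diff: "f \<in> hardy \<rho> \<Longrightarrow> g \<in> hardy \<rho> \<Longrightarrow> (\<lambda>t. f t - g t) \<in> hardy \<rho>"
  by (auto simp: hardy_def fourier_coeff_diff bfs_integrable intro: bfs_diff)

lemma hardy_chi: "0 \<le> j \<Longrightarrow> chi j \<in> hardy \<rho>"
  using bfs_trig_poly[OF trig_poly_powi[of 1 j]] fourier_coeff_powi[of j]
  by (auto simp: hardy_def chi_def[abs_def])

lemma hardy_sum:
  "finite J \<Longrightarrow> (\<And>j. j \<in> J \<Longrightarrow> f j \<in> hardy \<rho>) \<Longrightarrow> (\<lambda>t. \<Sum>j\<in>J. c j * f j t) \<in> hardy \<rho>"
proof (induction J rule: finite_induct)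
  case empty
  show ?case using hardy_cmult[OF hardy_chi[of 0], of 0] by simp
next
  case (insert j J)
  then show ?case using hardy_add[OF hardy_cmult[of "f j" "c j"], of "\<lambda>t. \<Sum>j\<in>J. c j * f j t"] by simp
qed

end

text \<open>The supremum over the unit ball extends to all arguments by scaling to norm 1. An
  argument of norm 0 cannot be scaled; there the bound with the constant C shows that the image has
  norm 0.\<close>

lemma operator_norm_bound:
  assumes "bfn \<rho>" "bfn \<sigma>" and A: "bounded_operator \<rho> V \<sigma> W A" and V: "V \<subseteq> bfs \<rho>" and W: "W \<subseteq> bfs \<sigma>"
    and scale: "\<And>f c. f \<in> V \<Longrightarrow> (\<lambda>t. c * f t) \<in> V" and f: "f \<in> V"
  shows "bfs_norm \<sigma> (A f) \<le> operator_norm \<rho> V \<sigma> A * bfs_norm \<rho> f"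
proof -
  interpret X: bfn \<rho> by fact
  interpret Y: bfn \<sigma> by fact
  have AV: "A g \<in> W" if "g \<in> V" for g using A that unfolding bounded_operator_def by blast
  obtain C where C: "\<And>g. g \<in> V \<Longrightarrow> Y.N (A g) \<le> ennreal C * X.N g"
    using A unfolding bounded_operator_def by blast
  have fX: "f \<in> bfs \<rho>" using f V by blast
  obtain n where n: "X.N f = ennreal n" "0 \<le> n" using X.bfs_finite[OF fX] by (cases "X.N f") auto
  show ?thesis
  proof (cases "n = 0")
    case True
    then have "Y.N (A f) \<le> 0" using C[OF f] n by simp
    then show ?thesis by simp
  next
    case False
    then have np: "0 < n" using n by simp
    define g where "g t = of_real (1 / n) * f t" for t
    have gV: "g \<in> V" unfolding g_def by (rule scale[OF f])
    have "X.N g = ennreal (1 / n) * ennreal n"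
      unfolding g_def using X.N_cmult[OF X.bfs_measurable[OF fX], of "of_real (1 / n)"] np n(1)
      by (simp only: norm_of_real) simp
    then have g1: "X.N g = 1" using np by (simp add: ennreal_mult[symmetric])
    have fg: "f = (\<lambda>t. of_real n * g t)" using np by (simp add: g_def fun_eq_iff)
    have "AE t in circle. A (\<lambda>t. of_real n * g t) t = of_real n * A g t"
      using A gV unfolding bounded_operator_def by blast
    then have ae: "AE t in circle. cmod (A f t) = cmod (of_real n * A g t)"
      unfolding fg[symmetric] by eventually_elim simp
    have m: "A f \<in> borel_measurable circle" "A g \<in> borel_measurable circle"
      using AV[OF f] AV[OF gV] W Y.bfs_measurable by blast+
    have "Y.N (A f) = Y.N (\<lambda>t. of_real n * A g t)"
      using ae m by (intro Y.N_cong) auto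
    also have "\<dots> = ennreal n * Y.N (A g)" using Y.N_cmult[OF m(2), of "of_real n"] np by simp
    also have "\<dots> \<le> ennreal n * operator_norm \<rho> V \<sigma> A"
      unfolding operator_norm_def using gV g1 by (intro mult_left_mono SUP_upper) auto
    finally show ?thesis by (simp add: n(1) mult.commute)
  qed
qed

lemma operator_norm_finite:
  assumes "bounded_operator \<rho> V \<sigma> W A"
  shows "operator_norm \<rho> V \<sigma> A < \<infinity>"
proof -
  obtain C where C: "\<And>g. g \<in> V \<Longrightarrow> bfs_norm \<sigma> (A g) \<le> ennreal C * bfs_norm \<rho> g"
    using assms unfolding bounded_operator_def by blast
  have "operator_norm \<rho> V \<sigma> A \<le> ennreal C"
    unfolding operator_norm_def
  proof (rule SUP_least)
    fix f assume "f \<in> {f \<in> V. bfs_norm \<rho> f \<le> 1}"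
    then have "f \<in> V" "bfs_norm \<rho> f \<le> 1" by auto
    then show "bfs_norm \<sigma> (A f) \<le> ennreal C"
      using C[of f] mult_left_mono[of "bfs_norm \<rho> f" 1 "ennreal C"] by simp
  qed
  then show ?thesis by (rule le_less_trans) simp
qed

lemma coeff_times:
  fixes c :: "int \<Rightarrow> complex"
  assumes a: "integrable circle a" and J: "finite J" and p: "\<And>t. cmod t = 1 \<Longrightarrow> p t = (\<Sum>j\<in>J. c j * t powi j)"
  shows "fourier_coeff (\<lambda>t. a t * p t) m = (\<Sum>j\<in>J. c j * fourier_coeff a (m - j))"
proof -
  have i: "integrable circle (\<lambda>t. t powi j * a t)" for j
    using integrable_fourier[OF a, of j] by (simp only: mult.commute)
  have "fourier_coeff (\<lambda>t. a t * p t) m = fourier_coeff (\<lambda>t. \<Sum>j\<in>J. c j * (t powi j * a t)) m"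
    unfolding fourier_coeff_def
    by (intro Bochner_Integration.integral_cong refl) (simp add: space_circle p sum_distrib_left mult_ac)
  also have "\<dots> = (\<Sum>j\<in>J. fourier_coeff (\<lambda>t. c j * (t powi j * a t)) m)"
    by (intro fourier_coeff_sum integrable_mult_right i)
  also have "\<dots> = (\<Sum>j\<in>J. c j * fourier_coeff a (m - j))"
    by (simp only: fourier_coeff_cmult fourier_coeff_powi_mult)
  finally show ?thesis .
qed

lemma ennreal_mult_le_limit:
  assumes "K < \<infinity>" "\<And>n. x \<le> K * (y + ennreal (1 / real (Suc n)))"
  shows "x \<le> K * y"
proof -
  have "(\<lambda>n. ennreal (1 / real (Suc n))) \<longlonglongrightarrow> ennreal 0"
    by (intro tendsto_ennrealI LIMSEQ_Suc[OF lim_1_over_n])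
  then have "(\<lambda>n. K * (y + ennreal (1 / real (Suc n)))) \<longlonglongrightarrow> K * (y + ennreal 0)"
    using assms(1) by (intro ennreal_tendsto_cmult tendsto_add tendsto_const) auto
  then have "x \<le> K * (y + ennreal 0)" by (rule LIMSEQ_le_const) (use assms(2) in blast)
  then show ?thesis by simp
qed

section \<open>From the matrix to the symbol\<close>

locale toeplitz_matrix = X: separable_bfn \<rho>X + Y: riesz_bounded \<rho>Y for \<rho>X \<rho>Y +
  fixes A :: "(complex \<Rightarrow> complex) \<Rightarrow> complex \<Rightarrow> complex" and \<alpha> :: "int \<Rightarrow> complex"
  assumes A: "bounded_operator \<rho>X (hardy \<rho>X) \<rho>Y (hardy \<rho>Y) A"
    and mat: "\<And>j k :: int. 0 \<le> j \<Longrightarrow> 0 \<le> k \<Longrightarrow> pairing (A (chi j)) (chi k) = \<alpha> (k - j)"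
begin

abbreviation op where "op \<equiv> operator_norm \<rho>X (hardy \<rho>X) \<rho>Y A"

lemma op_bound: "f \<in> hardy \<rho>X \<Longrightarrow> Y.N (A f) \<le> op * X.N f"
  by (rule operator_norm_bound[OF X.bfn_axioms Y.bfn_axioms A]) (auto simp: hardy_bfs X.hardy_cmult)

lemma op_finite: "op < \<infinity>"
  by (rule operator_norm_finite[OF A])

lemma A_hardy: "f \<in> hardy \<rho>X \<Longrightarrow> A f \<in> hardy \<rho>Y"
  using A unfolding bounded_operator_def by blast

lemma A_add: "f \<in> hardy \<rho>X \<Longrightarrow> g \<in> hardy \<rho>X \<Longrightarrow> AE t in circle. A (\<lambda>s. f s + g s) t = A f t + A g t"
  using A unfolding bounded_operator_def by blast

lemma A_cmult: "f \<in> hardy \<rho>X \<Longrightarrow> AE t in circle. A (\<lambda>s. c * f s) t = c * A f t"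
  using A unfolding bounded_operator_def by blast

lemma A_measurable: "f \<in> hardy \<rho>X \<Longrightarrow> A f \<in> borel_measurable circle"
  by (rule Y.bfs_measurable[OF hardy_bfs[OF A_hardy]])

lemma A_integrable: "f \<in> hardy \<rho>X \<Longrightarrow> integrable circle (A f)"
  by (rule Y.bfs_integrable[OF hardy_bfs[OF A_hardy]])

lemma A_diff:
  assumes "f \<in> hardy \<rho>X" "g \<in> hardy \<rho>X"
  shows "AE t in circle. A (\<lambda>s. f s - g s) t = A f t - A g t"
  using A_add[OF assms(1) X.hardy_cmult[OF assms(2), of "-1"]] A_cmult[OF assms(2), of "-1"]
  by eventually_elim simp

lemma A_sum:
  assumes "finite J" "\<And>j. j \<in> J \<Longrightarrow> f j \<in> hardy \<rho>X"
  shows "AE t in circle. A (\<lambda>t. \<Sum>j\<in>J. c j * f j t) t = (\<Sum>j\<in>J. c j * A (f j) t)"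
  using assms
proof (induction J rule: finite_induct)
  case empty
  show ?case using A_cmult[OF X.hardy_chi[of 0], of 0] by simp
next
  case (insert j J)
  have fj: "f j \<in> hardy \<rho>X" using insert by simp
  have "(\<lambda>t. \<Sum>j\<in>J. c j * f j t) \<in> hardy \<rho>X" using insert by (intro X.hardy_sum) auto
  from A_add[OF X.hardy_cmult[OF fj, of "c j"] this]
  have 1: "AE t in circle. A (\<lambda>t. c j * f j t + (\<Sum>j\<in>J. c j * f j t)) t = A (\<lambda>t. c j * f j t) t + A (\<lambda>t. \<Sum>j\<in>J. c j * f j t) t" .
  have 2: "AE t in circle. A (\<lambda>t. \<Sum>j\<in>J. c j * f j t) t = (\<Sum>j\<in>J. c j * A (f j) t)"
    using insert by (intro insert.IH) auto
  have 3: "(\<lambda>t. \<Sum>j\<in>insert j J. c j * f j t) = (\<lambda>t. c j * f j t + (\<Sum>j\<in>J. c j * f j t))"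
    using insert.hyps by (simp add: fun_eq_iff)
  show ?case
    unfolding 3 using 1 2 A_cmult[OF fj, of "c j"]
    by eventually_elim (use insert.hyps in simp)
qed

lemma coeff_A_chi: "0 \<le> j \<Longrightarrow> 0 \<le> k \<Longrightarrow> fourier_coeff (A (chi j)) k = \<alpha> (k - j)"
proof -
  assume jk: "0 \<le> j" "0 \<le> k"
  have "pairing (A (chi j)) (chi k) = fourier_coeff (A (chi j)) k"
    unfolding pairing_def fourier_coeff_def chi_def
    by (intro Bochner_Integration.integral_cong refl)
       (simp add: space_circle cnj_powi_unit del: complex_cnj_power_int)
  then show ?thesis using mat[OF jk] by simp
qed

lemma coeff_A_sum:
  assumes J: "finite J" "\<And>j. j \<in> J \<Longrightarrow> 0 \<le> s j" and k: "0 \<le> k"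
  shows "fourier_coeff (A (\<lambda>t. \<Sum>j\<in>J. c j * chi (s j) t)) k = (\<Sum>j\<in>J. c j * \<alpha> (k - s j))"
proof -
  have h: "chi (s j) \<in> hardy \<rho>X" if "j \<in> J" for j by (rule X.hardy_chi[OF J(2)[OF that]])
  have S: "(\<lambda>t. \<Sum>j\<in>J. c j * chi (s j) t) \<in> hardy \<rho>X" by (rule X.hardy_sum[OF J(1) h])
  have m: "(\<lambda>t. \<Sum>j\<in>J. c j * A (chi (s j)) t) \<in> borel_measurable circle"
    using A_measurable[OF h] by (intro borel_measurable_sum borel_measurable_times) auto
  have "fourier_coeff (A (\<lambda>t. \<Sum>j\<in>J. c j * chi (s j) t)) k = fourier_coeff (\<lambda>t. \<Sum>j\<in>J. c j * A (chi (s j)) t) k"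
    by (rule fourier_coeff_cong_AE[OF A_measurable[OF S] m A_sum[OF J(1) h]])
  also have "\<dots> = (\<Sum>j\<in>J. fourier_coeff (\<lambda>t. c j * A (chi (s j)) t) k)"
    by (intro fourier_coeff_sum integrable_mult_right A_integrable h)
  also have "\<dots> = (\<Sum>j\<in>J. c j * \<alpha> (k - s j))"
    by (intro sum.cong refl) (simp add: fourier_coeff_cmult coeff_A_chi J k)
  finally show ?thesis .
qed

text \<open>The functions \<open>t^(-k) (A (t^k f))(t)\<close> are bounded in \<open>Y\<close>, and their Fourier coefficients are
  eventually those of the product of \<open>f\<close> with the symbol.\<close>

lemma symbol_times:
  fixes c :: "int \<Rightarrow> complex"
  assumes J: "finite J" and f: "\<And>t. cmod t = 1 \<Longrightarrow> f t = (\<Sum>j\<in>J. c j * t powi j)"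
  obtains h where "h \<in> bfs \<rho>Y" "Y.N h \<le> op * X.N f" "\<And>m. fourier_coeff h m = (\<Sum>j\<in>J. c j * \<alpha> (m - j))"
proof -
  have tf: "trig_poly f" unfolding trig_poly_def using J f by auto
  have fX: "f \<in> bfs \<rho>X" by (rule X.bfs_trig_poly[OF tf])
  have M: "op * X.N f < \<infinity>" using op_finite X.bfs_finite[OF fX] by (simp add: ennreal_mult_less_top)
  obtain n0 where n0: "\<And>j. j \<in> J \<Longrightarrow> \<bar>j\<bar> \<le> int n0"
  proof -
    have "\<exists>n0. \<forall>j\<in>J. \<bar>j\<bar> \<le> int n0"
      by (rule exI[of _ "nat (Max (insert 0 (abs ` J)))"]) (use J in \<open>auto intro!: Max_ge simp: nat_le_iff le_nat_iff\<close>)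
    then show ?thesis using that by blast
  qed
  have ex: "\<exists>h\<in>bfs \<rho>Y. Y.N h \<le> op * X.N f \<and> (\<forall>m. \<bar>m\<bar> \<le> int n \<longrightarrow> fourier_coeff h m = (\<Sum>j\<in>J. c j * \<alpha> (m - j)))" for n
  proof -
    \<comment> \<open>k >= n0 removes all negative frequencies from t^k f, so that \<open>A\<close>
      applies; k >= n makes m + k nonnegative for |m| <= n, so that the matrix determines this
      coefficient of the image. In the entry of row m + k and column j + k the shift
      cancels.\<close>
    define k where "k = int (max n n0)"
    have k: "int n \<le> k" "0 \<le> k" "\<And>j. j \<in> J \<Longrightarrow> 0 \<le> j + k" using n0 by (force simp: k_def)+
    define F where "F = (\<lambda>t. \<Sum>j\<in>J. c j * chi (j + k) t)"
    have FH: "F \<in> hardy \<rho>X" unfolding F_def by (rule X.hardy_sum[OF J X.hardy_chi[OF k(3)]])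
    have Ff: "F t = t powi k * f t" if t: "cmod t = 1" for t
    proof -
      have "t \<noteq> 0" using t by auto
      then show ?thesis unfolding F_def chi_def f[OF t] by (simp add: sum_distrib_left power_int_add mult_ac)
    qed
    have NF: "X.N F = X.N f"
      by (rule X.N_cong[OF X.bfs_measurable[OF fX] X.bfs_measurable[OF hardy_bfs[OF FH]] AE_circleI])
         (simp add: Ff norm_mult norm_power_int)
    define h where "h = (\<lambda>t. t powi (- k) * A F t)"
    have hm: "h \<in> borel_measurable circle" unfolding h_def using A_measurable[OF FH] by simp
    have Nh: "Y.N h = Y.N (A F)"
      by (rule Y.N_cong[OF A_measurable[OF FH] hm AE_circleI]) (simp add: h_def norm_mult norm_power_int)
    have hN: "Y.N h \<le> op * X.N f" unfolding Nh NF[symmetric] by (rule op_bound[OF FH])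
    have "fourier_coeff h m = (\<Sum>j\<in>J. c j * \<alpha> (m - j))" if "\<bar>m\<bar> \<le> int n" for m
    proof -
      have "fourier_coeff h m = fourier_coeff (A F) (m + k)"
        unfolding h_def fourier_coeff_powi_mult by simp
      also have "\<dots> = (\<Sum>j\<in>J. c j * \<alpha> ((m + k) - (j + k)))"
        unfolding F_def by (rule coeff_A_sum[OF J k(3)]) (use that k in auto)
      finally show ?thesis by simp
    qed
    then show ?thesis using Y.bfsI[OF hm hN M] hN by blast
  qed
  show thesis by (rule Y.extract_limit[OF M ex]) (rule that)
qed

text \<open>The symbol is the limit obtained for the constant 1. The limit obtained for a polynomial
  p has the Fourier coefficients of a p, so it equals a p by uniqueness and passes its norm bound on
  to it.\<close>

lemma symbol_exists:
  obtains a where "a \<in> bfs \<rho>Y" "\<And>n. fourier_coeff a n = \<alpha> n"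
    "\<And>p. trig_poly p \<Longrightarrow> Y.N (\<lambda>t. a t * p t) \<le> op * X.N p"
proof -
  obtain a where a: "a \<in> bfs \<rho>Y" "\<And>m. fourier_coeff a m = (\<Sum>j\<in>{0}. 1 * \<alpha> (m - j))"
    by (rule symbol_times[of "{0}" "\<lambda>_. 1" "\<lambda>_. 1"]) (auto intro: that)
  have ac: "fourier_coeff a n = \<alpha> n" for n using a(2) by simp
  have ai: "integrable circle a" by (rule Y.bfs_integrable[OF a(1)])
  have "Y.N (\<lambda>t. a t * p t) \<le> op * X.N p" if p: "trig_poly p" for p
  proof -
    obtain J c where J: "finite J" and pt: "\<forall>t\<in>sphere 0 1. p t = (\<Sum>j\<in>J. c j * t powi j)"
      using p unfolding trig_poly_def by blast
    have pt': "p t = (\<Sum>j\<in>J. c j * t powi j)" if "cmod t = 1" for t using pt that by simp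
    obtain h where h: "h \<in> bfs \<rho>Y" "Y.N h \<le> op * X.N p" "\<And>m. fourier_coeff h m = (\<Sum>j\<in>J. c j * \<alpha> (m - j))"
      by (rule symbol_times[OF J pt'], assumption) (rule that)
    obtain B where B: "\<And>t. cmod t = 1 \<Longrightarrow> cmod (p t) \<le> B" using trig_poly_bounded[OF p] by blast
    have api: "integrable circle (\<lambda>t. a t * p t)"
      by (rule integrable_mult_bounded[OF ai trig_poly_measurable[OF p] B])
    have "fourier_coeff h m = fourier_coeff (\<lambda>t. a t * p t) m" for m
      unfolding h(3) using coeff_times[OF ai J pt', of m] by (simp add: ac)
    then have "AE t in circle. h t = a t * p t"
      by (intro fourier_unique Y.bfs_integrable[OF h(1)] api)
    then have "Y.N (\<lambda>t. a t * p t) = Y.N h"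
      by (intro Y.N_cong Y.bfs_measurable[OF h(1)] borel_measurable_integrable[OF api]) (auto elim!: eventually_mono)
    then show ?thesis using h(2) by simp
  qed
  with a(1) ac show thesis by (rule that)
qed

text \<open>Polynomials converging to \<open>f\<close> in X have a subsequence converging almost
  everywhere, and the Fatou property of Y yields the bound without prior knowledge that a f lies in
  Y.\<close>

lemma multiplier_bound:
  assumes a: "a \<in> bfs \<rho>Y" and ap: "\<And>p. trig_poly p \<Longrightarrow> Y.N (\<lambda>t. a t * p t) \<le> op * X.N p" and f: "f \<in> bfs \<rho>X"
  shows "Y.N (\<lambda>t. a t * f t) \<le> op * X.N f"
proof (rule ennreal_mult_le_limit[OF op_finite])
  fix n
  have fm: "f \<in> borel_measurable circle" by (rule X.bfs_measurable[OF f])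
  have am: "a \<in> borel_measurable circle" by (rule Y.bfs_measurable[OF a])
  have "\<exists>p. trig_poly p \<and> X.N (\<lambda>t. f t - p t) \<le> ennreal (1 / real (Suc k))" for k
    by (rule X.trig_poly_dense[OF f]) simp
  from choice[OF allI[OF this]] obtain p where p: "\<forall>k. trig_poly (p k) \<and> X.N (\<lambda>t. f t - p k t) \<le> ennreal (1 / real (Suc k))" ..
  have pt: "trig_poly (p k)" and pN: "X.N (\<lambda>t. f t - p k t) \<le> ennreal (1 / real (Suc k))" for k using p by auto
  have pm: "p k \<in> borel_measurable circle" for k by (rule trig_poly_measurable[OF pt])
  have dX: "(\<lambda>t. f t - p k t) \<in> bfs \<rho>X" for k by (rule X.bfs_diff[OF f X.bfs_trig_poly[OF pt]])
  obtain C where C: "0 < C" "\<And>f e. f \<in> borel_measurable circle \<Longrightarrow> X.N f \<le> ennreal e \<Longrightarrow> 0 \<le> e \<Longrightarrow> (\<integral>t. cmod (f t) \<partial>circle) \<le> C * e"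
    by (rule X.L1_of_N) (rule that)
  have "(\<lambda>k. \<integral>t. norm (f t - p k t) \<partial>circle) \<longlonglongrightarrow> 0"
  proof (rule tendsto_sandwich[OF always_eventually always_eventually tendsto_const])
    show "\<forall>k. (\<integral>t. norm (f t - p k t) \<partial>circle) \<le> C * (1 / real (Suc k))"
      using C(2)[OF X.bfs_measurable[OF dX] pN] by simp
    show "(\<lambda>k. C * (1 / real (Suc k))) \<longlonglongrightarrow> 0"
      by (rule tendsto_mult_right_zero[OF LIMSEQ_Suc[OF lim_1_over_n]])
  qed auto
  then obtain r where r: "strict_mono r" "AE t in circle. (\<lambda>k. f t - p (r k) t) \<longlonglongrightarrow> 0"
    using tendsto_L1_AE_subseq[of circle "\<lambda>k t. f t - p k t", OF X.bfs_integrable[OF dX]] by blast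
  show "Y.N (\<lambda>t. a t * f t) \<le> op * (X.N f + ennreal (1 / real (Suc n)))"
  \<comment> \<open>Fatou needs one bound for the whole sequence; from index n on the norms of the
    polynomials exceed that of \<open>f\<close> by at most 1 / (n + 1).\<close>
  proof (rule Y.N_fatou[of "\<lambda>k t. a t * p (r (k + n)) t"])
    show "(\<lambda>t. a t * p (r (k + n)) t) \<in> borel_measurable circle" for k using am pm[of "r (k + n)"] by simp
    show "(\<lambda>t. a t * f t) \<in> borel_measurable circle" using am fm by simp
    show "AE t in circle. (\<lambda>k. a t * p (r (k + n)) t) \<longlonglongrightarrow> a t * f t"
      using r(2)
    proof eventually_elim
      case (elim t)
      then have "(\<lambda>k. f t - (f t - p (r k) t)) \<longlonglongrightarrow> f t - 0" by (intro tendsto_intros)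
      then have "(\<lambda>k. p (r k) t) \<longlonglongrightarrow> f t" by simp
      then have "(\<lambda>k. p (r (k + n)) t) \<longlonglongrightarrow> f t" by (rule LIMSEQ_ignore_initial_segment)
      then show ?case by (intro tendsto_intros)
    qed
    fix k
    let ?i = "r (k + n)"
    have ri: "n \<le> ?i" using seq_suble[OF r(1), of "k + n"] by simp
    have "Y.N (\<lambda>t. a t * p ?i t) \<le> op * X.N (p ?i)" by (rule ap[OF pt])
    also have "X.N (p ?i) = X.N (\<lambda>t. f t - (f t - p ?i t))" by simp
    also have "\<dots> \<le> X.N f + X.N (\<lambda>t. f t - p ?i t)" by (rule X.N_diff[OF fm X.bfs_measurable[OF dX]])
    also have "\<dots> \<le> X.N f + ennreal (1 / real (Suc n))"
    proof (rule add_left_mono)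
      have "X.N (\<lambda>t. f t - p ?i t) \<le> ennreal (1 / real (Suc ?i))" by (rule pN)
      also have "\<dots> \<le> ennreal (1 / real (Suc n))" using ri by (intro ennreal_leI) (simp add: frac_le)
      finally show "X.N (\<lambda>t. f t - p ?i t) \<le> ennreal (1 / real (Suc n))" .
    qed
    finally show "Y.N (\<lambda>t. a t * p ?i t) \<le> op * (X.N f + ennreal (1 / real (Suc n)))"
      by (simp add: mult_left_mono)
  qed
qed

text \<open>Both sides are integrable with equal Fourier coefficients: for indices m >= 0 each is
  the finite convolution of the coefficients of p with \<alpha>, and for negative indices both
  vanish, since the image under \<open>A\<close> lies in H[Y] and the projection removes
  them.\<close>

lemma A_analytic_poly:
  assumes a: "a \<in> bfs \<rho>Y" "\<And>n. fourier_coeff a n = \<alpha> n" and apX: "(\<lambda>t. a t * p t) \<in> bfs \<rho>Y"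
    and p: "analytic_poly p"
  shows "p \<in> hardy \<rho>X" "AE t in circle. A p t = toeplitz a p t"
proof -
  have pX: "p \<in> bfs \<rho>X" by (rule X.bfs_trig_poly[OF analytic_poly_trig[OF p]])
  obtain n :: nat and c where c: "\<forall>t\<in>sphere 0 1. p t = (\<Sum>i<n. c i * t ^ i)"
    using p unfolding analytic_poly_def by blast
  define J where "J = int ` {..<n}"
  define P where "P = (\<lambda>t. \<Sum>j\<in>J. c (nat j) * chi j t)"
  have pP: "p t = P t" if "cmod t = 1" for t
    using c that unfolding P_def J_def chi_def by (subst sum.reindex) auto
  have J: "finite J" "\<And>j. j \<in> J \<Longrightarrow> 0 \<le> j" by (auto simp: J_def)
  have PH: "P \<in> hardy \<rho>X" unfolding P_def by (rule X.hardy_sum[OF J(1) X.hardy_chi[OF J(2)]])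
  have fc: "fourier_coeff p m = fourier_coeff P m" for m
    unfolding fourier_coeff_def by (intro Bochner_Integration.integral_cong refl) (simp add: space_circle pP)
  show pH: "p \<in> hardy \<rho>X" using pX PH by (simp add: hardy_def fc)
  \<comment> \<open>\<open>p\<close> and its expansion \<open>P\<close> agree on the circle only and
    may be different arguments of \<open>A\<close>; the norm bound makes the image of their
    difference vanish almost everywhere.\<close>
  have 1: "AE t in circle. A p t = A P t"
  proof -
    have d: "(\<lambda>s. p s - P s) \<in> hardy \<rho>X" by (rule X.hardy_diff[OF pH PH])
    have "X.N (\<lambda>s. p s - P s) = 0"
      using X.N_eq_0[OF X.bfs_measurable[OF hardy_bfs[OF d]]] pP by (simp add: AE_circleI)
    then have "Y.N (A (\<lambda>s. p s - P s)) \<le> 0" using op_bound[OF d] by simp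
    then have "AE t in circle. A (\<lambda>s. p s - P s) t = 0"
      using Y.N_eq_0[OF A_measurable[OF d]] by simp
    then show ?thesis using A_diff[OF pH PH] by eventually_elim simp
  qed
  have "AE t in circle. A P t = riesz (\<lambda>t. a t * p t) t"
  proof (rule fourier_unique)
    show "integrable circle (A P)" by (rule A_integrable[OF PH])
    show "integrable circle (riesz (\<lambda>t. a t * p t))" by (rule Y.bfs_integrable[OF Y.riesz_bfs[OF apX]])
    show "fourier_coeff (A P) m = fourier_coeff (riesz (\<lambda>t. a t * p t)) m" for m
    proof (cases "0 \<le> m")
      case True
      have "fourier_coeff (A P) m = (\<Sum>j\<in>J. c (nat j) * \<alpha> (m - j))"
        unfolding P_def by (rule coeff_A_sum[OF J True])
      also have "\<dots> = fourier_coeff (\<lambda>t. a t * p t) m"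
        using coeff_times[OF Y.bfs_integrable[OF a(1)] J(1), of p "\<lambda>j. c (nat j)" m] pP
        by (simp add: P_def chi_def a(2))
      finally show ?thesis using True by (simp add: Y.fourier_riesz[OF apX])
    next
      case False
      then show ?thesis using hardy_coeff[OF A_hardy[OF PH]] by (simp add: Y.fourier_riesz[OF apX])
    qed
  qed
  with 1 show "AE t in circle. A p t = toeplitz a p t"
    unfolding toeplitz_def by eventually_elim simp
qed

text \<open>Both operators are bounded on H[X], by \<open>op\<close> and by the bound of the
  projection times \<open>op\<close>, and they agree on analytic polynomials; the norm of the
  difference at \<open>f\<close> is thus at most a constant times the distance of \<open>f\<close>
  from these polynomials, which is arbitrarily small.\<close>

lemma A_eq_toeplitz:
  assumes a: "a \<in> bfs \<rho>Y" "\<And>n. fourier_coeff a n = \<alpha> n"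
    and mult: "\<And>f. f \<in> bfs \<rho>X \<Longrightarrow> Y.N (\<lambda>t. a t * f t) \<le> op * X.N f" and f: "f \<in> hardy \<rho>X"
  shows "AE t in circle. A f t = toeplitz a f t"
proof -
  have am: "a \<in> borel_measurable circle" by (rule Y.bfs_measurable[OF a(1)])
  have aX: "(\<lambda>t. a t * g t) \<in> bfs \<rho>Y" if g: "g \<in> bfs \<rho>X" for g
  proof (rule Y.bfsI[OF _ mult[OF g]])
    show "(\<lambda>t. a t * g t) \<in> borel_measurable circle" using am X.bfs_measurable[OF g] by simp
    show "op * X.N g < \<infinity>" using op_finite X.bfs_finite[OF g] by (simp add: ennreal_mult_less_top)
  qed
  have fX: "f \<in> bfs \<rho>X" by (rule hardy_bfs[OF f])
  have TX: "toeplitz a g \<in> bfs \<rho>Y" if "g \<in> bfs \<rho>X" for g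
    unfolding toeplitz_def by (rule Y.riesz_bfs[OF aX[OF that]])
  obtain P where P: "0 \<le> P" "\<And>f. f \<in> bfs \<rho>Y \<Longrightarrow> Y.N (riesz f) \<le> ennreal P * Y.N f"
    by (rule Y.riesz_bound) (rule that)
  have dm: "(\<lambda>t. A f t - toeplitz a f t) \<in> borel_measurable circle"
    using A_measurable[OF f] Y.bfs_measurable[OF TX[OF fX]] by simp
  \<comment> \<open>The factor 0 is the limit of the distances 1 / (n + 1) between \<open>f\<close>
    and the approximating polynomials.\<close>
  have "Y.N (\<lambda>t. A f t - toeplitz a f t) \<le> (op + ennreal P * op) * 0"
  proof (rule ennreal_mult_le_limit)
    show "op + ennreal P * op < \<infinity>" using op_finite by (simp add: ennreal_mult_less_top)
    fix n
    let ?e = "ennreal (1 / real (Suc n))"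
    obtain p where p: "analytic_poly p" "X.N (\<lambda>t. f t - p t) \<le> ?e"
      using X.analytic_poly_dense[OF f, of "1 / real (Suc n)"] by auto
    have pX: "p \<in> bfs \<rho>X" by (rule X.bfs_trig_poly[OF analytic_poly_trig[OF p(1)]])
    note Ap = A_analytic_poly[OF a aX[OF pX] p(1)]
    have dX: "(\<lambda>t. f t - p t) \<in> hardy \<rho>X" by (rule X.hardy_diff[OF f Ap(1)])
    let ?D = "\<lambda>t. a t * (f t - p t)"
    have DX: "?D \<in> bfs \<rho>Y" by (rule aX[OF hardy_bfs[OF dX]])
    have D: "?D = (\<lambda>t. a t * f t - a t * p t)" by (simp add: fun_eq_iff right_diff_distrib)
    have "AE t in circle. riesz ?D t = toeplitz a f t - toeplitz a p t"
      unfolding D toeplitz_def by (rule Y.riesz_diff[OF aX[OF fX] aX[OF pX]])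
    then have ae: "AE t in circle. A f t - toeplitz a f t = A (\<lambda>s. f s - p s) t - riesz ?D t"
      using Ap(2) A_diff[OF f Ap(1)] by eventually_elim simp
    have m: "A (\<lambda>s. f s - p s) \<in> borel_measurable circle" "riesz ?D \<in> borel_measurable circle"
      using A_measurable[OF dX] Y.bfs_measurable[OF Y.riesz_bfs[OF DX]] by auto
    have "Y.N (\<lambda>t. A f t - toeplitz a f t) = Y.N (\<lambda>t. A (\<lambda>s. f s - p s) t - riesz ?D t)"
      using ae m by (intro Y.N_cong dm) (auto elim!: eventually_mono)
    also have "\<dots> \<le> Y.N (A (\<lambda>s. f s - p s)) + Y.N (riesz ?D)" by (rule Y.N_diff[OF m])
    also have "\<dots> \<le> op * ?e + ennreal P * (op * ?e)"
    proof (rule add_mono)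
      show "Y.N (A (\<lambda>s. f s - p s)) \<le> op * ?e"
        by (rule order_trans[OF op_bound[OF dX] mult_left_mono[OF p(2)]]) simp
      have "Y.N (riesz ?D) \<le> ennreal P * Y.N ?D" by (rule P(2)[OF DX])
      also have "\<dots> \<le> ennreal P * (op * ?e)"
        by (intro mult_left_mono order_trans[OF mult[OF hardy_bfs[OF dX]] mult_left_mono[OF p(2)]]) auto
      finally show "Y.N (riesz ?D) \<le> ennreal P * (op * ?e)" .
    qed
    also have "\<dots> = (op + ennreal P * op) * (0 + ?e)" by (simp add: distrib_right mult.assoc)
    finally show "Y.N (\<lambda>t. A f t - toeplitz a f t) \<le> (op + ennreal P * op) * (0 + ?e)" .
  qed
  then have "Y.N (\<lambda>t. A f t - toeplitz a f t) = 0" by simp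
  then have "AE t in circle. A f t - toeplitz a f t = 0" using Y.N_eq_0[OF dm] by simp
  then show ?thesis by eventually_elim simp
qed

end

section \<open>Representation of the operator and the two norm inequalities\<close>

theorem theorem1p2:
  fixes \<rho>X \<rho>Y :: "(complex \<Rightarrow> ennreal) \<Rightarrow> ennreal"
    and A :: "(complex \<Rightarrow> complex) \<Rightarrow> complex \<Rightarrow> complex"
    and \<alpha> :: "int \<Rightarrow> complex"
  assumes "banach_function_norm \<rho>X" and "banach_function_norm \<rho>Y"
    and "separable_bfs \<rho>X"
    and "bounded_operator \<rho>Y (bfs \<rho>Y) \<rho>Y (bfs \<rho>Y) riesz"
    and "bounded_operator \<rho>X (hardy \<rho>X) \<rho>Y (hardy \<rho>Y) A"
    and "\<And>j k :: int. 0 \<le> j \<Longrightarrow> 0 \<le> k \<Longrightarrow> pairing (A (chi j)) (chi k) = \<alpha> (k - j)"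
  shows "\<exists>a \<in> multipliers \<rho>X \<rho>Y.
           (\<forall>f \<in> hardy \<rho>X. AE t in circle. A f t = toeplitz a f t) \<and>
           (\<forall>n. fourier_coeff a n = \<alpha> n) \<and>
           multiplier_norm \<rho>X \<rho>Y a \<le> operator_norm \<rho>X (hardy \<rho>X) \<rho>Y (toeplitz a) \<and>
           operator_norm \<rho>X (hardy \<rho>X) \<rho>Y (toeplitz a)
             \<le> operator_norm \<rho>Y (bfs \<rho>Y) \<rho>Y riesz * multiplier_norm \<rho>X \<rho>Y a"
proof -
  interpret toeplitz_matrix \<rho>X \<rho>Y A \<alpha>
    by unfold_locales (use assms in auto)
  obtain a where a: "a \<in> bfs \<rho>Y" "\<And>n. fourier_coeff a n = \<alpha> n"
    "\<And>p. trig_poly p \<Longrightarrow> Y.N (\<lambda>t. a t * p t) \<le> op * X.N p"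
    by (rule symbol_exists) (rule that)
  have mult: "Y.N (\<lambda>t. a t * f t) \<le> op * X.N f" if "f \<in> bfs \<rho>X" for f
    by (rule multiplier_bound[OF a(1,3) that])
  have am: "a \<in> borel_measurable circle" by (rule Y.bfs_measurable[OF a(1)])
  have aX: "(\<lambda>t. a t * g t) \<in> bfs \<rho>Y" if g: "g \<in> bfs \<rho>X" for g
  proof (rule Y.bfsI[OF _ mult[OF g]])
    show "(\<lambda>t. a t * g t) \<in> borel_measurable circle" using am X.bfs_measurable[OF g] by simp
    show "op * X.N g < \<infinity>" using op_finite X.bfs_finite[OF g] by (simp add: ennreal_mult_less_top)
  qed
  have aM: "a \<in> multipliers \<rho>X \<rho>Y" unfolding multipliers_def using am aX by simp
  have eq: "AE t in circle. A f t = toeplitz a f t" if "f \<in> hardy \<rho>X" for f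
    by (rule A_eq_toeplitz[OF a(1,2) mult that])
  have Neq: "Y.N (toeplitz a f) = Y.N (A f)" if f: "f \<in> hardy \<rho>X" for f
    using eq[OF f] A_measurable[OF f] Y.bfs_measurable[OF Y.riesz_bfs[OF aX[OF hardy_bfs[OF f]]]]
    by (intro Y.N_cong) (auto simp: toeplitz_def elim!: eventually_mono)
  \<comment> \<open>Both operators agree on H[X], so the first norm inequality is the multiplier
    bound already obtained with the norm of \<open>A\<close>.\<close>
  have op_eq: "operator_norm \<rho>X (hardy \<rho>X) \<rho>Y (toeplitz a) = op"
    unfolding operator_norm_def by (intro SUP_cong refl) (simp add: Neq)
  have "multiplier_norm \<rho>X \<rho>Y a \<le> op"
    unfolding multiplier_norm_def
  proof (rule SUP_least)
    fix g assume "g \<in> {g \<in> bfs \<rho>X. X.N g \<le> 1}"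
    then have "g \<in> bfs \<rho>X" "X.N g \<le> 1" by auto
    then show "Y.N (\<lambda>t. a t * g t) \<le> op"
      using mult[of g] mult_left_mono[of "X.N g" 1 op] by simp
  qed
  moreover have "operator_norm \<rho>X (hardy \<rho>X) \<rho>Y (toeplitz a) \<le> operator_norm \<rho>Y (bfs \<rho>Y) \<rho>Y riesz * multiplier_norm \<rho>X \<rho>Y a"
    unfolding operator_norm_def[of \<rho>X]
  proof (rule SUP_least)
    fix f assume "f \<in> {f \<in> hardy \<rho>X. X.N f \<le> 1}"
    then have f: "f \<in> bfs \<rho>X" "X.N f \<le> 1" by (auto simp: hardy_bfs)
    have "Y.N (toeplitz a f) \<le> operator_norm \<rho>Y (bfs \<rho>Y) \<rho>Y riesz * Y.N (\<lambda>t. a t * f t)"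
      unfolding toeplitz_def
      by (rule operator_norm_bound[OF Y.bfn_axioms Y.bfn_axioms Y.riesz]) (auto intro: Y.bfs_cmult aX f)
    also have "\<dots> \<le> operator_norm \<rho>Y (bfs \<rho>Y) \<rho>Y riesz * multiplier_norm \<rho>X \<rho>Y a"
      unfolding multiplier_norm_def using f by (intro mult_left_mono SUP_upper) auto
    finally show "Y.N (toeplitz a f) \<le> operator_norm \<rho>Y (bfs \<rho>Y) \<rho>Y riesz * multiplier_norm \<rho>X \<rho>Y a" .
  qed
  ultimately show ?thesis
    using eq a(2) by (intro bexI[OF _ aM] conjI ballI allI) (simp_all only: op_eq)
qed

end
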